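(* Let $\pi\colon M\to B$ be a submersion equipped with a vertical metric, $\mathtt E\to M$ a hermitian vector bundle, and $\mathcal D$ a vertically elliptic, symmetric, first-order differential operator on $\mathtt E\to M$. The following statements are equivalent: (1) the (closure of the) operator $\mathcal D$ is a regular operator on $\Gamma_0(B,E_\bullet)$; (2) for each $b\in B$, the subspace $\mathrm{ev}_b(\mathrm{Dom}\,\mathcal D^* )\subset\mathrm{Dom}\,\mathcal D_b^*$ is a core for $\mathcal D_b^*$; (3) for each $b\in B$, the subspace $\mathrm{ev}_b(\mathrm{Dom}\,\mathcal D^* )$ is equal to $\mathrm{Dom}\,\mathcal D_b^*$.
   Context: Manifolds are smooth, without boundary, possibly non-compact; submersions are surjective. $T_VM:=\mathrm{Ker}\,d\pi$; a vertical metric is a smooth inner product on $T_VM$ (fibres $M_b=\pi^{-1}(b)$ need not be complete), inducing a metric and volume $\mathrm{dvol}_b$ on $M_b$. $E_b:=L^2(M_b,\mathtt E|_{M_b})$; $\Gamma_0(B,E_\bullet)$ is the Hilbert $C_0(B)$-module completion of $\Gamma_c^\infty(M,\mathtt E)$ in $\langle\phi|\psi\rangle(b)=\int_{M_b}\langle\phi(y)|\psi(y)\rangle\,\mathrm{dvol}_b(y)$, with right action $(\psi f)(x)=\psi(x)f(\pi(x))$. A first-order differential operator is vertical if it is $C^\infty(B)$-linear, and vertically elliptic if moreover its principal symbol $\sigma_{\mathcal D}(\xi)(x)$ is invertible for all $x\in M$ and $0\ne\xi\in(T_V^*M)_x$. Symmetry is with respect to the $C_0(B)$-valued inner product $\langle\phi|\psi\rangle(b)=\int_{M_b}\langle\phi(y)|\psi(y)\rangle\,\mathrm{dvol}_b(y)$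 on $\Gamma_c^\infty(M,\mathtt E)$. $\mathcal D$ also denotes its closure on $\Gamma_0(B,E_\bullet)$ with initial domain $\Gamma_c^\infty(M,\mathtt E)$; $\mathcal D_b$ is the closure on $E_b$ of its restriction to $\Gamma_c^\infty(M_b,\mathtt E|_{M_b})$; $\mathrm{ev}_b\colon\Gamma_0(B,E_\bullet)\to E_b$ is evaluation. A closed densely defined operator $T$ on a Hilbert module is regular if $T^*$ is densely defined and $1+T^*T$ has dense range. *)

theory Defs
  imports "HOL-Analysis.Analysis"
begin

section \<open>Smooth manifolds\<close>

text \<open>
  Model spaces are types of class \<open>real_inner\<close> that are assumed to be finite-dimensional.
  Unlike \<open>euclidean_space\<close>, this includes dimension zero.
\<close>

definition finite_dimensional :: "'a::real_vector itself \<Rightarrow> bool" where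
  "finite_dimensional _ \<longleftrightarrow> (\<exists>S::'a set. finite S \<and> span S = UNIV)"

primrec Ck_on :: "nat \<Rightarrow> 'a::real_normed_vector set \<Rightarrow> ('a \<Rightarrow> 'c::real_normed_vector) \<Rightarrow> bool" where
  "Ck_on 0 W f \<longleftrightarrow> continuous_on W f"
| "Ck_on (Suc k) W f \<longleftrightarrow>
     (\<forall>x\<in>W. f differentiable (at x)) \<and> (\<forall>v. Ck_on k W (\<lambda>x. frechet_derivative f (at x) v))"

text \<open>Only meant for open \<open>W\<close>.\<close>

definition smooth_on :: "'a::real_normed_vector set \<Rightarrow> ('a \<Rightarrow> 'c::real_normed_vector) \<Rightarrow> bool" where
  "smooth_on W f \<longleftrightarrow> (\<forall>k. Ck_on k W f)"

type_synonym ('m, 'a) chart = "'m set \<times> ('m \<Rightarrow> 'a)"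

definition chart_inv :: "('m, 'a) chart \<Rightarrow> 'a \<Rightarrow> 'm" where
  "chart_inv c = inv_into (fst c) (snd c)"

definition is_chart :: "('m::topological_space, 'a::real_normed_vector) chart \<Rightarrow> bool" where
  "is_chart c \<longleftrightarrow> open (fst c) \<and> open (snd c ` fst c) \<and>
     homeomorphism (fst c) (snd c ` fst c) (snd c) (chart_inv c)"

definition smoothly_compatible ::
  "('m, 'a::real_normed_vector) chart \<Rightarrow> ('m, 'a) chart \<Rightarrow> bool" where
  "smoothly_compatible c d \<longleftrightarrow>
     smooth_on (snd c ` (fst c \<inter> fst d)) (snd d \<circ> chart_inv c) \<and>
     smooth_on (snd d ` (fst c \<inter> fst d)) (snd c \<circ> chart_inv d)"

definition smooth_atlas :: "('m::topological_space, 'a::real_normed_vector) chart set \<Rightarrow> bool" where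
  "smooth_atlas A \<longleftrightarrow> (\<forall>c\<in>A. is_chart c) \<and> (\<Union>c\<in>A. fst c) = UNIV \<and>
     (\<forall>c\<in>A. \<forall>d\<in>A. smoothly_compatible c d)"

text \<open>The points of the manifold are all elements of the type \<open>'m\<close>.\<close>

definition smooth_manifold ::
  "('m::{t2_space,second_countable_topology}, 'a::real_inner) chart set \<Rightarrow> bool" where
  "smooth_manifold A \<longleftrightarrow> finite_dimensional TYPE('a) \<and> smooth_atlas A"

definition smooth_charts ::
  "('m::topological_space, 'a::real_normed_vector) chart set \<Rightarrow> ('m, 'a) chart set" where
  "smooth_charts A = {c. is_chart c \<and> (\<forall>d\<in>A. smoothly_compatible c d)}"

definition smooth_fun ::
  "('m, 'a::real_normed_vector) chart set \<Rightarrow> 'm set \<Rightarrow> ('m \<Rightarrow> 'c::real_normed_vector) \<Rightarrow> bool" where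
  "smooth_fun A W f \<longleftrightarrow> (\<forall>c\<in>A. smooth_on (snd c ` (fst c \<inter> W)) (f \<circ> chart_inv c))"

definition smooth_map ::
  "('m::topological_space, 'a::real_normed_vector) chart set \<Rightarrow>
   ('b::topological_space, 'e::real_normed_vector) chart set \<Rightarrow> ('m \<Rightarrow> 'b) \<Rightarrow> bool" where
  "smooth_map A A' \<pi> \<longleftrightarrow> continuous_on UNIV \<pi> \<and>
     (\<forall>c\<in>A. \<forall>d\<in>A'. smooth_on (snd c ` (fst c \<inter> \<pi> -` fst d)) (snd d \<circ> \<pi> \<circ> chart_inv c))"

section \<open>Tangent vectors and submersions\<close>

text \<open>
  A tangent vector at \<open>x\<close> is identified with the directional derivative it defines on
  smooth functions; it is set to \<open>0\<close> on all other functions, so that equality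
  of tangent vectors is equality of functionals.
\<close>

type_synonym 'm tangent = "('m \<Rightarrow> real) \<Rightarrow> real"

definition tangent_vector ::
  "('m, 'a::real_normed_vector) chart set \<Rightarrow> ('m, 'a) chart \<Rightarrow> 'm \<Rightarrow> 'a \<Rightarrow> 'm tangent" where
  "tangent_vector A c x v = (\<lambda>f. if smooth_fun A UNIV f
     then frechet_derivative (f \<circ> chart_inv c) (at (snd c x)) v else 0)"

definition tangent_space ::
  "('m, 'a::real_normed_vector) chart set \<Rightarrow> 'm \<Rightarrow> 'm tangent set" where
  "tangent_space A x = {tangent_vector A c x v | c v. c \<in> A \<and> x \<in> fst c}"

definition differential ::
  "('b, 'e::real_normed_vector) chart set \<Rightarrow> ('m \<Rightarrow> 'b) \<Rightarrow> 'm tangent \<Rightarrow> 'b tangent" where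
  "differential A' \<pi> X = (\<lambda>h. if smooth_fun A' UNIV h then X (h \<circ> \<pi>) else 0)"

definition submersion ::
  "('m::topological_space, 'a::real_normed_vector) chart set \<Rightarrow>
   ('b::topological_space, 'e::real_normed_vector) chart set \<Rightarrow> ('m \<Rightarrow> 'b) \<Rightarrow> bool" where
  "submersion A A' \<pi> \<longleftrightarrow> smooth_map A A' \<pi> \<and> surj \<pi> \<and>
     (\<forall>x. tangent_space A' (\<pi> x) \<subseteq> differential A' \<pi> ` tangent_space A x)"

definition vertical_space ::
  "('m, 'a::real_normed_vector) chart set \<Rightarrow> ('b, 'e::real_normed_vector) chart set \<Rightarrow>
   ('m \<Rightarrow> 'b) \<Rightarrow> 'm \<Rightarrow> 'm tangent set" where
  "vertical_space A A' \<pi> x = {X \<in> tangent_space A x. differential A' \<pi> X = (\<lambda>_. 0)}"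

text \<open>
  Charts of \<open>M\<close> in which \<open>\<pi>\<close> is the second projection \<open>'f \<times> 'e \<rightarrow> 'e\<close>.
  They restrict to slice charts of the fibres, and the vectors \<open>(v, 0)\<close> span the vertical
  tangent bundle.
\<close>

definition submersion_charts ::
  "('m::topological_space, 'f::real_normed_vector \<times> 'e::real_normed_vector) chart set \<Rightarrow>
   ('b::topological_space, 'e) chart set \<Rightarrow> ('m \<Rightarrow> 'b) \<Rightarrow> ('m, 'f \<times> 'e) chart set" where
  "submersion_charts A A' \<pi> = {c \<in> smooth_charts A.
     \<exists>d\<in>smooth_charts A'. \<pi> ` fst c \<subseteq> fst d \<and> (\<forall>x\<in>fst c. snd (snd c x) = snd d (\<pi> x))}"

definition fibre_chart ::
  "('m \<Rightarrow> 'b) \<Rightarrow> 'b \<Rightarrow> ('m, 'f \<times> 'e) chart \<Rightarrow> ('m, 'f) chart" where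
  "fibre_chart \<pi> b c = (fst c \<inter> \<pi> -` {b}, fst \<circ> snd c)"

definition fibre_atlas ::
  "('m::topological_space, 'f::real_normed_vector \<times> 'e::real_normed_vector) chart set \<Rightarrow>
   ('b::topological_space, 'e) chart set \<Rightarrow> ('m \<Rightarrow> 'b) \<Rightarrow> 'b \<Rightarrow> ('m, 'f) chart set" where
  "fibre_atlas A A' \<pi> b = fibre_chart \<pi> b ` submersion_charts A A' \<pi>"

definition vertical_vector ::
  "('m, 'f::real_normed_vector \<times> 'e::real_normed_vector) chart set \<Rightarrow>
   ('m, 'f \<times> 'e) chart \<Rightarrow> 'm \<Rightarrow> 'f \<Rightarrow> 'm tangent" where
  "vertical_vector A c x v = tangent_vector A c x (v, 0)"

section \<open>Vertical metrics and the volume of the fibres\<close>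

definition vertical_metric ::
  "('m::topological_space, 'f::real_normed_vector \<times> 'e::real_normed_vector) chart set \<Rightarrow>
   ('b::topological_space, 'e) chart set \<Rightarrow> ('m \<Rightarrow> 'b) \<Rightarrow>
   ('m \<Rightarrow> 'm tangent \<Rightarrow> 'm tangent \<Rightarrow> real) \<Rightarrow> bool" where
  "vertical_metric A A' \<pi> g \<longleftrightarrow>
     (\<forall>x. \<forall>X\<in>vertical_space A A' \<pi> x. \<forall>Y\<in>vertical_space A A' \<pi> x.
        g x X Y = g x Y X \<and>
        (X \<noteq> (\<lambda>_. 0) \<longrightarrow> g x X X > 0) \<and>
        (\<forall>Z\<in>vertical_space A A' \<pi> x. \<forall>r.
           g x X (\<lambda>f. r * Y f + Z f) = r * g x X Y + g x X Z)) \<and>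
     (\<forall>c\<in>submersion_charts A A' \<pi>. \<forall>v w.
        smooth_fun A (fst c) (\<lambda>x. g x (vertical_vector A c x v) (vertical_vector A c x w)))"

definition orthonormal_enum :: "nat \<Rightarrow> 'f::real_inner" where
  "orthonormal_enum = (SOME e. \<forall>i<dim (UNIV::'f set). \<forall>j<dim (UNIV::'f set).
     inner (e i) (e j) = (if i = j then 1 else 0))"

text \<open>
  Lebesgue measure on \<open>'f\<close>, independent of the choice of the orthonormal basis; it is the
  Dirac measure at \<open>0\<close> in dimension zero.
\<close>

definition model_lebesgue :: "'f::real_inner measure" where
  "model_lebesgue = distr (Pi\<^sub>M {..<dim (UNIV::'f set)} (\<lambda>_. lborel)) borel
     (\<lambda>t. \<Sum>i<dim (UNIV::'f set). t i *\<^sub>R orthonormal_enum i)"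

definition gram_det ::
  "('m, 'f::real_inner \<times> 'e::real_normed_vector) chart set \<Rightarrow>
   ('m \<Rightarrow> 'm tangent \<Rightarrow> 'm tangent \<Rightarrow> real) \<Rightarrow> ('m, 'f \<times> 'e) chart \<Rightarrow> 'm \<Rightarrow> real" where
  "gram_det A g c x = (\<Sum>p | p permutes {..<dim (UNIV::'f set)}. of_int (sign p) *
     (\<Prod>i<dim (UNIV::'f set). g x (vertical_vector A c x (orthonormal_enum i))
                                 (vertical_vector A c x (orthonormal_enum (p i)))))"

definition chart_partition ::
  "('m::topological_space, 'f::real_normed_vector \<times> 'e::real_normed_vector) chart set \<Rightarrow>
   ('b::topological_space, 'e) chart set \<Rightarrow> ('m \<Rightarrow> 'b) \<Rightarrow>
   (nat \<Rightarrow> ('m, 'f \<times> 'e) chart) \<times> (nat \<Rightarrow> 'm \<Rightarrow> real) \<Rightarrow> bool" where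
  "chart_partition A A' \<pi> = (\<lambda>(c, \<rho>).
     (\<forall>n. c n \<in> submersion_charts A A' \<pi> \<and> smooth_fun A UNIV (\<rho> n) \<and> (\<forall>x. \<rho> n x \<ge> 0) \<and>
          closure {x. \<rho> n x \<noteq> 0} \<subseteq> fst (c n)) \<and>
     (\<forall>x. \<exists>W. open W \<and> x \<in> W \<and> finite {n. \<exists>y\<in>W. \<rho> n y \<noteq> 0}) \<and>
     (\<forall>x. (\<Sum>n. \<rho> n x) = 1))"

text \<open>
  The Riemannian volume of the fibre over \<open>b\<close>: in a fibre chart it is
  \<open>sqrt (det g\<^sub>i\<^sub>j) dy\<close>, and the local expressions are glued by a smooth partition of
  unity. By the change of variables formula the result does not depend on the charts and the
  partition of unity.
\<close>

definition fibre_volume ::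
  "('m::topological_space, 'f::real_inner \<times> 'e::real_normed_vector) chart set \<Rightarrow>
   ('b::topological_space, 'e) chart set \<Rightarrow> ('m \<Rightarrow> 'b) \<Rightarrow>
   ('m \<Rightarrow> 'm tangent \<Rightarrow> 'm tangent \<Rightarrow> real) \<Rightarrow> 'b \<Rightarrow> 'm measure" where
  "fibre_volume A A' \<pi> g b =
     (let (c, \<rho>) = (SOME P. chart_partition A A' \<pi> P) in
      measure_of (\<pi> -` {b}) (sets (restrict_space borel (\<pi> -` {b})))
        (\<lambda>S. \<Sum>n. \<integral>\<^sup>+ y \<in> (fst \<circ> snd (c n)) ` (fst (c n) \<inter> S).
            (let x = chart_inv (fibre_chart \<pi> b (c n)) y
             in ennreal (\<rho> n x * sqrt (gram_det A g (c n) x))) \<partial>model_lebesgue))"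

section \<open>Hermitian vector bundles\<close>

text \<open>
  The fibres of a vector bundle are subspaces of an arbitrary complex vector space \<open>'v\<close>
  (for an abstract bundle one may take the direct sum of all its fibres); neighbouring fibres are
  only related by the local trivialisations \<open>(U, r, \<tau>)\<close>, where \<open>\<tau> x\<close> identifies the
  fibre at \<open>x \<in> U\<close> with \<open>\<complex>\<^sup>r\<close>, the sequences vanishing from \<open>r\<close> on.
  Inner products are antilinear in the first argument.
\<close>

record ('m, 'v) vbundle =
  scaleB :: "complex \<Rightarrow> 'v \<Rightarrow> 'v"
  fib :: "'m \<Rightarrow> 'v set"
  trivs :: "('m set \<times> nat \<times> ('m \<Rightarrow> 'v \<Rightarrow> nat \<Rightarrow> complex)) set"
  herm :: "'m \<Rightarrow> 'v \<Rightarrow> 'v \<Rightarrow> complex"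

definition local_frame ::
  "('m, 'v) vbundle \<Rightarrow> ('m \<Rightarrow> 'v \<Rightarrow> nat \<Rightarrow> complex) \<Rightarrow> nat \<Rightarrow> 'm \<Rightarrow> 'v" where
  "local_frame E \<tau> j x = inv_into (fib E x) (\<tau> x) (\<lambda>l. if l = j then 1 else 0)"

definition vector_bundle ::
  "('m::topological_space, 'a::real_normed_vector) chart set \<Rightarrow>
   ('m, 'v::ab_group_add) vbundle \<Rightarrow> bool" where
  "vector_bundle A E \<longleftrightarrow>
     vector_space (scaleB E) \<and>
     (\<forall>x. module.subspace (scaleB E) (fib E x)) \<and>
     (\<Union>(U, r, \<tau>)\<in>trivs E. U) = UNIV \<and>
     (\<forall>(U, r, \<tau>)\<in>trivs E. open U \<and>
        (\<forall>x\<in>U. bij_betw (\<tau> x) (fib E x) {z. \<forall>i\<ge>r. z i = 0} \<and>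
           (\<forall>u\<in>fib E x. \<forall>v\<in>fib E x. \<forall>a i.
              \<tau> x (scaleB E a u + v) i = a * \<tau> x u i + \<tau> x v i))) \<and>
     (\<forall>(U, r, \<tau>)\<in>trivs E. \<forall>(U', r', \<tau>')\<in>trivs E. \<forall>j<r. \<forall>i.
        smooth_fun A (U \<inter> U') (\<lambda>x. \<tau>' x (local_frame E \<tau> j x) i))"

definition hermitian_bundle ::
  "('m::topological_space, 'a::real_normed_vector) chart set \<Rightarrow>
   ('m, 'v::ab_group_add) vbundle \<Rightarrow> bool" where
  "hermitian_bundle A E \<longleftrightarrow> vector_bundle A E \<and>
     (\<forall>x. \<forall>u\<in>fib E x. \<forall>v\<in>fib E x.
        herm E x u v = cnj (herm E x v u) \<and>
        (u \<noteq> 0 \<longrightarrow> Re (herm E x u u) > 0) \<and>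
        (\<forall>w\<in>fib E x. \<forall>a. herm E x u (scaleB E a v + w) = a * herm E x u v + herm E x u w)) \<and>
     (\<forall>(U, r, \<tau>)\<in>trivs E. \<forall>i<r. \<forall>j<r.
        smooth_fun A U (\<lambda>x. herm E x (local_frame E \<tau> i x) (local_frame E \<tau> j x)))"

text \<open>
  \<open>S\<close> is the manifold covered by the charts in \<open>A\<close>: either all of \<open>M\<close>, or
  a fibre with its fibre atlas. Values off \<open>S\<close> are irrelevant.
\<close>

definition smooth_sections ::
  "('m, 'a::real_normed_vector) chart set \<Rightarrow> 'm set \<Rightarrow> ('m, 'v) vbundle \<Rightarrow> ('m \<Rightarrow> 'v) set" where
  "smooth_sections A S E = {s. (\<forall>x\<in>S. s x \<in> fib E x) \<and>
     (\<forall>(U, r, \<tau>)\<in>trivs E. \<forall>i. smooth_fun A (U \<inter> S) (\<lambda>x. \<tau> x (s x) i))}"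

definition compact_sections ::
  "('m::topological_space, 'a::real_normed_vector) chart set \<Rightarrow> 'm set \<Rightarrow>
   ('m, 'v::zero) vbundle \<Rightarrow> ('m \<Rightarrow> 'v) set" where
  "compact_sections A S E = {s \<in> smooth_sections A S E.
     \<exists>K. compact K \<and> K \<subseteq> S \<and> (\<forall>x\<in>S - K. s x = 0)}"

section \<open>Vertical differential operators\<close>

text \<open>
  In a chart and a local trivialisation the operator reads
  \<open>\<Sum>\<^sub>e a\<^sub>e \<partial>\<^sub>e + b\<close> with smooth matrix-valued coefficients.
\<close>

definition first_order_diffop ::
  "('m, 'a::real_normed_vector) chart set \<Rightarrow> ('m, 'v) vbundle \<Rightarrow>
   (('m \<Rightarrow> 'v) \<Rightarrow> 'm \<Rightarrow> 'v) \<Rightarrow> bool" where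
  "first_order_diffop A E D \<longleftrightarrow>
     (\<forall>s\<in>smooth_sections A UNIV E. D s \<in> smooth_sections A UNIV E) \<and>
     (\<forall>c\<in>A. \<forall>(V, r, \<tau>)\<in>trivs E. \<exists>Bs a b. finite Bs \<and>
        (\<forall>k<r. \<forall>l<r. (\<forall>e\<in>Bs. smooth_fun A (fst c \<inter> V) (a k l e)) \<and>
                     smooth_fun A (fst c \<inter> V) (b k l)) \<and>
        (\<forall>s\<in>smooth_sections A UNIV E. \<forall>x\<in>fst c \<inter> V. \<forall>k<r.
           \<tau> x (D s x) k =
             (\<Sum>l<r. (\<Sum>e\<in>Bs. (a k l e x :: complex) *
                 frechet_derivative (\<lambda>y. \<tau> (chart_inv c y) (s (chart_inv c y)) l) (at (snd c x)) e)
               + b k l x * \<tau> x (s x) l)))"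

definition vertical_diffop ::
  "('m, 'a::real_normed_vector) chart set \<Rightarrow> ('b, 'e::real_normed_vector) chart set \<Rightarrow>
   ('m \<Rightarrow> 'b) \<Rightarrow> ('m, 'v) vbundle \<Rightarrow> (('m \<Rightarrow> 'v) \<Rightarrow> 'm \<Rightarrow> 'v) \<Rightarrow> bool" where
  "vertical_diffop A A' \<pi> E D \<longleftrightarrow> first_order_diffop A E D \<and>
     (\<forall>f::'b \<Rightarrow> complex. \<forall>s\<in>smooth_sections A UNIV E. smooth_fun A' UNIV f \<longrightarrow>
        (\<forall>x. D (\<lambda>y. scaleB E (f (\<pi> y)) (s y)) x = scaleB E (f (\<pi> x)) (D s x)))"

definition vertical_covector ::
  "('m, 'a::real_normed_vector) chart set \<Rightarrow> ('b, 'e::real_normed_vector) chart set \<Rightarrow>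
   ('m \<Rightarrow> 'b) \<Rightarrow> 'm \<Rightarrow> ('m tangent \<Rightarrow> real) \<Rightarrow> bool" where
  "vertical_covector A A' \<pi> x \<xi> \<longleftrightarrow>
     (\<forall>X\<in>vertical_space A A' \<pi> x. \<forall>Y\<in>vertical_space A A' \<pi> x. \<forall>r.
        \<xi> (\<lambda>f. r * X f + Y f) = r * \<xi> X + \<xi> Y)"

text \<open>
  \<open>\<sigma>\<^sub>D(\<xi>)(x) v = ([D, f] s)(x)\<close> for \<open>s x = v\<close> and \<open>f\<close> with vertical
  differential \<open>\<xi>\<close> at \<open>x\<close>.
\<close>

definition principal_symbol ::
  "('m, 'a::real_normed_vector) chart set \<Rightarrow> ('b, 'e::real_normed_vector) chart set \<Rightarrow>
   ('m \<Rightarrow> 'b) \<Rightarrow> ('m, 'v::ab_group_add) vbundle \<Rightarrow> (('m \<Rightarrow> 'v) \<Rightarrow> 'm \<Rightarrow> 'v) \<Rightarrow>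
   ('m tangent \<Rightarrow> real) \<Rightarrow> 'm \<Rightarrow> 'v \<Rightarrow> 'v" where
  "principal_symbol A A' \<pi> E D \<xi> x v = (THE w. \<exists>f::'m \<Rightarrow> real. \<exists>s\<in>smooth_sections A UNIV E.
     smooth_fun A UNIV f \<and> (\<forall>X\<in>vertical_space A A' \<pi> x. \<xi> X = X f) \<and> s x = v \<and>
     w = D (\<lambda>y. scaleB E (complex_of_real (f y)) (s y)) x
           - scaleB E (complex_of_real (f x)) (D s x))"

definition vertically_elliptic ::
  "('m, 'a::real_normed_vector) chart set \<Rightarrow> ('b, 'e::real_normed_vector) chart set \<Rightarrow>
   ('m \<Rightarrow> 'b) \<Rightarrow> ('m, 'v::ab_group_add) vbundle \<Rightarrow> (('m \<Rightarrow> 'v) \<Rightarrow> 'm \<Rightarrow> 'v) \<Rightarrow> bool" where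
  "vertically_elliptic A A' \<pi> E D \<longleftrightarrow> vertical_diffop A A' \<pi> E D \<and>
     (\<forall>x \<xi>. vertical_covector A A' \<pi> x \<xi> \<and> (\<exists>X\<in>vertical_space A A' \<pi> x. \<xi> X \<noteq> 0) \<longrightarrow>
        bij_betw (principal_symbol A A' \<pi> E D \<xi> x) (fib E x) (fib E x))"

definition symmetric_op ::
  "('m::topological_space, 'a::real_normed_vector) chart set \<Rightarrow> ('m, 'v::zero) vbundle \<Rightarrow>
   ('b \<Rightarrow> 'm measure) \<Rightarrow> (('m \<Rightarrow> 'v) \<Rightarrow> 'm \<Rightarrow> 'v) \<Rightarrow> bool" where
  "symmetric_op A E vol D \<longleftrightarrow>
     (\<forall>\<phi>\<in>compact_sections A UNIV E. \<forall>\<psi>\<in>compact_sections A UNIV E. \<forall>b.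
        (\<integral>y. herm E y (D \<phi> y) (\<psi> y) \<partial>vol b) = (\<integral>y. herm E y (\<phi> y) (D \<psi> y) \<partial>vol b))"

section \<open>Operators on Hilbert modules\<close>

text \<open>
  Right Hilbert \<open>C\<^sub>0(B)\<close>-modules; a Hilbert space is the case of a one-point base
  \<open>unit\<close>. Operators are represented by their graphs.
\<close>

record ('x, 'b) hilbert_module =
  hcarrier :: "'x set"
  hzero :: "'x"
  hadd :: "'x \<Rightarrow> 'x \<Rightarrow> 'x"
  hscale :: "complex \<Rightarrow> 'x \<Rightarrow> 'x"
  hact :: "'x \<Rightarrow> ('b \<Rightarrow> complex) \<Rightarrow> 'x"
  hinner :: "'x \<Rightarrow> 'x \<Rightarrow> 'b \<Rightarrow> complex"

type_synonym 'x operator = "('x \<times> 'x) set"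

definition C0 :: "('b::topological_space \<Rightarrow> complex) set" where
  "C0 = {f. continuous_on UNIV f \<and> (\<forall>\<epsilon>>0. \<exists>K. compact K \<and> (\<forall>b\<in>-K. cmod (f b) < \<epsilon>))}"

definition hnorm :: "('x, 'b) hilbert_module \<Rightarrow> 'x \<Rightarrow> real" where
  "hnorm H x = sqrt (SUP b. cmod (hinner H x x b))"

definition hdist :: "('x, 'b) hilbert_module \<Rightarrow> 'x \<Rightarrow> 'x \<Rightarrow> real" where
  "hdist H x y = hnorm H (hadd H x (hscale H (-1) y))"

definition hdense :: "('x, 'b) hilbert_module \<Rightarrow> 'x set \<Rightarrow> bool" where
  "hdense H Y \<longleftrightarrow> Y \<subseteq> hcarrier H \<and> (\<forall>x\<in>hcarrier H. \<forall>\<epsilon>>0. \<exists>y\<in>Y. hdist H x y < \<epsilon>)"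

definition op_closure :: "('x, 'b) hilbert_module \<Rightarrow> 'x operator \<Rightarrow> 'x operator" where
  "op_closure H T = {(x, y). x \<in> hcarrier H \<and> y \<in> hcarrier H \<and>
     (\<forall>\<epsilon>>0. \<exists>(x', y')\<in>T. hdist H x x' < \<epsilon> \<and> hdist H y y' < \<epsilon>)}"

definition op_adjoint :: "('x, 'b) hilbert_module \<Rightarrow> 'x operator \<Rightarrow> 'x operator" where
  "op_adjoint H T = {(x, y). x \<in> hcarrier H \<and> y \<in> hcarrier H \<and>
     (\<forall>(u, v)\<in>T. hinner H v x = hinner H u y)}"

definition closed_operator ::
  "('x, 'b::topological_space) hilbert_module \<Rightarrow> 'x operator \<Rightarrow> bool" where
  "closed_operator H T \<longleftrightarrow>
     T \<subseteq> hcarrier H \<times> hcarrier H \<and> single_valued T \<and> (hzero H, hzero H) \<in> T \<and>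
     (\<forall>(x, y)\<in>T. \<forall>(x', y')\<in>T. (hadd H x x', hadd H y y') \<in> T) \<and>
     (\<forall>(x, y)\<in>T. \<forall>a. (hscale H a x, hscale H a y) \<in> T) \<and>
     (\<forall>(x, y)\<in>T. \<forall>f\<in>C0. (hact H x f, hact H y f) \<in> T) \<and>
     op_closure H T = T"

definition regular_operator ::
  "('x, 'b::topological_space) hilbert_module \<Rightarrow> 'x operator \<Rightarrow> bool" where
  "regular_operator H T \<longleftrightarrow> closed_operator H T \<and> hdense H (Domain T) \<and>
     hdense H (Domain (op_adjoint H T)) \<and>
     hdense H {hadd H x z | x y z. (x, y) \<in> T \<and> (y, z) \<in> op_adjoint H T}"

definition is_core :: "('x, 'b) hilbert_module \<Rightarrow> 'x set \<Rightarrow> 'x operator \<Rightarrow> bool" where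
  "is_core H C T \<longleftrightarrow> C \<subseteq> Domain T \<and> op_closure H {(x, y) \<in> T. x \<in> C} = T"

section \<open>The field of Hilbert spaces and the operators of the family\<close>

definition square_integrable ::
  "('m, 'v) vbundle \<Rightarrow> 'm measure \<Rightarrow> ('m \<Rightarrow> 'v) set" where
  "square_integrable E \<mu> = {\<psi>. (\<forall>x\<in>space \<mu>. \<psi> x \<in> fib E x) \<and>
     (\<forall>(U, r, \<tau>)\<in>trivs E. \<forall>i. (\<lambda>x. \<tau> x (\<psi> x) i) \<in> borel_measurable (restrict_space \<mu> U)) \<and>
     (\<integral>\<^sup>+ x. ennreal (Re (herm E x (\<psi> x) (\<psi> x))) \<partial>\<mu>) < \<infinity>}"

definition L2_class ::
  "('m, 'v) vbundle \<Rightarrow> 'm measure \<Rightarrow> ('m \<Rightarrow> 'v) \<Rightarrow> ('m \<Rightarrow> 'v) set" where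
  "L2_class E \<mu> \<psi> = {\<psi>' \<in> square_integrable E \<mu>. AE x in \<mu>. \<psi>' x = \<psi> x}"

definition rep :: "'a set \<Rightarrow> 'a" where
  "rep X = (SOME \<psi>. \<psi> \<in> X)"

definition L2_space ::
  "('m, 'v::ab_group_add) vbundle \<Rightarrow> 'm measure \<Rightarrow> (('m \<Rightarrow> 'v) set, unit) hilbert_module" where
  "L2_space E \<mu> = \<lparr>
     hcarrier = L2_class E \<mu> ` square_integrable E \<mu>,
     hzero = L2_class E \<mu> (\<lambda>_. 0),
     hadd = (\<lambda>X Y. L2_class E \<mu> (\<lambda>x. rep X x + rep Y x)),
     hscale = (\<lambda>a X. L2_class E \<mu> (\<lambda>x. scaleB E a (rep X x))),
     hact = (\<lambda>X f. L2_class E \<mu> (\<lambda>x. scaleB E (f ()) (rep X x))),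
     hinner = (\<lambda>X Y _. \<integral>x. herm E x (rep X x) (rep Y x) \<partial>\<mu>) \<rparr>"

definition field_class ::
  "('m, 'v) vbundle \<Rightarrow> ('b \<Rightarrow> 'm measure) \<Rightarrow> ('m \<Rightarrow> 'v) \<Rightarrow> 'b \<Rightarrow> ('m \<Rightarrow> 'v) set" where
  "field_class E vol \<phi> = (\<lambda>b. L2_class E (vol b) \<phi>)"

text \<open>
  The completion of \<open>\<Gamma>\<^sub>c\<^sup>\<infinity>(M, E)\<close> is realised as its closure, in the supremum
  norm, inside the product of the complete spaces \<open>L\<^sup>2(M\<^sub>b, E)\<close>. Evaluation at \<open>b\<close> is
  then evaluation of functions.
\<close>

definition Gamma0 ::
  "('m::topological_space, 'a::real_normed_vector) chart set \<Rightarrow> ('m, 'v::ab_group_add) vbundle \<Rightarrow>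
   ('b \<Rightarrow> 'm measure) \<Rightarrow> ('b \<Rightarrow> ('m \<Rightarrow> 'v) set, 'b) hilbert_module" where
  "Gamma0 A E vol = \<lparr>
     hcarrier = {\<Psi>. (\<forall>b. \<Psi> b \<in> hcarrier (L2_space E (vol b))) \<and>
       (\<forall>\<epsilon>>0. \<exists>\<phi>\<in>compact_sections A UNIV E. \<forall>b.
          hdist (L2_space E (vol b)) (\<Psi> b) (field_class E vol \<phi> b) < \<epsilon>)},
     hzero = (\<lambda>b. hzero (L2_space E (vol b))),
     hadd = (\<lambda>\<Psi> \<Phi> b. hadd (L2_space E (vol b)) (\<Psi> b) (\<Phi> b)),
     hscale = (\<lambda>a \<Psi> b. hscale (L2_space E (vol b)) a (\<Psi> b)),
     hact = (\<lambda>\<Psi> f b. hscale (L2_space E (vol b)) (f b) (\<Psi> b)),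
     hinner = (\<lambda>\<Psi> \<Phi> b. hinner (L2_space E (vol b)) (\<Psi> b) (\<Phi> b) ()) \<rparr>"

definition ev :: "'b \<Rightarrow> ('b \<Rightarrow> 'y) \<Rightarrow> 'y" where
  "ev b \<Psi> = \<Psi> b"

definition total_op ::
  "('m::topological_space, 'a::real_normed_vector) chart set \<Rightarrow> ('m, 'v::ab_group_add) vbundle \<Rightarrow>
   ('b \<Rightarrow> 'm measure) \<Rightarrow> (('m \<Rightarrow> 'v) \<Rightarrow> 'm \<Rightarrow> 'v) \<Rightarrow> ('b \<Rightarrow> ('m \<Rightarrow> 'v) set) operator" where
  "total_op A E vol D = op_closure (Gamma0 A E vol)
     {(field_class E vol \<phi>, field_class E vol (D \<phi>)) | \<phi>. \<phi> \<in> compact_sections A UNIV E}"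

text \<open>
  A vertical operator restricts to the fibre over \<open>b\<close>: the restriction maps \<open>s\<close> to
  \<open>D t\<close> on the fibre, for any smooth extension \<open>t\<close> of \<open>s\<close> to \<open>M\<close>.
\<close>

definition fibre_op ::
  "('m::topological_space, 'f::real_normed_vector \<times> 'e::real_normed_vector) chart set \<Rightarrow>
   ('b::topological_space, 'e) chart set \<Rightarrow> ('m \<Rightarrow> 'b) \<Rightarrow> ('m, 'v::ab_group_add) vbundle \<Rightarrow>
   ('b \<Rightarrow> 'm measure) \<Rightarrow> (('m \<Rightarrow> 'v) \<Rightarrow> 'm \<Rightarrow> 'v) \<Rightarrow> 'b \<Rightarrow> ('m \<Rightarrow> 'v) set operator" where
  "fibre_op A A' \<pi> E vol D b = op_closure (L2_space E (vol b))
     {(L2_class E (vol b) s, L2_class E (vol b) (D t)) | s t.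
        s \<in> compact_sections (fibre_atlas A A' \<pi> b) (\<pi> -` {b}) E \<and>
        t \<in> smooth_sections A UNIV E \<and> (\<forall>x\<in>\<pi> -` {b}. t x = s x)}"

end

theory Submission
  imports Defs
begin

text \<open>
  Let \<open>T\<close> be the closure of the operator on the Hilbert module and \<open>T\<^sub>b\<close> its fibres, and let \<open>N\<close> be
  the sum of the graph of \<open>T\<close> and the rotated graph of \<open>T\<^sup>*\<close>. The two graphs are orthogonal, so \<open>N\<close>
  is closed, and \<open>T\<close> is regular if and only if \<open>N\<close> is everything. Evaluating \<open>N\<close> at \<open>b\<close>
  gives a decomposition of every pair of vectors over \<open>b\<close> along the graphs of \<open>T\<^sub>b\<close> and
  \<open>T\<^sub>b\<^sup>*\<close>, so regularity lifts every element of the domain of \<open>T\<^sub>b\<^sup>*\<close>. Conversely, if the evaluations of the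
  domain of \<open>T\<^sup>*\<close> are cores, then the evaluations of \<open>N\<close> are dense over every \<open>b\<close>; norms of elements
  of the module being continuous in \<open>b\<close> and \<open>N\<close> being a module over continuous functions, a
  partition of unity on the base shows that \<open>N\<close> is dense.

  Besides symmetry, this needs of the family only that norms of smooth sections are
  continuous in \<open>b\<close> (integration along the fibres in submersion charts), that compactly supported
  smooth sections are dense in every \<open>L\<^sup>2\<close> space, and that multiplication by
  continuous functions on the base is approximated by multiplication by smooth ones, with
  which the operator commutes.
\<close>

section \<open>Hilbert spaces\<close>

text \<open>A closed submodule of a Hilbert module need not be complemented, and that is the whole
  difficulty: \<open>N\<close> is closed in every case, but a trivial annihilator would not make it
  everything. Over a single point the projection theorem does hold, so density can be tested there.
  If (p, q) annihilates the fibre of \<open>N\<close>, orthogonality to the graph of T_b says that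
  (q, -p) lies in the graph of the adjoint of T_b; the core property extends the annihilation from
  the lifted elements of that graph to all of it, in particular to (q, -p) itself, and this gives
  |p|^2 + |q|^2 = 0. In the other direction the element to lift is u in the domain of the adjoint of
  T_b, with image u'. Every vector over b is the value of an element of the module, so (-u', u) is
  the value of a pair in the module, and this pair splits along \<open>N\<close>. Over b its
  component along T also lies in the orthogonal complement of the graph of T_b, hence vanishes, and
  u is the value of an element of the domain of the adjoint of T.\<close>

locale hilbert =
  fixes H :: "('x, unit) hilbert_module"
  assumes zero_closed: "hzero H \<in> hcarrier H"
    and add_closed: "\<And>x y. \<lbrakk>x \<in> hcarrier H; y \<in> hcarrier H\<rbrakk> \<Longrightarrow> hadd H x y \<in> hcarrier H"
    and scale_closed: "\<And>a x. x \<in> hcarrier H \<Longrightarrow> hscale H a x \<in> hcarrier H"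
    and inner_zero: "\<And>x. x \<in> hcarrier H \<Longrightarrow> hinner H x (hzero H) () = 0"
    and inner_add: "\<And>x y z. \<lbrakk>x \<in> hcarrier H; y \<in> hcarrier H; z \<in> hcarrier H\<rbrakk>
      \<Longrightarrow> hinner H z (hadd H x y) () = hinner H z x () + hinner H z y ()"
    and inner_scale: "\<And>a x z. \<lbrakk>x \<in> hcarrier H; z \<in> hcarrier H\<rbrakk>
      \<Longrightarrow> hinner H z (hscale H a x) () = a * hinner H z x ()"
    and inner_sym: "\<And>x y. \<lbrakk>x \<in> hcarrier H; y \<in> hcarrier H\<rbrakk>
      \<Longrightarrow> hinner H x y () = cnj (hinner H y x ())"
    and inner_pos: "\<And>x. x \<in> hcarrier H \<Longrightarrow> 0 \<le> Re (hinner H x x ())"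
    and inner_ext: "\<And>x y. \<lbrakk>x \<in> hcarrier H; y \<in> hcarrier H;
      \<And>z. z \<in> hcarrier H \<Longrightarrow> hinner H z x () = hinner H z y ()\<rbrakk> \<Longrightarrow> x = y"
    and complete: "\<And>X. \<lbrakk>\<And>n::nat. X n \<in> hcarrier H;
      \<And>\<epsilon>. 0 < \<epsilon> \<Longrightarrow> \<exists>N. \<forall>m\<ge>N. \<forall>n\<ge>N. hdist H (X m) (X n) < \<epsilon>\<rbrakk>
      \<Longrightarrow> \<exists>x\<in>hcarrier H. (\<lambda>n. hdist H (X n) x) \<longlonglongrightarrow> 0"
begin

abbreviation C where "C \<equiv> hcarrier H"
abbreviation ip where "ip x y \<equiv> hinner H x y ()"
abbreviation sub where "sub x y \<equiv> hadd H x (hscale H (-1) y)"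
abbreviation nrm where "nrm x \<equiv> hnorm H x"
abbreviation dst where "dst x y \<equiv> hdist H x y"

lemma inner_add_left:
  "\<lbrakk>x \<in> C; y \<in> C; z \<in> C\<rbrakk> \<Longrightarrow> ip (hadd H x y) z = ip x z + ip y z"
  by (metis add_closed complex_cnj_add inner_add inner_sym)

lemma inner_scale_left:
  "\<lbrakk>x \<in> C; z \<in> C\<rbrakk> \<Longrightarrow> ip (hscale H a x) z = cnj a * ip x z"
  by (metis complex_cnj_mult inner_scale inner_sym scale_closed)

lemma inner_zero_left: "x \<in> C \<Longrightarrow> ip (hzero H) x = 0"
  by (metis complex_cnj_zero inner_sym inner_zero zero_closed)

lemmas hilb_simps = zero_closed add_closed scale_closed inner_zero inner_zero_left
  inner_add inner_add_left inner_scale inner_scale_left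

lemma inner_self_real: "x \<in> C \<Longrightarrow> ip x x = complex_of_real (Re (ip x x))"
  by (metis Reals_cnj_iff inner_sym of_real_Re)

lemma nrm_eq: "x \<in> C \<Longrightarrow> nrm x = sqrt (Re (ip x x))"
  unfolding hnorm_def UNIV_unit
  by (simp, subst inner_self_real, assumption) (simp add: inner_pos del: of_real_Re)

lemma nrm_sq: "x \<in> C \<Longrightarrow> (nrm x)\<^sup>2 = Re (ip x x)"
  by (simp add: nrm_eq inner_pos)

lemma nrm_ge0: "x \<in> C \<Longrightarrow> 0 \<le> nrm x"
  by (simp add: nrm_eq inner_pos)

lemma dst_eq: "dst x y = nrm (sub x y)"
  by (simp add: hdist_def)

lemma Re_inner_commute: "\<lbrakk>x \<in> C; y \<in> C\<rbrakk> \<Longrightarrow> Re (ip x y) = Re (ip y x)"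
  by (metis cnj.simps(1) inner_sym)

text \<open>A discriminant argument: \<open>t = 1 / N\<close> minimises the quadratic, and for
  \<open>N = 0\<close> a large \<open>t\<close> makes it negative unless \<open>p = 0\<close>. With
  \<open>p\<close> a squared inner product it gives Cauchy-Schwarz, and with \<open>X = 0\<close>
  the orthogonality of a shortest residue.\<close>

lemma quad_ineq:
  fixes X p N :: real
  assumes "\<And>t::real. 0 \<le> X - 2 * t * p + t\<^sup>2 * p * N" "0 \<le> p" "0 \<le> N" "0 \<le> X"
  shows "p \<le> X * N"
proof (cases "N = 0")
  case True
  have "p = 0"
  proof (rule ccontr)
    assume "p \<noteq> 0"
    then have "p > 0" using assms by simp
    have "0 \<le> X - 2 * ((X + 1) / p) * p" using assms(1)[of "(X+1)/p"] True by simp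
    then show False using \<open>p > 0\<close> assms(4) by simp
  qed
  then show ?thesis using True by simp
next
  case False
  then have "N > 0" using assms by simp
  have "0 \<le> X - 2 * (1/N) * p + (1/N)\<^sup>2 * p * N" by (rule assms(1))
  then have "0 \<le> X - p / N" using \<open>N > 0\<close> by (simp add: power2_eq_square field_simps)
  then show ?thesis using \<open>N > 0\<close> by (simp add: field_simps)
qed

text \<open>The factor \<open>ip y x\<close> in the coefficient aligns the phase, so that the term
  linear in \<open>t\<close> is real and carries the squared modulus.\<close>

lemma norm_expand:
  assumes "x \<in> C" "y \<in> C"
  shows "Re (ip (sub x (hscale H (of_real t * ip y x) y)) (sub x (hscale H (of_real t * ip y x) y)))
    = Re (ip x x) - 2 * t * (cmod (ip y x))\<^sup>2 + t\<^sup>2 * (cmod (ip y x))\<^sup>2 * Re (ip y y)"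
proof -
  have s: "ip x y = cnj (ip y x)" by (rule inner_sym) (use assms in auto)
  show ?thesis
  proof -
    obtain r where r: "ip y y = complex_of_real r" using inner_self_real[OF assms(2)] by metis
    have c: "(cmod (ip y x))\<^sup>2 = Re (ip y x) * Re (ip y x) + Im (ip y x) * Im (ip y x)"
      by (simp add: cmod_power2 flip: power2_eq_square)
    show ?thesis
      unfolding c using assms by (simp add: hilb_simps s r power2_eq_square algebra_simps)
  qed
qed

lemma cauchy_schwarz:
  assumes "x \<in> C" "y \<in> C"
  shows "cmod (ip x y) \<le> nrm x * nrm y"
proof -
  have "(cmod (ip y x))\<^sup>2 \<le> Re (ip x x) * Re (ip y y)"
  proof (rule quad_ineq)
    fix t :: real
    show "0 \<le> Re (ip x x) - 2 * t * (cmod (ip y x))\<^sup>2 + t\<^sup>2 * (cmod (ip y x))\<^sup>2 * Re (ip y y)"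
      unfolding norm_expand[OF assms, symmetric] by (rule inner_pos) (simp add: hilb_simps assms)
  qed (use assms inner_pos in auto)
  also have "cmod (ip y x) = cmod (ip x y)" using assms by (subst inner_sym) auto
  finally have "(cmod (ip x y))\<^sup>2 \<le> (nrm x * nrm y)\<^sup>2"
    using assms by (simp add: power_mult_distrib nrm_sq)
  then show ?thesis
    by (rule power2_le_imp_le) (simp add: assms nrm_ge0)
qed

lemma nrm_triangle:
  assumes "x \<in> C" "y \<in> C"
  shows "nrm (hadd H x y) \<le> nrm x + nrm y"
proof -
  have "Re (ip x y) \<le> nrm x * nrm y"
    using cauchy_schwarz[OF assms] complex_Re_le_cmod[of "ip x y"] by linarith
  moreover have "Re (ip y x) = Re (ip x y)" using Re_inner_commute assms by blast
  ultimately have "(nrm (hadd H x y))\<^sup>2 \<le> (nrm x + nrm y)\<^sup>2"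
    using assms by (simp add: nrm_sq hilb_simps power2_sum)
  then show ?thesis
    by (rule power2_le_imp_le) (simp add: assms nrm_ge0)
qed

lemma nrm_scale: "x \<in> C \<Longrightarrow> nrm (hscale H a x) = cmod a * nrm x"
proof -
  assume x: "x \<in> C"
  have "Re (ip (hscale H a x) (hscale H a x)) = (cmod a)\<^sup>2 * Re (ip x x)"
  proof -
    obtain r where r: "ip x x = complex_of_real r" using inner_self_real[OF x] by metis
    have c: "(cmod a)\<^sup>2 = Re a * Re a + Im a * Im a"
      by (simp add: cmod_power2 flip: power2_eq_square)
    show ?thesis
      unfolding c using x by (simp add: hilb_simps r power2_eq_square algebra_simps)
  qed
  then show ?thesis using x by (simp add: nrm_eq scale_closed real_sqrt_mult)
qed

lemma nrm_zero_iff: "x \<in> C \<Longrightarrow> nrm x = 0 \<longleftrightarrow> x = hzero H"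
proof
  assume x: "x \<in> C" and "nrm x = 0"
  then have "ip z x = 0" if "z \<in> C" for z
    using cauchy_schwarz[OF that x] by simp
  then show "x = hzero H"
    by (intro inner_ext) (simp_all add: hilb_simps x)
qed (simp add: nrm_eq hilb_simps)

lemma nrm_zero: "nrm (hzero H) = 0"
  using nrm_zero_iff zero_closed by blast

lemma sub_closed: "\<lbrakk>x \<in> C; y \<in> C\<rbrakk> \<Longrightarrow> sub x y \<in> C"
  by (simp add: hilb_simps)

lemma dst_ge0: "\<lbrakk>x \<in> C; y \<in> C\<rbrakk> \<Longrightarrow> 0 \<le> dst x y"
  by (simp add: dst_eq nrm_ge0 sub_closed)

lemma dst_sym: "\<lbrakk>x \<in> C; y \<in> C\<rbrakk> \<Longrightarrow> dst x y = dst y x"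
proof -
  assume "x \<in> C" "y \<in> C"
  \<comment> \<open>The locale has no vector space axioms. Identities between vectors are tested by
    \<open>inner_ext\<close> against all inner products, where they become identities of complex
    numbers.\<close>
  then have "sub x y = hscale H (-1) (sub y x)"
    by (intro inner_ext) (simp_all add: hilb_simps)
  with \<open>x \<in> C\<close> \<open>y \<in> C\<close> show ?thesis by (simp add: dst_eq nrm_scale sub_closed)
qed

lemma dst_triangle: "\<lbrakk>x \<in> C; y \<in> C; z \<in> C\<rbrakk> \<Longrightarrow> dst x z \<le> dst x y + dst y z"
proof -
  assume *: "x \<in> C" "y \<in> C" "z \<in> C"
  then have "sub x z = hadd H (sub x y) (sub y z)"
    by (intro inner_ext) (simp_all add: hilb_simps)
  with * show ?thesis by (simp add: dst_eq nrm_triangle sub_closed)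
qed

lemma dst_self: "x \<in> C \<Longrightarrow> dst x x = 0"
proof -
  assume "x \<in> C"
  then have "sub x x = hzero H"
    by (intro inner_ext) (simp_all add: hilb_simps)
  then show ?thesis by (simp add: dst_eq nrm_zero)
qed

lemma dst_eq_0: "\<lbrakk>x \<in> C; y \<in> C; dst x y = 0\<rbrakk> \<Longrightarrow> x = y"
proof -
  assume *: "x \<in> C" "y \<in> C" "dst x y = 0"
  then have z: "sub x y = hzero H" by (simp add: dst_eq nrm_zero_iff sub_closed)
  show ?thesis
  proof (rule inner_ext[OF *(1,2)])
    fix z assume "z \<in> C"
    then have "ip z (sub x y) = 0" by (simp add: z hilb_simps)
    then show "ip z x = ip z y" using \<open>z \<in> C\<close> * by (simp add: hilb_simps)
  qed
qed

lemma dst_zero: "x \<in> C \<Longrightarrow> dst x (hzero H) = nrm x"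
proof -
  assume "x \<in> C"
  then have "sub x (hzero H) = x"
    by (intro inner_ext) (simp_all add: hilb_simps)
  then show ?thesis by (simp add: dst_eq)
qed

lemma dst_add:
  "\<lbrakk>x \<in> C; y \<in> C; x' \<in> C; y' \<in> C\<rbrakk> \<Longrightarrow> dst (hadd H x y) (hadd H x' y') \<le> dst x x' + dst y y'"
proof -
  assume *: "x \<in> C" "y \<in> C" "x' \<in> C" "y' \<in> C"
  then have "sub (hadd H x y) (hadd H x' y') = hadd H (sub x x') (sub y y')"
    by (intro inner_ext) (simp_all add: hilb_simps)
  with * show ?thesis by (simp add: dst_eq nrm_triangle sub_closed)
qed

lemma dst_scale:
  "\<lbrakk>x \<in> C; x' \<in> C\<rbrakk> \<Longrightarrow> dst (hscale H a x) (hscale H a x') = cmod a * dst x x'"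
proof -
  assume *: "x \<in> C" "x' \<in> C"
  then have "sub (hscale H a x) (hscale H a x') = hscale H a (sub x x')"
    by (intro inner_ext) (simp_all add: hilb_simps algebra_simps)
  with * show ?thesis by (simp add: dst_eq nrm_scale sub_closed)
qed

section \<open>Continuity of the inner product and orthogonal projection\<close>

lemma inner_continuous:
  assumes "x \<in> C" "x' \<in> C" "y \<in> C" "y' \<in> C"
  shows "cmod (ip x y - ip x' y') \<le> dst x x' * nrm y + nrm x' * dst y y'"
proof -
  have "ip x y - ip x' y' = ip (sub x x') y + ip x' (sub y y')"
    using assms by (simp add: hilb_simps)
  also have "cmod \<dots> \<le> cmod (ip (sub x x') y) + cmod (ip x' (sub y y'))"
    by (rule norm_triangle_ineq)
  also have "\<dots> \<le> dst x x' * nrm y + nrm x' * dst y y'"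
    unfolding dst_eq using assms by (intro add_mono cauchy_schwarz) (simp_all add: sub_closed)
  finally show ?thesis .
qed

lemma inner_tendsto:
  assumes "\<And>n::nat. X n \<in> C" "x \<in> C" "\<And>n. Y n \<in> C" "y \<in> C"
    and "(\<lambda>n. dst (X n) x) \<longlonglongrightarrow> 0" "(\<lambda>n. dst (Y n) y) \<longlonglongrightarrow> 0"
  shows "(\<lambda>n. ip (X n) (Y n)) \<longlonglongrightarrow> ip x y"
proof -
  have 1: "cmod (ip (X n) (Y n) - ip x y) \<le> dst (X n) x * (nrm y + dst (Y n) y) + nrm x * dst (Y n) y" for n
  proof -
    have "nrm (Y n) \<le> dst (Y n) y + nrm y"
      using dst_triangle[of "Y n" y "hzero H"] by (simp add: assms dst_zero zero_closed)
    then show ?thesis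
      using inner_continuous[of "X n" x "Y n" y] mult_left_mono[of "nrm (Y n)" "nrm y + dst (Y n) y" "dst (X n) x"]
      by (simp add: assms dst_ge0)
  qed
  have "(\<lambda>n. dst (X n) x * (nrm y + dst (Y n) y) + nrm x * dst (Y n) y) \<longlonglongrightarrow> 0 * (nrm y + 0) + nrm x * 0"
    by (intro tendsto_intros assms)
  then have "(\<lambda>n. dst (X n) x * (nrm y + dst (Y n) y) + nrm x * dst (Y n) y) \<longlonglongrightarrow> 0" by simp
  then have "(\<lambda>n. ip (X n) (Y n) - ip x y) \<longlonglongrightarrow> 0"
    by (rule Lim_null_comparison[rotated]) (simp add: 1)
  then show ?thesis by (simp add: LIM_zero_iff)
qed

text \<open>Near-minimisers of the distance to \<open>x\<close> form a Cauchy sequence by the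
  parallelogram law, their limit minimises, and the first variation in the direction
  \<open>g\<close> vanishes.\<close>

lemma projection_exists:
  assumes F: "F \<subseteq> C" "hzero H \<in> F" "\<And>x y. \<lbrakk>x \<in> F; y \<in> F\<rbrakk> \<Longrightarrow> hadd H x y \<in> F"
    "\<And>a x. x \<in> F \<Longrightarrow> hscale H a x \<in> F"
    and closed: "\<And>X x. \<lbrakk>\<And>n::nat. X n \<in> F; x \<in> C; (\<lambda>n. dst (X n) x) \<longlonglongrightarrow> 0\<rbrakk> \<Longrightarrow> x \<in> F"
    and x: "x \<in> C"
  shows "\<exists>f\<in>F. \<forall>g\<in>F. ip g (sub x f) = 0"
proof -
  define Q where "Q f = Re (ip (sub x f) (sub x f))" for f
  define d where "d = Inf (Q ` F)"
  have FC: "f \<in> C" if "f \<in> F" for f using that F by blast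
  have bdd: "bdd_below (Q ` F)"
    by (rule bdd_belowI[of _ 0]) (auto simp: Q_def FC x sub_closed intro!: inner_pos)
  have dle: "d \<le> Q f" if "f \<in> F" for f
    unfolding d_def using that bdd by (intro cInf_lower) auto
  have "\<exists>f\<in>F. Q f < d + 1 / real (Suc n)" for n
  proof -
    have "Inf (Q ` F) < d + 1 / real (Suc n)" unfolding d_def by simp
    then show ?thesis using F(2) bdd by (subst (asm) cInf_less_iff) auto
  qed
  then obtain X where X: "X n \<in> F" "Q (X n) < d + 1 / real (Suc n)" for n by metis
  have XC: "X n \<in> C" for n using X FC by blast
  have par: "(dst (X m) (X n))\<^sup>2 \<le> 2 / real (Suc m) + 2 / real (Suc n)" for m n
  proof -
    \<comment> \<open>The midpoint lies in \<open>F\<close>, so its squared distance to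
      \<open>x\<close> is at least \<open>d\<close>; in the parallelogram identity this leaves only
      the two errors of the near-minimisers.\<close>
    let ?h = "hscale H (1/2) (hadd H (X m) (X n))"
    have "?h \<in> F" using X F by blast
    have "(dst (X m) (X n))\<^sup>2 = 2 * Q (X m) + 2 * Q (X n) - 4 * Q ?h"
      unfolding Q_def dst_eq using XC[of m] XC[of n] x Re_inner_commute[of "X m" "X n"]
        Re_inner_commute[of "X m" x] Re_inner_commute[of "X n" x]
      by (simp add: nrm_sq sub_closed) (simp add: hilb_simps field_simps)
    also have "\<dots> \<le> 2 * (d + 1 / real (Suc m)) + 2 * (d + 1 / real (Suc n)) - 4 * d"
    proof -
      have "2 * a + 2 * b - 4 * c \<le> 2 * (d + u) + 2 * (d + v) - 4 * d"
        if "a < d + u" "b < d + v" "d \<le> c" for a b c u v :: real using that by (smt (verit))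
      then show ?thesis using X(2)[of m] X(2)[of n] dle[OF \<open>?h \<in> F\<close>] by blast
    qed
    finally show ?thesis by simp
  qed
  have "\<exists>f\<in>C. (\<lambda>n. dst (X n) f) \<longlonglongrightarrow> 0"
  proof (rule complete)
    fix e :: real assume "e > 0"
    obtain N where N: "4 / e\<^sup>2 < real N" using reals_Archimedean2 by blast
    have "dst (X m) (X n) < e" if "m \<ge> N" "n \<ge> N" for m n
    proof -
      have "0 < real N" using N \<open>e>0\<close> by (smt (verit) divide_pos_pos zero_less_power)
      have "(dst (X m) (X n))\<^sup>2 \<le> 2 / real (Suc m) + 2 / real (Suc n)" by (rule par)
      also have "\<dots> \<le> 2 / real N + 2 / real N"
        using that \<open>0 < real N\<close> by (intro add_mono divide_left_mono) auto
      also have "\<dots> = 4 / real N" by simp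
      also have "\<dots> < e\<^sup>2" using N \<open>e>0\<close> \<open>0 < real N\<close> by (simp add: field_simps)
      finally show ?thesis using \<open>e>0\<close> by (metis less_eq_real_def power_less_imp_less_base)
    qed
    then show "\<exists>N. \<forall>m\<ge>N. \<forall>n\<ge>N. dst (X m) (X n) < e" by blast
  qed (rule XC)
  then obtain f where f: "f \<in> C" "(\<lambda>n. dst (X n) f) \<longlonglongrightarrow> 0" by blast
  have fF: "f \<in> F" using closed X(1) f by blast
  have "(\<lambda>n. dst (sub x (X n)) (sub x f)) \<longlonglongrightarrow> 0"
  proof (rule Lim_null_comparison[OF _ f(2)], rule always_eventually, rule allI)
    fix n
    have "dst (sub x (X n)) (sub x f) \<le> dst x x + dst (hscale H (-1) (X n)) (hscale H (-1) f)"
      using XC f x by (intro dst_add) (simp_all add: hilb_simps)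
    then show "norm (dst (sub x (X n)) (sub x f)) \<le> dst (X n) f"
      using XC f x by (simp add: dst_self dst_scale dst_ge0 sub_closed)
  qed
  then have "(\<lambda>n. ip (sub x (X n)) (sub x (X n))) \<longlonglongrightarrow> ip (sub x f) (sub x f)"
    using XC f x by (intro inner_tendsto) (simp_all add: sub_closed)
  then have "(\<lambda>n. Q (X n)) \<longlonglongrightarrow> Q f" unfolding Q_def by (rule tendsto_Re)
  moreover have "(\<lambda>n. d + 1 / real (Suc n)) \<longlonglongrightarrow> d + 0"
    by (intro tendsto_intros LIMSEQ_Suc lim_1_over_n)
  ultimately have Qf: "Q f \<le> d"
    using X(2) by (intro LIMSEQ_le[of "\<lambda>n. Q (X n)"]) (auto intro: less_imp_le)
  have "ip g (sub x f) = 0" if g: "g \<in> F" for g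
  proof -
    let ?p = "(cmod (ip g (sub x f)))\<^sup>2" and ?N = "Re (ip g g)"
    have gC: "g \<in> C" using g FC by blast
    \<comment> \<open>Minimality of \<open>f\<close> bounds the competitor in the direction
      \<open>g\<close> from below by \<open>d\<close>; the quadratic in \<open>t\<close> then has
      constant term 0, and \<open>quad_ineq\<close> applies.\<close>
    have "0 \<le> - 2 * t * ?p + t\<^sup>2 * ?p * ?N" for t :: real
    proof -
      let ?c = "complex_of_real t * ip g (sub x f)"
      have "sub (sub x f) (hscale H ?c g) = sub x (hadd H f (hscale H ?c g))"
        using x f gC by (intro inner_ext) (simp_all add: hilb_simps)
      then have "Re (ip (sub x f) (sub x f)) - 2 * t * ?p + t\<^sup>2 * ?p * ?N = Q (hadd H f (hscale H ?c g))"
        unfolding Q_def by (subst norm_expand[symmetric]) (simp_all add: x f gC hilb_simps)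
      moreover have "d \<le> Q (hadd H f (hscale H ?c g))"
        using fF g F by (intro dle) blast
      ultimately show ?thesis using Qf unfolding Q_def by linarith
    qed
    then have "?p \<le> 0 * ?N"
      by (intro quad_ineq) (auto simp: gC inner_pos)
    then show ?thesis by simp
  qed
  with fF show ?thesis by blast
qed

lemma subspace_eq_carrier:
  assumes F: "F \<subseteq> C" "hzero H \<in> F" "\<And>x y. \<lbrakk>x \<in> F; y \<in> F\<rbrakk> \<Longrightarrow> hadd H x y \<in> F"
    "\<And>a x. x \<in> F \<Longrightarrow> hscale H a x \<in> F"
    and closed: "\<And>X x. \<lbrakk>\<And>n::nat. X n \<in> F; x \<in> C; (\<lambda>n. dst (X n) x) \<longlonglongrightarrow> 0\<rbrakk> \<Longrightarrow> x \<in> F"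
    and triv: "\<And>x. \<lbrakk>x \<in> C; \<And>f. f \<in> F \<Longrightarrow> ip f x = 0\<rbrakk> \<Longrightarrow> x = hzero H"
  shows "F = C"
proof (intro equalityI F subsetI)
  fix x assume x: "x \<in> C"
  obtain f where f: "f \<in> F" "\<And>g. g \<in> F \<Longrightarrow> ip g (sub x f) = 0"
    using projection_exists[OF F _ x] closed by metis
  have fC: "f \<in> C" using f(1) F(1) by blast
  have "sub x f = hzero H" using x fC f(2) by (intro triv) (auto simp: sub_closed)
  then have "dst x f = 0" by (simp add: dst_eq nrm_zero)
  then show "x \<in> F" using dst_eq_0[OF x fC] f(1) by simp
qed

end

text \<open>The orthogonal sum of two copies of the space: graphs are subspaces of it, so that the
  projection theorem can be applied to relations.\<close>

definition hilbert_square :: "('x, unit) hilbert_module \<Rightarrow> ('x \<times> 'x, unit) hilbert_module" where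
  "hilbert_square H = \<lparr>
     hcarrier = hcarrier H \<times> hcarrier H,
     hzero = (hzero H, hzero H),
     hadd = (\<lambda>(x, y) (x', y'). (hadd H x x', hadd H y y')),
     hscale = (\<lambda>a (x, y). (hscale H a x, hscale H a y)),
     hact = (\<lambda>(x, y) f. (hact H x f, hact H y f)),
     hinner = (\<lambda>(x, y) (x', y') _. hinner H x x' () + hinner H y y' ()) \<rparr>"

lemma (in hilbert) hdist_square:
  assumes "x \<in> C" "y \<in> C" "x' \<in> C" "y' \<in> C"
  shows "(hdist (hilbert_square H) (x, y) (x', y')) = sqrt ((dst x x')\<^sup>2 + (dst y y')\<^sup>2)"
proof -
  have "ip (sub x x') (sub x x') + ip (sub y y') (sub y y')
      = complex_of_real ((dst x x')\<^sup>2 + (dst y y')\<^sup>2)"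
    unfolding dst_eq using assms inner_self_real[of "sub x x'"] inner_self_real[of "sub y y'"]
    by (simp add: nrm_sq sub_closed)
  then show ?thesis
    unfolding hdist_def[of "hilbert_square H"] hnorm_def[of "hilbert_square H"]
    by (simp add: hilbert_square_def UNIV_unit del: of_real_add)
qed

lemma (in hilbert) hilbert_hilbert_square: "hilbert (hilbert_square H)"
proof (unfold_locales, goal_cases)
  case (7 x y)
  then show ?case
    by (cases x, cases y) (simp add: hilbert_square_def, metis inner_sym)
next
  case (9 x y)
  obtain a b c d where [simp]: "x = (a, b)" "y = (c, d)" by (metis prod.exhaust)
  have m: "a \<in> C" "b \<in> C" "c \<in> C" "d \<in> C" using 9(1,2) by (auto simp: hilbert_square_def)
  have "ip z a = ip z c" if "z \<in> C" for z
    using 9(3)[of "(z, hzero H)"] that m by (simp add: hilbert_square_def hilb_simps)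
  moreover have "ip z b = ip z d" if "z \<in> C" for z
    using 9(3)[of "(hzero H, z)"] that m by (simp add: hilbert_square_def hilb_simps)
  ultimately show ?case using m inner_ext by simp
next
  case (10 X)
  have XC: "fst (X n) \<in> C" "snd (X n) \<in> C" for n
    using 10(1)[of n] by (auto simp: hilbert_square_def)
  have d: "hdist (hilbert_square H) (X m) (X n)
      = sqrt ((dst (fst (X m)) (fst (X n)))\<^sup>2 + (dst (snd (X m)) (snd (X n)))\<^sup>2)" for m n
    using hdist_square[OF XC(1)[of m] XC(2)[of m] XC(1)[of n] XC(2)[of n]] by simp
  have le1: "dst (fst (X m)) (fst (X n)) \<le> hdist (hilbert_square H) (X m) (X n)" for m n
    unfolding d by (rule real_le_rsqrt) simp
  have le2: "dst (snd (X m)) (snd (X n)) \<le> hdist (hilbert_square H) (X m) (X n)" for m n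
    unfolding d by (rule real_le_rsqrt) simp
  obtain x where x: "x \<in> C" "(\<lambda>n. dst (fst (X n)) x) \<longlonglongrightarrow> 0"
    using complete[of "\<lambda>n. fst (X n)"] XC 10(2) le1 by (meson le_less_trans)
  obtain y where y: "y \<in> C" "(\<lambda>n. dst (snd (X n)) y) \<longlonglongrightarrow> 0"
    using complete[of "\<lambda>n. snd (X n)"] XC 10(2) le2 by (meson le_less_trans)
  have "(\<lambda>n. sqrt ((dst (fst (X n)) x)\<^sup>2 + (dst (snd (X n)) y)\<^sup>2)) \<longlonglongrightarrow> sqrt (0\<^sup>2 + 0\<^sup>2)"
    by (intro tendsto_intros x y)
  then have "(\<lambda>n. hdist (hilbert_square H) (X n) (x, y)) \<longlonglongrightarrow> 0"
    using hdist_square[OF XC(1) XC(2) x(1) y(1)] by (subst (asm) hdist_square[symmetric]) (simp_all add: XC x y)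
  then show ?case using x y by (intro bexI[of _ "(x, y)"]) (auto simp: hilbert_square_def)
next
  case (8 x)
  then show ?case by (auto simp: hilbert_square_def inner_pos)
qed (auto simp: hilbert_square_def hilb_simps distrib_left)

context hilbert
begin

text \<open>For fixed \<open>p\<close> and \<open>q\<close> the equation is a closed condition on
  the pair (u, v). This is why an adjoint may be computed on generators of a graph, and why a core
  suffices for testing.\<close>

lemma op_closure_annihilate:
  assumes S: "S \<subseteq> C \<times> C" and xy: "(x, y) \<in> op_closure H S" and pq: "p \<in> C" "q \<in> C"
    and ann: "\<And>u v. (u, v) \<in> S \<Longrightarrow> ip u p = ip v q"
  shows "ip x p = ip y q"
proof (rule ccontr)
  assume ne: "ip x p \<noteq> ip y q"
  define e where "e = cmod (ip x p - ip y q)"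
  have "e > 0" using ne by (simp add: e_def)
  \<comment> \<open>The summand 1 keeps \<open>r\<close> positive when \<open>p\<close> and
    \<open>q\<close> vanish, and it leaves the final bound strictly below \<open>e\<close>, since (r
    - 1) / r < 1.\<close>
  define r where "r = nrm p + nrm q + 1"
  have "r > 0" using pq nrm_ge0 by (simp add: r_def add_nonneg_pos)
  have xC: "x \<in> C" "y \<in> C" using xy by (auto simp: op_closure_def)
  obtain u v where uv: "(u, v) \<in> S" "dst x u < e / r" "dst y v < e / r"
    using xy \<open>e > 0\<close> \<open>r > 0\<close> unfolding op_closure_def by (auto dest!: spec[of _ "e / r"])
  have uC: "u \<in> C" "v \<in> C" using uv S by auto
  have 1: "cmod (ip x p - ip u p) \<le> dst x u * nrm p"
    using inner_continuous[of x u p p] xC uC pq by (simp add: dst_self)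
  have 2: "cmod (ip y q - ip v q) \<le> dst y v * nrm q"
    using inner_continuous[of y v q q] xC uC pq by (simp add: dst_self)
  have "e = cmod ((ip x p - ip u p) - (ip y q - ip v q))"
    using ann[OF uv(1)] by (simp add: e_def)
  also have "\<dots> \<le> dst x u * nrm p + dst y v * nrm q"
    using norm_triangle_ineq4[of "ip x p - ip u p" "ip y q - ip v q"] 1 2 by linarith
  also have "\<dots> \<le> (e / r) * nrm p + (e / r) * nrm q"
    using uv(2,3) pq by (intro add_mono mult_right_mono) (auto simp: nrm_ge0)
  also have "\<dots> = (e / r) * (r - 1)" by (simp add: r_def distrib_left)
  also have "\<dots> = e * ((r - 1) / r)" by simp
  also have "\<dots> < e * 1" using \<open>r > 0\<close> \<open>e > 0\<close> by (intro mult_strict_left_mono) auto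
  finally show False by simp
qed

lemma dense_ann:
  assumes "S \<subseteq> C" and dense: "\<And>x e. \<lbrakk>x \<in> C; e > 0\<rbrakk> \<Longrightarrow> \<exists>s\<in>S. dst x s < e"
    and "x \<in> C" "y \<in> C" and eq: "\<And>s. s \<in> S \<Longrightarrow> ip s x = ip s y"
  shows "x = y"
proof (rule inner_ext)
  fix z assume z: "z \<in> C"
  \<comment> \<open>Density of \<open>S\<close> says that the diagonal over \<open>S\<close> has
    every (z, z) in its closure, which is the form handled for relations.\<close>
  have "(z, z) \<in> op_closure H {(s, s) | s. s \<in> S}"
    unfolding op_closure_def using z dense[OF z] by fastforce
  then show "ip z x = ip z y"
    by (rule op_closure_annihilate[rotated]) (use assms in auto)
qed (use assms in auto)

lemma inner_swap_eq:
  "\<lbrakk>ip x y = ip z w; x \<in> C; y \<in> C; z \<in> C; w \<in> C\<rbrakk> \<Longrightarrow> ip y x = ip w z"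
  using inner_sym[of y x] inner_sym[of w z] by simp

text \<open>Pythagoras for (u, v) and (-z, w): the last hypothesis says that these two pairs are
  orthogonal.\<close>

lemma sum_dst_sq:
  assumes "u \<in> C" "v \<in> C" "w \<in> C" "z \<in> C" "ip v w = ip u z"
  shows "(nrm (sub u z))\<^sup>2 + (nrm (hadd H v w))\<^sup>2 = (nrm u)\<^sup>2 + (nrm v)\<^sup>2 + (nrm w)\<^sup>2 + (nrm z)\<^sup>2"
proof -
  have "Re (ip z u) = Re (ip u z)" "Re (ip w v) = Re (ip v w)" using assms Re_inner_commute by blast+
  then show ?thesis using assms by (simp add: nrm_sq sub_closed hilb_simps)
qed

lemma op_closure_add:
  assumes S: "S \<subseteq> C \<times> C" "\<And>x y x' y'. \<lbrakk>(x, y) \<in> S; (x', y') \<in> S\<rbrakk> \<Longrightarrow> (hadd H x x', hadd H y y') \<in> S"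
    and "(x, y) \<in> op_closure H S" "(x', y') \<in> op_closure H S"
  shows "(hadd H x x', hadd H y y') \<in> op_closure H S"
proof -
  have C: "x \<in> C" "y \<in> C" "x' \<in> C" "y' \<in> C" using assms(3,4) by (auto simp: op_closure_def)
  have "\<exists>(p, q)\<in>S. dst (hadd H x x') p < e \<and> dst (hadd H y y') q < e" if "e > 0" for e
  proof -
    have "e/2 > 0" using that by simp
    obtain u v where 1: "(u, v) \<in> S" "dst x u < e/2" "dst y v < e/2"
      using assms(3) \<open>e/2>0\<close> unfolding op_closure_def by blast
    obtain u' v' where 2: "(u', v') \<in> S" "dst x' u' < e/2" "dst y' v' < e/2"
      using assms(4) \<open>e/2>0\<close> unfolding op_closure_def by blast
    have "u \<in> C" "v \<in> C" "u' \<in> C" "v' \<in> C" using 1 2 S(1) by auto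
    then show ?thesis
      using 1 2 dst_add[of x x' u u'] dst_add[of y y' v v'] C
      by (intro bexI[OF _ S(2)[OF 1(1) 2(1)]]) simp
  qed
  then show ?thesis using C by (simp add: op_closure_def add_closed)
qed

lemma op_closure_scale:
  assumes S: "S \<subseteq> C \<times> C" "\<And>x y. (x, y) \<in> S \<Longrightarrow> (hscale H a x, hscale H a y) \<in> S"
    and "(x, y) \<in> op_closure H S"
  shows "(hscale H a x, hscale H a y) \<in> op_closure H S"
proof -
  have C: "x \<in> C" "y \<in> C" using assms(3) by (auto simp: op_closure_def)
  have "\<exists>(p, q)\<in>S. dst (hscale H a x) p < e \<and> dst (hscale H a y) q < e" if "e > 0" for e
  proof -
    define d where "d = e / (cmod a + 1)"
    have c: "cmod a + 1 > 0" by (simp add: add_nonneg_pos)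
    then have "d > 0" using that by (simp add: d_def)
    then obtain u v where 1: "(u, v) \<in> S" "dst x u < d" "dst y v < d"
      using assms(3) unfolding op_closure_def by blast
    have uC: "u \<in> C" "v \<in> C" using 1 S(1) by auto
    have k: "cmod a * t < e" if "t < d" "t \<ge> 0" for t
    proof -
      have "cmod a * t \<le> cmod a * d" using that by (intro mult_left_mono) auto
      also have "\<dots> < (cmod a + 1) * d" using \<open>d > 0\<close> by (simp add: distrib_right)
      also have "\<dots> = e" using c by (simp add: d_def)
      finally show ?thesis .
    qed
    show ?thesis
      using k[OF 1(2)] k[OF 1(3)] C uC
      by (intro bexI[OF _ S(2)[OF 1(1)]]) (simp add: dst_scale dst_ge0)
  qed
  then show ?thesis using C by (simp add: op_closure_def scale_closed)
qed

lemma op_closure_idem: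
  assumes "S \<subseteq> C \<times> C"
  shows "op_closure H (op_closure H S) = op_closure H S"
proof (intro equalityI subsetI; clarify)
  fix x y assume xy: "(x, y) \<in> op_closure H (op_closure H S)"
  show "(x, y) \<in> op_closure H S"
    unfolding op_closure_def
  proof (clarify, intro conjI allI impI)
    show C: "x \<in> C" "y \<in> C" using xy by (auto simp: op_closure_def)
    fix e :: real assume "e > 0"
    then have "e/2 > 0" by simp
    then obtain u v where uv: "(u, v) \<in> op_closure H S" "dst x u < e/2" "dst y v < e/2"
      using xy unfolding op_closure_def[of H "op_closure H S"] by blast
    then obtain p q where pq: "(p, q) \<in> S" "dst u p < e/2" "dst v q < e/2"
      using \<open>e/2 > 0\<close> unfolding op_closure_def by blast
    have m: "u \<in> C" "v \<in> C" "p \<in> C" "q \<in> C" using uv pq assms by (auto simp: op_closure_def)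
    have "dst x p < e" "dst y q < e"
      using dst_triangle[of x u p] dst_triangle[of y v q] C m uv pq by auto
    then show "\<exists>(x', y')\<in>S. dst x x' < e \<and> dst y y' < e" using pq by blast
  qed
next
  fix x y assume xy: "(x, y) \<in> op_closure H S"
  then have C: "x \<in> C" "y \<in> C" by (auto simp: op_closure_def)
  show "(x, y) \<in> op_closure H (op_closure H S)"
    unfolding op_closure_def[of H "op_closure H S"]
    using C xy dst_self by force
qed

end

text \<open>In the orthogonal sum the closure of \<open>S\<close> is a closed subspace, and by the
  projection theorem a closed subspace with trivial annihilator is everything. Density in a fibre is
  always proved through this criterion.\<close>

lemma (in hilbert) relation_dense:
  assumes S: "S \<subseteq> C \<times> C" "(hzero H, hzero H) \<in> S"
    and add: "\<And>x y x' y'. \<lbrakk>(x, y) \<in> S; (x', y') \<in> S\<rbrakk> \<Longrightarrow> (hadd H x x', hadd H y y') \<in> S"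
    and scale: "\<And>a x y. (x, y) \<in> S \<Longrightarrow> (hscale H a x, hscale H a y) \<in> S"
    and triv: "\<And>p q. \<lbrakk>p \<in> C; q \<in> C; \<And>x y. (x, y) \<in> S \<Longrightarrow> ip x p + ip y q = 0\<rbrakk>
      \<Longrightarrow> p = hzero H \<and> q = hzero H"
  shows "op_closure H S = C \<times> C"
proof -
  interpret Q: hilbert "hilbert_square H" by (rule hilbert_hilbert_square)
  have QC: "Q.C = C \<times> C" by (simp add: hilbert_square_def)
  have sub: "S \<subseteq> op_closure H S"
  proof clarify
    fix x y assume *: "(x, y) \<in> S"
    then have "x \<in> C" "y \<in> C" using S(1) by auto
    with * show "(x, y) \<in> op_closure H S"
      by (auto simp: op_closure_def dst_self intro!: bexI[of _ "(x, y)"])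
  qed
  have "op_closure H S = Q.C"
  proof (rule Q.subspace_eq_carrier)
    show "op_closure H S \<subseteq> Q.C" unfolding QC by (auto simp: op_closure_def)
    show "hzero (hilbert_square H) \<in> op_closure H S" using S(2) sub by (auto simp: hilbert_square_def)
    show "hadd (hilbert_square H) f g \<in> op_closure H S" if "f \<in> op_closure H S" "g \<in> op_closure H S" for f g
      using op_closure_add[OF S(1) add, of "fst f" "snd f" "fst g" "snd g"] that
      by (simp add: hilbert_square_def split_beta)
    show "hscale (hilbert_square H) a f \<in> op_closure H S" if "f \<in> op_closure H S" for f a
      using op_closure_scale[OF S(1) scale, of "fst f" "snd f"] that
      by (simp add: hilbert_square_def split_beta)
    show "f = hzero (hilbert_square H)"
      if f: "f \<in> Q.C" "\<And>g. g \<in> op_closure H S \<Longrightarrow> Q.ip g f = 0" for f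
    proof -
      obtain p q where [simp]: "f = (p, q)" by (cases f)
      have "p = hzero H \<and> q = hzero H"
      proof (rule triv)
        fix x y assume "(x, y) \<in> S"
        then show "ip x p + ip y q = 0" using f(2)[of "(x, y)"] sub by (auto simp: hilbert_square_def)
      qed (use f(1) in \<open>auto simp: QC\<close>)
      then show ?thesis by (simp add: hilbert_square_def)
    qed
    show "f \<in> op_closure H S" if X: "\<And>n::nat. X n \<in> op_closure H S" "f \<in> Q.C" "(\<lambda>n. Q.dst (X n) f) \<longlonglongrightarrow> 0" for X f
    proof -
      obtain p q where f: "f = (p, q)" by (cases f)
      have pq: "p \<in> C" "q \<in> C" using X(2) by (auto simp: QC f)
      have "\<exists>(x, y)\<in>op_closure H S. dst p x < e \<and> dst q y < e" if "e > 0" for e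
      proof -
        obtain n where n: "Q.dst (X n) f < e"
          using order_tendstoD(2)[OF X(3) \<open>e > 0\<close>] by (meson eventually_sequentially le_refl)
        obtain x y where xy: "X n = (x, y)" by (cases "X n")
        have xyC: "x \<in> C" "y \<in> C" using X(1)[of n] xy by (auto simp: op_closure_def)
        have d: "Q.dst (X n) f = sqrt ((dst x p)\<^sup>2 + (dst y q)\<^sup>2)"
          unfolding xy f by (rule hdist_square[OF xyC pq])
        have "dst x p \<le> Q.dst (X n) f" "dst y q \<le> Q.dst (X n) f"
          unfolding d by (rule real_le_rsqrt; simp)+
        then show ?thesis
          using n X(1)[of n] dst_sym[OF xyC(1) pq(1)] dst_sym[OF xyC(2) pq(2)]
          unfolding xy by (intro bexI[of _ "(x, y)"]) auto
      qed
      then have "(p, q) \<in> op_closure H (op_closure H S)"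
        using pq by (simp add: op_closure_def[of H "op_closure H S"])
      then show ?thesis using op_closure_idem[OF S(1)] f by simp
    qed
  qed
  then show ?thesis using QC by simp
qed

section \<open>Continuous fields of Hilbert spaces\<close>

text \<open>\<open>Gamma0\<close> with the classes of compactly supported smooth sections replaced
  by any set of generating fields, which separates the operator theory from the geometry.\<close>

definition field_module ::
  "('b \<Rightarrow> ('x, unit) hilbert_module) \<Rightarrow> ('b \<Rightarrow> 'x) set \<Rightarrow> ('b \<Rightarrow> 'x, 'b) hilbert_module" where
  "field_module Hb \<Gamma> = \<lparr>
     hcarrier = {\<Psi>. (\<forall>b. \<Psi> b \<in> hcarrier (Hb b)) \<and>
       (\<forall>\<epsilon>>0. \<exists>\<phi>\<in>\<Gamma>. \<forall>b. hdist (Hb b) (\<Psi> b) (\<phi> b) < \<epsilon>)},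
     hzero = (\<lambda>b. hzero (Hb b)),
     hadd = (\<lambda>\<Psi> \<Phi> b. hadd (Hb b) (\<Psi> b) (\<Phi> b)),
     hscale = (\<lambda>a \<Psi> b. hscale (Hb b) a (\<Psi> b)),
     hact = (\<lambda>\<Psi> f b. hscale (Hb b) (f b) (\<Psi> b)),
     hinner = (\<lambda>\<Psi> \<Phi> b. hinner (Hb b) (\<Psi> b) (\<Phi> b) ()) \<rparr>"

text \<open>\<open>G\<close> is the graph of the operator on the generating fields.
  \<open>G_act\<close> asks only for approximation, but of both components at once: multiplication
  by a continuous function leaves the smooth sections, and it is the closure of the graph that has
  to be stable under it. The function may be unbounded because the fields have compact
  support.\<close>

locale hilbert_field =
  fixes Hb :: "'b::t2_space \<Rightarrow> ('x, unit) hilbert_module" and G :: "('b \<Rightarrow> 'x) operator"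
  assumes hilb: "\<And>b. hilbert (Hb b)"
    and G_closed: "\<And>\<phi> \<psi> b. (\<phi>, \<psi>) \<in> G \<Longrightarrow> \<phi> b \<in> hcarrier (Hb b)"
    and G_zero: "((\<lambda>b. hzero (Hb b)), (\<lambda>b. hzero (Hb b))) \<in> G"
    and G_add: "\<And>\<phi> \<psi> \<phi>' \<psi>'. \<lbrakk>(\<phi>, \<psi>) \<in> G; (\<phi>', \<psi>') \<in> G\<rbrakk>
      \<Longrightarrow> ((\<lambda>b. hadd (Hb b) (\<phi> b) (\<phi>' b)), (\<lambda>b. hadd (Hb b) (\<psi> b) (\<psi>' b))) \<in> G"
    and G_range: "\<And>\<phi> \<psi>. (\<phi>, \<psi>) \<in> G \<Longrightarrow> \<psi> \<in> Domain G"
    and G_norm: "\<And>\<phi> \<psi>. (\<phi>, \<psi>) \<in> G \<Longrightarrow> continuous_on UNIV (\<lambda>b. hnorm (Hb b) (\<phi> b))"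
    and G_supp: "\<And>\<phi> \<psi>. (\<phi>, \<psi>) \<in> G \<Longrightarrow> \<exists>K. compact K \<and> (\<forall>b\<in>-K. \<phi> b = hzero (Hb b))"
    and G_dense: "\<And>b \<xi> \<epsilon>. \<lbrakk>\<xi> \<in> hcarrier (Hb b); \<epsilon> > 0\<rbrakk>
      \<Longrightarrow> \<exists>\<phi>\<in>Domain G. hdist (Hb b) \<xi> (\<phi> b) < \<epsilon>"
    and G_act: "\<And>\<phi> \<psi> f \<epsilon>. \<lbrakk>(\<phi>, \<psi>) \<in> G; continuous_on UNIV (f :: 'b \<Rightarrow> complex); \<epsilon> > 0\<rbrakk>
      \<Longrightarrow> \<exists>(\<phi>', \<psi>')\<in>G. \<forall>b. hdist (Hb b) (hscale (Hb b) (f b) (\<phi> b)) (\<phi>' b) < \<epsilon> \<and>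
                            hdist (Hb b) (hscale (Hb b) (f b) (\<psi> b)) (\<psi>' b) < \<epsilon>"
    and G_sym: "\<And>\<phi> \<psi> \<phi>' \<psi>' b. \<lbrakk>(\<phi>, \<psi>) \<in> G; (\<phi>', \<psi>') \<in> G\<rbrakk>
      \<Longrightarrow> hinner (Hb b) (\<psi> b) (\<phi>' b) () = hinner (Hb b) (\<phi> b) (\<psi>' b) ()"
    and bump: "\<And>b W. \<lbrakk>open W; b \<in> W\<rbrakk> \<Longrightarrow> \<exists>h::'b \<Rightarrow> real. continuous_on UNIV h \<and>
      (\<forall>x. 0 \<le> h x \<and> h x \<le> 1) \<and> h b = 1 \<and> (\<forall>x. h x \<noteq> 0 \<longrightarrow> x \<in> W)"
begin

sublocale H: hilbert "Hb b" for b by (rule hilb)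

definition M where "M = field_module Hb (Domain G)"
abbreviation MC where "MC \<equiv> hcarrier M"
abbreviation hd where "hd b x y \<equiv> hdist (Hb b) x y"
abbreviation hn where "hn b x \<equiv> hnorm (Hb b) x"
abbreviation hi where "hi b x y \<equiv> hinner (Hb b) x y ()"
abbreviation ha where "ha b x y \<equiv> hadd (Hb b) x y"
abbreviation hs where "hs b a x \<equiv> hscale (Hb b) a x"

lemma M_simps [simp]:
  "hzero M = (\<lambda>b. hzero (Hb b))" "hadd M \<Psi> \<Phi> = (\<lambda>b. ha b (\<Psi> b) (\<Phi> b))"
  "hscale M a \<Psi> = (\<lambda>b. hs b a (\<Psi> b))" "hact M \<Psi> f = (\<lambda>b. hs b (f b) (\<Psi> b))"
  "hinner M \<Psi> \<Phi> = (\<lambda>b. hi b (\<Psi> b) (\<Phi> b))"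
  by (simp_all add: M_def field_module_def)

lemma MC_iff: "\<Psi> \<in> MC \<longleftrightarrow> (\<forall>b. \<Psi> b \<in> hcarrier (Hb b)) \<and>
    (\<forall>\<epsilon>>0. \<exists>\<phi>\<in>Domain G. \<forall>b. hd b (\<Psi> b) (\<phi> b) < \<epsilon>)"
  by (simp add: M_def field_module_def)

lemma MC_C: "\<Psi> \<in> MC \<Longrightarrow> \<Psi> b \<in> hcarrier (Hb b)"
  by (simp add: MC_iff)

lemma Dom_MC: "\<phi> \<in> Domain G \<Longrightarrow> \<phi> \<in> MC"
proof -
  assume "\<phi> \<in> Domain G"
  then have "hd b (\<phi> b) (\<phi> b) = 0" "\<phi> b \<in> hcarrier (Hb b)" for b
    using G_closed H.dst_self by blast+
  with \<open>\<phi> \<in> Domain G\<close> show ?thesis by (auto simp: MC_iff intro!: bexI[of _ \<phi>])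
qed

lemma G_MC: "(\<phi>, \<psi>) \<in> G \<Longrightarrow> \<phi> \<in> MC" "(\<phi>, \<psi>) \<in> G \<Longrightarrow> \<psi> \<in> MC"
  using Dom_MC G_range by blast+

lemma Dom_bounded:
  assumes "(\<phi>, \<psi>) \<in> G" shows "\<exists>B. \<forall>b. hn b (\<phi> b) \<le> B"
proof -
  obtain K where K: "compact K" "\<forall>b\<in>-K. \<phi> b = hzero (Hb b)" using G_supp assms by blast
  have "compact ((\<lambda>b. hn b (\<phi> b)) ` K)"
    using K(1) G_norm[OF assms] by (meson compact_continuous_image continuous_on_subset subset_UNIV)
  then obtain B where B: "\<forall>b\<in>K. norm (hn b (\<phi> b)) \<le> B"
    using compact_imp_bounded by (fastforce simp: bounded_iff)
  have "hn b (\<phi> b) \<le> max B 0" for b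
    using B K(2) H.nrm_zero[of b] by (cases "b \<in> K") fastforce+
  then show ?thesis by blast
qed

lemma hd_le_norms: "\<lbrakk>x \<in> hcarrier (Hb b); y \<in> hcarrier (Hb b)\<rbrakk> \<Longrightarrow> hn b x \<le> hd b x y + hn b y"
  by (metis H.dst_triangle H.dst_zero H.zero_closed)

lemma MC_bounded:
  assumes "\<Psi> \<in> MC" shows "\<exists>B\<ge>0. \<forall>b. hn b (\<Psi> b) \<le> B"
proof -
  obtain \<phi> where \<phi>: "\<phi> \<in> Domain G" "\<And>b. hd b (\<Psi> b) (\<phi> b) < 1"
    using assms unfolding MC_iff by (meson zero_less_one)
  obtain B where B: "\<And>b. hn b (\<phi> b) \<le> B" using \<phi>(1) Dom_bounded by blast
  have "hn b (\<Psi> b) \<le> 1 + \<bar>B\<bar>" for b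
    using hd_le_norms[of "\<Psi> b" b "\<phi> b"] \<phi>(2)[of b] B[of b] MC_C[OF assms] MC_C[OF Dom_MC[OF \<phi>(1)]]
    by (smt (verit))
  then show ?thesis by (intro exI[of _ "1 + \<bar>B\<bar>"]) auto
qed

text \<open>A strict bound on the norm at one point persists nearby; this is the half of continuity
  that carries an approximation from one fibre to a neighbourhood.\<close>

lemma MC_usc:
  assumes "\<Psi> \<in> MC" "hn b (\<Psi> b) < e"
  shows "\<exists>W. open W \<and> b \<in> W \<and> (\<forall>x\<in>W. hn x (\<Psi> x) < e)"
proof -
  \<comment> \<open>A third of the gap: passing to \<open>\<phi>\<close> costs \<open>d\<close> at
    \<open>b\<close> and again \<open>d\<close> at the nearby points, and the last third keeps the
    inequality strict.\<close>
  define d where "d = (e - hn b (\<Psi> b)) / 3"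
  have "d > 0" using assms by (simp add: d_def)
  obtain \<phi> where \<phi>: "\<phi> \<in> Domain G" "\<And>b. hd b (\<Psi> b) (\<phi> b) < d"
    using assms(1) \<open>d > 0\<close> unfolding MC_iff by meson
  have C: "\<Psi> x \<in> hcarrier (Hb x)" "\<phi> x \<in> hcarrier (Hb x)" for x
    using MC_C[OF assms(1)] MC_C[OF Dom_MC[OF \<phi>(1)]] by auto
  have "continuous_on UNIV (\<lambda>b. hn b (\<phi> b))" using \<phi>(1) G_norm by blast
  then have "open {x. hn x (\<phi> x) < e - d}"
    by (intro open_Collect_less continuous_on_const)
  moreover have "hn b (\<phi> b) < e - d"
  proof -
    have "hn b (\<Psi> b) = e - 3 * d" by (simp add: d_def field_simps)
    then show ?thesis
      using hd_le_norms[OF C(2)[of b] C(1)] H.dst_sym[OF C(2)[of b] C(1)] \<phi>(2)[of b] \<open>d > 0\<close>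
      by linarith
  qed
  moreover have "hn x (\<Psi> x) < e" if "hn x (\<phi> x) < e - d" for x
    using hd_le_norms[of "\<Psi> x" x "\<phi> x"] C[of x] \<phi>(2)[of x] that by simp
  ultimately show ?thesis by (intro exI[of _ "{x. hn x (\<phi> x) < e - d}"]) auto
qed

lemma MC_zero: "(\<lambda>b. hzero (Hb b)) \<in> MC"
  using G_MC G_zero by blast

lemma MC_add:
  assumes "\<Psi> \<in> MC" "\<Phi> \<in> MC" shows "(\<lambda>b. ha b (\<Psi> b) (\<Phi> b)) \<in> MC"
  unfolding MC_iff
proof (intro conjI allI impI)
  fix e :: real assume "e > 0"
  then have "e/2 > 0" by simp
  obtain \<phi> where \<phi>: "\<phi> \<in> Domain G" "\<And>b. hd b (\<Psi> b) (\<phi> b) < e/2"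
    using assms(1) \<open>e/2 > 0\<close> unfolding MC_iff by meson
  obtain \<psi> where \<psi>: "\<psi> \<in> Domain G" "\<And>b. hd b (\<Phi> b) (\<psi> b) < e/2"
    using assms(2) \<open>e/2 > 0\<close> unfolding MC_iff by meson
  have "hd b (ha b (\<Psi> b) (\<Phi> b)) (ha b (\<phi> b) (\<psi> b)) < e" for b
    using H.dst_add[of "\<Psi> b" b "\<Phi> b" "\<phi> b" "\<psi> b"] \<phi>(2)[of b] \<psi>(2)[of b]
      MC_C assms Dom_MC[OF \<phi>(1)] Dom_MC[OF \<psi>(1)] by (smt (verit) field_sum_of_halves)
  moreover have "(\<lambda>b. ha b (\<phi> b) (\<psi> b)) \<in> Domain G" using \<phi>(1) \<psi>(1) G_add by blast
  ultimately show "\<exists>\<phi>\<in>Domain G. \<forall>b. hd b (ha b (\<Psi> b) (\<Phi> b)) (\<phi> b) < e"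
    by (intro bexI[of _ "\<lambda>b. ha b (\<phi> b) (\<psi> b)"]) auto
qed (simp add: H.add_closed MC_C assms)

text \<open>Two errors of \<open>e / 2\<close>: replacing the pair by one from \<open>G\<close>,
  where \<open>f\<close> enters through its bound, and replacing the product with \<open>f\<close>
  by an element of \<open>G\<close>. The 1 in \<open>\<bar>B\<bar> + 1\<close> keeps the divisor
  positive.\<close>

lemma act_approx:
  assumes f: "continuous_on UNIV (f :: 'b \<Rightarrow> complex)" "\<And>b. cmod (f b) \<le> B"
    and C: "\<And>b. x b \<in> hcarrier (Hb b)" "\<And>b. y b \<in> hcarrier (Hb b)"
    and ap: "\<And>\<epsilon>. \<epsilon> > 0 \<Longrightarrow> \<exists>(\<phi>, \<psi>)\<in>G. \<forall>b. hd b (x b) (\<phi> b) < \<epsilon> \<and> hd b (y b) (\<psi> b) < \<epsilon>"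
    and e: "e > 0"
  shows "\<exists>(\<phi>, \<psi>)\<in>G. \<forall>b. hd b (hs b (f b) (x b)) (\<phi> b) < e \<and> hd b (hs b (f b) (y b)) (\<psi> b) < e"
proof -
  define d where "d = e / 2 / (\<bar>B\<bar> + 1)"
  have "d > 0" using e by (simp add: d_def)
  obtain \<phi> \<psi> where *: "(\<phi>, \<psi>) \<in> G" "\<And>b. hd b (x b) (\<phi> b) < d \<and> hd b (y b) (\<psi> b) < d"
    using ap[OF \<open>d > 0\<close>] by blast
  have "e/2 > 0" using e by simp
  obtain \<phi>' \<psi>' where **: "(\<phi>', \<psi>') \<in> G" "\<And>b. hd b (hs b (f b) (\<phi> b)) (\<phi>' b) < e/2 \<and>
      hd b (hs b (f b) (\<psi> b)) (\<psi>' b) < e/2"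
    using G_act[OF *(1) f(1) \<open>e/2 > 0\<close>] by blast
  have key: "hd b (hs b (f b) p) r < e"
    if "hd b p q < d" "hd b (hs b (f b) q) r < e/2" "p \<in> hcarrier (Hb b)" "q \<in> hcarrier (Hb b)"
      "r \<in> hcarrier (Hb b)" for b p q r
  proof -
    have "hd b (hs b (f b) p) (hs b (f b) q) = cmod (f b) * hd b p q"
      using that by (intro H.dst_scale) auto
    also have "\<dots> \<le> (\<bar>B\<bar> + 1) * d"
      using that f(2)[of b] H.dst_ge0[of p b q] by (intro mult_mono) auto
    also have "\<dots> = e/2"
    proof -
      have "c * (e / 2 / c) = e / 2" if "c \<noteq> 0" for c using that by simp
      moreover have "\<bar>B\<bar> + 1 \<noteq> 0" by linarith
      ultimately show ?thesis unfolding d_def by blast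
    qed
    finally show ?thesis
      using H.dst_triangle[of "hs b (f b) p" b "hs b (f b) q" r] that by (simp add: H.scale_closed)
  qed
  have "hd b (hs b (f b) (x b)) (\<phi>' b) < e \<and> hd b (hs b (f b) (y b)) (\<psi>' b) < e" for b
    using key[of b "x b" "\<phi> b" "\<phi>' b"] key[of b "y b" "\<psi> b" "\<psi>' b"] *(2)[of b] **(2)[of b]
      C[of b] MC_C[OF G_MC(1)[OF *(1)], of b] MC_C[OF G_MC(2)[OF *(1)], of b]
      MC_C[OF G_MC(1)[OF **(1)], of b] MC_C[OF G_MC(2)[OF **(1)], of b] by blast
  with **(1) show ?thesis by blast
qed

lemma MC_act:
  assumes "\<Psi> \<in> MC" and f: "continuous_on UNIV (f :: 'b \<Rightarrow> complex)" "\<And>b. cmod (f b) \<le> B"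
  shows "(\<lambda>b. hs b (f b) (\<Psi> b)) \<in> MC"
  unfolding MC_iff
proof (intro conjI allI impI)
  fix e :: real assume e: "e > 0"
  define d where "d = e / 2 / (\<bar>B\<bar> + 1)"
  have "d > 0" using e by (simp add: d_def)
  obtain \<phi> \<psi> where *: "(\<phi>, \<psi>) \<in> G" "\<And>b. hd b (\<Psi> b) (\<phi> b) < d"
    using assms(1) \<open>d > 0\<close> unfolding MC_iff by (meson DomainE)
  have "e/2 > 0" using e by simp
  obtain \<phi>' \<psi>' where **: "(\<phi>', \<psi>') \<in> G" "\<And>b. hd b (hs b (f b) (\<phi> b)) (\<phi>' b) < e/2"
    using G_act[OF *(1) f(1) \<open>e/2 > 0\<close>] by blast
  have "hd b (hs b (f b) (\<Psi> b)) (\<phi>' b) < e" for b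
  proof -
    have C: "\<Psi> b \<in> hcarrier (Hb b)" "\<phi> b \<in> hcarrier (Hb b)" "\<phi>' b \<in> hcarrier (Hb b)"
      using MC_C assms(1) G_MC(1)[OF *(1)] G_MC(1)[OF **(1)] by auto
    have "hd b (hs b (f b) (\<Psi> b)) (hs b (f b) (\<phi> b)) = cmod (f b) * hd b (\<Psi> b) (\<phi> b)"
      using C by (intro H.dst_scale) auto
    also have "\<dots> \<le> (\<bar>B\<bar> + 1) * d"
      using *(2)[of b] f(2)[of b] H.dst_ge0[OF C(1,2)] by (intro mult_mono) auto
    also have "\<dots> = e/2"
    proof -
      have "c * (e / 2 / c) = e / 2" if "c \<noteq> 0" for c using that by simp
      moreover have "\<bar>B\<bar> + 1 \<noteq> 0" by linarith
      ultimately show ?thesis unfolding d_def by blast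
    qed
    finally show ?thesis
      using H.dst_triangle[of "hs b (f b) (\<Psi> b)" b "hs b (f b) (\<phi> b)" "\<phi>' b"] C **(2)[of b]
      by (simp add: H.scale_closed)
  qed
  then show "\<exists>\<phi>\<in>Domain G. \<forall>b. hd b (hs b (f b) (\<Psi> b)) (\<phi> b) < e" using **(1) by blast
qed (simp add: H.scale_closed MC_C assms)

lemma MC_scale: "\<Psi> \<in> MC \<Longrightarrow> (\<lambda>b. hs b a (\<Psi> b)) \<in> MC"
  by (rule MC_act[of _ "\<lambda>_. a" "cmod a"]) auto

lemma MC_sub: "\<lbrakk>\<Psi> \<in> MC; \<Phi> \<in> MC\<rbrakk> \<Longrightarrow> (\<lambda>b. ha b (\<Psi> b) (hs b (-1) (\<Phi> b))) \<in> MC"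
  by (intro MC_add MC_scale)

text \<open>Convergence in the norm of the module, written fibrewise so that no supremum has to be
  handled.\<close>

definition ulim :: "(nat \<Rightarrow> 'b \<Rightarrow> 'x) \<Rightarrow> ('b \<Rightarrow> 'x) \<Rightarrow> bool" where
  "ulim X x \<longleftrightarrow> (\<forall>\<epsilon>>0. \<exists>N. \<forall>n\<ge>N. \<forall>b. hd b (X n b) (x b) < \<epsilon>)"

lemma ulim_pointwise:
  assumes "ulim X x" "\<And>n. X n b \<in> hcarrier (Hb b)" "x b \<in> hcarrier (Hb b)"
  shows "(\<lambda>n. hd b (X n b) (x b)) \<longlonglongrightarrow> 0"
  using assms H.dst_ge0 by (intro LIMSEQ_I) (fastforce simp: ulim_def)

text \<open>Completeness of the fibres gives a pointwise limit, the uniform Cauchy bound makes the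
  convergence uniform, and uniform limits stay in the module.\<close>

lemma MC_complete:
  assumes X: "\<And>n. X n \<in> MC"
    and Cauchy: "\<And>\<epsilon>. \<epsilon> > 0 \<Longrightarrow> \<exists>N. \<forall>m\<ge>N. \<forall>n\<ge>N. \<forall>b. hd b (X m b) (X n b) < \<epsilon>"
  shows "\<exists>\<Psi>\<in>MC. ulim X \<Psi>"
proof -
  have XC: "X n b \<in> hcarrier (Hb b)" for n b using X MC_C by blast
  have "\<exists>x\<in>hcarrier (Hb b). (\<lambda>n. hd b (X n b) x) \<longlonglongrightarrow> 0" for b
    by (rule H.complete) (use XC Cauchy in \<open>blast+\<close>)
  then obtain \<Psi> where \<Psi>: "\<And>b. \<Psi> b \<in> hcarrier (Hb b)" "\<And>b. (\<lambda>n. hd b (X n b) (\<Psi> b)) \<longlonglongrightarrow> 0"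
    by metis
  have u: "ulim X \<Psi>"
    unfolding ulim_def
  proof (intro allI impI)
    fix e :: real assume "e > 0"
    then have "e/2 > 0" by simp
    obtain N where N: "\<forall>m\<ge>N. \<forall>n\<ge>N. \<forall>b. hd b (X m b) (X n b) < e/2" using Cauchy[OF \<open>e/2>0\<close>] by blast
    have "hd b (X n b) (\<Psi> b) < e" if "n \<ge> N" for n b
    proof -
      have "\<forall>\<^sub>F m in sequentially. hd b (X m b) (\<Psi> b) < e/2"
        by (rule order_tendstoD(2)[OF \<Psi>(2) \<open>e/2>0\<close>])
      then obtain m where m: "m \<ge> N" "hd b (X m b) (\<Psi> b) < e/2"
        using eventually_happens'[OF _ eventually_conj[OF _ eventually_ge_at_top[of N]]]
          sequentially_bot by blast
      show ?thesis
        using H.dst_triangle[OF XC[of n] XC[of m] \<Psi>(1)[of b]] m N[rule_format, OF that m(1), of b] by simp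
    qed
    then show "\<exists>N. \<forall>n\<ge>N. \<forall>b. hd b (X n b) (\<Psi> b) < e" by blast
  qed
  have "\<Psi> \<in> MC"
    unfolding MC_iff
  proof (intro conjI allI impI)
    fix e :: real assume "e > 0"
    then have "e/2 > 0" by simp
    obtain n where n: "\<And>b. hd b (X n b) (\<Psi> b) < e/2"
      using u \<open>e/2>0\<close> unfolding ulim_def by blast
    obtain \<phi> where \<phi>: "\<phi> \<in> Domain G" "\<And>b. hd b (X n b) (\<phi> b) < e/2"
      using X[of n] \<open>e/2 > 0\<close> unfolding MC_iff by meson
    have "hd b (\<Psi> b) (\<phi> b) < e" for b
      using H.dst_triangle[OF \<Psi>(1) XC[of n] MC_C[OF Dom_MC[OF \<phi>(1)]], of b]
        H.dst_sym[OF \<Psi>(1)[of b] XC[of n]] n[of b] \<phi>(2)[of b] by simp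
    then show "\<exists>\<phi>\<in>Domain G. \<forall>b. hd b (\<Psi> b) (\<phi> b) < e" using \<phi>(1) by blast
  qed (rule \<Psi>)
  with u show ?thesis by blast
qed

lemma hdist_M_eq:
  assumes "\<Psi> \<in> MC" "\<Phi> \<in> MC"
  shows "hdist M \<Psi> \<Phi> = sqrt (SUP b. (hd b (\<Psi> b) (\<Phi> b))\<^sup>2)"
proof -
  have C: "ha b (\<Psi> b) (hs b (-1) (\<Phi> b)) \<in> hcarrier (Hb b)" for b
    using MC_C MC_sub assms by blast
  have "cmod (hi b (ha b (\<Psi> b) (hs b (-1) (\<Phi> b))) (ha b (\<Psi> b) (hs b (-1) (\<Phi> b)))) = (hd b (\<Psi> b) (\<Phi> b))\<^sup>2" for b
    unfolding H.dst_eq H.nrm_sq[OF C]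
    by (subst H.inner_self_real[OF C]) (simp add: H.inner_pos[OF C] del: of_real_Re)
  then show ?thesis by (simp add: hdist_def[of M] hnorm_def[of M])
qed

lemma hdist_M_bdd:
  assumes "\<Psi> \<in> MC" "\<Phi> \<in> MC"
  shows "bdd_above (range (\<lambda>b. (hd b (\<Psi> b) (\<Phi> b))\<^sup>2))"
proof -
  obtain B where "B \<ge> 0" and B: "\<And>b. hd b (\<Psi> b) (\<Phi> b) \<le> B"
    using MC_bounded[OF MC_sub[OF assms]] unfolding H.dst_eq by blast
  have "(hd b (\<Psi> b) (\<Phi> b))\<^sup>2 \<le> B\<^sup>2" for b
    using B H.dst_ge0 MC_C assms by (intro power_mono) auto
  then show ?thesis by (intro bdd_aboveI[of _ "B\<^sup>2"]) auto
qed

lemma hd_le_hdist_M: "\<lbrakk>\<Psi> \<in> MC; \<Phi> \<in> MC\<rbrakk> \<Longrightarrow> hd b (\<Psi> b) (\<Phi> b) \<le> hdist M \<Psi> \<Phi>"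
  unfolding hdist_M_eq by (rule real_le_rsqrt) (auto intro: cSUP_upper hdist_M_bdd)

lemma hdist_M_le:
  assumes "\<Psi> \<in> MC" "\<Phi> \<in> MC" "\<And>b. hd b (\<Psi> b) (\<Phi> b) \<le> e" "0 \<le> e"
  shows "hdist M \<Psi> \<Phi> \<le> e"
proof -
  have "(SUP b. (hd b (\<Psi> b) (\<Phi> b))\<^sup>2) \<le> e\<^sup>2"
    using assms H.dst_ge0 MC_C by (intro cSUP_least power_mono) auto
  then show ?thesis using assms by (simp add: hdist_M_eq real_le_lsqrt)
qed

lemma op_closure_M_iff:
  assumes "S \<subseteq> MC \<times> MC"
  shows "(x, y) \<in> op_closure M S \<longleftrightarrow> x \<in> MC \<and> y \<in> MC \<and>
    (\<forall>\<epsilon>>0. \<exists>(x', y')\<in>S. \<forall>b. hd b (x b) (x' b) < \<epsilon> \<and> hd b (y b) (y' b) < \<epsilon>)"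
proof (intro iffI conjI allI impI)
  assume l: "(x, y) \<in> op_closure M S"
  then show xy: "x \<in> MC" "y \<in> MC" by (auto simp: op_closure_def)
  fix e :: real assume "e > 0"
  then obtain x' y' where "(x', y') \<in> S" "hdist M x x' < e" "hdist M y y' < e"
    using l unfolding op_closure_def by blast
  then show "\<exists>(x', y')\<in>S. \<forall>b. hd b (x b) (x' b) < e \<and> hd b (y b) (y' b) < e"
  proof (intro bexI[of _ "(x', y')"], clarify)
    fix b
    have "x' \<in> MC" "y' \<in> MC" using \<open>(x', y') \<in> S\<close> assms by auto
    then show "hd b (x b) (x' b) < e \<and> hd b (y b) (y' b) < e"
      using hd_le_hdist_M[OF xy(1), of x' b] hd_le_hdist_M[OF xy(2), of y' b]
        \<open>hdist M x x' < e\<close> \<open>hdist M y y' < e\<close> by simp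
  qed
next
  assume r: "x \<in> MC \<and> y \<in> MC \<and>
    (\<forall>\<epsilon>>0. \<exists>(x', y')\<in>S. \<forall>b. hd b (x b) (x' b) < \<epsilon> \<and> hd b (y b) (y' b) < \<epsilon>)"
  have "\<exists>(x', y')\<in>S. hdist M x x' < e \<and> hdist M y y' < e" if "e > 0" for e
  proof -
    \<comment> \<open>Halved because a strict bound in every fibre gives only a weak one for the
      supremum.\<close>
    have "e / 2 > 0" using that by simp
    then obtain x' y' where s: "(x', y') \<in> S" "\<And>b. hd b (x b) (x' b) < e / 2 \<and> hd b (y b) (y' b) < e / 2"
      using r by blast
    then have "hdist M x x' \<le> e / 2" "hdist M y y' \<le> e / 2"
      using r assms that by (intro hdist_M_le; force intro: less_imp_le)+
    then show ?thesis using s that by (intro bexI[of _ "(x', y')"]) auto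
  qed
  then show "(x, y) \<in> op_closure M S" using r by (auto simp: op_closure_def)
qed

section \<open>The closed operator, its fibres and their adjoints\<close>

definition T where "T = op_closure M G"
definition Gb where "Gb b = {(\<phi> b, \<psi> b) | \<phi> \<psi>. (\<phi>, \<psi>) \<in> G}"
definition Tb where "Tb b = op_closure (Hb b) (Gb b)"

lemma G_sub: "G \<subseteq> MC \<times> MC" using G_MC by auto

lemma Gb_sub: "Gb b \<subseteq> hcarrier (Hb b) \<times> hcarrier (Hb b)"
  unfolding Gb_def using G_MC MC_C by blast

lemmas T_iff = op_closure_M_iff[OF G_sub, folded T_def]

lemma T_MC: "(x, y) \<in> T \<Longrightarrow> x \<in> MC" "(x, y) \<in> T \<Longrightarrow> y \<in> MC" by (auto simp: T_iff)

lemma T_sub: "T \<subseteq> MC \<times> MC" using T_MC by auto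

lemma G_T: "(\<phi>, \<psi>) \<in> G \<Longrightarrow> (\<phi>, \<psi>) \<in> T"
proof -
  assume *: "(\<phi>, \<psi>) \<in> G"
  then have "hd b (\<phi> b) (\<phi> b) = 0" "hd b (\<psi> b) (\<psi> b) = 0" for b
    using G_MC[OF *] MC_C H.dst_self by blast+
  with * G_MC[OF *] show ?thesis unfolding T_iff by (auto intro!: bexI[of _ "(\<phi>, \<psi>)"])
qed

lemma T_ev: "(x, y) \<in> T \<Longrightarrow> (x b, y b) \<in> Tb b"
  unfolding T_iff Tb_def op_closure_def Gb_def by (fastforce simp: MC_C)

lemma T_add:
  assumes "(x, y) \<in> T" "(x', y') \<in> T"
  shows "((\<lambda>b. ha b (x b) (x' b)), (\<lambda>b. ha b (y b) (y' b))) \<in> T"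
  unfolding T_iff
proof (intro conjI allI impI)
  show "(\<lambda>b. ha b (x b) (x' b)) \<in> MC" "(\<lambda>b. ha b (y b) (y' b)) \<in> MC"
    using assms T_MC MC_add by blast+
  fix e :: real assume "e > 0"
  then have "e/2 > 0" by simp
  obtain p q where pq: "(p, q) \<in> G" "\<And>b. hd b (x b) (p b) < e/2" "\<And>b. hd b (y b) (q b) < e/2"
    using assms(1) \<open>e/2>0\<close> unfolding T_iff by blast
  obtain p' q' where pq': "(p', q') \<in> G" "\<And>b. hd b (x' b) (p' b) < e/2" "\<And>b. hd b (y' b) (q' b) < e/2"
    using assms(2) \<open>e/2>0\<close> unfolding T_iff by blast
  have "hd b (ha b (x b) (x' b)) (ha b (p b) (p' b)) < e" "hd b (ha b (y b) (y' b)) (ha b (q b) (q' b)) < e" for b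
    using H.dst_add[of "x b" b "x' b" "p b" "p' b"] H.dst_add[of "y b" b "y' b" "q b" "q' b"]
      pq(2,3)[of b] pq'(2,3)[of b] MC_C[OF T_MC(1)[OF assms(1)]] MC_C[OF T_MC(2)[OF assms(1)]]
      MC_C[OF T_MC(1)[OF assms(2)]] MC_C[OF T_MC(2)[OF assms(2)]]
      MC_C[OF G_MC(1)[OF pq(1)]] MC_C[OF G_MC(2)[OF pq(1)]]
      MC_C[OF G_MC(1)[OF pq'(1)]] MC_C[OF G_MC(2)[OF pq'(1)]] by force+
  then show "\<exists>(x'', y'')\<in>G. \<forall>b. hd b (ha b (x b) (x' b)) (x'' b) < e \<and> hd b (ha b (y b) (y' b)) (y'' b) < e"
    by (intro bexI[OF _ G_add[OF pq(1) pq'(1)]]) auto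
qed

lemma T_act:
  assumes "(x, y) \<in> T" and f: "continuous_on UNIV (f :: 'b \<Rightarrow> complex)" "\<And>b. cmod (f b) \<le> B"
  shows "((\<lambda>b. hs b (f b) (x b)), (\<lambda>b. hs b (f b) (y b))) \<in> T"
  unfolding T_iff
proof (intro conjI allI impI)
  show "(\<lambda>b. hs b (f b) (x b)) \<in> MC" "(\<lambda>b. hs b (f b) (y b)) \<in> MC"
    using MC_act[OF T_MC(1)[OF assms(1)] f] MC_act[OF T_MC(2)[OF assms(1)] f] by auto
  fix e :: real assume "e > 0"
  then show "\<exists>(x', y')\<in>G. \<forall>b. hd b (hs b (f b) (x b)) (x' b) < e \<and> hd b (hs b (f b) (y b)) (y' b) < e"
    using assms(1) unfolding T_iff by (intro act_approx[OF f]) (auto simp: MC_C)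
qed

lemma T_scale: "(x, y) \<in> T \<Longrightarrow> ((\<lambda>b. hs b a (x b)), (\<lambda>b. hs b a (y b))) \<in> T"
  by (rule T_act[of _ _ "\<lambda>_. a" "cmod a"]) auto

lemma T_closed:
  assumes "x \<in> MC" "y \<in> MC"
    and ap: "\<And>\<epsilon>. \<epsilon> > 0 \<Longrightarrow> \<exists>(x', y')\<in>T. \<forall>b. hd b (x b) (x' b) < \<epsilon> \<and> hd b (y b) (y' b) < \<epsilon>"
  shows "(x, y) \<in> T"
  unfolding T_iff
proof (intro conjI allI impI)
  fix e :: real assume "e > 0"
  then have "e/2 > 0" by simp
  obtain u v where uv: "(u, v) \<in> T" "\<And>b. hd b (x b) (u b) < e/2" "\<And>b. hd b (y b) (v b) < e/2"
    using ap[OF \<open>e/2>0\<close>] by blast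
  obtain p q where pq: "(p, q) \<in> G" "\<And>b. hd b (u b) (p b) < e/2" "\<And>b. hd b (v b) (q b) < e/2"
    using uv(1) \<open>e/2>0\<close> unfolding T_iff by blast
  have "hd b (x b) (p b) < e" "hd b (y b) (q b) < e" for b
    using H.dst_triangle[OF MC_C[OF assms(1)] MC_C[OF T_MC(1)[OF uv(1)]] MC_C[OF G_MC(1)[OF pq(1)]], of b]
      H.dst_triangle[OF MC_C[OF assms(2)] MC_C[OF T_MC(2)[OF uv(1)]] MC_C[OF G_MC(2)[OF pq(1)]], of b]
      uv(2,3)[of b] pq(2,3)[of b] by linarith+
  then show "\<exists>(x', y')\<in>G. \<forall>b. hd b (x b) (x' b) < e \<and> hd b (y b) (y' b) < e" using pq(1) by blast
qed (use assms in auto)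

abbreviation Ta where "Ta \<equiv> op_adjoint M T"
abbreviation Tba where "Tba b \<equiv> op_adjoint (Hb b) (Tb b)"

lemma G_C: "(\<phi>, \<psi>) \<in> G \<Longrightarrow> \<phi> b \<in> hcarrier (Hb b)" "(\<phi>, \<psi>) \<in> G \<Longrightarrow> \<psi> b \<in> hcarrier (Hb b)"
  using G_MC MC_C by blast+

lemma field_ext:
  assumes "\<And>b. x b \<in> hcarrier (Hb b)" "\<And>b. y b \<in> hcarrier (Hb b)"
    "\<And>b z. z \<in> hcarrier (Hb b) \<Longrightarrow> hi b z (x b) = hi b z (y b)"
  shows "x = y"
  using assms H.inner_ext by blast

lemma G_Gb: "(u, v) \<in> G \<Longrightarrow> (u b, v b) \<in> Tb b"
  using G_T T_ev by blast

text \<open>The closure has the same adjoint as its generators, because the defining equation is a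
  closed condition.\<close>

lemma Tba_iff: "(x, y) \<in> Tba b \<longleftrightarrow> x \<in> hcarrier (Hb b) \<and> y \<in> hcarrier (Hb b) \<and>
    (\<forall>u v. (u, v) \<in> G \<longrightarrow> hi b (v b) x = hi b (u b) y)"
proof (intro iffI conjI allI impI)
  assume *: "(x, y) \<in> Tba b"
  then show "x \<in> hcarrier (Hb b)" "y \<in> hcarrier (Hb b)"
    by (auto simp: op_adjoint_def)
  fix u v assume "(u, v) \<in> G"
  from * G_Gb[OF this, of b] show "hi b (v b) x = hi b (u b) y"
    by (auto simp: op_adjoint_def fun_eq_iff)
next
  assume r: "x \<in> hcarrier (Hb b) \<and> y \<in> hcarrier (Hb b) \<and>
    (\<forall>u v. (u, v) \<in> G \<longrightarrow> hi b (v b) x = hi b (u b) y)"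
  have "hi b v x = hi b u y" if "(u, v) \<in> Tb b" for u v
  proof -
    have "hi b u y = hi b v x"
      by (rule H.op_closure_annihilate[OF Gb_sub that[unfolded Tb_def]]) (use r in \<open>auto simp: Gb_def\<close>)
    then show ?thesis by simp
  qed
  then show "(x, y) \<in> Tba b" using r by (auto simp: op_adjoint_def fun_eq_iff)
qed

text \<open>The equation defining the adjoint holds fibre by fibre, so the adjoint in the module
  consists of the fields of elements of the fibre adjoints whose two components belong to the
  module. Whether such a field passes through a given element over one point is the question of the
  theorem.\<close>

lemma Ta_iff: "(x, y) \<in> Ta \<longleftrightarrow> x \<in> MC \<and> y \<in> MC \<and> (\<forall>b. (x b, y b) \<in> Tba b)"
proof (intro iffI conjI allI)
  fix b
  assume a: "(x, y) \<in> Ta"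
  then show "x \<in> MC" "y \<in> MC" by (auto simp: op_adjoint_def)
  then show "(x b, y b) \<in> Tba b"
    using a G_T unfolding Tba_iff by (auto simp: op_adjoint_def MC_C fun_eq_iff)
next
  assume r: "x \<in> MC \<and> y \<in> MC \<and> (\<forall>b. (x b, y b) \<in> Tba b)"
  then have "hi b (v b) (x b) = hi b (u b) (y b)" if "(u, v) \<in> T" for u v b
    using T_ev[OF that, of b] by (auto simp: op_adjoint_def fun_eq_iff)
  then show "(x, y) \<in> Ta" using r by (auto simp: op_adjoint_def)
qed

lemma Tba_C: "(x, y) \<in> Tba b \<Longrightarrow> x \<in> hcarrier (Hb b)" "(x, y) \<in> Tba b \<Longrightarrow> y \<in> hcarrier (Hb b)"
  by (auto simp: op_adjoint_def)

lemma Dom_dense: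
  "\<lbrakk>x \<in> hcarrier (Hb b); e > 0\<rbrakk> \<Longrightarrow> \<exists>s\<in>(\<lambda>\<phi>. \<phi> b) ` Domain G. hd b x s < e"
  using G_dense by blast

lemma Dom_ev_sub: "(\<lambda>\<phi>. \<phi> b) ` Domain G \<subseteq> hcarrier (Hb b)"
  using Dom_MC MC_C by blast

lemma Tba_unique: "\<lbrakk>(x, y) \<in> Tba b; (x, y') \<in> Tba b\<rbrakk> \<Longrightarrow> y = y'"
  by (rule H.dense_ann[OF Dom_ev_sub[of b] Dom_dense]) (auto simp: Tba_iff)

text \<open>The place where symmetry enters: the adjoint extends \<open>G\<close> and is therefore
  densely defined.\<close>

lemma G_Ta: "(\<phi>, \<psi>) \<in> G \<Longrightarrow> (\<phi>, \<psi>) \<in> Ta"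
  unfolding Ta_iff Tba_iff using G_MC MC_C G_sym by blast

lemma Gb_sym: "(u, v) \<in> G \<Longrightarrow> (u b, v b) \<in> Tba b"
  using G_Ta Ta_iff by blast

lemma T_Tba_inner: "\<lbrakk>(x, y) \<in> T; (w, z) \<in> Tba b\<rbrakk> \<Longrightarrow> hi b (y b) w = hi b (x b) z"
  using T_ev[of x y b] by (auto simp: op_adjoint_def fun_eq_iff)

text \<open>By symmetry the generating fields lie in the domain of the fibre adjoint, so the inner
  products of \<open>y b\<close> with a dense set are determined by \<open>x b\<close>.\<close>

lemma T_unique:
  assumes "(x, y) \<in> T" "(x, y') \<in> T" shows "y = y'"
proof
  fix b
  have "hi b s (y b) = hi b s (y' b)" if s: "s \<in> (\<lambda>\<phi>. \<phi> b) ` Domain G" for s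
  proof -
    obtain \<phi> \<psi> where \<phi>: "(\<phi>, \<psi>) \<in> G" "s = \<phi> b" using s by blast
    have "hi b (y b) s = hi b (x b) (\<psi> b)" "hi b (y' b) s = hi b (x b) (\<psi> b)"
      unfolding \<phi>(2) by (rule T_Tba_inner[OF _ Gb_sym[OF \<phi>(1)]]; rule assms)+
    moreover have "s \<in> hcarrier (Hb b)" using s Dom_ev_sub by blast
    ultimately show ?thesis using H.inner_sym MC_C T_MC(2) assms by metis
  qed
  then show "y b = y' b"
    by (intro H.dense_ann[OF Dom_ev_sub Dom_dense]) (use MC_C T_MC(2) assms in auto)
qed

lemma C0_bounded:
  assumes "f \<in> C0" shows "\<exists>B. \<forall>b. cmod (f b) \<le> B"
proof -
  obtain K where K: "compact K" "\<forall>b\<in>-K. cmod (f b) < 1"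
    using assms unfolding C0_def by (force dest: spec[of _ 1])
  have "continuous_on K f" using assms unfolding C0_def by (blast intro: continuous_on_subset)
  then obtain B where "\<forall>b\<in>K. cmod (f b) \<le> B"
    using compact_imp_bounded[OF compact_continuous_image[OF \<open>continuous_on K f\<close> K(1)]]
    by (auto simp: bounded_iff)
  then have "cmod (f b) \<le> max B 1" for b
    using K(2) by (cases "b \<in> K") (auto simp: le_max_iff_disj less_imp_le)
  then show ?thesis by blast
qed

lemma closed_T: "closed_operator M T"
  unfolding closed_operator_def
proof (intro conjI)
  show "T \<subseteq> MC \<times> MC" by (rule T_sub)
  show "single_valued T" using T_unique by (auto simp: single_valued_def)
  show "(hzero M, hzero M) \<in> T" using G_zero G_T by simp
  show "\<forall>(x, y)\<in>T. \<forall>(x', y')\<in>T. (hadd M x x', hadd M y y') \<in> T" using T_add by auto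
  show "\<forall>(x, y)\<in>T. \<forall>a. (hscale M a x, hscale M a y) \<in> T" using T_scale by auto
  show "\<forall>(x, y)\<in>T. \<forall>f\<in>C0. (hact M x f, hact M y f) \<in> T"
  proof clarify
    fix x y f assume "(x, y) \<in> T" and f: "f \<in> (C0 :: ('b \<Rightarrow> complex) set)"
    then obtain B where B: "\<And>b. cmod (f b) \<le> B" using C0_bounded by blast
    have "continuous_on UNIV f" using f by (simp add: C0_def)
    from T_act[OF \<open>(x, y) \<in> T\<close> this B] show "(hact M x f, hact M y f) \<in> T" by simp
  qed
  show "op_closure M T = T"
  proof (intro equalityI subsetI; clarify)
    fix x y assume "(x, y) \<in> op_closure M T"
    then show "(x, y) \<in> T" unfolding op_closure_M_iff[OF T_sub] by (intro T_closed) auto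
  next
    fix x y assume *: "(x, y) \<in> T"
    then have "hd b (x b) (x b) = 0" "hd b (y b) (y b) = 0" for b
      using T_MC[OF *] MC_C H.dst_self by blast+
    with * T_MC[OF *] show "(x, y) \<in> op_closure M T"
      unfolding op_closure_M_iff[OF T_sub] by (auto intro!: bexI[of _ "(x, y)"])
  qed
qed

lemma hdense_M:
  assumes "Domain G \<subseteq> Y" "Y \<subseteq> MC"
  shows "hdense M Y"
  unfolding hdense_def
proof (intro conjI ballI allI impI assms)
  fix x and e :: real assume x: "x \<in> MC" "e > 0"
  then have "e/2 > 0" by simp
  then obtain \<phi> where \<phi>: "\<phi> \<in> Domain G" "\<And>b. hd b (x b) (\<phi> b) < e/2"
    using x unfolding MC_iff by meson
  then have "hdist M x \<phi> \<le> e/2"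
    using x Dom_MC by (intro hdist_M_le) (auto intro: less_imp_le)
  then show "\<exists>y\<in>Y. hdist M x y < e" using \<phi> x assms by (intro bexI[of _ \<phi>]) auto
qed

text \<open>
  The sum of the graph of \<open>T\<close> and the graph of \<open>T\<^sup>*\<close> rotated by \<open>(w, z) \<mapsto> (- z, w)\<close>,
  its orthogonal complement.
\<close>

definition N where "N = {((\<lambda>b. ha b (u b) (hs b (-1) (z b))), (\<lambda>b. ha b (v b) (w b))) | u v w z.
   (u, v) \<in> T \<and> (w, z) \<in> Ta}"

lemma N_iff: "(x, y) \<in> N \<longleftrightarrow> (\<exists>u v w z. (u, v) \<in> T \<and> (w, z) \<in> Ta \<and>
   x = (\<lambda>b. ha b (u b) (hs b (-1) (z b))) \<and> y = (\<lambda>b. ha b (v b) (w b)))"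
  by (auto simp: N_def)

lemma Ta_MC: "(x, y) \<in> Ta \<Longrightarrow> x \<in> MC" "(x, y) \<in> Ta \<Longrightarrow> y \<in> MC" by (auto simp: Ta_iff)

lemma Tba_add: "\<lbrakk>(x, y) \<in> Tba b; (x', y') \<in> Tba b\<rbrakk> \<Longrightarrow> (ha b x x', ha b y y') \<in> Tba b"
  unfolding Tba_iff by (auto simp: H.hilb_simps G_C)

lemma Tba_scale: "(x, y) \<in> Tba b \<Longrightarrow> (hs b a x, hs b a y) \<in> Tba b"
  unfolding Tba_iff by (auto simp: H.hilb_simps G_C)

lemma Tba_zero: "(hzero (Hb b), hzero (Hb b)) \<in> Tba b"
  unfolding Tba_iff by (auto simp: H.hilb_simps G_C)

lemma Ta_add: "\<lbrakk>(x, y) \<in> Ta; (x', y') \<in> Ta\<rbrakk> \<Longrightarrow> ((\<lambda>b. ha b (x b) (x' b)), (\<lambda>b. ha b (y b) (y' b))) \<in> Ta"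
  unfolding Ta_iff using Tba_add MC_add by blast

lemma Ta_act: "\<lbrakk>(x, y) \<in> Ta; continuous_on UNIV (f :: 'b \<Rightarrow> complex); \<And>b. cmod (f b) \<le> B\<rbrakk> \<Longrightarrow>
   ((\<lambda>b. hs b (f b) (x b)), (\<lambda>b. hs b (f b) (y b))) \<in> Ta"
  unfolding Ta_iff using Tba_scale MC_act[of x f B] MC_act[of y f B] by blast

lemma Ta_scale: "(x, y) \<in> Ta \<Longrightarrow> ((\<lambda>b. hs b a (x b)), (\<lambda>b. hs b a (y b))) \<in> Ta"
  by (rule Ta_act[of _ _ "\<lambda>_. a" "cmod a"]) auto

lemma Ta_zero: "((\<lambda>b. hzero (Hb b)), (\<lambda>b. hzero (Hb b))) \<in> Ta"
  unfolding Ta_iff using Tba_zero MC_zero by blast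

lemma T_zero: "((\<lambda>b. hzero (Hb b)), (\<lambda>b. hzero (Hb b))) \<in> T"
  using G_T G_zero by blast

lemma N_MC: "(x, y) \<in> N \<Longrightarrow> x \<in> MC" "(x, y) \<in> N \<Longrightarrow> y \<in> MC"
  unfolding N_iff using T_MC Ta_MC MC_add MC_sub by blast+

lemma N_add:
  assumes "(x, y) \<in> N" "(x', y') \<in> N"
  shows "((\<lambda>b. ha b (x b) (x' b)), (\<lambda>b. ha b (y b) (y' b))) \<in> N"
proof -
  obtain u v w z where 1: "(u, v) \<in> T" "(w, z) \<in> Ta"
    "x = (\<lambda>b. ha b (u b) (hs b (-1) (z b)))" "y = (\<lambda>b. ha b (v b) (w b))" using assms N_iff by auto
  obtain u' v' w' z' where 2: "(u', v') \<in> T" "(w', z') \<in> Ta"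
    "x' = (\<lambda>b. ha b (u' b) (hs b (-1) (z' b)))" "y' = (\<lambda>b. ha b (v' b) (w' b))" using assms N_iff by auto
  note C = MC_C[OF T_MC(1)[OF 1(1)]] MC_C[OF T_MC(2)[OF 1(1)]] MC_C[OF Ta_MC(1)[OF 1(2)]] MC_C[OF Ta_MC(2)[OF 1(2)]]
    MC_C[OF T_MC(1)[OF 2(1)]] MC_C[OF T_MC(2)[OF 2(1)]] MC_C[OF Ta_MC(1)[OF 2(2)]] MC_C[OF Ta_MC(2)[OF 2(2)]]
  have "(\<lambda>b. ha b (x b) (x' b)) = (\<lambda>b. ha b (ha b (u b) (u' b)) (hs b (-1) (ha b (z b) (z' b))))"
    unfolding 1 2 by (rule field_ext) (simp_all add: H.hilb_simps C)
  moreover have "(\<lambda>b. ha b (y b) (y' b)) = (\<lambda>b. ha b (ha b (v b) (v' b)) (ha b (w b) (w' b)))"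
    unfolding 1 2 by (rule field_ext) (simp_all add: H.hilb_simps C)
  ultimately show ?thesis
    unfolding N_iff using T_add[OF 1(1) 2(1)] Ta_add[OF 1(2) 2(2)] by blast
qed

lemma N_act:
  assumes "(x, y) \<in> N" and f: "continuous_on UNIV (f :: 'b \<Rightarrow> complex)" "\<And>b. cmod (f b) \<le> B"
  shows "((\<lambda>b. hs b (f b) (x b)), (\<lambda>b. hs b (f b) (y b))) \<in> N"
proof -
  obtain u v w z where 1: "(u, v) \<in> T" "(w, z) \<in> Ta"
    "x = (\<lambda>b. ha b (u b) (hs b (-1) (z b)))" "y = (\<lambda>b. ha b (v b) (w b))" using assms N_iff by auto
  note C = MC_C[OF T_MC(1)[OF 1(1)]] MC_C[OF T_MC(2)[OF 1(1)]] MC_C[OF Ta_MC(1)[OF 1(2)]] MC_C[OF Ta_MC(2)[OF 1(2)]]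
  have "(\<lambda>b. hs b (f b) (x b)) = (\<lambda>b. ha b (hs b (f b) (u b)) (hs b (-1) (hs b (f b) (z b))))"
    unfolding 1 by (rule field_ext) (simp_all add: H.hilb_simps C algebra_simps)
  moreover have "(\<lambda>b. hs b (f b) (y b)) = (\<lambda>b. ha b (hs b (f b) (v b)) (hs b (f b) (w b)))"
    unfolding 1 by (rule field_ext) (simp_all add: H.hilb_simps C algebra_simps)
  ultimately show ?thesis
    unfolding N_iff using T_act[OF 1(1) f] Ta_act[OF 1(2) f] by blast
qed

lemma N_scale: "(x, y) \<in> N \<Longrightarrow> ((\<lambda>b. hs b a (x b)), (\<lambda>b. hs b a (y b))) \<in> N"
  by (rule N_act[of _ _ "\<lambda>_. a" "cmod a"]) auto

lemma add_zero: "x \<in> hcarrier (Hb b) \<Longrightarrow> ha b x (hzero (Hb b)) = x"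
  "x \<in> hcarrier (Hb b) \<Longrightarrow> ha b (hzero (Hb b)) x = x"
  "x \<in> hcarrier (Hb b) \<Longrightarrow> ha b x (hs b a (hzero (Hb b))) = x"
  "x \<in> hcarrier (Hb b) \<Longrightarrow> hs b (-1) (hs b (-1) x) = x"
  by (rule H.inner_ext[where b=b]; simp add: H.hilb_simps)+

lemma T_N: assumes "(u, v) \<in> T" shows "(u, v) \<in> N"
  unfolding N_iff
  by (intro exI[of _ u] exI[of _ v] exI[of _ "\<lambda>b. hzero (Hb b)"] exI[of _ "\<lambda>b. hzero (Hb b)"] conjI ext assms Ta_zero)
    (simp_all add: add_zero MC_C T_MC(1)[OF assms] T_MC(2)[OF assms])

lemma Ta_N: assumes "(w, z) \<in> Ta" shows "((\<lambda>b. hs b (-1) (z b)), w) \<in> N"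
  unfolding N_iff
  by (intro exI[of _ w] exI[of _ z] exI[of _ "\<lambda>b. hzero (Hb b)"] exI[of _ "\<lambda>b. hzero (Hb b)"] conjI ext assms T_zero)
    (simp_all add: add_zero MC_C Ta_MC(1)[OF assms] Ta_MC(2)[OF assms] H.scale_closed)

lemma Tba_closed:
  assumes c: "(x, y) \<in> op_closure (Hb b) (Tba b)" shows "(x, y) \<in> Tba b"
  unfolding Tba_iff
proof (intro conjI allI impI)
  have S: "Tba b \<subseteq> hcarrier (Hb b) \<times> hcarrier (Hb b)" using Tba_C by auto
  show C: "x \<in> hcarrier (Hb b)" "y \<in> hcarrier (Hb b)" using c by (auto simp: op_closure_def)
  fix u v assume uv: "(u, v) \<in> G"
  have "hi b x (v b) = hi b y (u b)"
  proof (rule H.op_closure_annihilate[OF S c G_C(2)[OF uv] G_C(1)[OF uv]])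
    fix p q assume pq: "(p, q) \<in> Tba b"
    then have "hi b (v b) p = hi b (u b) q" using uv Tba_iff by blast
    then show "hi b p (v b) = hi b q (u b)"
      by (rule H.inner_swap_eq) (simp_all add: Tba_C[OF pq] G_C[OF uv])
  qed
  then show "hi b (v b) x = hi b (u b) y"
    by (rule H.inner_swap_eq) (simp_all add: C G_C[OF uv])
qed

lemma Ta_closed:
  assumes "x \<in> MC" "y \<in> MC"
    and ap: "\<And>\<epsilon>. \<epsilon> > 0 \<Longrightarrow> \<exists>(x', y')\<in>Ta. \<forall>b. hd b (x b) (x' b) < \<epsilon> \<and> hd b (y b) (y' b) < \<epsilon>"
  shows "(x, y) \<in> Ta"
  unfolding Ta_iff
proof (intro conjI allI assms(1,2))
  fix b
  have "(x b, y b) \<in> op_closure (Hb b) (Tba b)"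
    unfolding op_closure_def
  proof (clarify, intro conjI allI impI)
    show "x b \<in> hcarrier (Hb b)" "y b \<in> hcarrier (Hb b)" using assms MC_C by auto
    fix e :: real assume "e > 0"
    then obtain x' y' where "(x', y') \<in> Ta" "hd b (x b) (x' b) < e" "hd b (y b) (y' b) < e"
      using ap by blast
    then show "\<exists>(x', y')\<in>Tba b. hd b (x b) x' < e \<and> hd b (y b) y' < e"
      using Ta_iff by blast
  qed
  then show "(x b, y b) \<in> Tba b" by (rule Tba_closed)
qed

text \<open>The differences of the two summands are orthogonal pairs, so by
  \<open>sum_dst_sq\<close> each component is bounded by the difference of the sums. Convergence in
  \<open>N\<close> is thereby convergence of the components.\<close>

lemma hd_add_le:
  assumes "(u, v) \<in> T" "(w, z) \<in> Ta" "(u', v') \<in> T" "(w', z') \<in> Ta"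
    and x: "x = ha b (u b) (hs b (-1) (z b))" "x' = ha b (u' b) (hs b (-1) (z' b))"
    and y: "y = ha b (v b) (w b)" "y' = ha b (v' b) (w' b)"
  shows "hd b (u b) (u' b) \<le> hd b x x' + hd b y y'" "hd b (v b) (v' b) \<le> hd b x x' + hd b y y'"
    "hd b (w b) (w' b) \<le> hd b x x' + hd b y y'" "hd b (z b) (z' b) \<le> hd b x x' + hd b y y'"
proof -
  note C = MC_C[OF T_MC(1)[OF assms(1)]] MC_C[OF T_MC(2)[OF assms(1)]] MC_C[OF Ta_MC(1)[OF assms(2)]] MC_C[OF Ta_MC(2)[OF assms(2)]]
    MC_C[OF T_MC(1)[OF assms(3)]] MC_C[OF T_MC(2)[OF assms(3)]] MC_C[OF Ta_MC(1)[OF assms(4)]] MC_C[OF Ta_MC(2)[OF assms(4)]]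
  let ?u = "ha b (u b) (hs b (-1) (u' b))" and ?v = "ha b (v b) (hs b (-1) (v' b))"
  let ?w = "ha b (w b) (hs b (-1) (w' b))" and ?z = "ha b (z b) (hs b (-1) (z' b))"
  have D: "?u \<in> hcarrier (Hb b)" "?v \<in> hcarrier (Hb b)" "?w \<in> hcarrier (Hb b)" "?z \<in> hcarrier (Hb b)"
    by (simp_all add: C H.hilb_simps)
  have "(?w, ?z) \<in> Tba b"
    using assms(2,4) Tba_add Tba_scale Ta_iff by blast
  moreover have "((\<lambda>b. ha b (u b) (hs b (-1) (u' b))), (\<lambda>b. ha b (v b) (hs b (-1) (v' b)))) \<in> T"
    using T_add[OF assms(1) T_scale[OF assms(3)]] .
  ultimately have o: "hi b ?v ?w = hi b ?u ?z" using T_Tba_inner by blast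
  have "ha b x (hs b (-1) x') = ha b ?u (hs b (-1) ?z)"
    unfolding x by (rule H.inner_ext[where b=b]) (simp_all add: C H.hilb_simps)
  then have 1: "hd b x x' = hn b (ha b ?u (hs b (-1) ?z))" by (simp add: H.dst_eq)
  have "ha b y (hs b (-1) y') = ha b ?v ?w"
    unfolding y by (rule H.inner_ext[where b=b]) (simp_all add: C H.hilb_simps)
  then have 2: "hd b y y' = hn b (ha b ?v ?w)" by (simp add: H.dst_eq)
  have nn: "hd b x x' \<ge> 0" "hd b y y' \<ge> 0" unfolding 1 2 by (simp_all add: H.nrm_ge0 H.hilb_simps C)
  have e: "(hd b x x')\<^sup>2 + (hd b y y')\<^sup>2 = (hn b ?u)\<^sup>2 + (hn b ?v)\<^sup>2 + (hn b ?w)\<^sup>2 + (hn b ?z)\<^sup>2"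
    unfolding 1 2 by (rule H.sum_dst_sq[OF D o])
  have le: "t \<le> hd b x x' + hd b y y'" if "t\<^sup>2 \<le> (hd b x x')\<^sup>2 + (hd b y y')\<^sup>2" for t
  proof (rule power2_le_imp_le)
    show "t\<^sup>2 \<le> (hd b x x' + hd b y y')\<^sup>2"
      using that nn by (simp add: power2_sum add_increasing2)
  qed (use nn in simp)
  show "hd b (u b) (u' b) \<le> hd b x x' + hd b y y'" "hd b (v b) (v' b) \<le> hd b x x' + hd b y y'"
    "hd b (w b) (w' b) \<le> hd b x x' + hd b y y'" "hd b (z b) (z' b) \<le> hd b x x' + hd b y y'"
    unfolding H.dst_eq[of b "u b"] H.dst_eq[of b "v b"] H.dst_eq[of b "w b"] H.dst_eq[of b "z b"]
    using e by (auto intro!: le simp: add_increasing add_increasing2)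
qed

lemma ulim_unique:
  assumes "ulim X x" "ulim X x'" "\<And>n. X n \<in> MC" "x \<in> MC" "x' \<in> MC" shows "x = x'"
proof
  fix b
  have "hd b (x b) (x' b) \<le> 0"
  proof (rule field_le_epsilon)
    fix e :: real assume "e > 0"
    then have "e/2 > 0" by simp
    obtain N1 where "\<And>n b. n \<ge> N1 \<Longrightarrow> hd b (X n b) (x b) < e/2" using assms(1) \<open>e/2>0\<close> unfolding ulim_def by blast
    moreover obtain N2 where "\<And>n b. n \<ge> N2 \<Longrightarrow> hd b (X n b) (x' b) < e/2" using assms(2) \<open>e/2>0\<close> unfolding ulim_def by blast
    ultimately have "hd b (X (max N1 N2) b) (x b) < e/2" "hd b (X (max N1 N2) b) (x' b) < e/2" by auto
    then show "hd b (x b) (x' b) \<le> 0 + e"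
      using H.dst_triangle[OF MC_C[OF assms(4)] MC_C[OF assms(3)] MC_C[OF assms(5)], of b "max N1 N2"]
        H.dst_sym[OF MC_C[OF assms(4)] MC_C[OF assms(3)], of b "max N1 N2"] by simp
  qed
  then show "x b = x' b"
    using H.dst_eq_0 H.dst_ge0 MC_C assms(4,5) by (metis order_antisym)
qed

lemma ulim_add:
  assumes "ulim X x" "ulim Y y" "\<And>n. X n \<in> MC" "x \<in> MC" "\<And>n. Y n \<in> MC" "y \<in> MC"
  shows "ulim (\<lambda>n b. ha b (X n b) (Y n b)) (\<lambda>b. ha b (x b) (y b))"
  unfolding ulim_def
proof (intro allI impI)
  fix e :: real assume "e > 0"
  then have "e/2 > 0" by simp
  obtain N1 where 1: "\<And>n b. n \<ge> N1 \<Longrightarrow> hd b (X n b) (x b) < e/2" using assms(1) \<open>e/2>0\<close> unfolding ulim_def by blast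
  obtain N2 where 2: "\<And>n b. n \<ge> N2 \<Longrightarrow> hd b (Y n b) (y b) < e/2" using assms(2) \<open>e/2>0\<close> unfolding ulim_def by blast
  have "hd b (ha b (X n b) (Y n b)) (ha b (x b) (y b)) < e" if "n \<ge> max N1 N2" for n b
    using H.dst_add[OF MC_C[OF assms(3)] MC_C[OF assms(5)] MC_C[OF assms(4)] MC_C[OF assms(6)], of b n n]
      1[of n b] 2[of n b] that by simp
  then show "\<exists>N. \<forall>n\<ge>N. \<forall>b. hd b (ha b (X n b) (Y n b)) (ha b (x b) (y b)) < e" by blast
qed

lemma ulim_scale:
  assumes "ulim X x" "\<And>n. X n \<in> MC" "x \<in> MC"
  shows "ulim (\<lambda>n b. hs b (-1) (X n b)) (\<lambda>b. hs b (-1) (x b))"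
  using assms by (simp add: ulim_def H.dst_scale MC_C)

lemma pair_seq:
  assumes "\<And>\<epsilon>. \<epsilon> > 0 \<Longrightarrow> \<exists>(x', y')\<in>S. \<forall>b. hd b (x b) (x' b) < \<epsilon> \<and> hd b (y b) (y' b) < \<epsilon>"
    and "x \<in> MC" "y \<in> MC" "S \<subseteq> MC \<times> MC"
  obtains X Y where "\<And>n. (X n, Y n) \<in> S" "ulim X x" "ulim Y y"
proof -
  have "\<exists>p. p \<in> S \<and> (\<forall>b. hd b (x b) (fst p b) < inverse (real (Suc n)) \<and> hd b (y b) (snd p b) < inverse (real (Suc n)))" for n
    using assms(1)[of "inverse (real (Suc n))"] by fastforce
  then obtain P where P: "\<And>n. P n \<in> S" "\<And>n b. hd b (x b) (fst (P n) b) < inverse (real (Suc n))"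
    "\<And>n b. hd b (y b) (snd (P n) b) < inverse (real (Suc n))" by metis
  have PM: "fst (P n) \<in> MC" "snd (P n) \<in> MC" for n using P(1)[of n] assms(4) by auto
  have "ulim (\<lambda>n. fst (P n)) x"
    unfolding ulim_def
  proof (intro allI impI)
    fix e :: real assume "e > 0"
    then obtain N where N: "inverse (real (Suc N)) < e" using reals_Archimedean by blast
    have "hd b (fst (P n) b) (x b) < e" if "n \<ge> N" for n b
    proof -
      have "inverse (real (Suc n)) \<le> inverse (real (Suc N))" using that by (simp add: field_simps)
      then show ?thesis
        using P(2)[of b n] N H.dst_sym[OF MC_C[OF PM(1)] MC_C[OF assms(2)], of b n] by linarith
    qed
    then show "\<exists>N. \<forall>n\<ge>N. \<forall>b. hd b (fst (P n) b) (x b) < e" by blast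
  qed
  moreover have "ulim (\<lambda>n. snd (P n)) y"
    unfolding ulim_def
  proof (intro allI impI)
    fix e :: real assume "e > 0"
    then obtain N where N: "inverse (real (Suc N)) < e" using reals_Archimedean by blast
    have "hd b (snd (P n) b) (y b) < e" if "n \<ge> N" for n b
    proof -
      have "inverse (real (Suc n)) \<le> inverse (real (Suc N))" using that by (simp add: field_simps)
      then show ?thesis
        using P(3)[of b n] N H.dst_sym[OF MC_C[OF PM(2)] MC_C[OF assms(3)], of b n] by linarith
    qed
    then show "\<exists>N. \<forall>n\<ge>N. \<forall>b. hd b (snd (P n) b) (y b) < e" by blast
  qed
  moreover have "(fst (P n), snd (P n)) \<in> S" for n using P(1) by simp
  ultimately show thesis by (intro that[of "\<lambda>n. fst (P n)" "\<lambda>n. snd (P n)"])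
qed

lemma ulim_Cauchy:
  assumes "ulim X x" "\<And>n. X n \<in> MC" "x \<in> MC" "e > 0"
  shows "\<exists>N. \<forall>m\<ge>N. \<forall>n\<ge>N. \<forall>b. hd b (X m b) (X n b) < e"
proof -
  have "e/2 > 0" using assms by simp
  obtain N where N: "\<And>n b. n \<ge> N \<Longrightarrow> hd b (X n b) (x b) < e/2" using assms(1) \<open>e/2>0\<close> unfolding ulim_def by blast
  have "hd b (X m b) (X n b) < e" if "m \<ge> N" "n \<ge> N" for m n b
    using H.dst_triangle[OF MC_C[OF assms(2)] MC_C[OF assms(3)] MC_C[OF assms(2)], of b m n]
      H.dst_sym[OF MC_C[OF assms(2)] MC_C[OF assms(3)], of b n] N[OF that(1), of b] N[OF that(2), of b] by simp
  then show ?thesis by blast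
qed

lemma ulim_approx:
  assumes "ulim X x" "ulim Y y" "\<And>n. (X n, Y n) \<in> S" "S \<subseteq> MC \<times> MC" "x \<in> MC" "y \<in> MC" "e > 0"
  shows "\<exists>(x', y')\<in>S. \<forall>b. hd b (x b) (x' b) < e \<and> hd b (y b) (y' b) < e"
proof -
  obtain N1 where 1: "\<And>n b. n \<ge> N1 \<Longrightarrow> hd b (X n b) (x b) < e" using assms(1,7) unfolding ulim_def by blast
  obtain N2 where 2: "\<And>n b. n \<ge> N2 \<Longrightarrow> hd b (Y n b) (y b) < e" using assms(2,7) unfolding ulim_def by blast
  let ?n = "max N1 N2"
  have "X ?n \<in> MC" "Y ?n \<in> MC" using assms(3)[of ?n] assms(4) by auto
  then have "hd b (x b) (X ?n b) < e" "hd b (y b) (Y ?n b) < e" for b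
    using 1[of ?n b] 2[of ?n b] H.dst_sym[OF MC_C[OF assms(5)] MC_C[OF \<open>X ?n \<in> MC\<close>], of b]
      H.dst_sym[OF MC_C[OF assms(6)] MC_C[OF \<open>Y ?n \<in> MC\<close>], of b] by simp_all
  then show ?thesis using assms(3)[of ?n] by blast
qed

text \<open>By \<open>hd_add_le\<close> the four components of a convergent sequence are uniformly
  Cauchy, and both graphs are closed.\<close>

lemma N_closed:
  assumes "x \<in> MC" "y \<in> MC"
    and ap: "\<And>\<epsilon>. \<epsilon> > 0 \<Longrightarrow> \<exists>(x', y')\<in>N. \<forall>b. hd b (x b) (x' b) < \<epsilon> \<and> hd b (y b) (y' b) < \<epsilon>"
  shows "(x, y) \<in> N"
proof -
  have NS: "N \<subseteq> MC \<times> MC" using N_MC by auto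
  obtain X Y where XY: "\<And>n. (X n, Y n) \<in> N" "ulim X x" "ulim Y y"
    using pair_seq[OF ap assms(1,2) NS] by blast
  have XM: "X n \<in> MC" "Y n \<in> MC" for n using N_MC XY(1) by blast+
  have "\<forall>n. \<exists>u v w z. (u, v) \<in> T \<and> (w, z) \<in> Ta \<and>
      X n = (\<lambda>b. ha b (u b) (hs b (-1) (z b))) \<and> Y n = (\<lambda>b. ha b (v b) (w b))"
    using XY(1)[unfolded N_iff] by (rule allI)
  then obtain U V W Z where "\<forall>n. (U n, V n) \<in> T \<and> (W n, Z n) \<in> Ta \<and>
      X n = (\<lambda>b. ha b (U n b) (hs b (-1) (Z n b))) \<and> Y n = (\<lambda>b. ha b (V n b) (W n b))"
    unfolding choice_iff by blast
  then have q: "\<And>n. (U n, V n) \<in> T" "\<And>n. (W n, Z n) \<in> Ta"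
    "\<And>n. X n = (\<lambda>b. ha b (U n b) (hs b (-1) (Z n b)))" "\<And>n. Y n = (\<lambda>b. ha b (V n b) (W n b))"
    by blast+
  have M: "U n \<in> MC" "V n \<in> MC" "W n \<in> MC" "Z n \<in> MC" for n
    using q(1,2) T_MC Ta_MC by blast+
  have bound: "hd b (U m b) (U n b) \<le> hd b (X m b) (X n b) + hd b (Y m b) (Y n b)"
    "hd b (V m b) (V n b) \<le> hd b (X m b) (X n b) + hd b (Y m b) (Y n b)"
    "hd b (W m b) (W n b) \<le> hd b (X m b) (X n b) + hd b (Y m b) (Y n b)"
    "hd b (Z m b) (Z n b) \<le> hd b (X m b) (X n b) + hd b (Y m b) (Y n b)" for m n b
    by (rule hd_add_le[OF q(1)[of m] q(2)[of m] q(1)[of n] q(2)[of n]]; simp add: q)+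
  have Cauchy: "\<exists>N. \<forall>m\<ge>N. \<forall>n\<ge>N. \<forall>b. hd b (X m b) (X n b) + hd b (Y m b) (Y n b) < e" if "e > 0" for e
  proof -
    have "e/2 > 0" using that by simp
    obtain N1 where 1: "\<And>m n b. \<lbrakk>m \<ge> N1; n \<ge> N1\<rbrakk> \<Longrightarrow> hd b (X m b) (X n b) < e/2"
      using ulim_Cauchy[OF XY(2) XM(1) assms(1) \<open>e/2>0\<close>] by blast
    obtain N2 where 2: "\<And>m n b. \<lbrakk>m \<ge> N2; n \<ge> N2\<rbrakk> \<Longrightarrow> hd b (Y m b) (Y n b) < e/2"
      using ulim_Cauchy[OF XY(3) XM(2) assms(2) \<open>e/2>0\<close>] by blast
    have "hd b (X m b) (X n b) + hd b (Y m b) (Y n b) < e" if "m \<ge> max N1 N2" "n \<ge> max N1 N2" for m n b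
      using 1[of m n b] 2[of m n b] that by simp
    then show ?thesis by blast
  qed
  have Cl: "\<exists>\<Psi>\<in>MC. ulim F \<Psi>" if "\<And>n. F n \<in> MC"
    "\<And>m n b. hd b (F m b) (F n b) \<le> hd b (X m b) (X n b) + hd b (Y m b) (Y n b)" for F
  proof (rule MC_complete[OF that(1)])
    fix e :: real assume "e > 0"
    from Cauchy[OF this] obtain N where N: "\<forall>m\<ge>N. \<forall>n\<ge>N. \<forall>b. hd b (X m b) (X n b) + hd b (Y m b) (Y n b) < e" by blast
    show "\<exists>N. \<forall>m\<ge>N. \<forall>n\<ge>N. \<forall>b. hd b (F m b) (F n b) < e"
      by (intro exI[of _ N] allI impI le_less_trans[OF that(2)]) (simp add: N)
  qed
  obtain u where u: "u \<in> MC" "ulim U u" using Cl[OF M(1) bound(1)] by blast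
  obtain v where v: "v \<in> MC" "ulim V v" using Cl[OF M(2) bound(2)] by blast
  obtain w where w: "w \<in> MC" "ulim W w" using Cl[OF M(3) bound(3)] by blast
  obtain z where z: "z \<in> MC" "ulim Z z" using Cl[OF M(4) bound(4)] by blast
  have TaS: "Ta \<subseteq> MC \<times> MC" using Ta_MC by auto
  have "(u, v) \<in> T"
    by (rule T_closed[OF u(1) v(1)]) (rule ulim_approx[OF u(2) v(2) q(1) T_sub u(1) v(1)])
  moreover have "(w, z) \<in> Ta"
    by (rule Ta_closed[OF w(1) z(1)]) (rule ulim_approx[OF w(2) z(2) q(2) TaS w(1) z(1)])
  moreover have "x = (\<lambda>b. ha b (u b) (hs b (-1) (z b)))"
  proof (rule ulim_unique[OF XY(2) _ XM(1) assms(1)])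
    show "ulim X (\<lambda>b. ha b (u b) (hs b (-1) (z b)))"
      unfolding q(3) by (intro ulim_add ulim_scale u z M MC_scale)
  qed (intro MC_sub u z)
  moreover have "y = (\<lambda>b. ha b (v b) (w b))"
  proof (rule ulim_unique[OF XY(3) _ XM(2) assms(2)])
    show "ulim Y (\<lambda>b. ha b (v b) (w b))"
      unfolding q(4) by (intro ulim_add v w M)
  qed (intro MC_add v w)
  ultimately show ?thesis unfolding N_iff by blast
qed

text \<open>In (x, y) + (-q, p) with y + p = 0, the element \<open>y\<close> lies in the domain of
  the adjoint with image -q, so the first component is \<open>x\<close> plus the adjoint of
  \<open>T\<close> applied to \<open>T x\<close>.\<close>

lemma range_iff: "{hadd M x z | x y z. (x, y) \<in> T \<and> (y, z) \<in> Ta} = {w. (w, \<lambda>b. hzero (Hb b)) \<in> N}"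
proof (intro equalityI subsetI; clarify)
  fix x y z assume *: "(x, y) \<in> T" "(y, z) \<in> Ta"
  note C = MC_C[OF T_MC(1)[OF *(1)]] MC_C[OF T_MC(2)[OF *(1)]] MC_C[OF Ta_MC(2)[OF *(2)]]
  have "hadd M x z = (\<lambda>b. ha b (x b) (hs b (-1) (hs b (-1) (z b))))"
    by (simp add: add_zero C)
  moreover have "(\<lambda>b. hzero (Hb b)) = (\<lambda>b. ha b (y b) (hs b (-1) (y b)))"
    by (rule field_ext) (simp_all add: C H.hilb_simps)
  ultimately show "(hadd M x z, \<lambda>b. hzero (Hb b)) \<in> N"
    unfolding N_iff using *(1) Ta_scale[OF *(2), of "-1"] by blast
next
  fix w assume "(w, \<lambda>b. hzero (Hb b)) \<in> N"
  then obtain x y p q where *: "(x, y) \<in> T" "(p, q) \<in> Ta"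
    "w = (\<lambda>b. ha b (x b) (hs b (-1) (q b)))" "(\<lambda>b. hzero (Hb b)) = (\<lambda>b. ha b (y b) (p b))"
    unfolding N_iff by blast
  note C = MC_C[OF T_MC(1)[OF *(1)]] MC_C[OF T_MC(2)[OF *(1)]] MC_C[OF Ta_MC(1)[OF *(2)]]
  have "y = (\<lambda>b. hs b (-1) (p b))"
  proof (rule field_ext)
    fix b z assume z: "z \<in> hcarrier (Hb b)"
    have h: "hzero (Hb b) = ha b (y b) (p b)" using fun_cong[OF *(4), of b] by simp
    have "hi b z (ha b (y b) (p b)) = 0" using H.inner_zero[OF z] unfolding h .
    then show "hi b z (y b) = hi b z (hs b (- 1) (p b))"
      using z by (simp add: C H.hilb_simps add_eq_0_iff2)
  qed (simp_all add: C H.hilb_simps)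
  then have "(y, \<lambda>b. hs b (-1) (q b)) \<in> Ta" using Ta_scale[OF *(2), of "-1"] by simp
  then show "\<exists>x y z. w = hadd M x z \<and> (x, y) \<in> T \<and> (y, z) \<in> Ta"
    using * by (intro exI[of _ x] exI[of _ y] exI[of _ "\<lambda>b. hs b (-1) (q b)"]) simp
qed

section \<open>Regularity in terms of \<open>N\<close>\<close>

lemma hdense_approx:
  assumes "hdense M Y" "x \<in> MC" "e > 0"
  shows "\<exists>y\<in>Y. \<forall>b. hd b (x b) (y b) < e"
proof -
  obtain y where y: "y \<in> Y" "hdist M x y < e" "y \<in> MC"
    using assms unfolding hdense_def by blast
  then show ?thesis using hd_le_hdist_M[OF assms(2) y(3)] by (intro bexI[of _ y]) (auto intro: le_less_trans)
qed

lemma N_eqI: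
  assumes "\<And>x y. \<lbrakk>x \<in> MC; y \<in> MC\<rbrakk> \<Longrightarrow> (x, y) \<in> N"
  shows "N = MC \<times> MC"
proof (rule set_eqI)
  fix p :: "('b \<Rightarrow> 'x) \<times> ('b \<Rightarrow> 'x)"
  obtain x y where p: "p = (x, y)" by (cases p)
  show "p \<in> N \<longleftrightarrow> p \<in> MC \<times> MC"
    unfolding p mem_Times_iff fst_conv snd_conv using N_MC[of x y] assms[of x y] by blast
qed

text \<open>The range condition concerns only the pairs (x, 0). The pairs (0, y) are reached through
  the dense domain of the adjoint, by adding (z, 0) to (-z, w).\<close>

lemma regular_iff: "regular_operator M T \<longleftrightarrow> N = MC \<times> MC"
proof
  assume r: "regular_operator M T"
  have 1: "(x, \<lambda>b. hzero (Hb b)) \<in> N" if x: "x \<in> MC" for x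
  proof (rule N_closed[OF x MC_zero])
    fix e :: real assume e: "e > 0"
    have "hdense M {w. (w, \<lambda>b. hzero (Hb b)) \<in> N}"
      using r unfolding regular_operator_def range_iff by blast
    from hdense_approx[OF this x e] obtain w where w: "(w, \<lambda>b. hzero (Hb b)) \<in> N" "\<And>b. hd b (x b) (w b) < e"
      by blast
    then show "\<exists>(x', y')\<in>N. \<forall>b. hd b (x b) (x' b) < e \<and> hd b (hzero (Hb b)) (y' b) < e"
      using e by (intro bexI[OF _ w(1)]) (simp add: H.dst_self H.zero_closed)
  qed
  have 2: "((\<lambda>b. hzero (Hb b)), w) \<in> N" if w: "(w, z) \<in> Ta" for w z
  proof -
    note C = MC_C[OF Ta_MC(1)[OF w]] MC_C[OF Ta_MC(2)[OF w]]
    have "((\<lambda>b. ha b (hs b (-1) (z b)) (z b)), (\<lambda>b. ha b (w b) (hzero (Hb b)))) \<in> N"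
      using N_add[OF Ta_N[OF w] 1[OF Ta_MC(2)[OF w]]] by simp
    moreover have "(\<lambda>b. ha b (hs b (-1) (z b)) (z b)) = (\<lambda>b. hzero (Hb b))"
      by (rule field_ext) (simp_all add: C H.hilb_simps)
    ultimately show ?thesis by (simp add: add_zero C)
  qed
  have 3: "((\<lambda>b. hzero (Hb b)), y) \<in> N" if y: "y \<in> MC" for y
  proof (rule N_closed[OF MC_zero y])
    fix e :: real assume e: "e > 0"
    have "hdense M (Domain Ta)" using r unfolding regular_operator_def by blast
    from hdense_approx[OF this y e] obtain w z where w: "(w, z) \<in> Ta" "\<And>b. hd b (y b) (w b) < e"
      by blast
    then show "\<exists>(x', y')\<in>N. \<forall>b. hd b (hzero (Hb b)) (x' b) < e \<and> hd b (y b) (y' b) < e"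
      using e by (intro bexI[OF _ 2[OF w(1)]]) (simp add: H.dst_self H.zero_closed)
  qed
  have "(x, y) \<in> N" if "x \<in> MC" "y \<in> MC" for x y
    using N_add[OF 1[OF that(1)] 3[OF that(2)]] that by (simp add: add_zero MC_C)
  then show "N = MC \<times> MC" by (rule N_eqI)
next
  assume N: "N = MC \<times> MC"
  have d: "Domain G \<subseteq> Domain T" "Domain G \<subseteq> Domain Ta" using G_T G_Ta by blast+
  have d': "Domain T \<subseteq> MC" "Domain Ta \<subseteq> MC" using T_MC Ta_MC by blast+
  have eq: "{w. (w, \<lambda>b. hzero (Hb b)) \<in> N} = MC" using N MC_zero by blast
  have "hdense M {w. (w, \<lambda>b. hzero (Hb b)) \<in> N}"
    unfolding eq by (intro hdense_M subset_refl subsetI Dom_MC)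
  then show "regular_operator M T"
    unfolding regular_operator_def range_iff
    by (intro conjI closed_T hdense_M[OF d(1) d'(1)] hdense_M[OF d(2) d'(2)])
qed

text \<open>Approximations of \<open>\<xi>\<close> by values of fields converge at \<open>b\<close>,
  with no control elsewhere. The increments are therefore cut off to neighbourhoods on which they
  are as small as at \<open>b\<close>, so that the telescoping series converges uniformly and keeps
  its value at \<open>b\<close>.\<close>

lemma surj_ev:
  assumes \<xi>: "\<xi> \<in> hcarrier (Hb b)"
  shows "\<exists>\<Psi>\<in>MC. \<Psi> b = \<xi>"
proof -
  \<comment> \<open>Two consecutive errors of this size add up to less than
    \<open>(1/2) ^ n\<close>.\<close>
  have "\<exists>\<phi>. \<phi> \<in> Domain G \<and> hd b \<xi> (\<phi> b) < (1/2) ^ Suc n / 2" for n :: nat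
    using G_dense[OF \<xi>, of "(1/2) ^ Suc n / 2"] by auto
  then obtain \<phi> where \<phi>: "\<And>n. \<phi> n \<in> Domain G" "\<And>n. hd b \<xi> (\<phi> n b) < (1/2) ^ Suc n / 2" by metis
  have PC: "\<phi> n x \<in> hcarrier (Hb x)" for n x using MC_C Dom_MC \<phi>(1) by blast
  define \<delta> where "\<delta> n = (\<lambda>x. ha x (\<phi> (Suc n) x) (hs x (-1) (\<phi> n x)))" for n
  have \<delta>M: "\<delta> n \<in> MC" for n unfolding \<delta>_def using Dom_MC \<phi>(1) by (intro MC_sub) auto
  have \<delta>b: "hn b (\<delta> n b) < (1/2) ^ n" for n
  proof -
    have "hn b (\<delta> n b) = hd b (\<phi> (Suc n) b) (\<phi> n b)" by (simp add: \<delta>_def H.dst_eq)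
    also have "\<dots> \<le> hd b (\<phi> (Suc n) b) \<xi> + hd b \<xi> (\<phi> n b)" by (intro H.dst_triangle PC \<xi>)
    also have "\<dots> < (1/2) ^ Suc (Suc n) / 2 + (1/2) ^ Suc n / 2"
      using \<phi>(2)[of "Suc n"] \<phi>(2)[of n] H.dst_sym[OF PC \<xi>, of "Suc n"] by linarith
    also have "\<dots> \<le> (1/2) ^ n" by simp
    finally show ?thesis .
  qed
  have "\<exists>h::'b \<Rightarrow> real. continuous_on UNIV h \<and> (\<forall>x. 0 \<le> h x \<and> h x \<le> 1) \<and> h b = 1 \<and>
      (\<forall>x. h x \<noteq> 0 \<longrightarrow> hn x (\<delta> n x) < (1/2) ^ n)" for n
  proof -
    obtain W where W: "open W" "b \<in> W" "\<forall>x\<in>W. hn x (\<delta> n x) < (1/2) ^ n"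
      using MC_usc[OF \<delta>M \<delta>b] by blast
    then show ?thesis using bump[OF W(1,2)] by blast
  qed
  then obtain h where h: "\<And>n. continuous_on UNIV (h n :: 'b \<Rightarrow> real)" "\<And>n x. 0 \<le> h n x" "\<And>n x. h n x \<le> 1"
    "\<And>n. h n b = 1" "\<And>n x. h n x \<noteq> 0 \<Longrightarrow> hn x (\<delta> n x) < (1/2) ^ n" by metis
  define S where "S = rec_nat (\<phi> 0) (\<lambda>n s. \<lambda>x. ha x (s x) (hs x (of_real (h n x)) (\<delta> n x)))"
  have S0: "S 0 = \<phi> 0" and SS: "S (Suc n) = (\<lambda>x. ha x (S n x) (hs x (of_real (h n x)) (\<delta> n x)))" for n
    by (simp_all add: S_def)
  have SM: "S n \<in> MC" for n
  proof (induction n)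
    case 0 then show ?case using S0 Dom_MC \<phi>(1) by simp
  next
    case (Suc n)
    have "(\<lambda>x. hs x (of_real (h n x)) (\<delta> n x)) \<in> MC"
      by (rule MC_act[OF \<delta>M, of "\<lambda>x. of_real (h n x)" 1]) (use h in \<open>auto intro: continuous_intros\<close>)
    then show ?case unfolding SS using Suc by (intro MC_add)
  qed
  have Sb: "S n b = \<phi> n b" for n
  proof (induction n)
    case (Suc n)
    show ?case unfolding SS Suc h(4) \<delta>_def
      by (rule H.inner_ext[where b=b]) (simp_all add: H.hilb_simps PC)
  qed (simp add: S0)
  have step: "hd x (S n x) (S (Suc n) x) \<le> (1/2) ^ n" for n x
  proof -
    have C: "S n x \<in> hcarrier (Hb x)" "\<delta> n x \<in> hcarrier (Hb x)" using MC_C SM \<delta>M by blast+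
    have "ha x (S (Suc n) x) (hs x (-1) (S n x)) = hs x (of_real (h n x)) (\<delta> n x)"
      unfolding SS by (rule H.inner_ext[where b=x]) (simp_all add: H.hilb_simps C)
    then have "hd x (S (Suc n) x) (S n x) = h n x * hn x (\<delta> n x)"
      using h(2)[of n x] C by (simp add: H.dst_eq H.nrm_scale)
    also have "\<dots> \<le> 1 * (1/2) ^ n"
      using h(2,3,5)[of n x] H.nrm_ge0[OF C(2)] mult_mono[of "h n x" 1 "hn x (\<delta> n x)" "(1/2) ^ n"]
      by (cases "h n x = 0") auto
    finally show ?thesis using H.dst_sym[OF C(1) MC_C[OF SM[of "Suc n"]]] by simp
  qed
  \<comment> \<open>The geometric sum in closed form, as the induction needs it; the factor 2 is the
    sum of the whole series.\<close>
  have tail: "hd x (S m x) (S (m + k) x) \<le> 2 * (1/2) ^ m * (1 - (1/2) ^ k)" for m k x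
  proof (induction k)
    case 0 then show ?case using H.dst_self MC_C SM by simp
  next
    case (Suc k)
    have "hd x (S m x) (S (m + Suc k) x) \<le> hd x (S m x) (S (m + k) x) + hd x (S (m + k) x) (S (Suc (m + k)) x)"
      using H.dst_triangle[OF MC_C[OF SM] MC_C[OF SM] MC_C[OF SM]] by simp
    also have "\<dots> \<le> 2 * (1/2) ^ m * (1 - (1/2) ^ k) + (1/2) ^ (m + k)"
      using Suc step by (intro add_mono)
    also have "\<dots> = 2 * (1/2) ^ m * (1 - (1/2) ^ Suc k)"
      by (simp add: power_add algebra_simps)
    finally show ?case .
  qed
  have "\<exists>\<Psi>\<in>MC. ulim S \<Psi>"
  proof (rule MC_complete[OF SM])
    fix e :: real assume "e > 0"
    then obtain N where N: "(1/2::real) ^ N < e / 4"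
      using real_arch_pow_inv[of "e/4" "1/2"] by auto
    have tl: "hd x (S m x) (S n x) < e / 2" if "m \<ge> N" "n \<ge> m" for m n x
    proof -
      have "hd x (S m x) (S n x) \<le> 2 * (1/2) ^ m * (1 - (1/2) ^ (n - m))"
        using tail[of x m "n - m"] that by simp
      also have "\<dots> \<le> 2 * (1/2) ^ m * 1" by (intro mult_left_mono) auto
      also have "\<dots> \<le> 2 * (1/2) ^ N" using that by (simp add: power_decreasing)
      finally show ?thesis using N by simp
    qed
    have "hd x (S m x) (S n x) < e" if "m \<ge> N" "n \<ge> N" for m n x
      using tl[OF that(1), of n x] tl[OF that(2), of m x] H.dst_sym[OF MC_C[OF SM] MC_C[OF SM], of x m n] \<open>e > 0\<close>
      by (cases "n \<ge> m") auto
    then show "\<exists>N. \<forall>m\<ge>N. \<forall>n\<ge>N. \<forall>b. hd b (S m b) (S n b) < e" by blast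
  qed
  then obtain \<Psi> where \<Psi>: "\<Psi> \<in> MC" "ulim S \<Psi>" by blast
  have "hd b (\<Psi> b) \<xi> \<le> 0"
  proof (rule LIMSEQ_le[of "\<lambda>n. hd b (\<Psi> b) \<xi>" _ "\<lambda>n. hd b (S n b) (\<Psi> b) + (1/2) ^ Suc n / 2"])
    have "(\<lambda>n. hd b (S n b) (\<Psi> b) + (1/2) ^ Suc n / 2) \<longlonglongrightarrow> 0 + 0 / 2"
      by (intro tendsto_intros ulim_pointwise[OF \<Psi>(2)] MC_C SM \<Psi>(1) LIMSEQ_Suc LIMSEQ_power_zero) auto
    then show "(\<lambda>n. hd b (S n b) (\<Psi> b) + (1/2) ^ Suc n / 2) \<longlonglongrightarrow> 0" by simp
    have "hd b (\<Psi> b) \<xi> \<le> hd b (S n b) (\<Psi> b) + (1/2) ^ Suc n / 2" for n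
      using H.dst_triangle[OF MC_C[OF \<Psi>(1)] PC \<xi>, of n] H.dst_sym[OF MC_C[OF \<Psi>(1)] PC, of b n]
        H.dst_sym[OF \<xi> PC, of n] \<phi>(2)[of n] unfolding Sb by linarith
    then show "\<exists>N. \<forall>n\<ge>N. hd b (\<Psi> b) \<xi> \<le> hd b (S n b) (\<Psi> b) + (1/2) ^ Suc n / 2" by blast
  qed simp
  then have "\<Psi> b = \<xi>"
    using H.dst_eq_0[OF MC_C[OF \<Psi>(1)] \<xi>] H.dst_ge0[OF MC_C[OF \<Psi>(1)] \<xi>] by simp
  with \<Psi>(1) show ?thesis by blast
qed

section \<open>Lifting the domains of the fibre adjoints\<close>

lemma ev_Ta_sub: "ev b ` Domain Ta \<subseteq> Domain (Tba b)"
  using Ta_iff unfolding ev_def by blast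

lemma regular_imp_eq:
  assumes "regular_operator M T"
  shows "ev b ` Domain Ta = Domain (Tba b)"
proof (intro equalityI ev_Ta_sub subsetI)
  have N: "N = MC \<times> MC" using assms regular_iff by blast
  fix u assume "u \<in> Domain (Tba b)"
  then obtain u' where u: "(u, u') \<in> Tba b" by blast
  note uC = Tba_C[OF u]
  \<comment> \<open>The pair \<open>(- u', u)\<close> is the rotation of \<open>(u, u')\<close>,
    which places it in the second summand of \<open>N\<close> over \<open>b\<close>.\<close>
  obtain x where x: "x \<in> MC" "x b = hs b (-1) u'" using surj_ev[OF H.scale_closed[OF uC(2)]] by blast
  obtain y where y: "y \<in> MC" "y b = u" using surj_ev[OF uC(1)] by blast
  obtain p q w z where *: "(p, q) \<in> T" "(w, z) \<in> Ta"
    "x = (\<lambda>b. ha b (p b) (hs b (-1) (z b)))" "y = (\<lambda>b. ha b (q b) (w b))"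
  proof -
    have "(x, y) \<in> N" using x(1) y(1) N by simp
    then show ?thesis using that unfolding N_iff by blast
  qed
  note C = MC_C[OF T_MC(1)[OF *(1)], of b] MC_C[OF T_MC(2)[OF *(1)], of b]
    MC_C[OF Ta_MC(1)[OF *(2)], of b] MC_C[OF Ta_MC(2)[OF *(2)], of b]
  have e1: "hs b (-1) u' = ha b (p b) (hs b (-1) (z b))" using x(2) unfolding *(3) by simp
  have e2: "u = ha b (q b) (w b)" using y(2) unfolding *(4) by simp
  let ?d = "ha b u (hs b (-1) (w b))" and ?d' = "ha b u' (hs b (-1) (z b))"
  have d: "(?d, ?d') \<in> Tba b" using u *(2) Tba_add Tba_scale Ta_iff by blast
  have dq: "?d = q b"
    by (rule H.inner_ext[where b=b]) (simp_all add: H.hilb_simps C e2)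
  have dp: "hs b (-1) ?d' = p b"
  proof (rule H.inner_ext[where b=b])
    fix s assume s: "s \<in> hcarrier (Hb b)"
    have "- hi b s u' = hi b s (hs b (-1) u')" using s uC by (simp add: H.hilb_simps)
    also have "\<dots> = hi b s (p b) - hi b s (z b)" unfolding e1 using s C by (simp add: H.hilb_simps)
    finally show "hi b s (hs b (-1) ?d') = hi b s (p b)" using s C uC by (simp add: H.hilb_simps algebra_simps)
  qed (simp_all add: H.hilb_simps C uC)
  \<comment> \<open>The component \<open>(p b, q b)\<close> lies in the graph of the fibre operator
    and, by \<open>dq\<close> and \<open>dp\<close>, in its orthogonal complement; the equation is
    its orthogonality to itself.\<close>
  have "hi b (q b) (q b) = hi b (p b) ?d'"
    using T_Tba_inner[OF *(1) d] unfolding dq .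
  also have "\<dots> = - hi b (p b) (p b)"
    unfolding dp[symmetric] using C uC by (simp add: H.hilb_simps)
  finally have "Re (hi b (q b) (q b)) = - Re (hi b (p b) (p b))" by simp
  then have "hn b (q b) = 0"
    using H.inner_pos[OF C(1)] H.inner_pos[OF C(2)] by (simp add: H.nrm_eq C)
  then have "?d = hzero (Hb b)" unfolding dq using C H.nrm_zero_iff by blast
  then have "hd b u (w b) = 0" by (simp add: H.dst_eq H.nrm_zero)
  then have "u = w b" using H.dst_eq_0 uC C by blast
  then show "u \<in> ev b ` Domain Ta" using *(2) unfolding ev_def by blast
qed

lemma eq_imp_core:
  assumes "ev b ` Domain Ta = Domain (Tba b)"
  shows "is_core (Hb b) (ev b ` Domain Ta) (Tba b)"
proof -
  have "{(x, y) \<in> Tba b. x \<in> Domain (Tba b)} = Tba b" by auto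
  moreover have "op_closure (Hb b) (Tba b) = Tba b"
  proof (intro equalityI subsetI; clarify)
    fix x y assume "(x, y) \<in> op_closure (Hb b) (Tba b)"
    then show "(x, y) \<in> Tba b" by (rule Tba_closed)
  next
    fix x y assume *: "(x, y) \<in> Tba b"
    then show "(x, y) \<in> op_closure (Hb b) (Tba b)"
      using Tba_C[OF *] by (auto simp: op_closure_def H.dst_self intro!: bexI[of _ "(x, y)"])
  qed
  ultimately show ?thesis unfolding is_core_def assms by simp
qed

lemma core_imp_dense:
  assumes core: "is_core (Hb b) (ev b ` Domain Ta) (Tba b)"
    and pq: "p \<in> hcarrier (Hb b)" "q \<in> hcarrier (Hb b)" "e > 0"
  shows "\<exists>x y. (x, y) \<in> N \<and> hd b p (x b) < e \<and> hd b q (y b) < e"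
proof -
  define S where "S = {(x b, y b) | x y. (x, y) \<in> N}"
  have "op_closure (Hb b) S = hcarrier (Hb b) \<times> hcarrier (Hb b)"
  proof (rule H.relation_dense)
    show "S \<subseteq> hcarrier (Hb b) \<times> hcarrier (Hb b)" unfolding S_def using N_MC MC_C by blast
    have SI: "(x b, y b) \<in> S" if "(x, y) \<in> N" for x y using that by (auto simp: S_def)
    show "(hzero (Hb b), hzero (Hb b)) \<in> S" using SI[OF T_N[OF T_zero]] .
    show "(ha b x x', ha b y y') \<in> S" if xy: "(x, y) \<in> S" "(x', y') \<in> S" for x y x' y'
    proof -
      obtain p q where "(p, q) \<in> N" "x = p b" "y = q b" using xy(1) by (auto simp: S_def)
      moreover obtain p' q' where "(p', q') \<in> N" "x' = p' b" "y' = q' b" using xy(2) by (auto simp: S_def)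
      ultimately show ?thesis using SI[OF N_add] by simp
    qed
    show "(hs b a x, hs b a y) \<in> S" if xy: "(x, y) \<in> S" for a x y
    proof -
      obtain p q where "(p, q) \<in> N" "x = p b" "y = q b" using xy by (auto simp: S_def)
      then show ?thesis using SI[OF N_scale] by simp
    qed
    fix p q assume C: "p \<in> hcarrier (Hb b)" "q \<in> hcarrier (Hb b)"
      and ann: "\<And>x y. (x, y) \<in> S \<Longrightarrow> hi b x p + hi b y q = 0"
    \<comment> \<open>Annihilating the graph of \<open>T\<close> over \<open>b\<close> is, up to
      rotation, membership in the graph of the fibre adjoint.\<close>
    have "(q, hs b (-1) p) \<in> Tba b"
      unfolding Tba_iff
    proof (intro conjI allI impI)
      fix u v assume uv: "(u, v) \<in> G"
      have "hi b (u b) p + hi b (v b) q = 0"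
        by (rule ann[OF SI[OF T_N[OF G_T[OF uv]]]])
      then show "hi b (v b) q = hi b (u b) (hs b (- 1) p)"
        using C G_C[OF uv] by (simp add: H.hilb_simps add_eq_0_iff)
    qed (simp_all add: C H.hilb_simps)
    then have cl: "(q, hs b (-1) p) \<in> op_closure (Hb b) {(x, y) \<in> Tba b. x \<in> ev b ` Domain Ta}"
      using core unfolding is_core_def by simp
    \<comment> \<open>\<open>(p, q)\<close> annihilates the rotated elements of \<open>Ta\<close>
      over \<open>b\<close>; by the core property the annihilation extends to the rotation of every
      element of the fibre adjoint. Rotating \<open>(q, - p)\<close> gives back
      \<open>(p, q)\<close>.\<close>
    have "hi b q q = hi b (hs b (-1) p) p"
    proof (rule H.op_closure_annihilate[OF _ cl])
      show "{(x, y) \<in> Tba b. x \<in> ev b ` Domain Ta} \<subseteq> hcarrier (Hb b) \<times> hcarrier (Hb b)"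
        using Tba_C by auto
      fix u v assume "(u, v) \<in> {(x, y) \<in> Tba b. x \<in> ev b ` Domain Ta}"
      then obtain w z where w: "(u, v) \<in> Tba b" "(w, z) \<in> Ta" "u = w b" unfolding ev_def by blast
      then have v: "v = z b" using Tba_unique Ta_iff by blast
      have "(hs b (-1) (z b), w b) \<in> S" by (rule SI[OF Ta_N[OF w(2)]])
      then have "hi b (hs b (-1) (z b)) p + hi b (w b) q = 0" by (rule ann)
      then show "hi b u q = hi b v p"
        unfolding v w(3) using C MC_C[OF Ta_MC(1)[OF w(2)]] MC_C[OF Ta_MC(2)[OF w(2)]]
        by (simp add: H.hilb_simps algebra_simps)
    qed (simp_all add: C H.hilb_simps)
    then have "hi b q q + hi b p p = 0" using C by (simp add: H.hilb_simps add_eq_0_iff)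
    then have "Re (hi b q q) + Re (hi b p p) = 0" by (metis plus_complex.simps(1) zero_complex.simps(1))
    then have "hn b q = 0" "hn b p = 0"
      using H.inner_pos[OF C(1)] H.inner_pos[OF C(2)] by (simp_all add: H.nrm_eq C)
    then show "p = hzero (Hb b) \<and> q = hzero (Hb b)" using H.nrm_zero_iff C by blast
  qed
  then have "(p, q) \<in> op_closure (Hb b) S" using pq by simp
  then obtain s t where st: "(s, t) \<in> S" "hd b p s < e" "hd b q t < e"
    using \<open>e > 0\<close> unfolding op_closure_def by blast
  then obtain x y where "(x, y) \<in> N" "s = x b" "t = y b" by (auto simp: S_def)
  with st show ?thesis by (intro exI[of _ x] exI[of _ y]) simp
qed

section \<open>Gluing over the base\<close>

lemma N_zero: "((\<lambda>b. hzero (Hb b)), (\<lambda>b. hzero (Hb b))) \<in> N"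
  by (rule T_N[OF T_zero])

text \<open>The weights multiply the fields and the local approximations alike, so the errors add up
  to \<open>d\<close> times the sum of the weights. \<open>X i\<close> and \<open>Y i\<close> are
  close to the fields only where \<open>g i\<close> is nonzero; elsewhere their term is
  absent.\<close>

lemma N_glue:
  assumes "finite I" and x: "x \<in> MC" "y \<in> MC"
    and "\<And>i. i \<in> I \<Longrightarrow> (X i, Y i) \<in> N"
    and "\<And>i. i \<in> I \<Longrightarrow> continuous_on UNIV (g i :: 'b \<Rightarrow> real)"
    and "\<And>i b. i \<in> I \<Longrightarrow> 0 \<le> g i b \<and> g i b \<le> 1"
    and "\<And>i b. \<lbrakk>i \<in> I; g i b \<noteq> 0\<rbrakk> \<Longrightarrow> hd b (x b) (X i b) < d \<and> hd b (y b) (Y i b) < d"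
  shows "\<exists>p q. (p, q) \<in> N \<and> (\<forall>b.
    hd b (hs b (of_real (\<Sum>i\<in>I. g i b)) (x b)) (p b) \<le> d * (\<Sum>i\<in>I. g i b) \<and>
    hd b (hs b (of_real (\<Sum>i\<in>I. g i b)) (y b)) (q b) \<le> d * (\<Sum>i\<in>I. g i b))"
  using assms(1,4-)
proof (induction I rule: finite_induct)
  case empty
  have "hs b 0 (z b) = hzero (Hb b)" if "z \<in> MC" for z b
    by (rule H.inner_ext[where b=b]) (simp_all add: H.hilb_simps MC_C that)
  then show ?case
    using x by (intro exI[of _ "\<lambda>b. hzero (Hb b)"] conjI N_zero) (simp add: H.dst_self H.zero_closed)
next
  case (insert i I)
  then obtain p q where pq: "(p, q) \<in> N" "\<And>b. hd b (hs b (of_real (\<Sum>i\<in>I. g i b)) (x b)) (p b) \<le> d * (\<Sum>i\<in>I. g i b)"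
    "\<And>b. hd b (hs b (of_real (\<Sum>i\<in>I. g i b)) (y b)) (q b) \<le> d * (\<Sum>i\<in>I. g i b)" by (auto 4 4)
  have XY: "(X i, Y i) \<in> N" using insert by auto
  have gi: "continuous_on UNIV (g i)" "\<And>b. 0 \<le> g i b" "\<And>b. g i b \<le> 1" using insert by auto
  have step: "hd b (hs b (of_real (\<Sum>i\<in>insert i I. g i b)) (z b)) (ha b (r b) (hs b (of_real (g i b)) (Z b)))
      \<le> d * (\<Sum>i\<in>insert i I. g i b)"
    if m: "z \<in> MC" "r \<in> MC" "Z \<in> MC" and 1: "hd b (hs b (of_real (\<Sum>i\<in>I. g i b)) (z b)) (r b) \<le> d * (\<Sum>i\<in>I. g i b)"
      and 2: "g i b \<noteq> 0 \<Longrightarrow> hd b (z b) (Z b) < d" for z r Z b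
  proof -
    note C = m[THEN MC_C, of b]
    have "hs b (of_real (\<Sum>i\<in>insert i I. g i b)) (z b)
        = ha b (hs b (of_real (\<Sum>i\<in>I. g i b)) (z b)) (hs b (of_real (g i b)) (z b))"
      using insert(1,2) by (intro H.inner_ext[where b=b]) (simp_all add: H.hilb_simps C algebra_simps del: of_real_sum)
    then have "hd b (hs b (of_real (\<Sum>i\<in>insert i I. g i b)) (z b)) (ha b (r b) (hs b (of_real (g i b)) (Z b)))
      \<le> hd b (hs b (of_real (\<Sum>i\<in>I. g i b)) (z b)) (r b) + hd b (hs b (of_real (g i b)) (z b)) (hs b (of_real (g i b)) (Z b))"
      using C by (simp add: H.dst_add H.scale_closed del: of_real_sum)
    also have "hd b (hs b (of_real (g i b)) (z b)) (hs b (of_real (g i b)) (Z b)) = g i b * hd b (z b) (Z b)"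
      using C gi(2)[of b] by (simp add: H.dst_scale)
    also have "\<dots> \<le> g i b * d" using 2 gi(2)[of b] by (cases "g i b = 0") (auto intro!: mult_left_mono)
    finally show ?thesis using 1 insert(1,2) by (simp add: algebra_simps)
  qed
  have "((\<lambda>b. hs b (of_real (g i b)) (X i b)), (\<lambda>b. hs b (of_real (g i b)) (Y i b))) \<in> N"
    by (rule N_act[OF XY, of "\<lambda>b. of_real (g i b)" 1]) (use gi in \<open>auto intro!: continuous_intros\<close>)
  from N_add[OF pq(1) this] show ?case
    apply (intro exI conjI, assumption)
    apply (intro allI conjI step x N_MC(1)[OF pq(1)] N_MC(2)[OF pq(1)] N_MC(1)[OF XY] N_MC(2)[OF XY] pq(2,3))
    using insert(7) by auto
qed

text \<open>Over each point of the compact support of two generating fields there is an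
  approximation in \<open>N\<close>, good on a neighbourhood by semicontinuity; finitely many of
  these are glued. Generating fields are dense and \<open>N\<close> is closed.\<close>

lemma core_imp_regular:
  assumes core: "\<And>b. is_core (Hb b) (ev b ` Domain Ta) (Tba b)"
  shows "regular_operator M T"
proof -
  have cs: "\<exists>(p, q)\<in>N. \<forall>b. hd b (x b) (p b) \<le> d \<and> hd b (y b) (q b) \<le> d"
    if xy: "x \<in> Domain G" "y \<in> Domain G" and "d > 0" for x y d
  proof -
    obtain K1 where K1: "compact K1" "\<forall>b\<in>-K1. x b = hzero (Hb b)" using xy(1) G_supp by blast
    obtain K2 where K2: "compact K2" "\<forall>b\<in>-K2. y b = hzero (Hb b)" using xy(2) G_supp by blast
    define K where "K = K1 \<union> K2"
    have K: "compact K" "\<And>b. b \<notin> K \<Longrightarrow> x b = hzero (Hb b)" "\<And>b. b \<notin> K \<Longrightarrow> y b = hzero (Hb b)"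
      using K1 K2 unfolding K_def by auto
    have M: "x \<in> MC" "y \<in> MC" using xy Dom_MC by auto
    have "\<exists>X Y. \<exists>h::'b \<Rightarrow> real. (X, Y) \<in> N \<and> continuous_on UNIV h \<and> (\<forall>z. 0 \<le> h z \<and> h z \<le> 1) \<and> h c = 1 \<and>
       (\<forall>z. h z \<noteq> 0 \<longrightarrow> hd z (x z) (X z) < d \<and> hd z (y z) (Y z) < d)" for c
    proof -
      obtain X Y where N: "(X, Y) \<in> N" "hd c (x c) (X c) < d" "hd c (y c) (Y c) < d"
        using core_imp_dense[OF core MC_C[OF M(1)] MC_C[OF M(2)] \<open>d > 0\<close>] by blast
      obtain W where W: "open W" "c \<in> W" "\<forall>z\<in>W. hd z (x z) (X z) < d"
        using MC_usc[OF MC_sub[OF M(1) N_MC(1)[OF N(1)]], of c d] N(2) by (auto simp: H.dst_eq)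
      obtain W' where W': "open W'" "c \<in> W'" "\<forall>z\<in>W'. hd z (y z) (Y z) < d"
        using MC_usc[OF MC_sub[OF M(2) N_MC(2)[OF N(1)]], of c d] N(3) by (auto simp: H.dst_eq)
      have "open (W \<inter> W')" "c \<in> W \<inter> W'" using W W' by auto
      from bump[OF this] obtain h :: "'b \<Rightarrow> real" where "continuous_on UNIV h" "\<forall>x. 0 \<le> h x \<and> h x \<le> 1"
        "h c = 1" "\<forall>x. h x \<noteq> 0 \<longrightarrow> x \<in> W \<inter> W'" by blast
      with N(1) W(3) W'(3) show ?thesis by (intro exI[of _ X] exI[of _ Y] exI[of _ h]) auto
    qed
    then obtain X Y h where *: "\<And>c. (X c, Y c) \<in> N" "\<And>c. continuous_on UNIV (h c :: 'b \<Rightarrow> real)"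
      "\<And>c z. 0 \<le> h c z" "\<And>c z. h c z \<le> 1" "\<And>c. h c c = 1"
      "\<And>c z. h c z \<noteq> 0 \<Longrightarrow> hd z (x z) (X c z) < d \<and> hd z (y z) (Y c z) < d"
      by metis
    \<comment> \<open>Covering by half-level sets keeps the sum of the chosen functions at least 1/2
      on \<open>K\<close>.\<close>
    have o: "open {z. h c z > 1/2}" for c by (intro open_Collect_less continuous_on_const *(2))
    obtain I where I: "I \<subseteq> K" "finite I" "K \<subseteq> (\<Union>c\<in>I. {z. h c z > 1/2})"
    proof (rule compactE_image[OF K(1), of K "\<lambda>c. {z. h c z > 1/2}"])
      show "K \<subseteq> (\<Union>c\<in>K. {z. h c z > 1/2})" using *(5) by (auto intro!: bexI)
    qed (use o in auto)
    \<comment> \<open>The maximum with 1/2 makes the divisor positive on the whole base and changes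
      nothing on \<open>K\<close>, where the sum is at least 1/2.\<close>
    define m where "m z = max (\<Sum>c\<in>I. h c z) (1/2)" for z
    define g where "g c z = h c z / m z" for c z
    have mpos: "m z > 0" for z by (simp add: m_def less_max_iff_disj)
    have hm: "h c z \<le> m z" if "c \<in> I" for c z
      using member_le_sum[OF that, of "\<lambda>c. h c z"] *(3) I(2) by (simp add: m_def le_max_iff_disj)
    have gs: "(\<Sum>c\<in>I. g c z) = (\<Sum>c\<in>I. h c z) / m z" for z by (simp add: g_def sum_divide_distrib)
    have gs1: "(\<Sum>c\<in>I. g c z) \<le> 1" for z using mpos[of z] unfolding gs by (simp add: m_def)
    have gsK: "(\<Sum>c\<in>I. g c z) = 1" if "z \<in> K" for z
    proof -
      obtain c where c: "c \<in> I" "h c z > 1/2" using I(3) \<open>z \<in> K\<close> by blast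
      then have "(\<Sum>c\<in>I. h c z) \<ge> 1/2" using member_le_sum[OF c(1), of "\<lambda>c. h c z"] *(3) I(2) by fastforce
      then show ?thesis using mpos[of z] unfolding gs by (simp add: m_def)
    qed
    have "\<exists>p q. (p, q) \<in> N \<and> (\<forall>b.
      hd b (hs b (of_real (\<Sum>i\<in>I. g i b)) (x b)) (p b) \<le> d * (\<Sum>i\<in>I. g i b) \<and>
      hd b (hs b (of_real (\<Sum>i\<in>I. g i b)) (y b)) (q b) \<le> d * (\<Sum>i\<in>I. g i b))"
    proof (rule N_glue[OF I(2) M *(1)])
      show "continuous_on UNIV (g i)" for i
        unfolding g_def m_def using *(2) mpos
        by (intro continuous_intros) (auto simp: m_def less_le)
      show "0 \<le> g i b \<and> g i b \<le> 1" if "i \<in> I" for i b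
        using hm[OF that, of b] mpos[of b] *(3)[of i b] by (simp add: g_def)
      show "hd b (x b) (X i b) < d \<and> hd b (y b) (Y i b) < d" if "g i b \<noteq> 0" for i b
        using that *(6) by (simp add: g_def)
    qed
    then obtain p q where pq: "(p, q) \<in> N"
      "\<And>b. hd b (hs b (of_real (\<Sum>i\<in>I. g i b)) (x b)) (p b) \<le> d * (\<Sum>i\<in>I. g i b)"
      "\<And>b. hd b (hs b (of_real (\<Sum>i\<in>I. g i b)) (y b)) (q b) \<le> d * (\<Sum>i\<in>I. g i b)" by blast
    \<comment> \<open>On \<open>K\<close> the weights add up to 1; off \<open>K\<close> the field is
      zero, whatever the weights.\<close>
    have e: "hs b (of_real (\<Sum>i\<in>I. g i b)) (z b) = z b"
      if "z \<in> MC" "\<And>b. b \<notin> K \<Longrightarrow> z b = hzero (Hb b)" for z b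
    proof (cases "b \<in> K")
      case True
      show ?thesis unfolding gsK[OF True] using that(1)
        by (intro H.inner_ext[where b=b]) (simp_all add: H.hilb_simps MC_C)
    next
      case False
      show ?thesis unfolding that(2)[OF False]
        by (rule H.inner_ext[where b=b]) (simp_all add: H.hilb_simps)
    qed
    have "d * (\<Sum>i\<in>I. g i b) \<le> d" for b using gs1[of b] \<open>d > 0\<close> by simp
    moreover have "hs b (of_real (\<Sum>i\<in>I. g i b)) (x b) = x b" "hs b (of_real (\<Sum>i\<in>I. g i b)) (y b) = y b" for b
      by (rule e; use M K in simp)+
    ultimately have "hd b (x b) (p b) \<le> d" "hd b (y b) (q b) \<le> d" for b
      using pq(2,3)[of b] order_trans by metis+
    then show ?thesis by (intro bexI[OF _ pq(1)]) auto
  qed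
  have "(x, y) \<in> N" if xy: "x \<in> MC" "y \<in> MC" for x y
  proof (rule N_closed[OF xy])
    fix e :: real assume "e > 0"
    then have "e/3 > 0" by simp
    obtain \<phi> where \<phi>: "\<phi> \<in> Domain G" "\<And>b. hd b (x b) (\<phi> b) < e/3" using xy(1) \<open>e/3>0\<close> unfolding MC_iff by meson
    obtain \<psi> where \<psi>: "\<psi> \<in> Domain G" "\<And>b. hd b (y b) (\<psi> b) < e/3" using xy(2) \<open>e/3>0\<close> unfolding MC_iff by meson
    obtain p q where pq: "(p, q) \<in> N" "\<And>b. hd b (\<phi> b) (p b) \<le> e/3" "\<And>b. hd b (\<psi> b) (q b) \<le> e/3"
      using cs[OF \<phi>(1) \<psi>(1) \<open>e/3>0\<close>] by blast
    have "hd b (x b) (p b) < e" "hd b (y b) (q b) < e" for b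
      using H.dst_triangle[OF MC_C[OF xy(1)] MC_C[OF Dom_MC[OF \<phi>(1)]] MC_C[OF N_MC(1)[OF pq(1)]], of b]
        H.dst_triangle[OF MC_C[OF xy(2)] MC_C[OF Dom_MC[OF \<psi>(1)]] MC_C[OF N_MC(2)[OF pq(1)]], of b]
        \<phi>(2)[of b] \<psi>(2)[of b] pq(2,3)[of b] \<open>e > 0\<close> by linarith+
    then show "\<exists>(x', y')\<in>N. \<forall>b. hd b (x b) (x' b) < e \<and> hd b (y b) (y' b) < e" using pq(1) by blast
  qed
  then show ?thesis unfolding regular_iff by (rule N_eqI)
qed

lemma regular_core_eq:
  "(regular_operator M T \<longleftrightarrow> (\<forall>b. is_core (Hb b) (ev b ` Domain Ta) (Tba b))) \<and>
   ((\<forall>b. is_core (Hb b) (ev b ` Domain Ta) (Tba b)) \<longleftrightarrow> (\<forall>b. ev b ` Domain Ta = Domain (Tba b)))"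
proof (intro conjI iffI allI)
  fix b
  show "is_core (Hb b) (ev b ` Domain Ta) (Tba b)" if "regular_operator M T"
    by (rule eq_imp_core[OF regular_imp_eq[OF that]])
  show "ev b ` Domain Ta = Domain (Tba b)" if "\<forall>b. is_core (Hb b) (ev b ` Domain Ta) (Tba b)"
    by (rule regular_imp_eq[OF core_imp_regular[OF that[rule_format]]])
  show "is_core (Hb b) (ev b ` Domain Ta) (Tba b)" if "\<forall>b. ev b ` Domain Ta = Domain (Tba b)"
    by (rule eq_imp_core[OF that[rule_format]])
next
  show "regular_operator M T" if "\<forall>b. is_core (Hb b) (ev b ` Domain Ta) (Tba b)"
    by (rule core_imp_regular[OF that[rule_format]])
qed

end

section \<open>Smooth functions\<close>

text \<open>Takes the place of a basis fixed by the type; \<open>B\<close> is empty in dimension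
  zero. Orthogonalisation may leave the zero vector in \<open>C\<close>, and it is removed before
  normalising.\<close>

lemma finite_dimensional_basis:
  assumes "finite_dimensional TYPE('a::real_inner)"
  obtains B :: "'a::real_inner set" where "finite B" "\<And>x y. \<lbrakk>x \<in> B; y \<in> B\<rbrakk> \<Longrightarrow> inner x y = (if x = y then 1 else 0)"
    "\<And>x. x = (\<Sum>e\<in>B. inner x e *\<^sub>R e)"
proof -
  obtain S :: "'a set" where S: "finite S" "span S = UNIV"
    using assms by (auto simp: finite_dimensional_def)
  obtain C where C: "finite C" "span C = span S" "pairwise orthogonal C"
    using basis_orthogonal[OF S(1)] by blast
  define B where "B = (\<lambda>x. x /\<^sub>R norm x) ` (C - {0})"
  have fin: "finite B" using C(1) by (simp add: B_def)
  have on: "inner x y = (if x = y then 1 else 0)" if xy: "x \<in> B" "y \<in> B" for x y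
  proof -
    obtain a b where ab: "a \<in> C" "a \<noteq> 0" "x = a /\<^sub>R norm a" "b \<in> C" "b \<noteq> 0" "y = b /\<^sub>R norm b"
      using xy by (auto simp: B_def)
    show ?thesis
    proof (cases "a = b")
      case True
      then show ?thesis using ab by (simp add: inner_commute flip: power2_norm_eq_inner)
    next
      case False
      then have o: "inner a b = 0" using C(3) ab by (auto simp: pairwise_def orthogonal_def)
      have "x \<noteq> y"
      proof
        assume "x = y"
        have "inner x x = 0" by (subst (2) \<open>x = y\<close>) (simp add: ab(3,6) o)
        then show False using ab by simp
      qed
      then show ?thesis using ab o by simp
    qed
  qed
  have spanB: "span B = UNIV"
  proof -
    have "c \<in> span B" if "c \<in> C" for c
    proof (cases "c = 0")
      case False
      then have "c /\<^sub>R norm c \<in> span B" using that by (intro span_base) (auto simp: B_def)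
      then have "norm c *\<^sub>R (c /\<^sub>R norm c) \<in> span B" by (rule span_scale)
      then show ?thesis using False by simp
    qed (simp add: span_zero)
    then have "span C \<subseteq> span B" by (meson span_minimal subspace_span subsetI)
    then show ?thesis using C(2) S(2) by auto
  qed
  have "x = (\<Sum>e\<in>B. inner x e *\<^sub>R e)" for x
  proof -
    let ?d = "x - (\<Sum>e\<in>B. inner x e *\<^sub>R e)"
    have "inner ?d f = 0" if "f \<in> B" for f
    proof -
      have "inner (\<Sum>e\<in>B. inner x e *\<^sub>R e) f = (\<Sum>e\<in>B. if e = f then inner x f else 0)"
        unfolding inner_sum_left using on that by (intro sum.cong) auto
      then show ?thesis using fin that by (simp add: inner_diff_left)
    qed
    then have o: "\<And>y. y \<in> B \<Longrightarrow> orthogonal ?d y" by (simp add: orthogonal_def)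
    have "?d \<in> span B" by (simp only: spanB UNIV_I)
    then have "orthogonal ?d ?d" by (rule orthogonal_to_span[OF _ o])
    then show ?thesis by (simp add: orthogonal_self)
  qed
  with fin on show thesis using that by blast
qed

lemma finite_dimensional_real: "finite_dimensional TYPE(real)"
  unfolding finite_dimensional_def by (rule exI[of _ "{1}"]) (auto simp: span_singleton)

lemma finite_dimensional_prodD:
  assumes "finite_dimensional TYPE('a::real_vector \<times> 'b::real_vector)"
  shows "finite_dimensional TYPE('a::real_vector)" "finite_dimensional TYPE('b::real_vector)"
proof -
  obtain S :: "('a \<times> 'b) set" where S: "finite S" "span S = UNIV"
    using assms by (auto simp: finite_dimensional_def)
  have "linear (fst :: 'a \<times> 'b \<Rightarrow> 'a)" "linear (snd :: 'a \<times> 'b \<Rightarrow> 'b)"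
    by (auto intro: linearI)
  then have "span (fst ` S) = UNIV" "span (snd ` S) = UNIV"
    using S(2) by (simp_all add: linear_span_image)
  then show "finite_dimensional TYPE('a)" "finite_dimensional TYPE('b)"
    unfolding finite_dimensional_def using S(1) by blast+
qed

lemma finite_dimensional_linear_bounded:
  fixes f :: "'a::real_inner \<Rightarrow> 'b::real_normed_vector"
  assumes fd: "finite_dimensional TYPE('a)" and f: "linear f"
  shows "bounded_linear f"
proof -
  obtain B :: "'a set" where B: "finite B" "\<And>x. x = (\<Sum>e\<in>B. inner x e *\<^sub>R e)"
    "\<And>x y. \<lbrakk>x \<in> B; y \<in> B\<rbrakk> \<Longrightarrow> inner x y = (if x = y then 1 else 0)"
    using finite_dimensional_basis[OF fd] by metis
  have "norm (f x) \<le> norm x * (\<Sum>e\<in>B. norm (f e))" for x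
  proof -
    have "f x = (\<Sum>e\<in>B. inner x e *\<^sub>R f e)"
      by (subst B(2)[of x]) (simp add: linear_sum[OF f] linear_scale[OF f])
    also have "norm \<dots> \<le> (\<Sum>e\<in>B. norm (inner x e *\<^sub>R f e))" by (rule norm_sum)
    also have "\<dots> \<le> (\<Sum>e\<in>B. norm x * norm (f e))"
    proof (rule sum_mono)
      fix e assume "e \<in> B"
      then have "norm e = 1" using B(3)[of e e] by (simp add: norm_eq_sqrt_inner)
      then have "\<bar>inner x e\<bar> \<le> norm x" using Cauchy_Schwarz_ineq2[of x e] by simp
      then show "norm (inner x e *\<^sub>R f e) \<le> norm x * norm (f e)" by (simp add: mult_right_mono)
    qed
    finally show ?thesis by (simp add: sum_distrib_left)
  qed
  then show ?thesis using f by (simp add: bounded_linear_intros bounded_linear_def bounded_linear_axioms_def) blast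
qed

text \<open>The ball is closed and contained in the set of combinations of basis vectors with
  coefficients of modulus at most \<open>r\<close>, which is a continuous image of a product of
  compact intervals.\<close>

lemma finite_dimensional_compact_cball:
  fixes p :: "'a::real_inner"
  assumes fd: "finite_dimensional TYPE('a)"
  shows "compact (cball p r)"
proof -
  obtain B :: "'a set" where B: "finite B" "\<And>x. x = (\<Sum>e\<in>B. inner x e *\<^sub>R e)"
    "\<And>x y. \<lbrakk>x \<in> B; y \<in> B\<rbrakk> \<Longrightarrow> inner x y = (if x = y then 1 else 0)"
    using finite_dimensional_basis[OF fd] by metis
  have c: "compact {\<Sum>e\<in>F. c e *\<^sub>R e | c. \<forall>e\<in>F. \<bar>c e\<bar> \<le> r}" if "finite F" for F :: "'a set"
    using that
  proof induction
    case (insert e F)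
    let ?K = "{\<Sum>e\<in>F. c e *\<^sub>R e | c. \<forall>e\<in>F. \<bar>c e\<bar> \<le> r}"
    have "{\<Sum>e\<in>insert e F. c e *\<^sub>R e | c. \<forall>e\<in>insert e F. \<bar>c e\<bar> \<le> r}
        = (\<lambda>(s, x). s *\<^sub>R e + x) ` ({-r..r} \<times> ?K)" (is "?L = ?R")
    proof (intro equalityI subsetI)
      fix x assume "x \<in> ?L"
      then obtain c where c: "x = (\<Sum>e\<in>insert e F. c e *\<^sub>R e)" "\<forall>e\<in>insert e F. \<bar>c e\<bar> \<le> r" by blast
      then have "x = (\<lambda>(s, x). s *\<^sub>R e + x) (c e, \<Sum>e\<in>F. c e *\<^sub>R e)" using insert by simp
      moreover have "(c e, \<Sum>e\<in>F. c e *\<^sub>R e) \<in> {-r..r} \<times> ?K" using c(2) by auto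
      ultimately show "x \<in> ?R" by blast
    next
      fix x assume "x \<in> ?R"
      then obtain q where q: "x = (\<lambda>(s, x). s *\<^sub>R e + x) q" "q \<in> {-r..r} \<times> ?K" by (rule imageE)
      obtain s y where q': "q = (s, y)" by (cases q)
      have s: "\<bar>s\<bar> \<le> r" "y \<in> ?K" "x = s *\<^sub>R e + y" using q unfolding q' by auto
      then obtain c where "\<forall>e\<in>F. \<bar>c e\<bar> \<le> r" "y = (\<Sum>e\<in>F. c e *\<^sub>R e)" by blast
      with s have c: "\<bar>s\<bar> \<le> r" "\<forall>e\<in>F. \<bar>c e\<bar> \<le> r" "x = s *\<^sub>R e + (\<Sum>e\<in>F. c e *\<^sub>R e)" by auto
      have "(\<Sum>a\<in>F. (c(e := s)) a *\<^sub>R a) = (\<Sum>e\<in>F. c e *\<^sub>R e)"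
        using insert(2) by (intro sum.cong) auto
      then have "x = (\<Sum>a\<in>insert e F. (c(e := s)) a *\<^sub>R a)" using c insert by simp
      then show "x \<in> ?L" using c by (intro CollectI exI[of _ "c(e := s)"]) auto
    qed
    moreover have "compact ?R"
      by (intro compact_continuous_image compact_Times insert) (auto simp: split_beta intro!: continuous_intros)
    ultimately show ?case by simp
  qed simp
  have "cball 0 r \<subseteq> {\<Sum>e\<in>B. c e *\<^sub>R e | c. \<forall>e\<in>B. \<bar>c e\<bar> \<le> r}"
  proof
    fix x :: 'a assume "x \<in> cball 0 r"
    then have "norm x \<le> r" by simp
    have "\<bar>inner x e\<bar> \<le> r" if "e \<in> B" for e
    proof -
      have "norm e = 1" using B(3)[of e e] that by (simp add: norm_eq_sqrt_inner)
      then show ?thesis using Cauchy_Schwarz_ineq2[of x e] \<open>norm x \<le> r\<close> by simp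
    qed
    then show "x \<in> {\<Sum>e\<in>B. c e *\<^sub>R e | c. \<forall>e\<in>B. \<bar>c e\<bar> \<le> r}"
      using B(2)[of x] by (intro CollectI exI[of _ "inner x"]) auto
  qed
  then have "compact (cball (0::'a) r)"
    using compact_Int_closed[OF c[OF B(1)] closed_cball, of 0 r] by (simp add: Int_absorb1)
  then have "compact ((+) p ` cball 0 r)" by (intro compact_continuous_image continuous_intros)
  then show ?thesis by simp
qed

section \<open>Maps of class C^k and smooth maps\<close>

lemma Ck_on_subset: "Ck_on k W f \<Longrightarrow> V \<subseteq> W \<Longrightarrow> Ck_on k V f"
  by (induction k arbitrary: f) (auto intro: continuous_on_subset)

lemma Ck_on_cong:
  assumes "open W" "\<And>x. x \<in> W \<Longrightarrow> f x = g x" "Ck_on k W f"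
  shows "Ck_on k W g"
  using assms(2,3)
proof (induction k arbitrary: f g)
  case 0
  then show ?case using continuous_on_cong by force
next
  case (Suc k)
  have d: "g differentiable (at x)" "frechet_derivative g (at x) = frechet_derivative f (at x)" if "x \<in> W" for x
  proof -
    have "(f has_derivative frechet_derivative f (at x)) (at x)"
      using Suc.prems that frechet_derivative_works by auto
    then have "(g has_derivative frechet_derivative f (at x)) (at x)"
      by (rule has_derivative_transform_within_open[OF _ assms(1) that]) (rule Suc.prems)
    then show "g differentiable (at x)" "frechet_derivative g (at x) = frechet_derivative f (at x)"
      using differentiable_def frechet_derivative_at by metis+
  qed
  have "Ck_on k W (\<lambda>x. frechet_derivative g (at x) v)" for v
    by (rule Suc.IH[of "\<lambda>x. frechet_derivative f (at x) v"]) (use Suc.prems d in auto)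
  then show ?case using d by simp
qed

lemma Ck_on_local:
  assumes "\<And>x. x \<in> W \<Longrightarrow> \<exists>N. open N \<and> x \<in> N \<and> Ck_on k N f"
  shows "Ck_on k W f"
  using assms
proof (induction k arbitrary: f)
  case 0
  have "isCont f x" if "x \<in> W" for x
    using 0[OF that] by (auto simp: continuous_on_eq_continuous_at)
  then show ?case by (simp add: continuous_at_imp_continuous_on)
next
  case (Suc k)
  have "f differentiable (at x)" if "x \<in> W" for x using Suc.prems[OF that] by auto
  moreover have "Ck_on k W (\<lambda>x. frechet_derivative f (at x) v)" for v
  proof (rule Suc.IH)
    fix x assume "x \<in> W"
    then obtain N where "open N" "x \<in> N" "Ck_on (Suc k) N f" using Suc.prems by blast
    then show "\<exists>N. open N \<and> x \<in> N \<and> Ck_on k N (\<lambda>x. frechet_derivative f (at x) v)" by auto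
  qed
  ultimately show ?case by simp
qed

lemma Ck_on_SucD: "Ck_on (Suc k) W f \<Longrightarrow> Ck_on k W f"
proof (induction k arbitrary: f)
  case 0
  then show ?case
    by (auto intro!: continuous_at_imp_continuous_on differentiable_imp_continuous_within)
next
  case (Suc k)
  then show ?case by simp
qed

lemma Ck_on_Suc_derivative:
  assumes "Ck_on (Suc k) W f" "x \<in> W"
  shows "(f has_derivative frechet_derivative f (at x)) (at x)"
  using assms frechet_derivative_works by auto

lemma Ck_on_SucI:
  assumes "open W" "\<And>x. x \<in> W \<Longrightarrow> (f has_derivative f' x) (at x)" "\<And>v. Ck_on k W (\<lambda>x. f' x v)"
  shows "Ck_on (Suc k) W f"
proof -
  have "Ck_on k W (\<lambda>x. frechet_derivative f (at x) v)" for v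
    by (rule Ck_on_cong[OF assms(1) _ assms(3)[of v]]) (use assms(2) frechet_derivative_at in metis)
  moreover have "\<forall>x\<in>W. f differentiable (at x)" using assms(2) differentiable_def by blast
  ultimately show ?thesis by simp
qed

lemma Ck_on_const: "Ck_on k W (\<lambda>_. c)"
  by (induction k arbitrary: c) auto

lemma Ck_on_linear:
  assumes "bounded_linear f" shows "Ck_on k W f"
proof (rule Ck_on_subset[OF _ subset_UNIV])
  show "Ck_on k UNIV f"
  proof (cases k)
    case 0 then show ?thesis using assms linear_continuous_on by simp
  next
    case (Suc l)
    show ?thesis
      unfolding Suc
      by (rule Ck_on_SucI[OF open_UNIV bounded_linear_imp_has_derivative[OF assms] Ck_on_const])
  qed
qed

lemma Ck_on_add:
  assumes "open W" "Ck_on k W f" "Ck_on k W g" shows "Ck_on k W (\<lambda>x. f x + g x)"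
  using assms(2,3)
proof (induction k arbitrary: f g)
  case 0 then show ?case by (auto intro: continuous_intros)
next
  case (Suc k)
  show ?case
    by (rule Ck_on_SucI[OF assms(1) has_derivative_add[OF Ck_on_Suc_derivative[OF Suc.prems(1)] Ck_on_Suc_derivative[OF Suc.prems(2)]]])
      (use Suc in auto)
qed

lemma Ck_on_compose_linear:
  assumes "open W" "bounded_linear L" "Ck_on k W f" shows "Ck_on k W (\<lambda>x. L (f x))"
  using assms(3)
proof (induction k arbitrary: f)
  case 0 then show ?case
    using assms(2) by (auto intro: bounded_linear.continuous_on)
next
  case (Suc k)
  show ?case
    by (rule Ck_on_SucI[OF assms(1) bounded_linear.has_derivative[OF assms(2) Ck_on_Suc_derivative[OF Suc.prems]]])
      (use Suc in auto)
qed

lemma Ck_on_sum: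
  assumes "open W" "\<And>i. i \<in> I \<Longrightarrow> Ck_on k W (f i)" shows "Ck_on k W (\<lambda>x. \<Sum>i\<in>I. f i x)"
  using assms(2)
proof (induction I rule: infinite_finite_induct)
  case (insert i I)
  then show ?case by (simp add: Ck_on_add[OF assms(1)])
qed (simp_all add: Ck_on_const)

lemma Ck_on_bilinear:
  assumes "open W" "bounded_bilinear P" "Ck_on k W f" "Ck_on k W g"
  shows "Ck_on k W (\<lambda>x. P (f x) (g x))"
  using assms(3,4)
proof (induction k arbitrary: f g)
  case 0 then show ?case
    using assms(2) by (auto intro: bounded_bilinear.continuous_on)
next
  case (Suc k)
  show ?case
  proof (rule Ck_on_SucI[OF assms(1) bounded_bilinear.FDERIV[OF assms(2) Ck_on_Suc_derivative[OF Suc.prems(1)] Ck_on_Suc_derivative[OF Suc.prems(2)]]])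
    fix v
    show "Ck_on k W (\<lambda>x. P (f x) (frechet_derivative g (at x) v) + P (frechet_derivative f (at x) v) (g x))"
      by (intro Ck_on_add assms Suc.IH) (use Suc.prems Ck_on_SucD in auto)
  qed
qed

lemmas Ck_on_scaleR = Ck_on_bilinear[OF _ bounded_bilinear_scaleR]
lemmas Ck_on_mult = Ck_on_bilinear[OF _ bounded_bilinear_mult]
lemmas Ck_on_inner = Ck_on_bilinear[OF _ bounded_bilinear_inner]

text \<open>In the chain rule the derivative of \<open>f\<close> is applied to a varying direction,
  whereas \<open>Ck_on\<close> controls derivatives in fixed directions only. Expanding the
  direction in an orthonormal basis gives a finite sum of products.\<close>

lemma Ck_on_compose:
  fixes g :: "'a::real_normed_vector \<Rightarrow> 'b::real_inner" and f :: "'b \<Rightarrow> 'c::real_normed_vector"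
  assumes fd: "finite_dimensional TYPE('b)" and W: "open W" and gW: "g ` W \<subseteq> V"
    and "Ck_on k V f" "Ck_on k W g"
  shows "Ck_on k W (\<lambda>x. f (g x))"
  using assms(4,5)
proof (induction k arbitrary: f)
  case 0 then show ?case using gW by (auto intro: continuous_on_compose2)
next
  case (Suc k)
  obtain B :: "'b set" where B: "finite B" "\<And>x. x = (\<Sum>e\<in>B. inner x e *\<^sub>R e)"
    using finite_dimensional_basis[OF fd] by metis
  let ?g' = "\<lambda>x. frechet_derivative g (at x)" and ?f' = "\<lambda>y. frechet_derivative f (at y)"
  have fd: "(f has_derivative ?f' (g x)) (at (g x))" if "x \<in> W" for x
    using Ck_on_Suc_derivative[OF Suc.prems(1)] that gW by blast
  show ?case
  proof (rule Ck_on_SucI[OF W has_derivative_compose[OF Ck_on_Suc_derivative[OF Suc.prems(2)] fd]])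
    fix v
    have "Ck_on k W (\<lambda>x. \<Sum>e\<in>B. inner (?g' x v) e *\<^sub>R ?f' (g x) e)"
    proof (intro Ck_on_sum[OF W] Ck_on_scaleR[OF W] Ck_on_inner[OF W] Ck_on_const)
      show "Ck_on k W (\<lambda>x. ?g' x v)" using Suc.prems by auto
      show "Ck_on k W (\<lambda>x. ?f' (g x) e)" for e
        by (rule Suc.IH) (use Suc.prems Ck_on_SucD[OF Suc.prems(2)] in auto)
    qed
    then show "Ck_on k W (\<lambda>x. ?f' (g x) (?g' x v))"
    proof (rule Ck_on_cong[OF W, rotated])
      fix x assume "x \<in> W"
      then have lin: "linear (?f' (g x))" using fd has_derivative_linear by blast
      show "(\<Sum>e\<in>B. inner (?g' x v) e *\<^sub>R ?f' (g x) e) = ?f' (g x) (?g' x v)"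
        by (subst (2) B(2)[of "?g' x v"]) (simp add: linear_sum[OF lin] linear_scale[OF lin])
    qed
  qed auto
qed

lemma smooth_on_subset: "smooth_on W f \<Longrightarrow> V \<subseteq> W \<Longrightarrow> smooth_on V f"
  unfolding smooth_on_def using Ck_on_subset by blast

lemma smooth_on_cong: "open W \<Longrightarrow> (\<And>x. x \<in> W \<Longrightarrow> f x = g x) \<Longrightarrow> smooth_on W f \<Longrightarrow> smooth_on W g"
  unfolding smooth_on_def using Ck_on_cong by metis

lemma smooth_on_local:
  "(\<And>x. x \<in> W \<Longrightarrow> \<exists>N. open N \<and> x \<in> N \<and> smooth_on N f) \<Longrightarrow> smooth_on W f"
  unfolding smooth_on_def by (intro allI Ck_on_local) blast

lemma smooth_on_imp_continuous_on: "smooth_on W f \<Longrightarrow> continuous_on W f"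
  unfolding smooth_on_def using Ck_on.simps(1) by blast

lemma smooth_on_has_derivative:
  "smooth_on W f \<Longrightarrow> x \<in> W \<Longrightarrow> (f has_derivative frechet_derivative f (at x)) (at x)"
  unfolding smooth_on_def using Ck_on_Suc_derivative by blast

lemma smooth_on_const: "smooth_on W (\<lambda>_. c)"
  by (simp add: smooth_on_def Ck_on_const)

lemma smooth_on_linear: "bounded_linear f \<Longrightarrow> smooth_on W f"
  by (simp add: smooth_on_def Ck_on_linear)

lemma smooth_on_add: "open W \<Longrightarrow> smooth_on W f \<Longrightarrow> smooth_on W g \<Longrightarrow> smooth_on W (\<lambda>x. f x + g x)"
  by (simp add: smooth_on_def Ck_on_add)

lemma smooth_on_compose_linear: "open W \<Longrightarrow> bounded_linear L \<Longrightarrow> smooth_on W f \<Longrightarrow> smooth_on W (\<lambda>x. L (f x))"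
  by (simp add: smooth_on_def Ck_on_compose_linear)

lemma smooth_on_bilinear:
  "open W \<Longrightarrow> bounded_bilinear P \<Longrightarrow> smooth_on W f \<Longrightarrow> smooth_on W g \<Longrightarrow> smooth_on W (\<lambda>x. P (f x) (g x))"
  by (simp add: smooth_on_def Ck_on_bilinear)

lemmas smooth_on_mult = smooth_on_bilinear[OF _ bounded_bilinear_mult]
lemmas smooth_on_inner = smooth_on_bilinear[OF _ bounded_bilinear_inner]

lemma smooth_on_compose:
  fixes g :: "'a::real_normed_vector \<Rightarrow> 'b::real_inner"
  shows "finite_dimensional TYPE('b) \<Longrightarrow> open W \<Longrightarrow> g ` W \<subseteq> V \<Longrightarrow> smooth_on V f \<Longrightarrow> smooth_on W g
    \<Longrightarrow> smooth_on W (\<lambda>x. f (g x))"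
  using Ck_on_compose unfolding smooth_on_def by blast

lemma smooth_on_diff: "open W \<Longrightarrow> smooth_on W f \<Longrightarrow> smooth_on W g \<Longrightarrow> smooth_on W (\<lambda>x. f x - g x)"
  using smooth_on_add[of W f "\<lambda>x. - g x"] smooth_on_compose_linear[OF _ bounded_linear_minus[OF bounded_linear_ident], of W g]
  by simp

lemma smooth_on_Pair:
  fixes f :: "'a::real_normed_vector \<Rightarrow> 'b::real_normed_vector" and g :: "'a \<Rightarrow> 'c::real_normed_vector"
  assumes "open W" "smooth_on W f" "smooth_on W g" shows "smooth_on W (\<lambda>x. (f x, g x))"
proof -
  have "bounded_linear (\<lambda>y::'b. (y, 0::'c))" "bounded_linear (\<lambda>y::'c. (0::'b, y))"
    by (intro bounded_linear_Pair bounded_linear_ident bounded_linear_zero)+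
  then have "smooth_on W (\<lambda>x. (f x, 0) + (0, g x))"
    by (intro smooth_on_add smooth_on_compose_linear[of W "\<lambda>y. (y, 0)"] smooth_on_compose_linear[of W "\<lambda>y. (0, y)"] assms)
  then show ?thesis by simp
qed

lemma smooth_on_inverse: "smooth_on {x::real. x \<noteq> 0} inverse"
proof -
  have o: "open {x::real. x \<noteq> 0}" by (simp add: open_Collect_neq)
  have "Ck_on k {x::real. x \<noteq> 0} inverse" for k
  proof (induction k)
    case 0 then show ?case by (auto intro!: continuous_intros)
  next
    case (Suc k)
    show ?case
    proof (rule Ck_on_SucI[OF o, of _ "\<lambda>x v. - (inverse x * v * inverse x)"])
      show "(inverse has_derivative (\<lambda>v. - (inverse x * v * inverse x))) (at x)" if "x \<in> {x. x \<noteq> 0}" for x :: real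
        using that by (intro has_derivative_inverse') auto
      fix v :: real
      have "Ck_on k {x::real. x \<noteq> 0} (\<lambda>x. (- v) * (inverse x * inverse x))"
        by (intro Ck_on_mult[OF o] Ck_on_const Suc)
      then show "Ck_on k {x::real. x \<noteq> 0} (\<lambda>x. - (inverse x * v * inverse x))"
        by (simp add: algebra_simps)
    qed
  qed
  then show ?thesis by (simp add: smooth_on_def)
qed

text \<open>The functions \<open>flat n\<close> are a family whose span is closed under differentiation.\<close>

definition flat :: "nat \<Rightarrow> real \<Rightarrow> real" where
  "flat n t = (if t \<le> 0 then 0 else exp (- (1 / t)) / t ^ n)"

text \<open>From \<open>1 + s \<le> exp s\<close> at \<open>s = 1 / (m * t)\<close> with
  \<open>m = n + 1\<close>, raised to the power \<open>m\<close>: the numerator is at most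
  \<open>(m * t) ^ m\<close>, one power of \<open>t\<close> more than the denominator.\<close>

lemma flat_le:
  assumes "t > 0" shows "flat n t \<le> real (Suc n) ^ Suc n * t"
proof -
  let ?m = "real (Suc n)"
  have "1 / (?m * t) \<le> exp (1 / (?m * t))" using exp_ge_add_one_self[of "1 / (?m * t)"] by linarith
  then have "(1 / (?m * t)) ^ Suc n \<le> exp (1 / (?m * t)) ^ Suc n"
    using assms by (intro power_mono) auto
  also have "\<dots> = exp (?m * (1 / (?m * t)))" by (rule exp_of_nat_mult[symmetric])
  also have "?m * (1 / (?m * t)) = 1 / t" by (simp del: of_nat_Suc)
  finally have "exp (- (1 / t)) \<le> inverse ((1 / (?m * t)) ^ Suc n)"
    using assms by (simp only: exp_minus) (intro le_imp_inverse_le, auto)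
  also have "\<dots> = (?m * t) ^ Suc n" by (simp only: power_one_over inverse_eq_divide) simp
  finally have "exp (- (1 / t)) / t ^ n \<le> (?m * t) ^ Suc n / t ^ n"
    using assms by (intro divide_right_mono) auto
  also have "\<dots> = ?m ^ Suc n * t" using assms by (simp only: power_mult_distrib) simp
  finally show ?thesis using assms by (simp add: flat_def)
qed

lemma flat_nonneg: "0 \<le> flat n t"
  by (simp add: flat_def)

lemma flat_derivative:
  "(flat n has_real_derivative (flat (n + 2) t - real n * flat (n + 1) t)) (at t)"
proof (cases "t = 0")
  case False
  show ?thesis
  proof (cases "t > 0")
    case True
    have "((\<lambda>t. exp (- (1 / t)) / t ^ n) has_real_derivative
        (exp (- (1 / t)) / t ^ (n + 2) - real n * (exp (- (1 / t)) / t ^ (n + 1)))) (at t)"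
    proof -
      have i: "((\<lambda>t. inverse t ^ n) has_real_derivative real n * (inverse t ^ (n - 1) * - (inverse t)\<^sup>2)) (at t)"
        using DERIV_power[OF DERIV_inverse[of t], of n] True by (simp add: numeral_2_eq_2 mult_ac)
      have e: "((\<lambda>t. exp (- (1 / t))) has_real_derivative exp (- (1 / t)) * (inverse t)\<^sup>2) (at t)"
        using True by (auto intro!: derivative_eq_intros simp: power2_eq_square divide_inverse)
      have eq: "real n * (inverse t ^ (n - 1) * - (inverse t)\<^sup>2) = - real n * inverse t ^ (n + 1)"
        by (cases n) (simp_all add: power2_eq_square algebra_simps)
      show ?thesis using DERIV_mult[OF e i[unfolded eq]]
        by (simp add: divide_inverse power_inverse algebra_simps power2_eq_square)
    qed
    then have "(flat n has_real_derivative
        (exp (- (1 / t)) / t ^ (n + 2) - real n * (exp (- (1 / t)) / t ^ (n + 1)))) (at t)"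
      by (rule has_field_derivative_transform_within_open[of _ _ _ "{0<..}"]) (use True in \<open>auto simp: flat_def\<close>)
    then show ?thesis using True by (simp add: flat_def)
  next
    case False
    then have "t < 0" using \<open>t \<noteq> 0\<close> by simp
    have "((\<lambda>_. 0) has_real_derivative 0) (at t)" by simp
    then have "(flat n has_real_derivative 0) (at t)"
      by (rule has_field_derivative_transform_within_open[of _ _ _ "{..<0}"]) (use \<open>t < 0\<close> in \<open>auto simp: flat_def\<close>)
    then show ?thesis using False by (simp add: flat_def)
  qed
next
  case True
  \<comment> \<open>At 0 the difference quotient is \<open>flat (Suc n)\<close> for positive
    \<open>h\<close>, and this tends to 0 by \<open>flat_le\<close>.\<close>
  have "(\<lambda>h. flat n h / h) \<midarrow>0\<rightarrow> 0"
  proof (rule Lim_null_comparison)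
    show "\<forall>\<^sub>F h in at 0. norm (flat n h / h) \<le> real (Suc (Suc n)) ^ Suc (Suc n) * \<bar>h\<bar>"
    proof (rule always_eventually, rule allI)
      fix h :: real
      show "norm (flat n h / h) \<le> real (Suc (Suc n)) ^ Suc (Suc n) * \<bar>h\<bar>"
      proof (cases "h > 0")
        case True
        then have "flat n h / h = flat (Suc n) h" by (simp add: flat_def field_simps)
        then show ?thesis using flat_le[OF True, of "Suc n"] flat_nonneg[of "Suc n" h] True by simp
      next
        case False
        then have "flat n h / h = 0" by (simp add: flat_def)
        moreover have "0 \<le> real (Suc (Suc n)) ^ Suc (Suc n) * \<bar>h\<bar>"
          by (intro mult_nonneg_nonneg zero_le_power) auto
        ultimately show ?thesis by (simp only: norm_zero)
      qed
    qed
    have "((\<lambda>h. real (Suc (Suc n)) ^ Suc (Suc n) * \<bar>h\<bar>) \<longlongrightarrow> real (Suc (Suc n)) ^ Suc (Suc n) * \<bar>0\<bar>) (at 0)"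
      by (intro tendsto_intros)
    then show "((\<lambda>h. real (Suc (Suc n)) ^ Suc (Suc n) * \<bar>h\<bar>) \<longlongrightarrow> 0) (at 0)" by simp
  qed
  then show ?thesis using True by (simp add: DERIV_def flat_def[of _ 0])
qed

lemma smooth_on_flat: "smooth_on UNIV (flat n)"
proof -
  have "Ck_on k UNIV (flat n)" for k
  proof (induction k arbitrary: n)
    case 0
    show ?case by (auto intro!: continuous_at_imp_continuous_on DERIV_isCont[OF flat_derivative])
  next
    case (Suc k)
    show ?case
    proof (rule Ck_on_SucI[OF open_UNIV, of _ "\<lambda>t v. (flat (n + 2) t - real n * flat (n + 1) t) * v"])
      show "(flat n has_derivative (*) (flat (n + 2) t - real n * flat (n + 1) t)) (at t)" for t
        using flat_derivative by (simp add: has_field_derivative_def)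
      have "Ck_on k UNIV (\<lambda>t. (flat (n + 2) t + (- real n) * flat (n + 1) t) * v)" for v
        by (intro Ck_on_mult[OF open_UNIV] Ck_on_add[OF open_UNIV] Ck_on_const Suc)
      then show "Ck_on k UNIV (\<lambda>t. (flat (n + 2) t - real n * flat (n + 1) t) * v)" for v by simp
    qed
  qed
  then show ?thesis by (simp add: smooth_on_def)
qed

definition smooth_step :: "real \<Rightarrow> real" where
  "smooth_step t = flat 0 t * inverse (flat 0 t + flat 0 (1 - t))"

lemma flat_pos: "t > 0 \<Longrightarrow> flat 0 t > 0"
  by (simp add: flat_def)

lemma smooth_step_pos: "flat 0 t + flat 0 (1 - t) > 0"
  using flat_pos[of t] flat_pos[of "1 - t"] flat_nonneg[of 0 t] flat_nonneg[of 0 "1 - t"]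
  by (cases "t > 0") auto

lemma smooth_step_bounds: "0 \<le> smooth_step t" "smooth_step t \<le> 1"
  using smooth_step_pos[of t] flat_nonneg[of 0 t] flat_nonneg[of 0 "1 - t"]
  by (auto simp: smooth_step_def field_simps)

lemma smooth_step_eq: "t \<le> 0 \<Longrightarrow> smooth_step t = 0" "t \<ge> 1 \<Longrightarrow> smooth_step t = 1"
  using flat_pos[of t] by (auto simp: smooth_step_def flat_def[of 0])

lemma smooth_on_smooth_step: "smooth_on UNIV smooth_step"
proof -
  have s: "smooth_on UNIV (\<lambda>t. flat 0 (1 - t))"
    by (rule smooth_on_compose[OF finite_dimensional_real open_UNIV _ smooth_on_flat])
      (auto intro: smooth_on_diff[OF open_UNIV smooth_on_const smooth_on_linear[OF bounded_linear_ident]])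
  have "smooth_on UNIV (\<lambda>t. inverse (flat 0 t + flat 0 (1 - t)))"
    by (rule smooth_on_compose[OF finite_dimensional_real open_UNIV _ smooth_on_inverse])
      (use smooth_step_pos in \<open>auto intro!: smooth_on_add s smooth_on_flat simp: less_le\<close>)
  then have "smooth_on UNIV (\<lambda>t. flat 0 t * inverse (flat 0 t + flat 0 (1 - t)))"
    by (intro smooth_on_mult open_UNIV smooth_on_flat)
  then show ?thesis by (simp add: smooth_step_def[abs_def])
qed

lemma bump_function:
  fixes p :: "'a::real_inner"
  assumes "r > 0"
  obtains \<beta> :: "'a \<Rightarrow> real" where "smooth_on UNIV \<beta>" "\<And>x. 0 \<le> \<beta> x" "\<And>x. \<beta> x \<le> 1"
    "\<And>x. x \<in> ball p r \<Longrightarrow> \<beta> x = 1" "\<And>x. \<beta> x \<noteq> 0 \<Longrightarrow> x \<in> cball p (2 * r)"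
proof
  \<comment> \<open>\<open>?q x\<close> is 2 minus the squared distance to \<open>p\<close> in units
    of \<open>r\<close>: at least 1 on the ball of radius \<open>r\<close>, at most 0 outside the
    ball of radius \<open>2 * r\<close>, and smooth at the centre because the distance is
    squared.\<close>
  let ?q = "\<lambda>x. 2 - inverse (r\<^sup>2) * inner (x - p) (x - p)"
  let ?\<beta> = "\<lambda>x. smooth_step (?q x)"
  have l: "smooth_on UNIV (\<lambda>x. x - p)"
    by (rule smooth_on_diff[OF open_UNIV smooth_on_linear[OF bounded_linear_ident] smooth_on_const])
  have "smooth_on UNIV ?q"
    by (rule smooth_on_diff[OF open_UNIV smooth_on_const
          smooth_on_mult[OF open_UNIV smooth_on_const smooth_on_inner[OF open_UNIV l l]]])
  then show "smooth_on UNIV ?\<beta>"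
    by (rule smooth_on_compose[OF finite_dimensional_real open_UNIV _ smooth_on_smooth_step, rotated]) simp
  show "0 \<le> ?\<beta> x" "?\<beta> x \<le> 1" for x by (rule smooth_step_bounds)+
  have q: "?q x = 2 - (dist p x / r)\<^sup>2" for x
    by (simp add: dist_norm norm_minus_commute power_mult_distrib power_inverse divide_inverse
        flip: power2_norm_eq_inner)
  show "?\<beta> x = 1" if "x \<in> ball p r" for x
  proof (rule smooth_step_eq(2))
    have "(dist p x / r)\<^sup>2 \<le> 1\<^sup>2" using that assms by (intro power_mono) auto
    then show "1 \<le> ?q x" unfolding q by simp
  qed
  show "x \<in> cball p (2 * r)" if "?\<beta> x \<noteq> 0" for x
  proof -
    have "?q x > 0" using that smooth_step_eq(1)[of "?q x"] by force
    then have "(dist p x / r)\<^sup>2 \<le> 2\<^sup>2" unfolding q by simp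
    then have "dist p x / r \<le> 2" by (rule power2_le_imp_le) simp
    then show ?thesis using assms by (simp add: field_simps)
  qed
qed

section \<open>The inverse function theorem\<close>

text \<open>The image of a basis is independent and of the same size; if it did not span, one more
  vector would exceed the bound on independent sets.\<close>

lemma finite_dimensional_inj_imp_surj:
  fixes f :: "'a::real_vector \<Rightarrow> 'a"
  assumes fd: "finite_dimensional TYPE('a)" and f: "linear f" "inj f"
  shows "surj f"
proof -
  obtain S :: "'a set" where S: "finite S" "span S = UNIV"
    using fd by (auto simp: finite_dimensional_def)
  obtain B where B: "B \<subseteq> S" "independent B" "span B = UNIV"
    using maximal_independent_subset[of S] S(2) span_mono span_span
    by (metis UNIV_eq_I top.extremum_uniqueI)
  have finB: "finite B" using B(1) S(1) finite_subset by blast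
  have "independent (f ` B)"
    by (rule linear_independent_injective_image[OF f(1) B(2) inj_on_subset[OF f(2) subset_UNIV]])
  moreover have "card (f ` B) = card B" using f(2) by (intro card_image) (auto intro: inj_on_subset)
  ultimately have ind: "independent (f ` B)" "card (f ` B) = card B" by auto
  have "span (f ` B) = UNIV"
  proof (rule ccontr)
    assume "span (f ` B) \<noteq> UNIV"
    then obtain x where x: "x \<notin> span (f ` B)" by blast
    then have "independent (insert x (f ` B))" by (rule independent_insertI[OF _ ind(1)])
    then have "card (insert x (f ` B)) \<le> card B"
      using independent_span_bound[OF finB] B(3) by blast
    moreover have "x \<notin> f ` B"
    proof
      assume "x \<in> f ` B"
      then have "x \<in> span (f ` B)" by (rule span_base)
      with x show False by simp
    qed
    ultimately show False using ind(2) finB by simp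
  qed
  then show ?thesis using linear_span_image[OF f(1), of B] B(3) by simp
qed

text \<open>A product rule in which one factor is merely continuous, at a zero of the other. It
  differentiates the inverse of a family of linear maps when only its continuity is known.\<close>

lemma has_derivative_scaleR_zero:
  fixes a :: "'a::real_normed_vector \<Rightarrow> real" and q :: "'a \<Rightarrow> 'b::real_normed_vector"
  assumes a: "(a has_derivative a') (at z)" "a z = 0" and q: "isCont q z"
  shows "((\<lambda>x. a x *\<^sub>R q x) has_derivative (\<lambda>h. a' h *\<^sub>R q z)) (at z)"
proof -
  have bl: "bounded_linear a'" using a(1) has_derivative_bounded_linear by blast
  have "((\<lambda>x. a x *\<^sub>R (q x - q z)) has_derivative (\<lambda>_. 0)) (at z)"
    unfolding has_derivative_at
  proof (intro conjI bounded_linear_zero)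
    have lim: "(\<lambda>h. norm (a (z + h) - a z - a' h) / norm h) \<midarrow>0\<rightarrow> 0"
      using a(1) by (simp add: has_derivative_at)
    obtain K where K: "\<And>h. norm (a' h) \<le> norm h * K" using bounded_linear.bounded[OF bl] by blast
    have q0: "(\<lambda>h. norm (q (z + h) - q z)) \<midarrow>0\<rightarrow> 0"
      using q LIM_offset_zero[of q "q z" z] unfolding isCont_def
      by (simp add: LIM_zero tendsto_norm_zero)
    have "(\<lambda>h. (norm (a (z + h) - a z - a' h) / norm h + K) * norm (q (z + h) - q z)) \<midarrow>0\<rightarrow> (0 + K) * 0"
      by (intro tendsto_intros lim q0)
    then have l0: "(\<lambda>h. (norm (a (z + h) - a z - a' h) / norm h + K) * norm (q (z + h) - q z)) \<midarrow>0\<rightarrow> 0" by simp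
    show "(\<lambda>h. norm (a (z + h) *\<^sub>R (q (z + h) - q z) - a z *\<^sub>R (q z - q z) - 0) / norm h) \<midarrow>0\<rightarrow> 0"
    proof (rule Lim_null_comparison[OF _ l0], unfold eventually_at_filter, rule always_eventually, intro allI impI)
      fix h :: 'a assume "h \<noteq> 0"
      have "\<bar>a (z + h)\<bar> \<le> norm (a (z + h) - a z - a' h) + norm h * K"
        using K[of h] a(2) by simp
      then have "\<bar>a (z + h)\<bar> / norm h \<le> norm (a (z + h) - a z - a' h) / norm h + K"
        using \<open>h \<noteq> 0\<close> by (simp add: field_simps)
      then have "\<bar>a (z + h)\<bar> / norm h * norm (q (z + h) - q z)
          \<le> (norm (a (z + h) - a z - a' h) / norm h + K) * norm (q (z + h) - q z)"
        by (rule mult_right_mono) simp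
      then show "norm (norm (a (z + h) *\<^sub>R (q (z + h) - q z) - a z *\<^sub>R (q z - q z) - 0) / norm h)
          \<le> (norm (a (z + h) - a z - a' h) / norm h + K) * norm (q (z + h) - q z)"
        by simp
    qed
  qed
  moreover have "((\<lambda>x. a x *\<^sub>R q z) has_derivative (\<lambda>h. a' h *\<^sub>R q z)) (at z)"
    using a(1) by (intro has_derivative_scaleR_left)
  ultimately have "((\<lambda>x. a x *\<^sub>R (q x - q z) + a x *\<^sub>R q z) has_derivative (\<lambda>h. 0 + a' h *\<^sub>R q z)) (at z)"
    by (rule has_derivative_add)
  then show ?thesis by (simp add: scaleR_diff_right)
qed

lemma finite_dimensional_expand:
  fixes L :: "'a::real_inner \<Rightarrow> 'b::real_vector"
  assumes "linear L" "\<And>x. x = (\<Sum>e\<in>B. inner x e *\<^sub>R e)"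
  shows "L x = (\<Sum>e\<in>B. inner x e *\<^sub>R L e)"
  by (subst assms(2)[of x]) (simp add: linear_sum[OF assms(1)] linear_scale[OF assms(1)])

lemma linear_inv:
  assumes "linear f" "bij f" shows "linear (inv f)"
proof -
  have f: "f (inv f y) = y" "inv f (f x) = x" for x y
    using assms(2) by (simp_all add: bij_is_inj bij_is_surj surj_f_inv_f)
  show ?thesis
  proof (rule linearI)
    show "inv f (x + y) = inv f x + inv f y" for x y
    proof -
      have "inv f (x + y) = inv f (f (inv f x) + f (inv f y))" by (simp only: f)
      also have "\<dots> = inv f x + inv f y" by (simp only: f(2) flip: linear_add[OF assms(1)])
      finally show ?thesis .
    qed
    show "inv f (c *\<^sub>R x) = c *\<^sub>R inv f x" for c x
    proof -
      have "inv f (c *\<^sub>R x) = inv f (c *\<^sub>R f (inv f x))" by (simp only: f)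
      also have "\<dots> = c *\<^sub>R inv f x" by (simp only: f(2) flip: linear_scale[OF assms(1)])
      finally show ?thesis .
    qed
  qed
qed

text \<open>Induction on \<open>k\<close>: continuity comes from a perturbation of the identity,
  differentiability from the resolvent identity, and the derivative is again built from the inverse
  and the derivative of \<open>M\<close>.\<close>

lemma Ck_on_inverse_linear:
  fixes M :: "'z::real_normed_vector \<Rightarrow> 'a::real_inner \<Rightarrow> 'a"
  assumes fd: "finite_dimensional TYPE('a)" and V: "open V"
    and M: "\<And>z. z \<in> V \<Longrightarrow> linear (M z)" "\<And>z. z \<in> V \<Longrightarrow> bij (M z)"
    and Ck: "\<And>w. Ck_on k V (\<lambda>z. M z w)"
  shows "Ck_on k V (\<lambda>z. inv (M z) v)"
  using Ck
proof (induction k arbitrary: v)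
  case 0
  obtain B :: "'a set" where B: "finite B" "\<And>x. x = (\<Sum>e\<in>B. inner x e *\<^sub>R e)"
    "\<And>x y. \<lbrakk>x \<in> B; y \<in> B\<rbrakk> \<Longrightarrow> inner x y = (if x = y then 1 else 0)"
    using finite_dimensional_basis[OF fd] by metis
  have cont: "isCont (\<lambda>z. M z w) z" if "z \<in> V" for z w
    using 0 that V by (auto simp: continuous_on_eq_continuous_at)
  have "isCont (\<lambda>z. inv (M z) v) z0" if z0: "z0 \<in> V" for z0
  proof -
    define N where "N = inv (M z0)"
    have linN: "linear N" unfolding N_def by (rule linear_inv[OF M[OF z0]])
    have bN: "bounded_linear N" by (rule finite_dimensional_linear_bounded[OF fd linN])
    have NM: "N (M z0 w) = w" for w unfolding N_def using M(2)[OF z0] by (simp add: bij_is_inj)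
    define u0 where "u0 = inv (M z0) v"
    have Mu0: "M z0 u0 = v" unfolding u0_def using M(2)[OF z0] by (simp add: bij_is_surj surj_f_inv_f)
    have cN: "isCont (\<lambda>z. N (M z w)) z0" for w
      using cont[OF z0] bN by (rule bounded_linear.isCont[rotated])
    have "((\<lambda>z. \<Sum>e\<in>B. norm (N (M z e) - e)) \<longlongrightarrow> (\<Sum>e\<in>B. norm (N (M z0 e) - e))) (at z0)"
      using cN unfolding isCont_def by (intro tendsto_intros)
    then have "((\<lambda>z. \<Sum>e\<in>B. norm (N (M z e) - e)) \<longlongrightarrow> 0) (at z0)" by (simp add: NM)
    then have ev1: "\<forall>\<^sub>F z in at z0. (\<Sum>e\<in>B. norm (N (M z e) - e)) < 1/2"
      by (rule order_tendstoD) simp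
    have ev2: "\<forall>\<^sub>F z in at z0. z \<in> V"
      using V z0 by (simp add: eventually_at_topological) blast
    have "\<forall>\<^sub>F z in at z0. norm (inv (M z) v - u0) \<le> 2 * norm (N (v - M z u0))"
      using ev1 ev2
    proof eventually_elim
      case (elim z)
      have lin: "linear (M z)" using M(1) elim by blast
      have linNM: "linear (\<lambda>w. N (M z w) - w)"
        by (intro linear_compose_sub linear_ident linear_compose[OF lin linN, unfolded o_def])
      \<comment> \<open>\<open>N (M z w)\<close> differs from \<open>w\<close> by at most half its
        norm, uniformly in the direction, so \<open>norm w\<close> is at most twice
        \<open>norm (N (M z w))\<close>.\<close>
      have small: "norm (N (M z w) - w) \<le> norm w / 2" for w
      proof -
        have "N (M z w) - w = (\<Sum>e\<in>B. inner w e *\<^sub>R (N (M z e) - e))"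
          by (rule finite_dimensional_expand[OF linNM B(2)])
        also have "norm \<dots> \<le> (\<Sum>e\<in>B. norm (inner w e *\<^sub>R (N (M z e) - e)))" by (rule norm_sum)
        also have "\<dots> \<le> (\<Sum>e\<in>B. norm w * norm (N (M z e) - e))"
        proof (rule sum_mono)
          fix e assume "e \<in> B"
          then have "norm e = 1" using B(3)[of e e] by (simp add: norm_eq_sqrt_inner)
          then have "\<bar>inner w e\<bar> \<le> norm w" using Cauchy_Schwarz_ineq2[of w e] by simp
          then show "norm (inner w e *\<^sub>R (N (M z e) - e)) \<le> norm w * norm (N (M z e) - e)"
            by (simp add: mult_right_mono)
        qed
        also have "\<dots> = norm w * (\<Sum>e\<in>B. norm (N (M z e) - e))" by (simp add: sum_distrib_left)
        also have "\<dots> \<le> norm w * (1/2)" using elim by (intro mult_left_mono) auto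
        finally show ?thesis by simp
      qed
      define w where "w = inv (M z) v - u0"
      have "M z (inv (M z) v) = v" using M(2) elim by (simp add: bij_is_surj surj_f_inv_f)
      then have "M z w = v - M z u0" unfolding w_def by (simp add: linear_diff[OF lin])
      then have "norm (N (v - M z u0) - w) \<le> norm w / 2" using small[of w] by simp
      then show ?case
        using norm_triangle_ineq2[of w "N (v - M z u0)"] norm_minus_commute[of w "N (v - M z u0)"]
        by (simp add: w_def)
    qed
    moreover have "((\<lambda>z. 2 * norm (N (v - M z u0))) \<longlongrightarrow> 0) (at z0)"
    proof -
      have "((\<lambda>z. 2 * norm (N (v - M z u0))) \<longlongrightarrow> 2 * norm (N (v - M z0 u0))) (at z0)"
        using cont[OF z0, of u0] unfolding isCont_def
        by (intro tendsto_intros bounded_linear.tendsto[OF bN])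
      then show ?thesis by (simp add: Mu0 linear_0[OF linN])
    qed
    ultimately have "((\<lambda>z. inv (M z) v - u0) \<longlongrightarrow> 0) (at z0)"
      by (rule Lim_null_comparison)
    then show ?thesis unfolding isCont_def u0_def by (simp add: LIM_zero_iff)
  qed
  then show ?case by (auto intro: continuous_at_imp_continuous_on)
next
  case (Suc k)
  obtain B :: "'a set" where B: "finite B" "\<And>x. x = (\<Sum>e\<in>B. inner x e *\<^sub>R e)"
    using finite_dimensional_basis[OF fd] by metis
  have Ck: "Ck_on k V (\<lambda>z. M z w)" for w using Suc.prems Ck_on_SucD by blast
  have IH: "Ck_on k V (\<lambda>z. inv (M z) v)" for v by (rule Suc.IH[OF Ck])
  define M' where "M' w z = frechet_derivative (\<lambda>z. M z w) (at z)" for w z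
  have M': "((\<lambda>z. M z w) has_derivative M' w z) (at z)" if "z \<in> V" for w z
    unfolding M'_def by (rule Ck_on_Suc_derivative[OF Suc.prems that])
  have cont: "isCont (\<lambda>z. inv (M z) v) z" if "z \<in> V" for v z
  proof -
    have "Ck_on 0 V (\<lambda>z. inv (M z) v)" using IH[of v] by (induction k) (use Ck_on_SucD in blast)+
    then show ?thesis using V that by (simp add: continuous_on_eq_continuous_at)
  qed
  let ?u = "\<lambda>z. inv (M z) v"
  \<comment> \<open>Minus inverse, derivative of \<open>M\<close>, inverse, applied to
    \<open>v\<close>; both varying vectors are expanded in \<open>B\<close>, since regularity is
    known in fixed directions only.\<close>
  let ?d = "\<lambda>z h. - (\<Sum>f\<in>B. inner (\<Sum>e\<in>B. inner (?u z) e *\<^sub>R M' e z h) f *\<^sub>R inv (M z) f)"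
  show ?case
  proof (rule Ck_on_SucI[OF V, of _ ?d])
    fix z0 assume z0: "z0 \<in> V"
    define u0 where "u0 = ?u z0"
    define y' where "y' h = (\<Sum>e\<in>B. inner u0 e *\<^sub>R M' e z0 h)" for h
    have y: "((\<lambda>z. \<Sum>e\<in>B. inner u0 e *\<^sub>R M z e) has_derivative y') (at z0)"
      unfolding y'_def by (intro has_derivative_sum has_derivative_scaleR_right M'[OF z0])
    have yM: "(\<Sum>e\<in>B. inner u0 e *\<^sub>R M z e) = M z u0" if "z \<in> V" for z
      by (rule finite_dimensional_expand[OF M(1)[OF that] B(2), symmetric])
    let ?y = "\<lambda>z. \<Sum>e\<in>B. inner u0 e *\<^sub>R M z e"
    have "((\<lambda>z. inner (?y z - ?y z0) f *\<^sub>R inv (M z) f) has_derivative (\<lambda>h. inner (y' h) f *\<^sub>R inv (M z0) f)) (at z0)" for f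
    proof (rule has_derivative_scaleR_zero[OF _ _ cont[OF z0]])
      have "((\<lambda>z. ?y z - ?y z0) has_derivative (\<lambda>h. y' h - 0)) (at z0)"
        by (intro has_derivative_diff y has_derivative_const)
      then show "((\<lambda>z. inner (?y z - ?y z0) f) has_derivative (\<lambda>h. inner (y' h) f)) (at z0)"
        by (intro has_derivative_inner_left) simp
    qed simp
    then have "((\<lambda>z. u0 - (\<Sum>f\<in>B. inner (?y z - ?y z0) f *\<^sub>R inv (M z) f)) has_derivative
        (\<lambda>h. 0 - (\<Sum>f\<in>B. inner (y' h) f *\<^sub>R inv (M z0) f))) (at z0)"
      by (intro has_derivative_diff has_derivative_const has_derivative_sum)
    \<comment> \<open>The resolvent identity writes \<open>?u z\<close> as \<open>u0\<close> minus
      the inverse of \<open>M z\<close> applied to \<open>M z u0 - M z0 u0\<close>. This difference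
      vanishes at \<open>z0\<close>, the case covered by
      \<open>has_derivative_scaleR_zero\<close>.\<close>
    then have "(?u has_derivative (\<lambda>h. 0 - (\<Sum>f\<in>B. inner (y' h) f *\<^sub>R inv (M z0) f))) (at z0)"
    proof (rule has_derivative_transform_within_open[OF _ V z0])
      fix z assume z: "z \<in> V"
      have lin: "linear (inv (M z))" by (rule linear_inv[OF M[OF z]])
      have "(\<Sum>f\<in>B. inner (?y z - ?y z0) f *\<^sub>R inv (M z) f) = inv (M z) (?y z - ?y z0)"
        by (rule finite_dimensional_expand[OF lin B(2), symmetric])
      also have "\<dots> = inv (M z) (M z u0) - inv (M z) (M z0 u0)"
        by (simp add: yM z z0 linear_diff[OF lin])
      also have "inv (M z) (M z u0) = u0" using M(2)[OF z] by (simp add: bij_is_inj)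
      also have "M z0 u0 = v" unfolding u0_def using M(2)[OF z0] by (simp add: bij_is_surj surj_f_inv_f)
      finally show "u0 - (\<Sum>f\<in>B. inner (?y z - ?y z0) f *\<^sub>R inv (M z) f) = ?u z" by simp
    qed
    then show "(?u has_derivative ?d z0) (at z0)" by (simp add: y'_def u0_def)
  next
    fix h
    have M'Ck: "Ck_on k V (\<lambda>z. M' e z h)" for e
      using Suc.prems[of e] by (simp add: M'_def)
    have "Ck_on k V (\<lambda>z. (-1) *\<^sub>R (\<Sum>f\<in>B. inner (\<Sum>e\<in>B. inner (?u z) e *\<^sub>R M' e z h) f *\<^sub>R inv (M z) f))"
      by (intro Ck_on_scaleR[OF V] Ck_on_sum[OF V] Ck_on_inner[OF V] Ck_on_const IH M'Ck)
    then show "Ck_on k V (\<lambda>z. ?d z h)" by simp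
  qed
qed

text \<open>After composition with the inverse of the derivative at \<open>p\<close>, the map
  differs from the identity by a map of Lipschitz constant 1/2 on a ball. This gives injectivity,
  solvability by the contraction principle and a Lipschitz inverse; smoothness follows by
  bootstrapping.\<close>

lemma inverse_function_theorem_smooth:
  fixes f :: "'a::real_inner \<Rightarrow> 'a"
  assumes fd: "finite_dimensional TYPE('a)" and W: "open W" "p \<in> W" and f: "smooth_on W f"
    and bij: "bij (frechet_derivative f (at p))"
  obtains U V g where "open U" "p \<in> U" "U \<subseteq> W" "open V" "f ` U = V" "\<And>x. x \<in> U \<Longrightarrow> g (f x) = x"
    "g ` V = U" "\<And>y. y \<in> V \<Longrightarrow> f (g y) = y" "smooth_on V g"
proof -
  let ?f' = "\<lambda>x. frechet_derivative f (at x)"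
  obtain B :: "'a set" where B: "finite B" "\<And>x. x = (\<Sum>e\<in>B. inner x e *\<^sub>R e)"
    "\<And>x y. \<lbrakk>x \<in> B; y \<in> B\<rbrakk> \<Longrightarrow> inner x y = (if x = y then 1 else 0)"
    using finite_dimensional_basis[OF fd] by metis
  have f': "(f has_derivative ?f' x) (at x)" if "x \<in> W" for x
    by (rule smooth_on_has_derivative[OF f that])
  have linf': "linear (?f' x)" if "x \<in> W" for x using f'[OF that] has_derivative_linear by blast
  define N where "N = inv (?f' p)"
  have linN: "linear N" unfolding N_def by (rule linear_inv[OF linf'[OF W(2)] bij])
  have bN: "bounded_linear N" by (rule finite_dimensional_linear_bounded[OF fd linN])
  have NM: "N (?f' p w) = w" for w unfolding N_def using bij by (simp add: bij_is_inj)
  have MN: "?f' p (N w) = w" for w unfolding N_def using bij by (simp add: bij_is_surj surj_f_inv_f)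
  have contf': "isCont (\<lambda>x. ?f' x w) x" if "x \<in> W" for x w
  proof -
    have "Ck_on (Suc 0) W f" using f unfolding smooth_on_def by blast
    then show ?thesis using W(1) that by (simp add: continuous_on_eq_continuous_at)
  qed
  have "((\<lambda>x. \<Sum>e\<in>B. norm (N (?f' x e) - e)) \<longlongrightarrow> (\<Sum>e\<in>B. norm (N (?f' p e) - e))) (at p)"
    using contf'[OF W(2)] unfolding isCont_def by (intro tendsto_intros bounded_linear.tendsto[OF bN])
  then have "((\<lambda>x. \<Sum>e\<in>B. norm (N (?f' x e) - e)) \<longlongrightarrow> 0) (at p)" by (simp add: NM)
  then have "\<forall>\<^sub>F x in at p. (\<Sum>e\<in>B. norm (N (?f' x e) - e)) < 1/2"
    by (rule order_tendstoD) simp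
  then obtain r1 where r1: "r1 > 0" "\<And>x. \<lbrakk>x \<noteq> p; dist x p < r1\<rbrakk> \<Longrightarrow> (\<Sum>e\<in>B. norm (N (?f' x e) - e)) < 1/2"
    unfolding eventually_at by auto
  obtain r2 where r2: "r2 > 0" "ball p r2 \<subseteq> W" using W open_contains_ball by blast
  \<comment> \<open>Half the minimum, so that the closed ball still lies inside both
    neighbourhoods.\<close>
  define r where "r = min r1 r2 / 2"
  have r: "r > 0" "cball p r \<subseteq> W" "r < r1"
    using r1(1) r2 unfolding r_def by (auto simp: subset_iff)
  have sum_small: "(\<Sum>e\<in>B. norm (N (?f' x e) - e)) \<le> 1/2" if "x \<in> cball p r" for x
    using r1(2)[of x] that r(3) by (cases "x = p") (auto simp: NM dist_commute less_imp_le)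
  have small: "norm (N (?f' x w) - w) \<le> norm w / 2" if x: "x \<in> cball p r" for x w
  proof -
    have linNM: "linear (\<lambda>w. N (?f' x w) - w)"
      using x r(2) by (intro linear_compose_sub linear_ident linear_compose[OF linf' linN, unfolded o_def]) auto
    have "N (?f' x w) - w = (\<Sum>e\<in>B. inner w e *\<^sub>R (N (?f' x e) - e))"
      by (rule finite_dimensional_expand[OF linNM B(2)])
    also have "norm \<dots> \<le> (\<Sum>e\<in>B. norm (inner w e *\<^sub>R (N (?f' x e) - e)))" by (rule norm_sum)
    also have "\<dots> \<le> (\<Sum>e\<in>B. norm w * norm (N (?f' x e) - e))"
    proof (rule sum_mono)
      fix e assume "e \<in> B"
      then have "norm e = 1" using B(3)[of e e] by (simp add: norm_eq_sqrt_inner)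
      then have "\<bar>inner w e\<bar> \<le> norm w" using Cauchy_Schwarz_ineq2[of w e] by simp
      then show "norm (inner w e *\<^sub>R (N (?f' x e) - e)) \<le> norm w * norm (N (?f' x e) - e)"
        by (simp add: mult_right_mono)
    qed
    also have "\<dots> = norm w * (\<Sum>e\<in>B. norm (N (?f' x e) - e))" by (simp add: sum_distrib_left)
    also have "\<dots> \<le> norm w * (1/2)" using sum_small[OF x] by (intro mult_left_mono) auto
    finally show ?thesis by simp
  qed
  define k where "k x = N (f x)" for x
  have k': "(k has_derivative (\<lambda>w. N (?f' x w))) (at x)" if "x \<in> W" for x
    unfolding k_def by (rule bounded_linear.has_derivative[OF bN f'[OF that]])
  have h': "((\<lambda>x. k x - x) has_derivative (\<lambda>w. N (?f' x w) - w)) (at x within cball p r)" if "x \<in> cball p r" for x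
  proof -
    have "x \<in> W" using that r(2) by blast
    show ?thesis
      by (rule has_derivative_at_withinI[OF has_derivative_diff[OF k'[OF \<open>x \<in> W\<close>] has_derivative_ident]])
  qed
  have onr: "onorm (\<lambda>w. N (?f' x w) - w) \<le> 1/2" if "x \<in> cball p r" for x
    using small[OF that] by (intro onorm_bound) auto
  have contr: "norm ((k x - x) - (k y - y)) \<le> (1/2) * norm (x - y)" if "x \<in> cball p r" "y \<in> cball p r" for x y
    by (rule differentiable_bound[OF convex_cball h' onr that])
  have lower: "norm (x - y) \<le> 2 * norm (k x - k y)" if "x \<in> cball p r" "y \<in> cball p r" for x y
  proof -
    have "norm (x - y) = norm ((k x - k y) - ((k x - x) - (k y - y)))" by simp
    also have "\<dots> \<le> norm (k x - k y) + norm ((k x - x) - (k y - y))" by (rule norm_triangle_ineq4)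
    finally show ?thesis using contr[OF that] by simp
  qed
  have solve: "\<exists>x\<in>ball p r. k x = y" if y: "y \<in> ball (k p) (r/2)" for y
  proof -
    \<comment> \<open>Fixed points solve \<open>k x = y\<close>. For \<open>y\<close> within
      \<open>r / 2\<close> of \<open>k p\<close> the map sends the closed ball into the open one, so
      the solution is interior.\<close>
    let ?\<phi> = "\<lambda>x. y - (k x - x)"
    have maps: "norm (?\<phi> x - p) < r" if x: "x \<in> cball p r" for x
    proof -
      have "?\<phi> x - p = (y - k p) - ((k x - x) - (k p - p))" by simp
      then have "norm (?\<phi> x - p) \<le> norm (y - k p) + norm ((k x - x) - (k p - p))"
        by (metis norm_triangle_ineq4)
      also have "norm ((k x - x) - (k p - p)) \<le> (1/2) * norm (x - p)"
        using r(1) by (intro contr x) auto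
      also have "norm (y - k p) < r / 2" using y by (simp add: dist_norm norm_minus_commute)
      also have "norm (x - p) \<le> r" using x by (simp add: dist_norm norm_minus_commute)
      finally show ?thesis by simp
    qed
    have "\<exists>!x\<in>cball p r. ?\<phi> x = x"
    proof (rule Banach_fix[where c = "1/2"])
      show "complete (cball p r)"
        by (rule compact_imp_complete[OF finite_dimensional_compact_cball[OF fd]])
      show "cball p r \<noteq> {}" using r(1) by auto
      show "?\<phi> ` cball p r \<subseteq> cball p r"
        using maps by (auto simp: dist_norm norm_minus_commute less_imp_le)
      show "dist (?\<phi> x) (?\<phi> z) \<le> (1/2) * dist x z" if "x \<in> cball p r" "z \<in> cball p r" for x z
      proof -
        have "dist (?\<phi> x) (?\<phi> z) = norm ((k z - z) - (k x - x))"
          unfolding dist_norm by (rule arg_cong[where f = norm]) simp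
        also have "\<dots> \<le> (1/2) * norm (z - x)" using that by (intro contr) auto
        finally show ?thesis by (simp add: dist_norm norm_minus_commute)
      qed
    qed auto
    then obtain x where x: "x \<in> cball p r" "?\<phi> x = x" by blast
    then have "x \<in> ball p r" using maps[OF x(1)] by (simp add: dist_norm norm_minus_commute)
    moreover have "k x = y" using x(2) by (simp add: algebra_simps)
    ultimately show ?thesis by blast
  qed
  \<comment> \<open>\<open>U\<close> is cut down by \<open>k\<close> so that \<open>f\<close> maps
    it exactly onto \<open>V\<close>.\<close>
  define U where "U = {x \<in> ball p r. k x \<in> ball (k p) (r/2)}"
  define V where "V = {z. N z \<in> ball (k p) (r/2)}"
  define g where "g z = (SOME x. x \<in> U \<and> k x = N z)" for z
  have UW: "U \<subseteq> W" "U \<subseteq> cball p r" using r(2) by (auto simp: U_def)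
  have contk: "continuous_on (ball p r) k"
  proof (intro continuous_at_imp_continuous_on ballI)
    fix x assume "x \<in> ball p r"
    then have "x \<in> W" using r(2) by auto
    from has_derivative_continuous[OF k'[OF this]] show "isCont k x" .
  qed
  have U: "open U"
  proof -
    have "U = ball p r \<inter> k -` ball (k p) (r/2)" by (auto simp: U_def)
    then show ?thesis using contk continuous_open_preimage[OF contk open_ball open_ball] by simp
  qed
  have V: "open V"
  proof -
    have "V = N -` ball (k p) (r/2)" by (auto simp: V_def)
    moreover have "continuous_on UNIV N" using bN linear_continuous_on by blast
    ultimately show ?thesis by (simp add: open_vimage)
  qed
  have gU: "g z \<in> U \<and> k (g z) = N z" if "z \<in> V" for z
  proof -
    obtain x where "x \<in> ball p r" "k x = N z" using solve \<open>z \<in> V\<close> unfolding V_def by blast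
    then have "x \<in> U \<and> k x = N z" using that by (auto simp: U_def V_def)
    then show ?thesis unfolding g_def by (rule someI)
  qed
  have injN: "N a = N b \<Longrightarrow> a = b" for a b by (metis MN)
  have fg: "f (g z) = z" if "z \<in> V" for z
    using gU[OF that] injN unfolding k_def by blast
  have fU: "f x \<in> V" if "x \<in> U" for x using that by (simp add: U_def V_def k_def)
  have gf: "g (f x) = x" if "x \<in> U" for x
  proof -
    have "k (g (f x)) = k x" "g (f x) \<in> U" using gU[OF fU[OF that]] by (auto simp: k_def)
    then have "norm (g (f x) - x) \<le> 2 * norm (k (g (f x)) - k x)"
      using UW(2) that by (intro lower) blast+
    then have "norm (g (f x) - x) \<le> 0" using \<open>k (g (f x)) = k x\<close> by simp
    then show ?thesis by simp
  qed
  have gcont: "continuous_on V g"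
  proof (rule continuous_onI)
    fix z and e :: real assume z: "z \<in> V" and e: "e > 0"
    obtain K where K: "K > 0" "\<And>w. norm (N w) \<le> norm w * K" using bounded_linear.pos_bounded[OF bN] by blast
    have "dist (g z') (g z) \<le> e" if z': "z' \<in> V" "dist z' z < e / (2 * K)" for z'
    proof -
      have "norm (g z' - g z) \<le> 2 * norm (N z' - N z)"
      proof -
        have "norm (g z' - g z) \<le> 2 * norm (k (g z') - k (g z))"
          using gU[OF z] gU[OF z'(1)] UW(2) by (intro lower) blast+
        then show ?thesis using gU[OF z] gU[OF z'(1)] by simp
      qed
      also have "N z' - N z = N (z' - z)" by (simp add: linear_diff[OF linN])
      also have "2 * norm (N (z' - z)) \<le> 2 * (norm (z' - z) * K)" using K(2) by simp
      also have "\<dots> \<le> 2 * (e / (2 * K) * K)"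
        using z'(2) K(1) by (intro mult_left_mono mult_right_mono) (auto simp: dist_norm)
      also have "\<dots> = e" using K(1) by simp
      finally show ?thesis by (simp add: dist_norm)
    qed
    then show "\<exists>d>0. \<forall>x'\<in>V. dist x' z < d \<longrightarrow> dist (g x') (g z) \<le> e"
      using e K(1) by (intro exI[of _ "e / (2 * K)"]) auto
  qed
  have bijf': "bij (?f' x)" if x: "x \<in> cball p r" for x
  proof -
    have lin: "linear (?f' x)" using linf' x r(2) by blast
    have "inj (?f' x)"
    proof (subst linear_injective_0[OF lin], intro allI impI)
      fix w assume "?f' x w = 0"
      then have "norm w \<le> norm w / 2" using small[OF x, of w] by (simp add: linear_0[OF linN])
      then show "w = 0" by simp
    qed
    then show ?thesis using finite_dimensional_inj_imp_surj[OF fd lin] by (simp add: bij_def)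
  qed
  have bijg: "bij (?f' (g z))" "linear (?f' (g z))" if "z \<in> V" for z
    using bijf' linf' gU[OF that] UW by auto
  have g': "(g has_derivative inv (?f' (g z))) (at z)" if z: "z \<in> V" for z
  proof (rule has_derivative_inverse_basic[where T = V and f = f])
    show "(f has_derivative ?f' (g z)) (at (g z))" using f' gU[OF z] UW by blast
    show "bounded_linear (inv (?f' (g z)))"
      by (intro finite_dimensional_linear_bounded[OF fd] linear_inv bijg z)
    show "inv (?f' (g z)) \<circ> ?f' (g z) = id" using bijg(1)[OF z] by (simp add: bij_is_inj)
    show "continuous (at z) g" using gcont V z by (simp add: continuous_on_eq_continuous_at)
  qed (use V z fg in auto)
  \<comment> \<open>The derivative of \<open>g\<close> at \<open>z\<close> is the inverse of the
    derivative of \<open>f\<close> at \<open>g z\<close>; it is of class C^j as soon as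
    \<open>g\<close> is.\<close>
  have "Ck_on j V g" for j
  proof (induction j)
    case 0 then show ?case using gcont by simp
  next
    case (Suc j)
    show ?case
    proof (rule Ck_on_SucI[OF V g'])
      fix v
      have "Ck_on j V (\<lambda>z. ?f' (g z) w)" for w
      proof (rule Ck_on_compose[OF fd V _ _ Suc])
        show "g ` V \<subseteq> W" using gU UW by blast
        show "Ck_on j W (\<lambda>x. ?f' x w)" using f unfolding smooth_on_def by (metis Ck_on.simps(2))
      qed
      then show "Ck_on j V (\<lambda>z. inv (?f' (g z)) v)"
        by (intro Ck_on_inverse_linear[OF fd V bijg(2) bijg(1)])
    qed
  qed
  then have sg: "smooth_on V g" by (simp add: smooth_on_def)
  have "p \<in> U" using r(1) by (simp add: U_def)
  moreover have "f ` U = V" using fU fg gU by (auto intro!: image_eqI)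
  moreover have "g ` V = U" using fU gf gU by (auto intro!: image_eqI)
  ultimately show thesis using that U V UW(1) gf fg sg by blast
qed

section \<open>Manifolds and submersions\<close>

lemma chart_facts:
  assumes "is_chart c"
  shows "open (fst c)" "open (snd c ` fst c)" "continuous_on (fst c) (snd c)"
    "continuous_on (snd c ` fst c) (chart_inv c)" "inj_on (snd c) (fst c)"
    "\<And>x. x \<in> fst c \<Longrightarrow> chart_inv c (snd c x) = x"
    "\<And>y. y \<in> snd c ` fst c \<Longrightarrow> snd c (chart_inv c y) = y"
    "\<And>y. y \<in> snd c ` fst c \<Longrightarrow> chart_inv c y \<in> fst c"
proof -
  have h: "homeomorphism (fst c) (snd c ` fst c) (snd c) (chart_inv c)"
    using assms by (simp add: is_chart_def)
  show "open (fst c)" "open (snd c ` fst c)" using assms by (simp_all add: is_chart_def)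
  show "continuous_on (fst c) (snd c)" "continuous_on (snd c ` fst c) (chart_inv c)"
    using h by (simp_all add: homeomorphism_def)
  show i: "\<And>x. x \<in> fst c \<Longrightarrow> chart_inv c (snd c x) = x"
    using h by (simp add: homeomorphism_def)
  show "inj_on (snd c) (fst c)" by (rule inj_on_inverseI[of "fst c" "chart_inv c"]) (rule i)
  show "\<And>y. y \<in> snd c ` fst c \<Longrightarrow> snd c (chart_inv c y) = y"
    "\<And>y. y \<in> snd c ` fst c \<Longrightarrow> chart_inv c y \<in> fst c" using i by auto
qed

lemma chart_image_open:
  assumes c: "is_chart c" and V: "open V"
  shows "open (snd c ` (fst c \<inter> V))"
proof -
  have "snd c ` (fst c \<inter> V) = snd c ` fst c \<inter> chart_inv c -` V"
    using chart_facts(6)[OF c] by auto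
  then show ?thesis
    using continuous_open_preimage[OF chart_facts(4)[OF c] chart_facts(2)[OF c] V] by simp
qed

lemma chart_mem_image:
  assumes c: "is_chart c"
  shows "y \<in> snd c ` (fst c \<inter> V) \<longleftrightarrow> y \<in> snd c ` fst c \<and> chart_inv c y \<in> V"
  using chart_facts(6)[OF c] by auto

text \<open>Second countability in the form used below: a sequence of indices rather than of sets,
  so that the data attached to the open sets, such as charts, cutoffs or trivialisations, come
  along.\<close>

lemma lindelof_sequence:
  fixes S :: "'a \<Rightarrow> 'm::second_countable_topology set"
  assumes "\<And>x. x \<in> W \<Longrightarrow> \<exists>a. P a \<and> open (S a) \<and> x \<in> S a" and ne: "W \<noteq> {}"
  shows "\<exists>f :: nat \<Rightarrow> 'a. (\<forall>n. P (f n) \<and> open (S (f n))) \<and> W \<subseteq> (\<Union>n. S (f n))"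
proof -
  define I where "I = {a. P a \<and> open (S a)}"
  have op: "open T" if "T \<in> S ` I" for T using that by (auto simp: I_def)
  obtain F where F: "F \<subseteq> S ` I" "countable F" "\<Union>F = \<Union>(S ` I)"
    by (rule Lindelof[OF op])
  have cov: "W \<subseteq> \<Union>F" unfolding F(3) using assms(1) by (auto simp: I_def)
  then have "F \<noteq> {}" using ne by auto
  define s where "s = from_nat_into F"
  have s: "range s = F" unfolding s_def by (rule range_from_nat_into[OF \<open>F \<noteq> {}\<close> F(2)])
  have "\<forall>n. \<exists>a. a \<in> I \<and> S a = s n" using F(1) s by blast
  then obtain f where f: "\<And>n. f n \<in> I \<and> S (f n) = s n" by metis
  have "W \<subseteq> (\<Union>n. S (f n))" using cov s f by auto
  moreover have "P (f n)" "open (S (f n))" for n using f[of n] by (auto simp: I_def)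
  ultimately show ?thesis by (intro exI[of _ f] conjI allI)
qed

locale manifold =
  fixes A :: "('m::{t2_space,second_countable_topology}, 'a::real_inner) chart set"
  assumes mfd: "smooth_manifold A"
begin

lemma fd: "finite_dimensional TYPE('a)"
  using mfd by (simp add: smooth_manifold_def)

lemma atlas_chart: "c \<in> A \<Longrightarrow> is_chart c"
  using mfd by (simp add: smooth_manifold_def smooth_atlas_def)

lemma atlas_compat: "c \<in> A \<Longrightarrow> d \<in> A \<Longrightarrow> smoothly_compatible c d"
  using mfd by (simp add: smooth_manifold_def smooth_atlas_def)

lemma atlas_cover: "\<exists>c\<in>A. x \<in> fst c"
proof -
  have "(\<Union>c\<in>A. fst c) = UNIV" using mfd by (simp add: smooth_manifold_def smooth_atlas_def)
  then show ?thesis by blast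
qed

lemma atlas_smooth_charts: "c \<in> A \<Longrightarrow> c \<in> smooth_charts A"
  by (simp add: smooth_charts_def atlas_chart atlas_compat)

lemma smooth_charts_chart: "c \<in> smooth_charts A \<Longrightarrow> is_chart c"
  by (simp add: smooth_charts_def)

text \<open>\<open>smooth_fun\<close> refers to the atlas only; the transition map to an atlas chart
  carries smoothness to every compatible chart, in particular to submersion charts.\<close>

lemma smooth_fun_chart:
  assumes f: "smooth_fun A W f" and W: "open W" and c: "c \<in> smooth_charts A"
  shows "smooth_on (snd c ` (fst c \<inter> W)) (f \<circ> chart_inv c)"
proof (rule smooth_on_local)
  fix y assume y: "y \<in> snd c ` (fst c \<inter> W)"
  have ic: "is_chart c" by (rule smooth_charts_chart[OF c])
  note cf = chart_facts[OF ic]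
  obtain d where d: "d \<in> A" "chart_inv c y \<in> fst d" using atlas_cover by blast
  have id: "is_chart d" by (rule atlas_chart[OF d(1)])
  note df = chart_facts[OF id]
  let ?N = "snd c ` (fst c \<inter> (fst d \<inter> W))"
  have N: "open ?N" by (rule chart_image_open[OF ic open_Int[OF df(1) W]])
  have yN: "y \<in> ?N" using y d(2) cf(6) by auto
  have comp: "smoothly_compatible c d" using c d(1) by (simp add: smooth_charts_def)
  have "smooth_on ?N (\<lambda>y. (f \<circ> chart_inv d) ((snd d \<circ> chart_inv c) y))"
  proof (rule smooth_on_compose[OF fd N])
    show "(snd d \<circ> chart_inv c) ` ?N \<subseteq> snd d ` (fst d \<inter> W)" using cf(6) by auto
    show "smooth_on (snd d ` (fst d \<inter> W)) (f \<circ> chart_inv d)" using f d(1) by (simp add: smooth_fun_def)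
    show "smooth_on ?N (snd d \<circ> chart_inv c)"
      using comp unfolding smoothly_compatible_def by (blast intro: smooth_on_subset)
  qed
  then have "smooth_on ?N (f \<circ> chart_inv c)"
    by (rule smooth_on_cong[OF N, rotated]) (use cf(6) df(6) in auto)
  then show "\<exists>N. open N \<and> y \<in> N \<and> smooth_on N (f \<circ> chart_inv c)" using N yN by blast
qed

lemma smooth_fun_chart_map: "d \<in> smooth_charts A \<Longrightarrow> smooth_fun A (fst d) (snd d)"
  unfolding smooth_fun_def smooth_charts_def smoothly_compatible_def
  by (auto simp: Int_commute)

lemma smooth_fun_continuous:
  assumes f: "smooth_fun A W f" and W: "open W"
  shows "continuous_on W f"
proof (intro continuous_at_imp_continuous_on ballI)
  fix x assume x: "x \<in> W"
  obtain d where d: "d \<in> A" "x \<in> fst d" using atlas_cover by blast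
  have id: "is_chart d" by (rule atlas_chart[OF d(1)])
  note df = chart_facts[OF id]
  have o: "open (fst d \<inter> W)" using df(1) W by blast
  have "continuous_on (snd d ` (fst d \<inter> W)) (f \<circ> chart_inv d)"
    using f d(1) unfolding smooth_fun_def by (blast intro: smooth_on_imp_continuous_on)
  moreover have "continuous_on (fst d \<inter> W) (snd d)" using df(3) by (rule continuous_on_subset) auto
  ultimately have "continuous_on (fst d \<inter> W) (\<lambda>x. (f \<circ> chart_inv d) (snd d x))"
    by (rule continuous_on_compose2) auto
  moreover have "(f \<circ> chart_inv d) (snd d x) = f x" if "x \<in> fst d \<inter> W" for x using df(6) that by simp
  ultimately have "continuous_on (fst d \<inter> W) f" by (metis (no_types, lifting) continuous_on_cong)
  then show "isCont f x" using o d(2) x by (simp add: continuous_on_eq_continuous_at)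
qed

lemma smooth_fun_subset: "smooth_fun A W f \<Longrightarrow> V \<subseteq> W \<Longrightarrow> smooth_fun A V f"
  unfolding smooth_fun_def by (meson Int_mono image_mono order_refl smooth_on_subset)

lemma smooth_fun_local:
  assumes "\<And>x. x \<in> W \<Longrightarrow> \<exists>N. open N \<and> x \<in> N \<and> smooth_fun A N f"
  shows "smooth_fun A W f"
  unfolding smooth_fun_def
proof (intro ballI smooth_on_local)
  fix c y assume c: "c \<in> A" and "y \<in> snd c ` (fst c \<inter> W)"
  then obtain x where x: "x \<in> fst c" "x \<in> W" "y = snd c x" by blast
  obtain N where N: "open N" "x \<in> N" "smooth_fun A N f" using assms[OF x(2)] by blast
  show "\<exists>N. open N \<and> y \<in> N \<and> smooth_on N (f \<circ> chart_inv c)"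
    using chart_image_open[OF atlas_chart[OF c] N(1)] N x c unfolding smooth_fun_def by blast
qed

lemma smooth_fun_Un:
  assumes "open V" "open W" "smooth_fun A V f" "smooth_fun A W f"
  shows "smooth_fun A (V \<union> W) f"
  by (rule smooth_fun_local) (use assms in blast)

lemma smooth_fun_cong:
  assumes W: "open W" and eq: "\<And>x. x \<in> W \<Longrightarrow> f x = g x" and f: "smooth_fun A W f"
  shows "smooth_fun A W g"
  unfolding smooth_fun_def
proof
  fix c assume c: "c \<in> A"
  show "smooth_on (snd c ` (fst c \<inter> W)) (g \<circ> chart_inv c)"
  proof (rule smooth_on_cong[OF chart_image_open[OF atlas_chart[OF c] W]])
    show "smooth_on (snd c ` (fst c \<inter> W)) (f \<circ> chart_inv c)" using f c by (simp add: smooth_fun_def)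
  qed (use eq chart_facts(6)[OF atlas_chart[OF c]] in auto)
qed

lemma smooth_fun_const: "smooth_fun A W (\<lambda>_. k)"
  by (simp add: smooth_fun_def o_def smooth_on_const)

lemma smooth_fun_bilinear:
  assumes "open W" "bounded_bilinear P" "smooth_fun A W f" "smooth_fun A W g"
  shows "smooth_fun A W (\<lambda>x. P (f x) (g x))"
  using assms smooth_on_bilinear[OF chart_image_open[OF atlas_chart assms(1)] assms(2)]
  unfolding smooth_fun_def o_def by blast

lemmas smooth_fun_mult = smooth_fun_bilinear[OF _ bounded_bilinear_mult]
lemmas smooth_fun_scaleR = smooth_fun_bilinear[OF _ bounded_bilinear_scaleR]

lemma smooth_fun_add:
  assumes "open W" "smooth_fun A W f" "smooth_fun A W g"
  shows "smooth_fun A W (\<lambda>x. f x + g x)"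
  using assms smooth_on_add[OF chart_image_open[OF atlas_chart assms(1)]]
  unfolding smooth_fun_def o_def by blast

lemma smooth_fun_linear:
  assumes "open W" "bounded_linear L" "smooth_fun A W f"
  shows "smooth_fun A W (\<lambda>x. L (f x))"
  using assms smooth_on_compose_linear[OF chart_image_open[OF atlas_chart assms(1)] assms(2)]
  unfolding smooth_fun_def o_def by blast

lemma smooth_fun_diff:
  assumes "open W" "smooth_fun A W f" "smooth_fun A W g"
  shows "smooth_fun A W (\<lambda>x. f x - g x)"
  using smooth_fun_add[OF assms(1,2) smooth_fun_linear[OF assms(1) bounded_linear_minus[OF bounded_linear_ident] assms(3)]]
  by simp

lemma smooth_fun_prod:
  fixes f :: "'i \<Rightarrow> 'm \<Rightarrow> real"
  assumes "open W" "\<And>i. i \<in> I \<Longrightarrow> smooth_fun A W (f i)"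
  shows "smooth_fun A W (\<lambda>x. \<Prod>i\<in>I. f i x)"
  using assms(2)
  by (induction I rule: infinite_finite_induct) (simp_all add: smooth_fun_const smooth_fun_mult[OF assms(1)])

lemma smooth_fun_compose:
  fixes f :: "'m \<Rightarrow> 'c::real_inner"
  assumes "finite_dimensional TYPE('c)" "open W" "f ` W \<subseteq> V" "smooth_on V h" "smooth_fun A W f"
  shows "smooth_fun A W (\<lambda>x. h (f x))"
  unfolding smooth_fun_def
proof
  fix c assume c: "c \<in> A"
  have "smooth_on (snd c ` (fst c \<inter> W)) (\<lambda>y. h ((f \<circ> chart_inv c) y))"
  proof (rule smooth_on_compose[OF assms(1) chart_image_open[OF atlas_chart[OF c] assms(2)] _ assms(4)])
    show "(f \<circ> chart_inv c) ` snd c ` (fst c \<inter> W) \<subseteq> V"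
      using chart_facts(6)[OF atlas_chart[OF c]] assms(3) by auto
    show "smooth_on (snd c ` (fst c \<inter> W)) (f \<circ> chart_inv c)" using assms(5) c by (simp add: smooth_fun_def)
  qed
  then show "smooth_on (snd c ` (fst c \<inter> W)) ((\<lambda>x. h (f x)) \<circ> chart_inv c)" by (simp add: o_def)
qed

section \<open>Smooth cutoff functions\<close>

definition bump :: "'m set \<Rightarrow> 'm set \<Rightarrow> ('m \<Rightarrow> real) \<Rightarrow> bool" where
  "bump W V \<eta> \<longleftrightarrow> smooth_fun A UNIV \<eta> \<and> (\<forall>z. 0 \<le> \<eta> z \<and> \<eta> z \<le> 1) \<and> open V \<and> (\<forall>z\<in>V. \<eta> z = 1) \<and>
    (\<exists>K. compact K \<and> K \<subseteq> W \<and> (\<forall>z. z \<notin> K \<longrightarrow> \<eta> z = 0))"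

lemma bumpD:
  assumes "bump W V \<eta>"
  shows "smooth_fun A UNIV \<eta>" "0 \<le> \<eta> z" "\<eta> z \<le> 1" "open V" "z \<in> V \<Longrightarrow> \<eta> z = 1" "z \<notin> W \<Longrightarrow> \<eta> z = 0"
    "\<exists>K. compact K \<and> K \<subseteq> W \<and> (\<forall>z. z \<notin> K \<longrightarrow> \<eta> z = 0)"
  using assms by (auto simp: bump_def)

lemma bump_mono:
  assumes "bump W V \<eta>" "W \<subseteq> W'"
  shows "bump W' V \<eta>"
proof -
  obtain K where K: "compact K" "K \<subseteq> W" "\<forall>z. z \<notin> K \<longrightarrow> \<eta> z = 0" using bumpD(7)[OF assms(1)] by blast
  then have "\<exists>K. compact K \<and> K \<subseteq> W' \<and> (\<forall>z. z \<notin> K \<longrightarrow> \<eta> z = 0)"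
    using assms(2) by (intro exI[of _ K]) simp
  then show ?thesis using assms(1) by (simp add: bump_def)
qed

text \<open>The cutoff is smooth on the chart domain and, being zero, on the complement of
  \<open>K\<close>. That complement is open because compact sets are closed in a Hausdorff space,
  and the two open sets cover the manifold.\<close>

lemma chart_bump:
  assumes c: "c \<in> smooth_charts A" and x: "x \<in> fst c" and W: "open W" "x \<in> W"
  shows "\<exists>V \<eta>. bump (fst c \<inter> W) V \<eta> \<and> x \<in> V"
proof -
  have ic: "is_chart c" by (rule smooth_charts_chart[OF c])
  note cf = chart_facts[OF ic]
  have o: "open (snd c ` (fst c \<inter> W))" by (rule chart_image_open[OF ic W(1)])
  obtain R where R: "R > 0" "cball (snd c x) R \<subseteq> snd c ` (fst c \<inter> W)"
    using open_contains_cball[THEN iffD1, OF o] x W(2) by blast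
  define r where "r = R / 2"
  have r: "r > 0" "2 * r = R" using R(1) by (simp_all add: r_def)
  obtain \<beta> :: "'a \<Rightarrow> real" where \<beta>: "smooth_on UNIV \<beta>" "\<And>y. 0 \<le> \<beta> y" "\<And>y. \<beta> y \<le> 1"
    "\<And>y. y \<in> ball (snd c x) r \<Longrightarrow> \<beta> y = 1" "\<And>y. \<beta> y \<noteq> 0 \<Longrightarrow> y \<in> cball (snd c x) R"
    using bump_function[OF r(1), of "snd c x"] unfolding r(2) by metis
  define \<eta> where "\<eta> z = (if z \<in> fst c then \<beta> (snd c z) else 0)" for z
  define K where "K = chart_inv c ` cball (snd c x) R"
  have sub: "cball (snd c x) R \<subseteq> snd c ` fst c" using R(2) by auto
  have K: "compact K" unfolding K_def
    by (rule compact_continuous_image[OF continuous_on_subset[OF cf(4) sub] finite_dimensional_compact_cball[OF fd]])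
  have KW: "K \<subseteq> fst c \<inter> W" unfolding K_def using R(2) cf(6) by auto
  have offK: "\<eta> z = 0" if "z \<notin> K" for z
  proof (rule ccontr)
    assume "\<eta> z \<noteq> 0"
    then have z: "z \<in> fst c" "\<beta> (snd c z) \<noteq> 0" by (auto simp: \<eta>_def split: if_splits)
    then have "snd c z \<in> cball (snd c x) R" using \<beta>(5) by blast
    then have "chart_inv c (snd c z) \<in> K" unfolding K_def by (rule imageI)
    then show False using that cf(6)[OF z(1)] by simp
  qed
  have "smooth_fun A (fst c) (\<lambda>z. \<beta> (snd c z))"
    by (rule smooth_fun_compose[OF fd cf(1) subset_UNIV \<beta>(1) smooth_fun_chart_map[OF c]])
  then have 1: "smooth_fun A (fst c) \<eta>"
    by (rule smooth_fun_cong[OF cf(1), rotated]) (simp add: \<eta>_def)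
  have oK: "open (- K)" using compact_imp_closed[OF K] by (simp add: open_Compl)
  have 2: "smooth_fun A (- K) \<eta>"
    by (rule smooth_fun_cong[OF oK _ smooth_fun_const[of _ 0]]) (simp add: offK)
  have "fst c \<union> - K = UNIV" using KW by auto
  then have s: "smooth_fun A UNIV \<eta>" using smooth_fun_Un[OF cf(1) oK 1 2] by simp
  define V where "V = fst c \<inter> snd c -` ball (snd c x) r"
  have oV: "open V" unfolding V_def by (rule continuous_open_preimage[OF cf(3) cf(1) open_ball])
  have "0 \<le> \<eta> z" "\<eta> z \<le> 1" for z using \<beta>(2,3) by (auto simp: \<eta>_def)
  moreover have "x \<in> V" using x r(1) by (simp add: V_def)
  moreover have "\<eta> z = 1" if "z \<in> V" for z using that \<beta>(4) by (simp add: V_def \<eta>_def)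
  ultimately show ?thesis unfolding bump_def using s oV K KW offK by blast
qed

lemma point_bump:
  assumes W: "open W" "x \<in> W"
  shows "\<exists>V \<eta>. bump W V \<eta> \<and> x \<in> V"
proof -
  obtain c where c: "c \<in> A" "x \<in> fst c" using atlas_cover by blast
  obtain V \<eta> where "bump (fst c \<inter> W) V \<eta>" "x \<in> V"
    using chart_bump[OF atlas_smooth_charts[OF c(1)] c(2) W] by blast
  then show ?thesis using bump_mono[OF _ Int_lower2] by blast
qed

lemma compact_bump:
  assumes K: "compact K" "K \<subseteq> W" and W: "open W"
  shows "\<exists>V \<eta>. bump W V \<eta> \<and> K \<subseteq> V"
proof -
  have "\<forall>x\<in>K. \<exists>p. bump W (fst p) (snd p) \<and> x \<in> fst p"
    using point_bump[OF W] K(2) by auto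
  then obtain p where p: "\<forall>x\<in>K. bump W (fst (p x)) (snd (p x)) \<and> x \<in> fst (p x)"
    unfolding bchoice_iff by (rule exE)
  have b: "bump W (fst (p x)) (snd (p x))" "x \<in> fst (p x)" if "x \<in> K" for x using p that by auto
  obtain I where I: "I \<subseteq> K" "finite I" "K \<subseteq> (\<Union>x\<in>I. fst (p x))"
    by (rule compactE_image[OF K(1), of K "\<lambda>x. fst (p x)"])
      (auto intro: bumpD(4)[OF b(1)] b(2))
  have bI: "bump W (fst (p x)) (snd (p x))" if "x \<in> I" for x using b(1) that I(1) by blast
  have "\<forall>x\<in>I. \<exists>L. compact L \<and> L \<subseteq> W \<and> (\<forall>z. z \<notin> L \<longrightarrow> snd (p x) z = 0)"
    using bumpD(7)[OF bI] by blast
  then obtain L where L: "\<forall>x\<in>I. compact (L x) \<and> L x \<subseteq> W \<and> (\<forall>z. z \<notin> L x \<longrightarrow> snd (p x) z = 0)"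
    unfolding bchoice_iff by (rule exE)
  \<comment> \<open>Equal to 1 as soon as one of the cutoffs is, and to 0 when all of them
    are.\<close>
  define \<eta> where "\<eta> z = 1 - (\<Prod>x\<in>I. 1 - snd (p x) z)" for z
  have "smooth_fun A UNIV \<eta>" unfolding \<eta>_def
    by (intro smooth_fun_diff[OF open_UNIV] smooth_fun_prod[OF open_UNIV] smooth_fun_const bumpD(1)[OF bI])
  moreover have "0 \<le> \<eta> z \<and> \<eta> z \<le> 1" for z
  proof -
    have "0 \<le> (\<Prod>x\<in>I. 1 - snd (p x) z)" "(\<Prod>x\<in>I. 1 - snd (p x) z) \<le> 1"
      using bumpD(2,3)[OF bI] by (auto intro!: prod_nonneg prod_le_1)
    then show ?thesis by (simp add: \<eta>_def)
  qed
  moreover have "open (\<Union>x\<in>I. fst (p x))" using bumpD(4)[OF bI] by blast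
  moreover have "\<eta> z = 1" if z: "z \<in> (\<Union>x\<in>I. fst (p x))" for z
  proof -
    obtain x where x: "x \<in> I" "z \<in> fst (p x)" using z by blast
    then have "snd (p x) z = 1" using bumpD(5)[OF bI] by blast
    then have "(\<Prod>x\<in>I. 1 - snd (p x) z) = 0" using x(1) I(2) by (intro prod_zero bexI[of _ x]) auto
    then show ?thesis by (simp add: \<eta>_def)
  qed
  moreover have "compact (\<Union>x\<in>I. L x)" using I(2) L by (intro compact_UN) auto
  moreover have "(\<Union>x\<in>I. L x) \<subseteq> W" using L by blast
  moreover have "\<eta> z = 0" if z: "z \<notin> (\<Union>x\<in>I. L x)" for z
  proof -
    have "snd (p x) z = 0" if "x \<in> I" for x using z L that by blast
    then show ?thesis by (simp add: \<eta>_def)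
  qed
  ultimately have "bump W (\<Union>x\<in>I. fst (p x)) \<eta>" unfolding bump_def by blast
  with I(3) show ?thesis by blast
qed

text \<open>Lets integrals over open sets be obtained from integrals against smooth functions, by
  dominated convergence.\<close>

lemma open_set_indicator_limit:
  assumes W: "open W"
  shows "\<exists>\<eta> :: nat \<Rightarrow> 'm \<Rightarrow> real. \<forall>n. smooth_fun A UNIV (\<eta> n) \<and> (\<forall>z. 0 \<le> \<eta> n z \<and> \<eta> n z \<le> 1 \<and>
    (\<lambda>n. \<eta> n z) \<longlonglongrightarrow> indicator W z)"
proof (cases "W = {}")
  case True
  then show ?thesis by (intro exI[of _ "\<lambda>_ _. 0"]) (simp add: smooth_fun_const)
next
  case False
  have ex: "\<exists>p. bump W (fst p) (snd p) \<and> open (fst p) \<and> x \<in> fst p" if "x \<in> W" for x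
    using point_bump[OF W that] bumpD(4) by auto
  obtain p :: "nat \<Rightarrow> 'm set \<times> ('m \<Rightarrow> real)" where
    "(\<forall>n. bump W (fst (p n)) (snd (p n)) \<and> open (fst (p n))) \<and> W \<subseteq> (\<Union>n. fst (p n))"
    using lindelof_sequence[where S=fst and P="\<lambda>p. bump W (fst p) (snd p)", OF ex False] by (rule exE)
  then have p: "\<And>n. bump W (fst (p n)) (snd (p n))" "\<And>n. open (fst (p n))"
    "W \<subseteq> (\<Union>n. fst (p n))" by simp_all
  define \<eta> where "\<eta> n z = 1 - (\<Prod>k<n. 1 - snd (p k) z)" for n :: nat and z
  have "smooth_fun A UNIV (\<eta> n)" for n unfolding \<eta>_def
    by (intro smooth_fun_diff[OF open_UNIV] smooth_fun_prod[OF open_UNIV] smooth_fun_const bumpD(1)[OF p(1)])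
  moreover have "0 \<le> \<eta> n z \<and> \<eta> n z \<le> 1" for n z
  proof -
    have "0 \<le> (\<Prod>k<n. 1 - snd (p k) z)" "(\<Prod>k<n. 1 - snd (p k) z) \<le> 1"
      using bumpD(2,3)[OF p(1)] by (auto intro!: prod_nonneg prod_le_1)
    then show ?thesis by (simp add: \<eta>_def)
  qed
  moreover have "(\<lambda>n. \<eta> n z) \<longlonglongrightarrow> indicator W z" for z
  proof (cases "z \<in> W")
    case True
    then obtain k where k: "z \<in> fst (p k)" using p(3) by blast
    have "\<eta> n z = 1" if "n \<ge> Suc k" for n
    proof -
      have "snd (p k) z = 1" using bumpD(5)[OF p(1) k] .
      then have "(\<Prod>k<n. 1 - snd (p k) z) = 0" using that by (intro prod_zero bexI[of _ k]) auto
      then show ?thesis by (simp add: \<eta>_def)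
    qed
    then have "\<forall>\<^sub>F n in sequentially. \<eta> n z = 1" by (rule eventually_sequentiallyI)
    then show ?thesis using True by (simp add: tendsto_eventually)
  next
    case False
    then have "\<eta> n z = 0" for n using bumpD(6)[OF p(1)] by (simp add: \<eta>_def)
    then show ?thesis using False by simp
  qed
  ultimately show ?thesis by blast
qed

end

lemma smooth_map_compose:
  fixes A :: "('m::{t2_space,second_countable_topology}, 'a::real_inner) chart set"
    and A' :: "('b::{t2_space,second_countable_topology}, 'e::real_inner) chart set"
  assumes M: "smooth_manifold A" and B: "smooth_manifold A'" and \<pi>: "smooth_map A A' \<pi>"
    and W: "open W" and h: "smooth_fun A' W h"
  shows "smooth_fun A (\<pi> -` W) (\<lambda>x. h (\<pi> x))"
  unfolding smooth_fun_def
proof (intro ballI smooth_on_local)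
  interpret M: manifold A by unfold_locales (rule M)
  interpret B: manifold A' by unfold_locales (rule B)
  fix c y assume c: "c \<in> A" and "y \<in> snd c ` (fst c \<inter> \<pi> -` W)"
  then obtain x where x: "x \<in> fst c" "\<pi> x \<in> W" "y = snd c x" by blast
  have ic: "is_chart c" by (rule M.atlas_chart[OF c])
  note cf = chart_facts[OF ic]
  obtain d where d: "d \<in> A'" "\<pi> x \<in> fst d" using B.atlas_cover by blast
  note df = chart_facts[OF B.atlas_chart[OF d(1)]]
  have cont: "continuous_on UNIV \<pi>" using \<pi> by (simp add: smooth_map_def)
  let ?N = "snd c ` (fst c \<inter> \<pi> -` (fst d \<inter> W))"
  have "open (\<pi> -` (fst d \<inter> W))" using cont df(1) W by (intro open_vimage) auto
  then have N: "open ?N" by (rule chart_image_open[OF ic])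
  have "smooth_on ?N (\<lambda>y. (h \<circ> chart_inv d) ((snd d \<circ> \<pi> \<circ> chart_inv c) y))"
  proof (rule smooth_on_compose[OF B.fd N])
    show "(snd d \<circ> \<pi> \<circ> chart_inv c) ` ?N \<subseteq> snd d ` (fst d \<inter> W)" using cf(6) by auto
    show "smooth_on (snd d ` (fst d \<inter> W)) (h \<circ> chart_inv d)" using h d(1) by (simp add: smooth_fun_def)
    have "smooth_on (snd c ` (fst c \<inter> \<pi> -` fst d)) (snd d \<circ> \<pi> \<circ> chart_inv c)"
      using \<pi> c d(1) by (simp add: smooth_map_def)
    then show "smooth_on ?N (snd d \<circ> \<pi> \<circ> chart_inv c)" by (rule smooth_on_subset) auto
  qed
  then have "smooth_on ?N ((\<lambda>x. h (\<pi> x)) \<circ> chart_inv c)"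
    by (rule smooth_on_cong[OF N, rotated]) (use cf(6) df(6) in auto)
  moreover have "y \<in> ?N" using x d(2) by auto
  ultimately show "\<exists>N. open N \<and> y \<in> N \<and> smooth_on N ((\<lambda>x. h (\<pi> x)) \<circ> chart_inv c)" using N by blast
qed

text \<open>\<open>L\<close> has to identify the kernel of \<open>Q\<close> with \<open>'f\<close>.
  Instead of computing dimensions, a basis of one is injected into a basis of the other, in
  whichever direction the cardinalities allow; the resulting injective endomorphism of the product
  is bijective.\<close>

lemma linear_complement_iso:
  fixes Q :: "'f::real_inner \<times> 'e::real_inner \<Rightarrow> 'e"
  assumes fdp: "finite_dimensional TYPE('f \<times> 'e)" and Q: "linear Q" "surj Q"
  shows "\<exists>L :: 'f \<times> 'e \<Rightarrow> 'f. linear L \<and> bij (\<lambda>z. (L z, Q z))"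
proof -
  obtain S :: "('f \<times> 'e) set" where S: "finite S" "span S = UNIV"
    using fdp by (auto simp: finite_dimensional_def)
  obtain S' :: "'f set" where S': "finite S'" "span S' = UNIV"
    using finite_dimensional_prodD(1)[OF fdp] by (auto simp: finite_dimensional_def)
  obtain r where r: "linear r" "Q \<circ> r = id" using linear_surjective_right_inverse[OF Q] by blast
  have Qr: "Q (r e) = e" for e using r(2) by (metis comp_apply id_apply)
  define ker where "ker = {z. Q z = 0}"
  have sub: "subspace ker" unfolding ker_def by (rule linear_subspace_kernel[OF Q(1)])
  obtain K where K: "K \<subseteq> ker" "independent K" "ker \<subseteq> span K" by (rule maximal_independent_subset)
  have spanK: "span K = ker" using K sub by (meson span_minimal subset_antisym)
  obtain F :: "'f set" where F: "independent F" "UNIV \<subseteq> span F" by (rule maximal_independent_subset[of UNIV])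
  have fin: "finite K" "finite F"
    using independent_span_bound[OF S(1) K(2)] independent_span_bound[OF S'(1) F(1)] S(2) S'(2) by auto
  define Pk where "Pk z = z - r (Q z)" for z
  have linPk: "linear Pk"
    unfolding Pk_def by (intro linear_compose_sub linear_ident linear_compose[OF Q(1) r(1), unfolded o_def])
  have Pk: "Pk z \<in> ker" for z unfolding Pk_def ker_def by (simp add: linear_diff[OF Q(1)] Qr)
  have linpair: "linear (\<lambda>z. (L z, M z))" if "linear L" "linear M" for L :: "'f \<times> 'e \<Rightarrow> 'f" and M :: "'f \<times> 'e \<Rightarrow> 'e"
    using that by (intro linearI) (simp_all add: linear_add linear_scale)
  show ?thesis
  proof (cases "card K \<le> card F")
    case True
    obtain j where j: "j ` K \<subseteq> F" "inj_on j K" using card_le_inj[OF fin True] by blast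
    obtain T where T: "linear T" "\<forall>x\<in>K. T x = j x" using linear_independent_extend[OF K(2)] by blast
    have im: "T ` K = j ` K" "inj_on T K" using T(2) j(2) by (auto simp: inj_on_def image_iff)
    have "independent (T ` K)" unfolding im(1) using F(1) j(1) independent_mono by blast
    then have injT: "inj_on T (span K)" by (rule linear_inj_on_span_independent_image[OF T(1) _ im(2)])
    define \<Phi> where "\<Phi> z = (T (Pk z), Q z)" for z
    have lin: "linear \<Phi>" unfolding \<Phi>_def
      by (rule linpair[OF linear_compose[OF linPk T(1), unfolded o_def] Q(1)])
    have "inj \<Phi>"
    proof (subst linear_injective_0[OF lin], intro allI impI)
      fix z assume "\<Phi> z = 0"
      then have z: "T (Pk z) = 0" "Q z = 0" by (simp_all add: \<Phi>_def zero_prod_def)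
      then have "Pk z = z" by (simp add: Pk_def linear_0[OF r(1)])
      moreover have "0 \<in> ker" by (simp add: ker_def linear_0[OF Q(1)])
      then have "Pk z = 0"
        using injT[THEN inj_onD, of "Pk z" 0] z(1) Pk[of z] spanK by (simp add: linear_0[OF T(1)] span_zero)
      ultimately show "z = 0" by simp
    qed
    then have "bij \<Phi>" using finite_dimensional_inj_imp_surj[OF fdp lin] by (simp add: bij_def)
    moreover have "linear (\<lambda>z. T (Pk z))" by (rule linear_compose[OF linPk T(1), unfolded o_def])
    ultimately show ?thesis unfolding \<Phi>_def by blast
  next
    case False
    then have "card F \<le> card K" by simp
    obtain j where j: "j ` F \<subseteq> K" "inj_on j F" using card_le_inj[OF fin(2,1) \<open>card F \<le> card K\<close>] by blast
    obtain J where J: "linear J" "\<forall>x\<in>F. J x = j x" using linear_independent_extend[OF F(1)] by blast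
    have im: "J ` F = j ` F" "inj_on J F" using J(2) j(2) by (auto simp: inj_on_def image_iff)
    have "independent (J ` F)" unfolding im(1) using K(2) j(1) independent_mono by blast
    then have "inj_on J (span F)" by (rule linear_inj_on_span_independent_image[OF J(1) _ im(2)])
    then have injJ: "inj J" using F(2) by (simp add: top.extremum_unique)
    have "J ` span F = span (J ` F)" by (rule linear_span_image[OF J(1), symmetric])
    also have "\<dots> \<subseteq> span K" unfolding im(1) by (rule span_mono[OF j(1)])
    finally have QJ: "Q (J a) = 0" for a using F(2) spanK by (auto simp: ker_def)
    define \<Psi> where "\<Psi> z = J (fst z) + r (snd z)" for z
    have lin: "linear \<Psi>" unfolding \<Psi>_def
      by (intro linear_compose_add linear_compose[OF linear_fst J(1), unfolded o_def]
          linear_compose[OF linear_snd r(1), unfolded o_def])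
    have Q\<Psi>: "Q (\<Psi> z) = snd z" for z unfolding \<Psi>_def by (simp add: linear_add[OF Q(1)] QJ Qr)
    have "inj \<Psi>"
    proof (subst linear_injective_0[OF lin], intro allI impI)
      fix z assume z: "\<Psi> z = 0"
      then have s: "snd z = 0" using Q\<Psi>[of z] by (simp add: linear_0[OF Q(1)])
      then have "J (fst z) = 0" using z by (simp add: \<Psi>_def linear_0[OF r(1)])
      then have "fst z = 0" using injJ linear_injective_0[OF J(1)] by blast
      then show "z = 0" using s by (simp add: prod_eq_iff)
    qed
    then have bij: "bij \<Psi>" using finite_dimensional_inj_imp_surj[OF fdp lin] by (simp add: bij_def)
    have lini: "linear (inv \<Psi>)" by (rule linear_inv[OF lin bij])
    have "snd (inv \<Psi> z) = Q z" for z
      using Q\<Psi>[of "inv \<Psi> z"] bij by (simp add: bij_is_surj surj_f_inv_f)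
    then have "(\<lambda>z. (fst (inv \<Psi> z), Q z)) = inv \<Psi>" by (simp add: prod_eq_iff fun_eq_iff)
    then have "bij (\<lambda>z. (fst (inv \<Psi> z), Q z))" using bij by (simp add: bij_imp_bij_inv)
    moreover have "linear (\<lambda>z. fst (inv \<Psi> z))" by (rule linear_compose[OF lini linear_fst, unfolded o_def])
    ultimately show ?thesis by blast
  qed
qed

section \<open>Submersions in charts\<close>

locale smooth_submersion = M: manifold A + B: manifold A'
  for A :: "('m::{t2_space,second_countable_topology}, 'f::real_inner \<times> 'e::real_inner) chart set"
    and A' :: "('b::{t2_space,second_countable_topology}, 'e) chart set" +
  fixes \<pi> :: "'m \<Rightarrow> 'b"
  assumes sub: "submersion A A' \<pi>"
begin

lemma smooth_pi: "smooth_map A A' \<pi>"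
  using sub by (simp add: submersion_def)

lemma continuous_pi: "continuous_on UNIV \<pi>"
  using smooth_pi by (simp add: smooth_map_def)

lemma open_preimage: "open W \<Longrightarrow> open (\<pi> -` W)"
  using continuous_pi by (simp add: open_vimage)

lemma smooth_compose_pi: "open W \<Longrightarrow> smooth_fun A' W h \<Longrightarrow> smooth_fun A (\<pi> -` W) (\<lambda>x. h (\<pi> x))"
  by (rule smooth_map_compose[OF M.mfd B.mfd smooth_pi])

lemma smooth_local_pi:
  assumes "c \<in> A" "d \<in> smooth_charts A'"
  shows "smooth_on (snd c ` (fst c \<inter> \<pi> -` fst d)) (\<lambda>y. snd d (\<pi> (chart_inv c y)))"
  using smooth_compose_pi[OF _ B.smooth_fun_chart_map[OF assms(2)]] assms(1)
    chart_facts(1)[OF B.smooth_charts_chart[OF assms(2)]]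
  unfolding smooth_fun_def o_def by blast

text \<open>Tangent functionals see only globally smooth functions, so a linear coordinate is
  multiplied by a cutoff; its germ at \<open>b\<close> is what matters. Values in any normed space
  are allowed because \<open>D_vertical\<close> uses complex ones.\<close>

lemma base_function:
  assumes d: "d \<in> smooth_charts A'" "b \<in> fst d" and L: "bounded_linear (L :: 'e \<Rightarrow> 'c::real_normed_vector)"
  obtains h where "smooth_fun A' UNIV h" "h b = 0"
    "\<exists>V. open V \<and> b \<in> V \<and> V \<subseteq> fst d \<and> (\<forall>z\<in>V. h z = L (snd d z - snd d b))"
proof -
  note df = chart_facts[OF B.smooth_charts_chart[OF d(1)]]
  obtain V \<eta> where V: "B.bump (fst d) V \<eta>" "b \<in> V" using B.point_bump[OF df(1) d(2)] by blast
  obtain K where K: "compact K" "K \<subseteq> fst d" "\<forall>z. z \<notin> K \<longrightarrow> \<eta> z = 0" using B.bumpD(7)[OF V(1)] by blast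
  define h where "h z = \<eta> z *\<^sub>R L (snd d z - snd d b)" for z
  have "smooth_fun A' (fst d) h" unfolding h_def
    by (intro B.smooth_fun_scaleR[OF df(1)] B.smooth_fun_linear[OF df(1) L] B.smooth_fun_diff[OF df(1)]
        B.smooth_fun_const B.smooth_fun_chart_map[OF d(1)] B.smooth_fun_subset[OF B.bumpD(1)[OF V(1)] subset_UNIV])
  moreover have oK: "open (- K)" using compact_imp_closed[OF K(1)] by (simp add: open_Compl)
  moreover have "smooth_fun A' (- K) h"
    by (rule B.smooth_fun_cong[OF oK _ B.smooth_fun_const[of _ 0]]) (use K(3) in \<open>simp add: h_def\<close>)
  moreover have "fst d \<union> - K = UNIV" using K(2) by auto
  ultimately have 1: "smooth_fun A' UNIV h" using B.smooth_fun_Un[OF df(1) oK] by metis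
  have "V \<subseteq> fst d"
  proof
    fix z assume "z \<in> V"
    then have "\<eta> z = 1" using B.bumpD(5)[OF V(1)] by blast
    then show "z \<in> fst d" using K(2,3) by (metis subsetD zero_neq_one)
  qed
  moreover have "h z = L (snd d z - snd d b)" if "z \<in> V" for z
    using B.bumpD(5)[OF V(1) that] by (simp add: h_def)
  ultimately have 2: "\<exists>V. open V \<and> b \<in> V \<and> V \<subseteq> fst d \<and> (\<forall>z\<in>V. h z = L (snd d z - snd d b))"
    using V(2) B.bumpD(4)[OF V(1)] by blast
  have "h b = 0" by (simp add: h_def linear_0[OF bounded_linear.linear[OF L]])
  with 1 2 show thesis using that by blast
qed

text \<open>\<open>submersion\<close> speaks of functionals on smooth functions. A vector
  \<open>w\<close> is lifted as such a functional and recovered by applying both sides to functions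
  whose germs are \<open>inner w'\<close> in the chart; the lift may be given in another chart
  \<open>c'\<close>, whence the chain rule at the end.\<close>

lemma surj_derivative:
  assumes c: "c \<in> A" "x \<in> fst c" and d: "d \<in> A'" "\<pi> x \<in> fst d"
  shows "surj (frechet_derivative (\<lambda>y. snd d (\<pi> (chart_inv c y))) (at (snd c x)))"
proof -
  have ds: "d \<in> smooth_charts A'" by (rule B.atlas_smooth_charts[OF d(1)])
  note df = chart_facts[OF B.atlas_chart[OF d(1)]]
  let ?P = "\<lambda>c y. snd d (\<pi> (chart_inv c y))"
  have P: "(?P c has_derivative frechet_derivative (?P c) (at (snd c x))) (at (snd c x))"
    if "c \<in> A" "x \<in> fst c" for c
    by (rule smooth_on_has_derivative[OF smooth_local_pi[OF that(1) ds]]) (use that d(2) in blast)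
  have "\<exists>v. w = frechet_derivative (?P c) (at (snd c x)) v" for w
  proof -
    have "tangent_vector A' d (\<pi> x) w \<in> tangent_space A' (\<pi> x)"
      using d unfolding tangent_space_def by blast
    then obtain Y where Y: "Y \<in> tangent_space A x" "tangent_vector A' d (\<pi> x) w = differential A' \<pi> Y"
      using sub unfolding submersion_def by blast
    obtain c' v where c': "c' \<in> A" "x \<in> fst c'" "Y = tangent_vector A c' x v"
      using Y(1) unfolding tangent_space_def by blast
    note cf' = chart_facts[OF M.atlas_chart[OF c'(1)]]
    have key: "inner w' w = inner w' (frechet_derivative (?P c') (at (snd c' x)) v)" for w'
    proof -
      obtain h where h: "smooth_fun A' UNIV h" "h (\<pi> x) = 0"
        "\<exists>V. open V \<and> \<pi> x \<in> V \<and> V \<subseteq> fst d \<and> (\<forall>z\<in>V. h z = inner w' (snd d z - snd d (\<pi> x)))"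
        using base_function[OF ds d(2) bounded_linear_inner_right[of w']] by metis
      obtain V where V: "open V" "\<pi> x \<in> V" "V \<subseteq> fst d" "\<And>z. z \<in> V \<Longrightarrow> h z = inner w' (snd d z - snd d (\<pi> x))"
        using h(3) by blast
      have hp: "smooth_fun A UNIV (h \<circ> \<pi>)" using smooth_compose_pi[OF open_UNIV h(1)] by (simp add: o_def)
      have "tangent_vector A' d (\<pi> x) w h = frechet_derivative (h \<circ> chart_inv d) (at (snd d (\<pi> x))) w"
        using h(1) by (simp add: tangent_vector_def)
      also have "\<dots> = inner w' w"
      proof -
        have o: "open (snd d ` (fst d \<inter> V))" by (rule chart_image_open[OF B.atlas_chart[OF d(1)] V(1)])
        have "((\<lambda>y. inner w' (y - snd d (\<pi> x))) has_derivative (\<lambda>v. inner w' (v - 0))) (at (snd d (\<pi> x)))"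
          by (intro has_derivative_inner_right has_derivative_diff has_derivative_ident has_derivative_const)
        then have "((h \<circ> chart_inv d) has_derivative (\<lambda>v. inner w' (v - 0))) (at (snd d (\<pi> x)))"
          by (rule has_derivative_transform_within_open[OF _ o]) (use V d(2) df(6) in auto)
        from frechet_derivative_at[OF this, symmetric] show ?thesis by simp
      qed
      finally have e1: "tangent_vector A' d (\<pi> x) w h = inner w' w" .
      have "differential A' \<pi> Y h = frechet_derivative (h \<circ> \<pi> \<circ> chart_inv c') (at (snd c' x)) v"
        using h(1) hp by (simp add: differential_def c'(3) tangent_vector_def)
      also have "\<dots> = inner w' (frechet_derivative (?P c') (at (snd c' x)) v)"
      proof -
        have o: "open (snd c' ` (fst c' \<inter> \<pi> -` V))"
          by (rule chart_image_open[OF M.atlas_chart[OF c'(1)] open_preimage[OF V(1)]])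
        have "((\<lambda>y. inner w' (?P c' y - snd d (\<pi> x))) has_derivative
            (\<lambda>v. inner w' (frechet_derivative (?P c') (at (snd c' x)) v - 0))) (at (snd c' x))"
          by (intro has_derivative_inner_right has_derivative_diff P[OF c'(1,2)] has_derivative_const)
        then have "((h \<circ> \<pi> \<circ> chart_inv c') has_derivative
            (\<lambda>v. inner w' (frechet_derivative (?P c') (at (snd c' x)) v - 0))) (at (snd c' x))"
          by (rule has_derivative_transform_within_open[OF _ o]) (use V c'(2) cf'(6) in auto)
        from frechet_derivative_at[OF this, symmetric] show ?thesis by simp
      qed
      finally show ?thesis using e1 Y(2) by simp
    qed
    have "w = frechet_derivative (?P c') (at (snd c' x)) v"
      by (rule vector_eq_ldot[THEN iffD1]) (use key in blast)
    also have "\<dots> = frechet_derivative (?P c) (at (snd c x)) (frechet_derivative (snd c \<circ> chart_inv c') (at (snd c' x)) v)"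
    proof -
      note cf = chart_facts[OF M.atlas_chart[OF c(1)]]
      have "smooth_on (snd c' ` (fst c' \<inter> fst c)) (snd c \<circ> chart_inv c')"
        using M.atlas_compat[OF c'(1) c(1)] by (simp add: smoothly_compatible_def)
      then have T: "((snd c \<circ> chart_inv c') has_derivative frechet_derivative (snd c \<circ> chart_inv c') (at (snd c' x))) (at (snd c' x))"
        by (rule smooth_on_has_derivative) (use c c' in blast)
      have "((\<lambda>y. ?P c ((snd c \<circ> chart_inv c') y)) has_derivative (\<lambda>v. frechet_derivative (?P c) (at (snd c x))
          (frechet_derivative (snd c \<circ> chart_inv c') (at (snd c' x)) v))) (at (snd c' x))"
        by (rule has_derivative_compose[OF T]) (use P[OF c] c' cf'(6) in simp)
      then have "(?P c' has_derivative (\<lambda>v. frechet_derivative (?P c) (at (snd c x))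
          (frechet_derivative (snd c \<circ> chart_inv c') (at (snd c' x)) v))) (at (snd c' x))"
        by (rule has_derivative_transform_within_open[OF _ chart_image_open[OF M.atlas_chart[OF c'(1)] cf(1)]])
          (use c c' cf'(6) cf(6) in auto)
      then show ?thesis using frechet_derivative_at by metis
    qed
    finally show ?thesis by blast
  qed
  then show ?thesis by blast
qed

text \<open>The local form \<open>P\<close> of \<open>\<pi>\<close> is completed by a linear map
  \<open>L\<close> to a map with bijective derivative. By the inverse function theorem this map,
  composed with the chart \<open>c\<close>, is again a chart, and its second component is
  \<open>\<pi>\<close> in the chart \<open>d\<close>.\<close>

lemma submersion_chart_exists: "\<exists>c\<in>submersion_charts A A' \<pi>. x \<in> fst c"
proof -
  obtain c where c: "c \<in> A" "x \<in> fst c" using M.atlas_cover by blast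
  obtain d where d: "d \<in> A'" "\<pi> x \<in> fst d" using B.atlas_cover by blast
  have ic: "is_chart c" by (rule M.atlas_chart[OF c(1)])
  note cf = chart_facts[OF ic]
  have ds: "d \<in> smooth_charts A'" by (rule B.atlas_smooth_charts[OF d(1)])
  note df = chart_facts[OF B.atlas_chart[OF d(1)]]
  define P where "P y = snd d (\<pi> (chart_inv c y))" for y
  define O' where "O' = snd c ` (fst c \<inter> \<pi> -` fst d)"
  define p where "p = snd c x"
  have O': "open O'" "p \<in> O'" unfolding O'_def p_def
    using chart_image_open[OF ic open_preimage[OF df(1)]] c d by auto
  have smP: "smooth_on O' P" unfolding O'_def P_def by (rule smooth_local_pi[OF c(1) ds])
  have Pd: "(P has_derivative frechet_derivative P (at p)) (at p)"
    by (rule smooth_on_has_derivative[OF smP O'(2)])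
  have "surj (frechet_derivative P (at p))"
    unfolding P_def[abs_def] p_def by (rule surj_derivative[OF c d])
  then obtain L :: "'f \<times> 'e \<Rightarrow> 'f" where L: "linear L" "bij (\<lambda>z. (L z, frechet_derivative P (at p) z))"
    using linear_complement_iso[OF M.fd has_derivative_linear[OF Pd]] by blast
  have bL: "bounded_linear L" by (rule finite_dimensional_linear_bounded[OF M.fd L(1)])
  define \<Phi> where "\<Phi> z = (L z, P z)" for z
  have sm\<Phi>: "smooth_on O' \<Phi>" unfolding \<Phi>_def by (intro smooth_on_Pair O' smooth_on_linear bL smP)
  have "(\<Phi> has_derivative (\<lambda>z. (L z, frechet_derivative P (at p) z))) (at p)"
    unfolding \<Phi>_def by (intro has_derivative_Pair bounded_linear_imp_has_derivative bL Pd)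
  then have "frechet_derivative \<Phi> (at p) = (\<lambda>z. (L z, frechet_derivative P (at p) z))"
    using frechet_derivative_at by metis
  then have bij: "bij (frechet_derivative \<Phi> (at p))" using L(2) by simp
  obtain U V g where U: "open U" "p \<in> U" "U \<subseteq> O'" and V: "open V" "\<Phi> ` U = V"
    and g: "\<And>x. x \<in> U \<Longrightarrow> g (\<Phi> x) = x" "g ` V = U" "\<And>y. y \<in> V \<Longrightarrow> \<Phi> (g y) = y" "smooth_on V g"
    using inverse_function_theorem_smooth[OF M.fd O' sm\<Phi> bij] by metis
  \<comment> \<open>The chart domain is shrunk to where \<open>\<Phi>\<close> is invertible.\<close>
  define W where "W = fst c \<inter> snd c -` U"
  define c' where "c' = (W, \<Phi> \<circ> snd c)"
  have W: "open W" unfolding W_def by (rule continuous_open_preimage[OF cf(3,1) U(1)])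
  have Uc: "U \<subseteq> snd c ` fst c" using U(3) unfolding O'_def by blast
  have imW: "snd c ` W = U" unfolding W_def using Uc cf(6) by auto
  have im: "(\<Phi> \<circ> snd c) ` W = V" unfolding image_comp[symmetric] imW V(2) ..
  have inv: "chart_inv c' y = chart_inv c (g y)" if y: "y \<in> V" for y
  proof -
    have gy: "g y \<in> U" using g(2) y by blast
    have gyc: "g y \<in> snd c ` fst c" using gy Uc by blast
    have i1: "chart_inv c (g y) \<in> W" unfolding W_def using gy cf(7)[OF gyc] cf(8)[OF gyc] by simp
    have i2: "(\<Phi> \<circ> snd c) (chart_inv c (g y)) = y" using cf(7)[OF gyc] g(3)[OF y] by simp
    have i3: "inj_on (\<Phi> \<circ> snd c) W"
    proof (rule comp_inj_on)
      show "inj_on (snd c) W" using cf(5) unfolding W_def by (rule inj_on_subset) auto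
      show "inj_on \<Phi> (snd c ` W)" unfolding imW by (rule inj_on_inverseI[of _ g]) (rule g(1))
    qed
    have "chart_inv c' y = inv_into W (\<Phi> \<circ> snd c) y" by (simp add: chart_inv_def c'_def)
    also have "\<dots> = chart_inv c (g y)" by (rule inv_into_f_eq[OF i3 i1 i2])
    finally show ?thesis .
  qed
  have contU: "continuous_on U \<Phi>" using smooth_on_imp_continuous_on[OF sm\<Phi>] U(3) by (rule continuous_on_subset)
  have contg: "continuous_on V g" by (rule smooth_on_imp_continuous_on[OF g(4)])
  have cW: "continuous_on W (snd c)" using cf(3) unfolding W_def by (rule continuous_on_subset) auto
  have gW: "g ` V \<subseteq> snd c ` fst c" using g(2) Uc by simp
  have "is_chart c'"
    unfolding is_chart_def c'_def fst_conv snd_conv im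
  proof (intro conjI W V(1), fold c'_def)
    show "homeomorphism W V (\<Phi> \<circ> snd c) (chart_inv c')"
      unfolding homeomorphism_def
    proof (intro conjI ballI)
      show "continuous_on W (\<Phi> \<circ> snd c)"
        by (rule continuous_on_compose[OF cW]) (simp add: imW contU)
      have "continuous_on V (\<lambda>y. chart_inv c (g y))" by (rule continuous_on_compose2[OF cf(4) contg gW])
      then show "continuous_on V (chart_inv c')" by (subst continuous_on_cong[OF refl inv])
      show "chart_inv c' ((\<Phi> \<circ> snd c) z) = z" if "z \<in> W" for z
      proof -
        have "snd c z \<in> U" "z \<in> fst c" using that by (auto simp: W_def)
        then show ?thesis using inv[of "\<Phi> (snd c z)"] V(2) g(1) cf(6) by auto
      qed
      then show "chart_inv c' ` V = W" unfolding im[symmetric] by force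
      show "(\<Phi> \<circ> snd c) ` W = V" by (rule im)
      show "(\<Phi> \<circ> snd c) (chart_inv c' y) = y" if "y \<in> V" for y
      proof -
        have "g y \<in> snd c ` fst c" using gW that by blast
        then show ?thesis using inv[OF that] g(3)[OF that] cf(7) by simp
      qed
    qed
  qed
  note c'f = chart_facts[OF this]
  have compat: "smoothly_compatible c' d'" if d': "d' \<in> A" for d'
    unfolding smoothly_compatible_def
  proof
    have id': "is_chart d'" by (rule M.atlas_chart[OF d'])
    note d'f = chart_facts[OF id']
    have cd: "smoothly_compatible c d'" by (rule M.atlas_compat[OF c(1) d'])
    have o1: "open (snd c' ` (fst c' \<inter> fst d'))"
      by (rule chart_image_open[OF \<open>is_chart c'\<close> d'f(1)])
    have sV: "snd c' ` (fst c' \<inter> fst d') \<subseteq> V" using im by (auto simp: c'_def)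
    have "smooth_on (snd c' ` (fst c' \<inter> fst d')) (\<lambda>y. (snd d' \<circ> chart_inv c) (g y))"
    proof (rule smooth_on_compose[OF M.fd o1, where f="snd d' \<circ> chart_inv c" and g=g])
      show "g ` snd c' ` (fst c' \<inter> fst d') \<subseteq> snd c ` (fst c \<inter> fst d')"
      proof (rule image_subsetI)
        fix y assume "y \<in> snd c' ` (fst c' \<inter> fst d')"
        then obtain z where z: "z \<in> fst c'" "z \<in> fst d'" "y = snd c' z" by blast
        have zU: "snd c z \<in> U" "z \<in> fst c" using z(1) by (simp_all add: c'_def W_def)
        have "g y = snd c z" using g(1)[OF zU(1)] z(3) by (simp add: c'_def)
        then show "g y \<in> snd c ` (fst c \<inter> fst d')" using zU(2) z(2) by blast
      qed
      show "smooth_on (snd c ` (fst c \<inter> fst d')) (snd d' \<circ> chart_inv c)"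
        using cd by (simp add: smoothly_compatible_def)
      show "smooth_on (snd c' ` (fst c' \<inter> fst d')) g" by (rule smooth_on_subset[OF g(4) sV])
    qed
    then show "smooth_on (snd c' ` (fst c' \<inter> fst d')) (snd d' \<circ> chart_inv c')"
      by (rule smooth_on_cong[OF o1, rotated]) (simp only: o_apply inv[OF subsetD[OF sV]])
    have o2: "open (snd d' ` (fst c' \<inter> fst d'))"
      using chart_image_open[OF id' c'f(1)] by (simp add: Int_commute)
    have "smooth_on (snd d' ` (fst c' \<inter> fst d')) (\<lambda>y. \<Phi> ((snd c \<circ> chart_inv d') y))"
    proof (rule smooth_on_compose[OF M.fd o2 _ sm\<Phi>, where g="snd c \<circ> chart_inv d'"])
      show "(snd c \<circ> chart_inv d') ` snd d' ` (fst c' \<inter> fst d') \<subseteq> O'"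
        using d'f(6) U(3) by (auto simp: c'_def W_def)
      have "smooth_on (snd d' ` (fst c \<inter> fst d')) (snd c \<circ> chart_inv d')"
        using cd by (simp add: smoothly_compatible_def)
      then show "smooth_on (snd d' ` (fst c' \<inter> fst d')) (snd c \<circ> chart_inv d')"
        by (rule smooth_on_subset) (auto simp: c'_def W_def)
    qed
    then show "smooth_on (snd d' ` (fst c' \<inter> fst d')) (snd c' \<circ> chart_inv d')"
      by (simp add: c'_def o_def)
  qed
  have "c' \<in> smooth_charts A" using \<open>is_chart c'\<close> compat by (simp add: smooth_charts_def)
  moreover have "\<pi> ` fst c' \<subseteq> fst d"
  proof clarify
    fix z assume "z \<in> fst c'"
    then have z: "z \<in> fst c" "snd c z \<in> O'" using U(3) by (auto simp: c'_def W_def)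
    then obtain z' where "z' \<in> fst c" "\<pi> z' \<in> fst d" "snd c z = snd c z'" unfolding O'_def by auto
    then show "\<pi> z \<in> fst d" using cf(6) z(1) by metis
  qed
  moreover have "snd (snd c' z) = snd d (\<pi> z)" if "z \<in> fst c'" for z
    using that cf(6) by (simp add: c'_def \<Phi>_def P_def W_def)
  ultimately have "c' \<in> submersion_charts A A' \<pi>" unfolding submersion_charts_def using ds by blast
  moreover have "x \<in> fst c'" using c(2) U(2) by (simp add: c'_def W_def p_def)
  ultimately show ?thesis by blast
qed

lemma submersion_chartD:
  assumes "c \<in> submersion_charts A A' \<pi>"
  shows "c \<in> smooth_charts A" "is_chart c"
    "\<exists>d\<in>smooth_charts A'. \<pi> ` fst c \<subseteq> fst d \<and> (\<forall>x\<in>fst c. snd (snd c x) = snd d (\<pi> x))"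
  using assms M.smooth_charts_chart by (auto simp: submersion_charts_def)

text \<open>The products telescope, so the functions add up to 1 without being normalised; on
  \<open>V k\<close> every term after the \<open>k\<close>-th vanishes, which gives local
  finiteness.\<close>

lemma chart_partition_exists: "\<exists>P. chart_partition A A' \<pi> P"
proof -
  define S :: "(('m, 'f \<times> 'e) chart \<times> ('m \<Rightarrow> real)) \<times> 'm set \<Rightarrow> 'm set" where "S = snd"
  define R where "R p \<longleftrightarrow> fst (fst p) \<in> submersion_charts A A' \<pi> \<and> M.bump (fst (fst (fst p))) (snd p) (snd (fst p))"
    for p :: "(('m, 'f \<times> 'e) chart \<times> ('m \<Rightarrow> real)) \<times> 'm set"
  have ex: "\<exists>p. R p \<and> open (S p) \<and> x \<in> S p" if "x \<in> UNIV" for x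
  proof -
    obtain c where c: "c \<in> submersion_charts A A' \<pi>" "x \<in> fst c" using submersion_chart_exists by blast
    note cs = submersion_chartD[OF c(1)]
    obtain V \<eta> where V: "M.bump (fst c) V \<eta>" "x \<in> V"
      using M.point_bump[OF chart_facts(1)[OF cs(2)] c(2)] by blast
    then have "R ((c, \<eta>), V)" using c by (simp add: R_def)
    then show ?thesis using V(2) M.bumpD(4)[OF V(1)] by (intro exI[of _ "((c, \<eta>), V)"]) (simp add: S_def)
  qed
  obtain p where "(\<forall>n::nat. R (p n) \<and> open (S (p n))) \<and> UNIV \<subseteq> (\<Union>n. S (p n))"
    using lindelof_sequence[where S=S and P=R, OF ex UNIV_not_empty] by (rule exE)
  then have p: "\<And>n. R (p n)" "\<And>n. open (S (p n))" "UNIV \<subseteq> (\<Union>n. S (p n))" by simp_all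
  define c where "c n = fst (fst (p n))" for n :: nat
  define h where "h n = snd (fst (p n))" for n :: nat
  define V where "V n = snd (p n)" for n :: nat
  define \<rho> where "\<rho> n x = h n x * (\<Prod>k<n. 1 - h k x)" for n x
  have c: "c n \<in> submersion_charts A A' \<pi>" and h: "M.bump (fst (c n)) (V n) (h n)" for n
    using p(1)[of n] by (simp_all add: R_def c_def h_def V_def)
  have cov: "\<exists>n. x \<in> V n" for x using p(3) by (auto simp: S_def V_def)
  have zero: "\<rho> n x = 0" if "x \<in> V k" "k < n" for n k x
  proof -
    have "h k x = 1" using M.bumpD(5)[OF h that(1)] .
    then have "(\<Prod>k<n. 1 - h k x) = 0" using that(2) by (intro prod_zero bexI[of _ k]) auto
    then show ?thesis by (simp add: \<rho>_def)
  qed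
  have sum: "(\<Sum>n<N. \<rho> n x) = 1 - (\<Prod>k<N. 1 - h k x)" for N x
    by (induction N) (simp_all add: \<rho>_def algebra_simps)
  have "chart_partition A A' \<pi> (c, \<rho>)"
    unfolding chart_partition_def prod.case
  proof (intro conjI allI)
    fix n
    show "c n \<in> submersion_charts A A' \<pi>" by (rule c)
    show "smooth_fun A UNIV (\<rho> n)" unfolding \<rho>_def
      by (intro M.smooth_fun_mult[OF open_UNIV] M.smooth_fun_prod[OF open_UNIV] M.smooth_fun_diff[OF open_UNIV]
          M.smooth_fun_const M.bumpD(1)[OF h])
    show "0 \<le> \<rho> n x" for x unfolding \<rho>_def
      using M.bumpD(2,3)[OF h] by (intro mult_nonneg_nonneg prod_nonneg) auto
    obtain K where K: "compact K" "K \<subseteq> fst (c n)" "\<forall>z. z \<notin> K \<longrightarrow> h n z = 0" using M.bumpD(7)[OF h] by blast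
    have "{x. \<rho> n x \<noteq> 0} \<subseteq> K" using K(3) by (auto simp: \<rho>_def)
    then have "closure {x. \<rho> n x \<noteq> 0} \<subseteq> K" by (rule closure_minimal[OF _ compact_imp_closed[OF K(1)]])
    then show "closure {x. \<rho> n x \<noteq> 0} \<subseteq> fst (c n)" using K(2) by blast
  next
    fix x
    obtain k where k: "x \<in> V k" using cov by blast
    have "{n. \<exists>y\<in>V k. \<rho> n y \<noteq> 0} \<subseteq> {..k}" using zero by (force simp: not_less[symmetric])
    then have "finite {n. \<exists>y\<in>V k. \<rho> n y \<noteq> 0}" by (rule finite_subset) simp
    then show "\<exists>W. open W \<and> x \<in> W \<and> finite {n. \<exists>y\<in>W. \<rho> n y \<noteq> 0}"
      using k M.bumpD(4)[OF h] by blast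
    have "(\<Prod>k<Suc k. 1 - h k x) = 0"
      using M.bumpD(5)[OF h k] by (intro prod_zero bexI[of _ k]) auto
    then have "(\<Sum>n<Suc k. \<rho> n x) = 1" unfolding sum by simp
    moreover have "(\<Sum>n. \<rho> n x) = (\<Sum>n<Suc k. \<rho> n x)"
      by (rule suminf_finite) (use zero[OF k] in auto)
    ultimately show "(\<Sum>n. \<rho> n x) = 1" by simp
  qed
  then show ?thesis by blast
qed

end

section \<open>Integration along the fibres\<close>

lemma orthonormal_enum:
  assumes fd: "finite_dimensional TYPE('f::real_inner)"
    and ij: "i < dim (UNIV :: 'f set)" "j < dim (UNIV :: 'f set)"
  shows "inner (orthonormal_enum i :: 'f) (orthonormal_enum j) = (if i = j then 1 else 0)"
proof -
  obtain B :: "'f set" where B: "finite B" "\<And>x y. \<lbrakk>x \<in> B; y \<in> B\<rbrakk> \<Longrightarrow> inner x y = (if x = y then 1 else 0)"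
    "\<And>x. x = (\<Sum>e\<in>B. inner x e *\<^sub>R e)"
    using finite_dimensional_basis[OF fd] by metis
  have "independent B"
  proof (rule pairwise_orthogonal_independent)
    show "pairwise orthogonal B" using B(2) by (auto simp: pairwise_def orthogonal_def)
    show "0 \<notin> B" using B(2)[of 0 0] by auto
  qed
  moreover have "x \<in> span B" for x
    by (subst B(3)[of x]) (intro span_sum span_scale span_base)
  then have "span B = span UNIV" by auto
  ultimately have d: "dim (UNIV :: 'f set) = card B" by (rule dim_eq_card[rotated])
  obtain h where h: "bij_betw h {0..<card B} B" using ex_bij_betw_nat_finite[OF B(1)] by blast
  have h1: "\<forall>i<dim (UNIV::'f set). \<forall>j<dim (UNIV::'f set). inner (h i) (h j) = (if i = j then 1 else 0)"
  proof (intro allI impI)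
    fix i j assume "i < dim (UNIV::'f set)" "j < dim (UNIV::'f set)"
    then have "h i \<in> B" "h j \<in> B" "h i = h j \<longleftrightarrow> i = j"
      using h unfolding d bij_betw_def by (auto dest: inj_onD)
    then show "inner (h i) (h j) = (if i = j then 1 else 0)" using B(2) by simp
  qed
  then have "\<exists>e :: nat \<Rightarrow> 'f. \<forall>i<dim (UNIV::'f set). \<forall>j<dim (UNIV::'f set).
      inner (e i) (e j) = (if i = j then 1 else 0)" by (rule exI[of _ h])
  from someI_ex[OF this] have "\<forall>i<dim (UNIV::'f set). \<forall>j<dim (UNIV::'f set).
      inner (orthonormal_enum i :: 'f) (orthonormal_enum j) = (if i = j then 1 else 0)"
    unfolding orthonormal_enum_def .
  then show ?thesis using ij by blast
qed

section \<open>Lebesgue measure on the model of the fibre\<close>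

lemma sets_model_lebesgue [simp, measurable_cong]: "sets model_lebesgue = sets borel"
  by (simp add: model_lebesgue_def)

lemma space_model_lebesgue [simp]: "space model_lebesgue = UNIV"
  by (simp add: model_lebesgue_def)

lemma coordinate_sum_measurable:
  fixes e :: "nat \<Rightarrow> 'f::real_normed_vector"
  shows "(\<lambda>t. \<Sum>i<d. t i *\<^sub>R e i) \<in> borel_measurable (Pi\<^sub>M {..<d} (\<lambda>_. lborel))"
proof -
  \<comment> \<open>Extension by zero replaces the finite product by the product over all naturals,
    whose product sigma-algebra is the Borel one, so that continuity gives measurability.\<close>
  let ?E = "\<lambda>t i. if i < d then t i else (0::real)"
  have 1: "?E \<in> measurable (Pi\<^sub>M {..<d} (\<lambda>_. lborel)) (Pi\<^sub>M UNIV (\<lambda>_. borel))"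
  proof (rule measurable_PiM_single')
    fix i :: nat
    show "(\<lambda>t. ?E t i) \<in> borel_measurable (Pi\<^sub>M {..<d} (\<lambda>_. lborel))"
    proof (cases "i < d")
      case True
      then have "(\<lambda>t. t i) \<in> measurable (Pi\<^sub>M {..<d} (\<lambda>_. lborel)) lborel"
        by (intro measurable_component_singleton) simp
      then show ?thesis using True by simp
    qed simp
  qed auto
  have "?E \<in> borel_measurable (Pi\<^sub>M {..<d} (\<lambda>_. lborel))"
    using 1 measurable_cong_sets[OF refl sets_PiM_equal_borel] by blast
  moreover have "(\<lambda>x. \<Sum>i<d. x i *\<^sub>R e i) \<in> borel_measurable (borel :: (nat \<Rightarrow> real) measure)"
    by (intro borel_measurable_continuous_onI continuous_intros continuous_on_product_coordinates)
  ultimately have "(\<lambda>t. \<Sum>i<d. ?E t i *\<^sub>R e i) \<in> borel_measurable (Pi\<^sub>M {..<d} (\<lambda>_. lborel))"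
    by (rule measurable_compose)
  then show ?thesis by simp
qed

text \<open>The coordinates of a ball with respect to an orthonormal basis lie in a cube.\<close>

lemma emeasure_model_lebesgue_cball:
  assumes fd: "finite_dimensional TYPE('f::real_inner)"
  shows "emeasure (model_lebesgue :: 'f measure) (cball 0 r) < \<infinity>"
proof -
  let ?d = "dim (UNIV :: 'f set)"
  let ?T = "\<lambda>t. \<Sum>i<?d. t i *\<^sub>R (orthonormal_enum i :: 'f)"
  let ?P = "Pi\<^sub>M {..<?d} (\<lambda>_. lborel :: real measure)"
  interpret product_sigma_finite "\<lambda>_. lborel :: real measure" by standard
  have "emeasure (model_lebesgue :: 'f measure) (cball 0 r) = emeasure ?P (?T -` cball 0 r \<inter> space ?P)"
    unfolding model_lebesgue_def by (rule emeasure_distr[OF coordinate_sum_measurable]) simp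
  also have "\<dots> \<le> emeasure ?P (Pi\<^sub>E {..<?d} (\<lambda>_. {-r..r}))"
  proof (rule emeasure_mono)
    show "?T -` cball 0 r \<inter> space ?P \<subseteq> Pi\<^sub>E {..<?d} (\<lambda>_. {-r..r})"
    proof
      fix t assume t: "t \<in> ?T -` cball 0 r \<inter> space ?P"
      have "\<bar>t i\<bar> \<le> r" if i: "i < ?d" for i
      proof -
        have "inner (?T t) (orthonormal_enum i) = (\<Sum>j<?d. if j = i then t i else 0)"
          unfolding inner_sum_left using orthonormal_enum[OF fd _ i] by (intro sum.cong) auto
        then have "t i = inner (?T t) (orthonormal_enum i)" using i by simp
        moreover have "norm (orthonormal_enum i :: 'f) = 1"
          using orthonormal_enum[OF fd i i] by (simp add: norm_eq_sqrt_inner)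
        ultimately have "\<bar>t i\<bar> \<le> norm (?T t)" using Cauchy_Schwarz_ineq2[of "?T t" "orthonormal_enum i"] by simp
        then show ?thesis using t by simp
      qed
      then show "t \<in> Pi\<^sub>E {..<?d} (\<lambda>_. {-r..r})" using t by (auto simp: space_PiM PiE_def Pi_def abs_le_iff minus_le_iff)
    qed
  qed (rule sets_PiM_I_finite, auto)
  also have "\<dots> = (\<Prod>i<?d. emeasure lborel {-r..r})"
    by (rule emeasure_PiM) auto
  also have "\<dots> < \<infinity>"
    by (cases "-r \<le> r") (auto simp: emeasure_lborel_Icc ennreal_power power_less_top_ennreal)
  finally show ?thesis .
qed

text \<open>Dominated convergence: \<open>F\<close> is bounded with compact support, so all its
  slices are dominated by a constant times the indicator of one ball.\<close>

lemma parameter_integral: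
  fixes F :: "'f::real_inner \<times> 'e::real_inner \<Rightarrow> real"
  assumes fd: "finite_dimensional TYPE('f)" and F: "continuous_on UNIV F" "\<And>z. 0 \<le> F z"
    and P: "compact P" "\<And>z. z \<notin> P \<Longrightarrow> F z = 0"
  shows "continuous_on UNIV (\<lambda>e. \<integral>y. F (y, e) \<partial>model_lebesgue)"
    and "(\<integral>\<^sup>+y. ennreal (F (y, e)) \<partial>model_lebesgue) = ennreal (\<integral>y. F (y, e) \<partial>model_lebesgue)"
    and "0 \<le> (\<integral>y. F (y, e) \<partial>model_lebesgue)"
proof -
  have "bounded (F ` P)"
    by (rule compact_imp_bounded[OF compact_continuous_image[OF continuous_on_subset[OF F(1) subset_UNIV] P(1)]])
  then obtain C0 where C0: "\<And>z. z \<in> P \<Longrightarrow> norm (F z) \<le> C0" by (auto simp: bounded_iff)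
  define C where "C = max C0 0"
  have C: "norm (F z) \<le> C" for z using C0[of z] P(2)[of z] by (cases "z \<in> P") (auto simp: C_def)
  have "bounded (fst ` P)"
    by (rule compact_imp_bounded[OF compact_continuous_image[OF _ P(1)]]) (intro continuous_intros)
  then obtain r where r: "\<And>z. z \<in> P \<Longrightarrow> norm (fst z) \<le> r" by (auto simp: bounded_iff)
  have bound: "norm (F (y, e)) \<le> C * indicator (cball 0 r) y" for y e
    using C[of "(y, e)"] P(2)[of "(y, e)"] r[of "(y, e)"] by (cases "(y, e) \<in> P") (auto simp: indicator_def C_def)
  have meas: "(\<lambda>y. F (y, e)) \<in> borel_measurable (model_lebesgue :: 'f measure)" for e
  proof -
    have "continuous_on UNIV (\<lambda>y. F (y, e))"
      by (rule continuous_on_compose2[OF F(1)]) (auto intro!: continuous_intros)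
    then have "(\<lambda>y. F (y, e)) \<in> borel_measurable borel" by (rule borel_measurable_continuous_onI)
    then show ?thesis using measurable_cong_sets[OF sets_model_lebesgue refl] by blast
  qed
  have ind: "integrable (model_lebesgue :: 'f measure) (\<lambda>y. C * indicator (cball 0 r) y)"
    using emeasure_model_lebesgue_cball[OF fd, of r]
    by (intro integrable_mult_right integrable_real_indicator) auto
  have int: "integrable (model_lebesgue :: 'f measure) (\<lambda>y. F (y, e))" for e
    by (rule Bochner_Integration.integrable_bound[OF ind meas]) (use bound[of _ e] in \<open>auto intro!: AE_I2 simp: C_def indicator_def\<close>)
  show "(\<integral>\<^sup>+y. ennreal (F (y, e)) \<partial>model_lebesgue) = ennreal (\<integral>y. F (y, e) \<partial>model_lebesgue)"
    by (rule nn_integral_eq_integral[OF int]) (simp add: F)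
  show "0 \<le> (\<integral>y. F (y, e) \<partial>model_lebesgue)" by (rule Bochner_Integration.integral_nonneg) (rule F(2))
  show "continuous_on UNIV (\<lambda>e. \<integral>y. F (y, e) \<partial>model_lebesgue)"
  proof (rule continuous_on_sequentiallyI)
    fix u :: "nat \<Rightarrow> 'e" and e assume u: "u \<longlonglongrightarrow> e"
    show "(\<lambda>n. \<integral>y. F (y, u n) \<partial>model_lebesgue) \<longlonglongrightarrow> (\<integral>y. F (y, e) \<partial>model_lebesgue)"
    proof (rule integral_dominated_convergence[OF meas meas ind])
      show "AE y in model_lebesgue. (\<lambda>n. F (y, u n)) \<longlonglongrightarrow> F (y, e)"
      proof (rule AE_I2)
        fix y :: 'f
        have "isCont F (y, e)" using F(1) by (simp add: continuous_on_eq_continuous_at)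
        moreover have "(\<lambda>n. (y, u n)) \<longlonglongrightarrow> (y, e)" by (intro tendsto_Pair tendsto_const u)
        ultimately show "(\<lambda>n. F (y, u n)) \<longlonglongrightarrow> F (y, e)" by (rule isCont_tendsto_compose)
      qed
      show "AE y in model_lebesgue. norm (F (y, u n)) \<le> C * indicator (cball 0 r) y" for n
        by (rule AE_I2) (rule bound)
    qed
  qed
qed

lemma suminf_swap_ennreal:
  fixes f :: "nat \<Rightarrow> nat \<Rightarrow> ennreal"
  shows "(\<Sum>i. \<Sum>n. f i n) = (\<Sum>n. \<Sum>i. f i n)"
  using nn_integral_suminf[of f "count_space UNIV"] by (simp add: nn_integral_count_space_nat)

lemma suminf_SUP_ennreal:
  fixes f :: "nat \<Rightarrow> nat \<Rightarrow> ennreal"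
  assumes "incseq f"
  shows "(SUP i. \<Sum>n. f i n) = (\<Sum>n. SUP i. f i n)"
  using nn_integral_monotone_convergence_SUP[OF assms, of "count_space UNIV"]
  by (simp add: nn_integral_count_space_nat image_comp)

text \<open>The fibre volume is given on sets as a countable sum over charts; induction over
  measurable functions carries this to integrals.\<close>

lemma nn_integral_suminf_measure:
  assumes sets: "\<And>n::nat. sets (N n) = sets M"
    and em: "\<And>S. S \<in> sets M \<Longrightarrow> emeasure M S = (\<Sum>n. emeasure (N n) S)"
    and f: "f \<in> borel_measurable M"
  shows "(\<integral>\<^sup>+x. f x \<partial>M) = (\<Sum>n. \<integral>\<^sup>+x. f x \<partial>N n)"
  using f
proof (induction rule: borel_measurable_induct)
  case (cong f g)
  have "(\<integral>\<^sup>+x. f x \<partial>N n) = (\<integral>\<^sup>+x. g x \<partial>N n)" for n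
    by (rule nn_integral_cong) (use cong(3) sets_eq_imp_space_eq[OF sets] in auto)
  moreover have "(\<integral>\<^sup>+x. f x \<partial>M) = (\<integral>\<^sup>+x. g x \<partial>M)" by (rule nn_integral_cong) (use cong(3) in auto)
  ultimately show ?case using cong(4) by simp
next
  case (set S)
  then show ?case using em sets by simp
next
  case (mult u c)
  have m: "u \<in> borel_measurable (N n)" for n using mult(2) measurable_cong_sets[OF sets refl] by blast
  show ?case using mult by (simp add: nn_integral_cmult m)
next
  case (add u v)
  have m: "u \<in> borel_measurable (N n)" "v \<in> borel_measurable (N n)" for n
    using add measurable_cong_sets[OF sets refl] by blast+
  show ?case using add by (simp add: nn_integral_add m suminf_add)
next
  case (seq U)
  have m: "U i \<in> borel_measurable (N n)" for i n using seq(1) measurable_cong_sets[OF sets refl] by blast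
  have mono: "incseq (\<lambda>i n. \<integral>\<^sup>+x. U i x \<partial>N n)"
    using seq(3) by (auto simp: incseq_def le_fun_def intro!: nn_integral_mono)
  have "(\<integral>\<^sup>+x. (SUP i. U i) x \<partial>M) = (SUP i. \<integral>\<^sup>+x. U i x \<partial>M)"
    using nn_integral_monotone_convergence_SUP[OF seq(3,1)] by (simp add: image_comp)
  also have "\<dots> = (SUP i. \<Sum>n. \<integral>\<^sup>+x. U i x \<partial>N n)" using seq(5) by simp
  also have "\<dots> = (\<Sum>n. SUP i. \<integral>\<^sup>+x. U i x \<partial>N n)" by (rule suminf_SUP_ennreal[OF mono])
  also have "\<dots> = (\<Sum>n. \<integral>\<^sup>+x. (SUP i. U i) x \<partial>N n)"
    using nn_integral_monotone_convergence_SUP[OF seq(3) m] by (simp add: image_comp)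
  finally show ?case .
qed

section \<open>The volume of the fibres\<close>

locale vertical_submersion = smooth_submersion A A' \<pi>
  for A :: "('m::{t2_space,second_countable_topology}, 'f::real_inner \<times> 'e::real_inner) chart set"
    and A' :: "('b::{t2_space,second_countable_topology}, 'e) chart set" and \<pi> :: "'m \<Rightarrow> 'b" +
  fixes g :: "'m \<Rightarrow> 'm tangent \<Rightarrow> 'm tangent \<Rightarrow> real"
  assumes metric: "vertical_metric A A' \<pi> g"
begin

abbreviation vol where "vol \<equiv> fibre_volume A A' \<pi> g"

lemma gram_continuous:
  assumes c: "c \<in> submersion_charts A A' \<pi>"
  shows "continuous_on (fst c) (gram_det A g c)"
proof -
  have "continuous_on (fst c) (\<lambda>x. g x (vertical_vector A c x v) (vertical_vector A c x w))" for v w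
    using metric c chart_facts(1)[OF submersion_chartD(2)[OF c]] M.smooth_fun_continuous
    unfolding vertical_metric_def by blast
  then show ?thesis unfolding gram_det_def[abs_def] by (intro continuous_intros)
qed

definition part where "part = (SOME P. chart_partition A A' \<pi> P)"
definition pc where "pc = fst part"
definition pr where "pr = snd part"

lemma partition: "chart_partition A A' \<pi> (pc, pr)"
  unfolding pc_def pr_def part_def using someI_ex[OF chart_partition_exists] by simp

lemma part_facts:
  shows "pc n \<in> submersion_charts A A' \<pi>" "smooth_fun A UNIV (pr n)" "0 \<le> pr n x"
    "closure {x. pr n x \<noteq> 0} \<subseteq> fst (pc n)" "\<exists>W. open W \<and> x \<in> W \<and> finite {n. \<exists>y\<in>W. pr n y \<noteq> 0}"
  using partition unfolding chart_partition_def by auto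

definition base_chart where "base_chart n = (SOME d. d \<in> smooth_charts A' \<and> \<pi> ` fst (pc n) \<subseteq> fst d \<and>
  (\<forall>x\<in>fst (pc n). snd (snd (pc n) x) = snd d (\<pi> x)))"

lemma base_chart: "base_chart n \<in> smooth_charts A'" "\<pi> ` fst (pc n) \<subseteq> fst (base_chart n)"
  "x \<in> fst (pc n) \<Longrightarrow> snd (snd (pc n) x) = snd (base_chart n) (\<pi> x)"
proof -
  have "\<exists>d. d \<in> smooth_charts A' \<and> \<pi> ` fst (pc n) \<subseteq> fst d \<and> (\<forall>x\<in>fst (pc n). snd (snd (pc n) x) = snd d (\<pi> x))"
    using submersion_chartD(3)[OF part_facts(1)[of n]] by blast
  from someI_ex[OF this] show "base_chart n \<in> smooth_charts A'" "\<pi> ` fst (pc n) \<subseteq> fst (base_chart n)"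
    "x \<in> fst (pc n) \<Longrightarrow> snd (snd (pc n) x) = snd (base_chart n) (\<pi> x)"
    unfolding base_chart_def[symmetric] by auto
qed

end

text \<open>The slice of a submersion chart over \<open>b\<close> consists of the \<open>y\<close>
  with \<open>(y, snd d b)\<close> in its image; in this way everything about fibre charts is
  reduced to the chart of the total space.\<close>

lemma (in smooth_submersion) fibre_chart_facts:
  assumes c: "c \<in> smooth_charts A" and d: "d \<in> smooth_charts A'" "\<pi> ` fst c \<subseteq> fst d"
    "\<forall>x\<in>fst c. snd (snd c x) = snd d (\<pi> x)"
  shows "b \<in> fst d \<Longrightarrow> y \<in> (fst \<circ> snd c) ` (fst c \<inter> \<pi> -` {b} \<inter> S) \<longleftrightarrow>
      (y, snd d b) \<in> snd c ` fst c \<and> chart_inv c (y, snd d b) \<in> S"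
    and "b \<in> fst d \<Longrightarrow> (y, snd d b) \<in> snd c ` fst c \<Longrightarrow> \<pi> (chart_inv c (y, snd d b)) = b"
    and "b \<in> fst d \<Longrightarrow> (y, snd d b) \<in> snd c ` fst c \<Longrightarrow> chart_inv (fibre_chart \<pi> b c) y = chart_inv c (y, snd d b)"
    and "b \<notin> fst d \<Longrightarrow> fst c \<inter> \<pi> -` {b} = {}"
proof -
  note cf = chart_facts[OF M.smooth_charts_chart[OF c]]
  note df = chart_facts[OF B.smooth_charts_chart[OF d(1)]]
  show pi: "\<pi> (chart_inv c (y, snd d b)) = b" if "b \<in> fst d" "(y, snd d b) \<in> snd c ` fst c" for y
  proof (rule inj_onD[OF df(5) _ _ that(1)])
    have x: "chart_inv c (y, snd d b) \<in> fst c" "snd c (chart_inv c (y, snd d b)) = (y, snd d b)"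
      using cf(7,8) that(2) by auto
    then show "\<pi> (chart_inv c (y, snd d b)) \<in> fst d" using d(2) by blast
    show "snd d (\<pi> (chart_inv c (y, snd d b))) = snd d b" using bspec[OF d(3) x(1)] x(2) by simp
  qed
  have pair: "snd c x = (fst (snd c x), snd d b)" if "x \<in> fst c" "\<pi> x = b" for x
    using bspec[OF d(3) that(1)] that(2) by (simp add: prod_eq_iff)
  show "y \<in> (fst \<circ> snd c) ` (fst c \<inter> \<pi> -` {b} \<inter> S) \<longleftrightarrow>
      (y, snd d b) \<in> snd c ` fst c \<and> chart_inv c (y, snd d b) \<in> S" if b: "b \<in> fst d"
  proof
    assume "y \<in> (fst \<circ> snd c) ` (fst c \<inter> \<pi> -` {b} \<inter> S)"
    then obtain x where x: "x \<in> fst c" "\<pi> x = b" "x \<in> S" "y = fst (snd c x)" by auto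
    then have "(y, snd d b) = snd c x" using pair by metis
    then show "(y, snd d b) \<in> snd c ` fst c \<and> chart_inv c (y, snd d b) \<in> S" using x cf(6) by auto
  next
    assume y: "(y, snd d b) \<in> snd c ` fst c \<and> chart_inv c (y, snd d b) \<in> S"
    then have "y = fst (snd c (chart_inv c (y, snd d b)))" using cf(7) by simp
    then show "y \<in> (fst \<circ> snd c) ` (fst c \<inter> \<pi> -` {b} \<inter> S)"
      using pi[OF b] y cf(8) by (intro image_eqI[of _ _ "chart_inv c (y, snd d b)"]) auto
  qed
  show "chart_inv (fibre_chart \<pi> b c) y = chart_inv c (y, snd d b)" if b: "b \<in> fst d" "(y, snd d b) \<in> snd c ` fst c"
  proof -
    have i1: "inj_on (fst \<circ> snd c) (fst c \<inter> \<pi> -` {b})"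
    proof (rule inj_onI)
      fix x x' assume "x \<in> fst c \<inter> \<pi> -` {b}" "x' \<in> fst c \<inter> \<pi> -` {b}" "(fst \<circ> snd c) x = (fst \<circ> snd c) x'"
      then have "snd c x = snd c x'" "x \<in> fst c" "x' \<in> fst c" using pair[of x] pair[of x'] by auto
      then show "x = x'" using cf(5) inj_onD by metis
    qed
    have i2: "chart_inv c (y, snd d b) \<in> fst c \<inter> \<pi> -` {b}" using cf(8)[OF b(2)] pi[OF b] by simp
    have i3: "(fst \<circ> snd c) (chart_inv c (y, snd d b)) = y" using cf(7)[OF b(2)] by simp
    have "chart_inv (fibre_chart \<pi> b c) y = inv_into (fst c \<inter> \<pi> -` {b}) (fst \<circ> snd c) y"
      by (simp add: chart_inv_def fibre_chart_def)
    also have "\<dots> = chart_inv c (y, snd d b)" by (rule inv_into_f_eq[OF i1 i2 i3])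
    finally show ?thesis .
  qed
  show "fst c \<inter> \<pi> -` {b} = {}" if "b \<notin> fst d" using d(2) that by auto
qed

context vertical_submersion
begin

lemma base_chart_snd: "\<forall>x\<in>fst (pc n). snd (snd (pc n) x) = snd (base_chart n) (\<pi> x)"
  using base_chart(3) by blast

lemma slice:
  shows "b \<in> fst (base_chart n) \<Longrightarrow> y \<in> (fst \<circ> snd (pc n)) ` (fst (pc n) \<inter> \<pi> -` {b} \<inter> S) \<longleftrightarrow>
      (y, snd (base_chart n) b) \<in> snd (pc n) ` fst (pc n) \<and> chart_inv (pc n) (y, snd (base_chart n) b) \<in> S"
    and "b \<in> fst (base_chart n) \<Longrightarrow> (y, snd (base_chart n) b) \<in> snd (pc n) ` fst (pc n)
      \<Longrightarrow> \<pi> (chart_inv (pc n) (y, snd (base_chart n) b)) = b"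
    and "b \<in> fst (base_chart n) \<Longrightarrow> (y, snd (base_chart n) b) \<in> snd (pc n) ` fst (pc n)
      \<Longrightarrow> chart_inv (fibre_chart \<pi> b (pc n)) y = chart_inv (pc n) (y, snd (base_chart n) b)"
    and "b \<notin> fst (base_chart n) \<Longrightarrow> fst (pc n) \<inter> \<pi> -` {b} = {}"
  by (rule fibre_chart_facts[OF submersion_chartD(1)[OF part_facts(1)] base_chart(1,2) base_chart_snd];
      assumption)+

definition fibm where "fibm b = restrict_space (borel :: 'm measure) (\<pi> -` {b})"
definition sl where "sl b n = (fst \<circ> snd (pc n)) ` (fst (pc n) \<inter> \<pi> -` {b})"
definition slice_inv where "slice_inv b n = chart_inv (fibre_chart \<pi> b (pc n))"
definition density_weight where "density_weight n x = ennreal (pr n x * sqrt (gram_det A g (pc n) x))"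
text \<open>The \<open>n\<close>-th summand of the fibre volume as a measure in its own right, so
  that countable additivity of the sum is inherited from its terms.\<close>

definition chart_volume where "chart_volume b n = distr (density (restrict_space model_lebesgue (sl b n)) (\<lambda>y. density_weight n (slice_inv b n y))) (fibm b) (slice_inv b n)"

lemma sl_iff: "b \<in> fst (base_chart n) \<Longrightarrow> y \<in> sl b n \<longleftrightarrow> (y, snd (base_chart n) b) \<in> snd (pc n) ` fst (pc n)"
  using slice(1)[of b n y UNIV] by (simp add: sl_def)

lemma sl_empty: "b \<notin> fst (base_chart n) \<Longrightarrow> sl b n = {}"
  using slice(4)[of b n] by (simp add: sl_def)

lemma slice_inv_eq: "b \<in> fst (base_chart n) \<Longrightarrow> y \<in> sl b n \<Longrightarrow> slice_inv b n y = chart_inv (pc n) (y, snd (base_chart n) b)"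
  using slice(3) sl_iff by (simp add: slice_inv_def)

lemma pc_chart: "is_chart (pc n)"
  by (rule submersion_chartD(2)[OF part_facts(1)])

lemma slice_facts: "open (sl b n)" "continuous_on (sl b n) (slice_inv b n)" "slice_inv b n ` sl b n \<subseteq> \<pi> -` {b} \<inter> fst (pc n)"
proof -
  note cf = chart_facts[OF pc_chart[of n]]
  have "open (sl b n) \<and> continuous_on (sl b n) (slice_inv b n) \<and> slice_inv b n ` sl b n \<subseteq> \<pi> -` {b} \<inter> fst (pc n)"
  proof (cases "b \<in> fst (base_chart n)")
    case True
    let ?e = "snd (base_chart n) b"
    have sl: "sl b n = (\<lambda>y. (y, ?e)) -` (snd (pc n) ` fst (pc n))" using sl_iff[OF True] by auto
    have c: "continuous_on UNIV (\<lambda>y. (y, ?e))" by (intro continuous_intros)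
    have 1: "open (sl b n)" unfolding sl by (rule open_vimage[OF cf(2) c])
    have "continuous_on (sl b n) (\<lambda>y. chart_inv (pc n) (y, ?e))"
      by (rule continuous_on_compose2[OF cf(4) continuous_on_subset[OF c subset_UNIV]]) (auto simp: sl)
    then have 2: "continuous_on (sl b n) (slice_inv b n)"
      by (subst continuous_on_cong[OF refl slice_inv_eq[OF True]])
    have "slice_inv b n y \<in> \<pi> -` {b} \<inter> fst (pc n)" if y: "y \<in> sl b n" for y
      using slice_inv_eq[OF True y] slice(2)[OF True] sl_iff[OF True] y cf(8) by auto
    with 1 2 show ?thesis by blast
  qed (simp add: sl_empty)
  then show "open (sl b n)" "continuous_on (sl b n) (slice_inv b n)" "slice_inv b n ` sl b n \<subseteq> \<pi> -` {b} \<inter> fst (pc n)" by auto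
qed

lemma space_fib [simp]: "space (fibm b) = \<pi> -` {b}"
  by (simp add: fibm_def space_restrict_space)

lemma restrict_model_measurable:
  assumes "continuous_on (sl b n) f"
  shows "f \<in> borel_measurable (restrict_space model_lebesgue (sl b n))"
  using borel_measurable_continuous_on_restrict[OF assms]
    measurable_cong_sets[OF sets_restrict_space_cong[OF sets_model_lebesgue] refl] by blast

lemma slice_inv_measurable: "slice_inv b n \<in> measurable (restrict_space model_lebesgue (sl b n)) (fibm b)"
  unfolding fibm_def
  by (rule measurable_restrict_space2[OF _ restrict_model_measurable[OF slice_facts(2)]])
    (use slice_facts(3)[of b n] in \<open>auto simp: space_restrict_space\<close>)

lemma density_weight_measurable: "(\<lambda>y. density_weight n (slice_inv b n y)) \<in> borel_measurable (restrict_space model_lebesgue (sl b n))"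
proof -
  have "continuous_on (fst (pc n)) (\<lambda>x. pr n x * sqrt (gram_det A g (pc n) x))"
    by (intro continuous_intros gram_continuous[OF part_facts(1)]
        continuous_on_subset[OF M.smooth_fun_continuous[OF part_facts(2) open_UNIV] subset_UNIV])
  then have "continuous_on (sl b n) (\<lambda>y. pr n (slice_inv b n y) * sqrt (gram_det A g (pc n) (slice_inv b n y)))"
    by (rule continuous_on_compose2[OF _ slice_facts(2)]) (use slice_facts(3) in blast)
  from restrict_model_measurable[OF this] show ?thesis unfolding density_weight_def by measurable
qed

lemma nn_integral_chart_volume:
  assumes f: "f \<in> borel_measurable (fibm b)"
  shows "(\<integral>\<^sup>+x. f x \<partial>chart_volume b n) = (\<integral>\<^sup>+y. density_weight n (slice_inv b n y) * f (slice_inv b n y) * indicator (sl b n) y \<partial>model_lebesgue)"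
proof -
  have m: "slice_inv b n \<in> measurable (density (restrict_space model_lebesgue (sl b n)) (\<lambda>y. density_weight n (slice_inv b n y))) (fibm b)"
    using slice_inv_measurable by simp
  have f': "f \<in> borel_measurable (distr (density (restrict_space model_lebesgue (sl b n)) (\<lambda>y. density_weight n (slice_inv b n y))) (fibm b) (slice_inv b n))"
    using f by simp
  have "(\<integral>\<^sup>+x. f x \<partial>chart_volume b n) = (\<integral>\<^sup>+y. density_weight n (slice_inv b n y) * f (slice_inv b n y) \<partial>restrict_space model_lebesgue (sl b n))"
    unfolding chart_volume_def nn_integral_distr[OF m f']
    by (rule nn_integral_density[OF density_weight_measurable measurable_compose[OF slice_inv_measurable f]])
  also have "\<dots> = (\<integral>\<^sup>+y. density_weight n (slice_inv b n y) * f (slice_inv b n y) * indicator (sl b n) y \<partial>model_lebesgue)"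
    by (rule nn_integral_restrict_space) (use slice_facts(1) in auto)
  finally show ?thesis .
qed

text \<open>\<open>measure_of\<close> is known to have the prescribed values once these are
  countably additive. Each summand is therefore first recognised as the measure
  \<open>chart_volume b n\<close>, after which the two countable sums are exchanged.\<close>

lemma vol_facts:
  shows space_vol: "space (vol b) = \<pi> -` {b}" and sets_vol: "sets (vol b) = sets (fibm b)"
    and emeasure_vol: "S \<in> sets (fibm b) \<Longrightarrow> emeasure (vol b) S = (\<Sum>n. emeasure (chart_volume b n) S)"
proof -
  define \<mu> where "\<mu> S = (\<Sum>n. \<integral>\<^sup>+ y \<in> (fst \<circ> snd (pc n)) ` (fst (pc n) \<inter> S).
            (let x = chart_inv (fibre_chart \<pi> b (pc n)) y
             in ennreal (pr n x * sqrt (gram_det A g (pc n) x))) \<partial>model_lebesgue)" for S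
  have vol: "vol b = measure_of (\<pi> -` {b}) (sets (fibm b)) \<mu>"
    unfolding fibre_volume_def \<mu>_def fibm_def pc_def pr_def part_def by (simp add: Let_def split_beta)
  have \<mu>: "\<mu> S = (\<Sum>n. emeasure (chart_volume b n) S)" if S: "S \<in> sets (fibm b)" for S
  proof -
    have Sb: "S \<subseteq> \<pi> -` {b}" using sets.sets_into_space[OF S] by simp
    have "(\<integral>\<^sup>+ y \<in> (fst \<circ> snd (pc n)) ` (fst (pc n) \<inter> S).
            (let x = chart_inv (fibre_chart \<pi> b (pc n)) y
             in ennreal (pr n x * sqrt (gram_det A g (pc n) x))) \<partial>model_lebesgue) = emeasure (chart_volume b n) S" for n
    proof -
      have "emeasure (chart_volume b n) S = (\<integral>\<^sup>+x. indicator S x \<partial>chart_volume b n)"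
        using S by (simp add: chart_volume_def)
      also have "\<dots> = (\<integral>\<^sup>+y. density_weight n (slice_inv b n y) * indicator S (slice_inv b n y) * indicator (sl b n) y \<partial>model_lebesgue)"
        by (rule nn_integral_chart_volume) (use S in simp)
      also have "\<dots> = (\<integral>\<^sup>+ y \<in> (fst \<circ> snd (pc n)) ` (fst (pc n) \<inter> S). density_weight n (slice_inv b n y) \<partial>model_lebesgue)"
      proof (rule nn_integral_cong)
        fix y
        have "y \<in> (fst \<circ> snd (pc n)) ` (fst (pc n) \<inter> S) \<longleftrightarrow> y \<in> sl b n \<and> slice_inv b n y \<in> S"
        proof (cases "b \<in> fst (base_chart n)")
          case True
          have "fst (pc n) \<inter> S = fst (pc n) \<inter> \<pi> -` {b} \<inter> S" using Sb by blast
          then show ?thesis using slice(1)[OF True, of y S] sl_iff[OF True] slice_inv_eq[OF True] by metis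
        next
          case False
          then show ?thesis using slice(4)[OF False] sl_empty[OF False] Sb by auto
        qed
        then show "density_weight n (slice_inv b n y) * indicator S (slice_inv b n y) * indicator (sl b n) y
          = density_weight n (slice_inv b n y) * indicator ((fst \<circ> snd (pc n)) ` (fst (pc n) \<inter> S)) y"
          by (cases "y \<in> sl b n"; cases "slice_inv b n y \<in> S") simp_all
      qed
      finally show ?thesis by (simp add: Let_def density_weight_def slice_inv_def)
    qed
    then show ?thesis unfolding \<mu>_def by simp
  qed
  have sa: "sigma_algebra (\<pi> -` {b}) (sets (fibm b))" using sets.sigma_algebra_axioms[of "fibm b"] by simp
  show "space (vol b) = \<pi> -` {b}" unfolding vol using sets.space_closed[of "fibm b"] by (simp add: space_measure_of)
  show "sets (vol b) = sets (fibm b)" unfolding vol by (rule sigma_algebra.sets_measure_of_eq[OF sa])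
  show "emeasure (vol b) S = (\<Sum>n. emeasure (chart_volume b n) S)" if S: "S \<in> sets (fibm b)"
    unfolding vol \<mu>[OF S, symmetric]
  proof (rule emeasure_measure_of_sigma[OF sa _ _ S])
    show "positive (sets (fibm b)) \<mu>" by (simp add: positive_def \<mu>)
    show "countably_additive (sets (fibm b)) \<mu>"
    proof (rule countably_additiveI)
      fix X :: "nat \<Rightarrow> 'm set" assume X: "range X \<subseteq> sets (fibm b)" "disjoint_family X" "(\<Union>i. X i) \<in> sets (fibm b)"
      have "(\<Sum>i. \<mu> (X i)) = (\<Sum>i. \<Sum>n. emeasure (chart_volume b n) (X i))" using X(1) \<mu> by (intro suminf_cong) auto
      also have "\<dots> = (\<Sum>n. \<Sum>i. emeasure (chart_volume b n) (X i))" by (rule suminf_swap_ennreal)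
      also have "\<dots> = (\<Sum>n. emeasure (chart_volume b n) (\<Union>i. X i))"
        using X by (intro suminf_cong suminf_emeasure) (auto simp: chart_volume_def)
      finally show "(\<Sum>i. \<mu> (X i)) = \<mu> (\<Union>i. X i)" using \<mu>[OF X(3)] by simp
    qed
  qed
qed

lemma nn_integral_vol:
  assumes "f \<in> borel_measurable (fibm b)"
  shows "(\<integral>\<^sup>+x. f x \<partial>vol b) = (\<Sum>n. \<integral>\<^sup>+x. f x \<partial>chart_volume b n)"
  by (rule nn_integral_suminf_measure) (use assms measurable_cong_sets[OF sets_vol refl] in
    \<open>auto simp: sets_vol emeasure_vol chart_volume_def\<close>)

text \<open>In a submersion chart the integrand extends by zero to a continuous function with
  compact support on the model space, and the base coordinate becomes a parameter of the
  integral.\<close>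

lemma chart_volume_continuous:
  assumes h: "continuous_on UNIV (h :: 'm \<Rightarrow> real)" "\<And>x. 0 \<le> h x" "compact K" "\<And>x. x \<notin> K \<Longrightarrow> h x = 0"
  shows "\<exists>G. continuous_on UNIV G \<and> (\<forall>b. 0 \<le> G b \<and> (\<integral>\<^sup>+x. ennreal (h x) \<partial>chart_volume b n) = ennreal (G b))"
proof -
  define c where "c = pc n"
  define d where "d = base_chart n"
  have cs: "c \<in> submersion_charts A A' \<pi>" unfolding c_def by (rule part_facts(1))
  note cf = chart_facts[OF submersion_chartD(2)[OF cs]]
  have ds: "d \<in> smooth_charts A'" unfolding d_def by (rule base_chart(1))
  note df = chart_facts[OF B.smooth_charts_chart[OF ds]]
  \<comment> \<open>Compact, and inside the chart domain because the support of the partition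
    function is.\<close>
  define L where "L = K \<inter> closure {x. pr n x \<noteq> 0}"
  have L: "compact L" "L \<subseteq> fst c"
    using compact_Int_closed[OF h(3) closed_closure] part_facts(4)[of n] by (auto simp: L_def c_def)
  \<comment> \<open>If the determinant were negative, so would be its \<open>sqrt\<close>, and
    \<open>ennreal\<close> would send the density to 0; the maximum with 0 has the same effect among
    the reals and makes \<open>q\<close> nonnegative.\<close>
  define q where "q x = h x * (pr n x * sqrt (max 0 (gram_det A g c x)))" for x
  have q0: "q x = 0" if "x \<notin> L" for x
  proof (cases "x \<in> K")
    case True
    then have "x \<notin> closure {x. pr n x \<noteq> 0}" using that by (simp add: L_def)
    then have "pr n x = 0" using closure_subset[of "{x. pr n x \<noteq> 0}"] by blast
    then show ?thesis by (simp add: q_def)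
  qed (simp add: q_def h(4))
  have qpos: "0 \<le> q x" for x by (simp add: q_def h(2) part_facts(3))
  have qcont: "continuous_on (fst c) q" unfolding q_def
    by (intro continuous_intros gram_continuous[OF cs] continuous_on_subset[OF h(1) subset_UNIV]
        continuous_on_subset[OF M.smooth_fun_continuous[OF part_facts(2) open_UNIV] subset_UNIV])
  define F where "F z = (if z \<in> snd c ` fst c then q (chart_inv c z) else 0)" for z
  define P where "P = snd c ` L"
  have P: "compact P" unfolding P_def
    by (rule compact_continuous_image[OF continuous_on_subset[OF cf(3) L(2)] L(1)])
  have F0: "F z = 0" if "z \<notin> P" for z
  proof (cases "z \<in> snd c ` fst c")
    case True
    then have "chart_inv c z \<notin> L" using that cf(7)[OF True] unfolding P_def by (metis imageI)
    then show ?thesis by (simp add: F_def q0)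
  qed (simp add: F_def)
  have Fpos: "0 \<le> F z" for z by (simp add: F_def qpos)
  have Fcont: "continuous_on UNIV F"
  proof -
    have oP: "open (- P)" using compact_imp_closed[OF P] by (simp add: open_Compl)
    have "continuous_on (snd c ` fst c) (\<lambda>z. q (chart_inv c z))"
      by (rule continuous_on_compose2[OF qcont cf(4)]) (use cf(8) in auto)
    then have 1: "continuous_on (snd c ` fst c) F"
      by (subst continuous_on_cong[OF refl]) (auto simp: F_def)
    have 2: "continuous_on (- P) F"
      by (subst continuous_on_cong[OF refl, of _ _ "\<lambda>_. 0"]) (auto simp: F0)
    have "snd c ` fst c \<union> - P = UNIV" using L(2) by (auto simp: P_def)
    then show ?thesis using continuous_on_open_Un[OF cf(2) oP 1 2] by simp
  qed
  have fdf: "finite_dimensional TYPE('f)" by (rule finite_dimensional_prodD(1)[OF M.fd])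
  have PI: "continuous_on UNIV (\<lambda>e. \<integral>y. F (y, e) \<partial>model_lebesgue)"
    "\<And>e. (\<integral>\<^sup>+y. ennreal (F (y, e)) \<partial>model_lebesgue) = ennreal (\<integral>y. F (y, e) \<partial>model_lebesgue)"
    "\<And>e. 0 \<le> (\<integral>y. F (y, e) \<partial>model_lebesgue)"
    by (rule parameter_integral[OF fdf Fcont Fpos P]; rule F0; assumption)+
  define G where "G b = (if b \<in> fst d then \<integral>y. F (y, snd d b) \<partial>model_lebesgue else 0)" for b
  have Gint: "(\<integral>\<^sup>+x. ennreal (h x) \<partial>chart_volume b n) = ennreal (G b)" for b
  proof -
    have hm: "(\<lambda>x. ennreal (h x)) \<in> borel_measurable (fibm b)"
      unfolding fibm_def by (intro measurable_restrict_space1 measurable_compose[OF borel_measurable_continuous_onI[OF h(1)]]) simp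
    have "(\<integral>\<^sup>+x. ennreal (h x) \<partial>chart_volume b n)
        = (\<integral>\<^sup>+y. density_weight n (slice_inv b n y) * ennreal (h (slice_inv b n y)) * indicator (sl b n) y \<partial>model_lebesgue)"
      by (rule nn_integral_chart_volume[OF hm])
    also have "\<dots> = ennreal (G b)"
    proof (cases "b \<in> fst d")
      case True
      have b: "b \<in> fst (base_chart n)" using True by (simp add: d_def)
      have "density_weight n (slice_inv b n y) * ennreal (h (slice_inv b n y)) * indicator (sl b n) y = ennreal (F (y, snd d b))" for y
      proof (cases "y \<in> sl b n")
        case True
        have j: "slice_inv b n y = chart_inv c (y, snd d b)" "(y, snd d b) \<in> snd c ` fst c"
          using slice_inv_eq[OF b True] sl_iff[OF b] True by (simp_all add: c_def d_def)
        have w: "density_weight n x = ennreal (pr n x * sqrt (max 0 (gram_det A g c x)))" for x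
          by (cases "gram_det A g c x \<ge> 0")
            (auto simp: density_weight_def c_def[symmetric] max_def ennreal_neg mult_nonneg_nonpos part_facts(3))
        have "density_weight n x * ennreal (h x) = ennreal (q x)" for x
          unfolding w q_def by (simp add: ennreal_mult'[symmetric] h(2) part_facts(3) mult.commute)
        then show ?thesis using True j by (simp add: F_def)
      next
        case False
        then have "(y, snd d b) \<notin> snd c ` fst c" using sl_iff[OF b] by (simp add: c_def d_def)
        then show ?thesis using False by (simp add: F_def)
      qed
      then show ?thesis using PI(2)[of "snd d b"] True by (simp add: G_def)
    next
      case False
      then have "sl b n = {}" using sl_empty by (simp add: d_def)
      then show ?thesis using False by (simp add: G_def)
    qed
    finally show ?thesis .
  qed
  \<comment> \<open>\<open>G\<close> vanishes off the compact image of \<open>L\<close>, so its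
    continuity on the base chart extends to the whole base.\<close>
  have piL: "compact (\<pi> ` L)" by (rule compact_continuous_image[OF continuous_on_subset[OF continuous_pi subset_UNIV] L(1)])
  have opi: "open (- \<pi> ` L)" using compact_imp_closed[OF piL] by (simp add: open_Compl)
  have "continuous_on (fst d) (\<lambda>b. \<integral>y. F (y, snd d b) \<partial>model_lebesgue)"
    by (rule continuous_on_compose2[OF PI(1) df(3)]) (rule subset_UNIV)
  then have 1: "continuous_on (fst d) G" by (subst continuous_on_cong[OF refl]) (auto simp: G_def)
  have "G b = 0" if "b \<notin> \<pi> ` L" for b
  proof (cases "b \<in> fst d")
    case True
    have "F (y, snd d b) = 0" for y
    proof (rule ccontr)
      assume ne: "F (y, snd d b) \<noteq> 0"
      then have z: "(y, snd d b) \<in> snd c ` fst c" by (auto simp: F_def split: if_splits)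
      then have "q (chart_inv c (y, snd d b)) \<noteq> 0" using ne by (simp add: F_def)
      then have "chart_inv c (y, snd d b) \<in> L" using q0 by blast
      then have "\<pi> (chart_inv c (y, snd d b)) \<in> \<pi> ` L" by (rule imageI)
      moreover have "\<pi> (chart_inv c (y, snd d b)) = b"
        using slice(2)[of b n y] True z by (simp add: c_def d_def)
      ultimately show False using \<open>b \<notin> \<pi> ` L\<close> by simp
    qed
    then show ?thesis by (simp add: G_def)
  qed (simp add: G_def)
  then have 2: "continuous_on (- \<pi> ` L) G" by (subst continuous_on_cong[OF refl, of _ _ "\<lambda>_. 0"]) auto
  have "\<pi> ` L \<subseteq> fst d" using L(2) base_chart(2)[of n] by (auto simp: c_def d_def)
  then have "fst d \<union> - \<pi> ` L = UNIV" by blast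
  then have "continuous_on UNIV G" using continuous_on_open_Un[OF df(1) opi 1 2] by simp
  moreover have "0 \<le> G b" for b using PI(3) by (simp add: G_def)
  ultimately show ?thesis using Gint by blast
qed

text \<open>By local finiteness only finitely many functions of the partition are nonzero somewhere
  on the compact set \<open>K\<close>.\<close>

lemma vol_continuous:
  assumes h: "continuous_on UNIV (h :: 'm \<Rightarrow> real)" "\<And>x. 0 \<le> h x" "compact K" "\<And>x. x \<notin> K \<Longrightarrow> h x = 0"
  shows "\<exists>I. continuous_on UNIV I \<and> (\<forall>b. 0 \<le> I b \<and> (\<integral>\<^sup>+x. ennreal (h x) \<partial>vol b) = ennreal (I b))"
proof -
  have "\<forall>x. \<exists>W. open W \<and> x \<in> W \<and> finite {n. \<exists>y\<in>W. pr n y \<noteq> 0}" using part_facts(5) by blast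
  from choice[OF this] obtain W
    where "\<forall>x. open (W x) \<and> x \<in> W x \<and> finite {n. \<exists>y\<in>W x. pr n y \<noteq> 0}" by (rule exE)
  then have W: "\<And>x. open (W x)" "\<And>x. x \<in> W x" "\<And>x. finite {n. \<exists>y\<in>W x. pr n y \<noteq> 0}" by simp_all
  obtain X where X: "X \<subseteq> K" "finite X" "K \<subseteq> (\<Union>x\<in>X. W x)"
    by (rule compactE_image[OF h(3), of K W]) (use W in auto)
  define J where "J = (\<Union>x\<in>X. {n. \<exists>y\<in>W x. pr n y \<noteq> 0})"
  have J: "finite J" using X(2) W(3) by (simp add: J_def)
  have zero: "pr n y = 0" if "y \<in> K" "n \<notin> J" for n y using that X(3) by (auto simp: J_def)
  have "\<forall>n. \<exists>G. continuous_on UNIV G \<and> (\<forall>b. 0 \<le> G b \<and> (\<integral>\<^sup>+x. ennreal (h x) \<partial>chart_volume b n) = ennreal (G b))"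
    by (intro allI chart_volume_continuous[OF h])
  then obtain G where G: "\<And>n. continuous_on UNIV (G n)" "\<And>n b. 0 \<le> G n b"
    "\<And>n b. (\<integral>\<^sup>+x. ennreal (h x) \<partial>chart_volume b n) = ennreal (G n b)" by metis
  have hm: "(\<lambda>x. ennreal (h x)) \<in> borel_measurable (fibm b)" for b
    unfolding fibm_def by (intro measurable_restrict_space1 measurable_compose[OF borel_measurable_continuous_onI[OF h(1)]]) simp
  have "(\<integral>\<^sup>+x. ennreal (h x) \<partial>vol b) = ennreal (\<Sum>n\<in>J. G n b)" for b
  proof -
    have z: "(\<integral>\<^sup>+x. ennreal (h x) \<partial>chart_volume b n) = 0" if n: "n \<notin> J" for n
    proof -
      have wz: "density_weight n x * ennreal (h x) = 0" for x
        using zero[OF _ n, of x] h(4)[of x] by (cases "x \<in> K") (simp_all add: density_weight_def)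
      show ?thesis unfolding nn_integral_chart_volume[OF hm] wz by simp
    qed
    have "(\<integral>\<^sup>+x. ennreal (h x) \<partial>vol b) = (\<Sum>n. \<integral>\<^sup>+x. ennreal (h x) \<partial>chart_volume b n)" by (rule nn_integral_vol[OF hm])
    also have "\<dots> = (\<Sum>n\<in>J. \<integral>\<^sup>+x. ennreal (h x) \<partial>chart_volume b n)" by (rule suminf_finite[OF J z])
    also have "\<dots> = ennreal (\<Sum>n\<in>J. G n b)" unfolding G(3) by (rule sum_ennreal) (rule G(2))
    finally show ?thesis .
  qed
  moreover have "continuous_on UNIV (\<lambda>b. \<Sum>n\<in>J. G n b)" by (intro continuous_on_sum G)
  moreover have "0 \<le> (\<Sum>n\<in>J. G n b)" for b by (intro sum_nonneg G)
  ultimately show ?thesis by blast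
qed

end

section \<open>Square integrable sections\<close>

locale hermitian = manifold A
  for A :: "('m::{t2_space,second_countable_topology}, 'a::real_inner) chart set" +
  fixes E :: "('m, 'v::ab_group_add) vbundle"
  assumes hb: "hermitian_bundle A E"
begin

lemma vb: "vector_bundle A E"
  using hb by (simp add: hermitian_bundle_def)

sublocale vs: vector_space "scaleB E"
  using vb by (simp add: vector_bundle_def)

abbreviation sc where "sc \<equiv> scaleB E"
abbreviation F where "F \<equiv> fib E"
abbreviation h where "h \<equiv> herm E"

declare vs.scale_minus_left [simp del]

lemma F_subspace: "vs.subspace (F x)"
  using vb by (simp add: vector_bundle_def)

lemma F_zero [simp]: "0 \<in> F x" and F_add [simp]: "u \<in> F x \<Longrightarrow> v \<in> F x \<Longrightarrow> u + v \<in> F x"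
  and F_scale [simp]: "u \<in> F x \<Longrightarrow> sc a u \<in> F x"
  using F_subspace vs.subspace_0 vs.subspace_add vs.subspace_scale by blast+

lemma F_sum: "(\<And>i. i \<in> I \<Longrightarrow> w i \<in> F x) \<Longrightarrow> (\<Sum>i\<in>I. w i) \<in> F x"
  by (rule vs.subspace_sum[OF F_subspace])

lemma herm_fibre: "\<forall>x. \<forall>u\<in>F x. \<forall>v\<in>F x. h x u v = cnj (h x v u) \<and> (u \<noteq> 0 \<longrightarrow> Re (h x u u) > 0) \<and>
    (\<forall>w\<in>F x. \<forall>a. h x u (sc a v + w) = a * h x u v + h x u w)"
  using hb unfolding hermitian_bundle_def by (elim conjE)

lemma h_sym: "u \<in> F x \<Longrightarrow> v \<in> F x \<Longrightarrow> h x u v = cnj (h x v u)"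
  using herm_fibre by blast

lemma h_lin: "u \<in> F x \<Longrightarrow> v \<in> F x \<Longrightarrow> w \<in> F x \<Longrightarrow> h x u (sc a v + w) = a * h x u v + h x u w"
  using herm_fibre by blast

lemma h_pos: "u \<in> F x \<Longrightarrow> u \<noteq> 0 \<Longrightarrow> 0 < Re (h x u u)"
  using herm_fibre by blast

lemma h_add: "u \<in> F x \<Longrightarrow> v \<in> F x \<Longrightarrow> w \<in> F x \<Longrightarrow> h x u (v + w) = h x u v + h x u w"
  using h_lin[of u x v w 1] by simp

lemma h_zero: "u \<in> F x \<Longrightarrow> h x u 0 = 0"
  using h_add[of u x 0 0] by simp

lemma h_scale: "u \<in> F x \<Longrightarrow> v \<in> F x \<Longrightarrow> h x u (sc a v) = a * h x u v"
  using h_lin[of u x v 0 a] by (simp add: h_zero)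

lemma h_add_left: "u \<in> F x \<Longrightarrow> v \<in> F x \<Longrightarrow> w \<in> F x \<Longrightarrow> h x (v + w) u = h x v u + h x w u"
  using h_add[of u x v w] h_sym[of u x] h_sym[of _ x u] by (metis F_add complex_cnj_add)

lemma h_scale_left: "u \<in> F x \<Longrightarrow> v \<in> F x \<Longrightarrow> h x (sc a v) u = cnj a * h x v u"
  using h_scale[of u x v a] h_sym[of _ x u] by (metis F_scale complex_cnj_mult)

lemma h_zero_left: "u \<in> F x \<Longrightarrow> h x 0 u = 0"
  using h_zero[of u x] h_sym[of 0 x u] by simp

lemma h_sum: "u \<in> F x \<Longrightarrow> (\<And>i. i \<in> I \<Longrightarrow> w i \<in> F x) \<Longrightarrow> h x u (\<Sum>i\<in>I. sc (a i) (w i)) = (\<Sum>i\<in>I. a i * h x u (w i))"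
  by (induction I rule: infinite_finite_induct) (simp_all add: h_zero h_add h_scale F_sum)

lemma h_sum_left: "u \<in> F x \<Longrightarrow> (\<And>i. i \<in> I \<Longrightarrow> w i \<in> F x) \<Longrightarrow> h x (\<Sum>i\<in>I. sc (a i) (w i)) u = (\<Sum>i\<in>I. cnj (a i) * h x (w i) u)"
  by (induction I rule: infinite_finite_induct) (simp_all add: h_zero_left h_add_left h_scale_left F_sum)

lemmas h_simps = h_add h_scale h_zero h_add_left h_scale_left h_zero_left

definition N where "N x u = Re (h x u u)"

lemma N_pos: "u \<in> F x \<Longrightarrow> 0 \<le> N x u"
  using h_pos[of u x] h_zero[of 0 x] by (cases "u = 0") (auto simp: N_def)

lemma N_eq_0: "u \<in> F x \<Longrightarrow> N x u = 0 \<Longrightarrow> u = 0"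
  using h_pos[of u x] by (force simp: N_def)

lemma N_zero [simp]: "N x 0 = 0"
  by (simp add: N_def h_zero)

lemma h_self: "u \<in> F x \<Longrightarrow> h x u u = complex_of_real (N x u)"
  using h_sym[of u x u] unfolding N_def by (metis Reals_cnj_iff of_real_Re)

lemma N_scale: "u \<in> F x \<Longrightarrow> N x (sc a u) = (cmod a)\<^sup>2 * N x u"
proof -
  assume u: "u \<in> F x"
  have "h x (sc a u) (sc a u) = a * cnj a * h x u u"
    using u by (simp add: h_simps)
  also have "\<dots> = complex_of_real ((cmod a)\<^sup>2 * N x u)"
    unfolding h_self[OF u] complex_norm_square[symmetric] by simp
  finally show ?thesis by (metis N_def Re_complex_of_real)
qed

lemma N_add: "u \<in> F x \<Longrightarrow> v \<in> F x \<Longrightarrow> N x (u + v) = N x u + N x v + 2 * Re (h x u v)"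
proof -
  assume u: "u \<in> F x" "v \<in> F x"
  have "Re (h x v u) = Re (h x u v)" using h_sym[OF u] by simp
  then show ?thesis using u by (simp add: N_def h_simps)
qed

lemma N_add_le: "u \<in> F x \<Longrightarrow> v \<in> F x \<Longrightarrow> N x (u + v) \<le> 2 * N x u + 2 * N x v"
proof -
  assume u: "u \<in> F x" "v \<in> F x"
  have "0 \<le> N x (u + sc (-1) v)" by (intro N_pos) (simp add: u)
  then show ?thesis using u by (simp add: N_add N_scale h_scale)
qed

text \<open>A bound by a sum instead of a product is enough for integrability and avoids square
  roots.\<close>

lemma h_bound: "u \<in> F x \<Longrightarrow> v \<in> F x \<Longrightarrow> cmod (h x u v) \<le> N x u + N x v"
proof (cases "h x u v = 0")
  case False
  assume u: "u \<in> F x" "v \<in> F x"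
  let ?w = "h x u v"
  \<comment> \<open>A unit scalar that turns \<open>h x u v\<close> into a negative real number; the
    bound is then the positivity of \<open>N x (u + sc c v)\<close>.\<close>
  define c where "c = - (cnj ?w / of_real (cmod ?w))"
  have c1: "cmod c = 1" using False by (simp add: c_def norm_divide)
  have "c * ?w = - (of_real (cmod ?w))"
    using False complex_norm_square[of ?w] by (simp add: c_def field_simps power2_eq_square)
  then have "Re (h x u (sc c v)) = - cmod ?w" using u by (simp add: h_scale)
  moreover have "0 \<le> N x (u + sc c v)" by (intro N_pos) (simp add: u)
  ultimately show ?thesis using u N_pos[OF u(1)] N_pos[OF u(2)] by (simp add: N_add N_scale c1)
qed (simp add: N_pos)

section \<open>Local trivialisations and frames\<close>

lemma triv:
  assumes "(U, r, \<tau>) \<in> trivs E"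
  shows "open U" "x \<in> U \<Longrightarrow> bij_betw (\<tau> x) (F x) {z. \<forall>i\<ge>r. z i = 0}"
    "x \<in> U \<Longrightarrow> u \<in> F x \<Longrightarrow> v \<in> F x \<Longrightarrow> \<tau> x (sc a u + v) i = a * \<tau> x u i + \<tau> x v i"
    "i < r \<Longrightarrow> j < r \<Longrightarrow> smooth_fun A U (\<lambda>x. h x (local_frame E \<tau> i x) (local_frame E \<tau> j x))"
    "(U', r', \<tau>') \<in> trivs E \<Longrightarrow> j < r \<Longrightarrow> smooth_fun A (U \<inter> U') (\<lambda>x. \<tau>' x (local_frame E \<tau> j x) i)"
proof -
  have 1: "\<forall>(U, r, \<tau>)\<in>trivs E. open U \<and>
        (\<forall>x\<in>U. bij_betw (\<tau> x) (F x) {z. \<forall>i\<ge>r. z i = 0} \<and>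
           (\<forall>u\<in>F x. \<forall>v\<in>F x. \<forall>a i. \<tau> x (sc a u + v) i = a * \<tau> x u i + \<tau> x v i))"
    and 2: "\<forall>(U, r, \<tau>)\<in>trivs E. \<forall>(U', r', \<tau>')\<in>trivs E. \<forall>j<r. \<forall>i.
        smooth_fun A (U \<inter> U') (\<lambda>x. \<tau>' x (local_frame E \<tau> j x) i)"
    using vb unfolding vector_bundle_def by - (elim conjE, assumption)+
  have 3: "\<forall>(U, r, \<tau>)\<in>trivs E. \<forall>i<r. \<forall>j<r.
        smooth_fun A U (\<lambda>x. h x (local_frame E \<tau> i x) (local_frame E \<tau> j x))"
    using hb unfolding hermitian_bundle_def by (elim conjE)
  note 1 = bspec[OF 1 assms, unfolded prod.case]
  show "open U" using 1 by (rule conjunct1)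
  show "bij_betw (\<tau> x) (F x) {z. \<forall>i\<ge>r. z i = 0}" if "x \<in> U"
    using bspec[OF conjunct2[OF 1] that] by (rule conjunct1)
  show "\<tau> x (sc a u + v) i = a * \<tau> x u i + \<tau> x v i" if "x \<in> U" "u \<in> F x" "v \<in> F x"
    by (rule conjunct2[OF bspec[OF conjunct2[OF 1] that(1)], rule_format, OF that(2,3)])
  show "smooth_fun A U (\<lambda>x. h x (local_frame E \<tau> i x) (local_frame E \<tau> j x))" if "i < r" "j < r"
    using bspec[OF 3 assms, unfolded prod.case] that by simp
  show "smooth_fun A (U \<inter> U') (\<lambda>x. \<tau>' x (local_frame E \<tau> j x) i)" if "(U', r', \<tau>') \<in> trivs E" "j < r"
    using bspec[OF bspec[OF 2 assms, unfolded prod.case] that(1), unfolded prod.case] that(2) by simp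
qed

lemma triv_cover: "\<exists>U r \<tau>. (U, r, \<tau>) \<in> trivs E \<and> x \<in> U"
proof -
  have "(\<Union>(U, r, \<tau>)\<in>trivs E. U) = UNIV" using vb by (simp add: vector_bundle_def)
  then have "x \<in> (\<Union>(U, r, \<tau>)\<in>trivs E. U)" by simp
  then obtain t where "t \<in> trivs E" "x \<in> (case t of (U, r, \<tau>) \<Rightarrow> U)" by (rule UN_E)
  then show ?thesis by (cases t) auto
qed

lemma triv_zero: "(U, r, \<tau>) \<in> trivs E \<Longrightarrow> x \<in> U \<Longrightarrow> \<tau> x 0 i = 0"
  using triv(3)[of U r \<tau> x 0 0 1 i] by simp

lemma triv_scale: "(U, r, \<tau>) \<in> trivs E \<Longrightarrow> x \<in> U \<Longrightarrow> u \<in> F x \<Longrightarrow> \<tau> x (sc a u) i = a * \<tau> x u i"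
  using triv(3)[of U r \<tau> x u 0 a i] by (simp add: triv_zero)

lemma triv_add: "(U, r, \<tau>) \<in> trivs E \<Longrightarrow> x \<in> U \<Longrightarrow> u \<in> F x \<Longrightarrow> v \<in> F x \<Longrightarrow> \<tau> x (u + v) i = \<tau> x u i + \<tau> x v i"
  using triv(3)[of U r \<tau> x u v 1 i] by simp

lemma triv_sum: "(U, r, \<tau>) \<in> trivs E \<Longrightarrow> x \<in> U \<Longrightarrow> (\<And>j. j \<in> J \<Longrightarrow> w j \<in> F x) \<Longrightarrow>
    \<tau> x (\<Sum>j\<in>J. sc (a j) (w j)) i = (\<Sum>j\<in>J. a j * \<tau> x (w j) i)"
  by (induction J rule: infinite_finite_induct) (simp_all add: triv_zero triv_add triv_scale F_sum)

lemma triv_inj: "(U, r, \<tau>) \<in> trivs E \<Longrightarrow> x \<in> U \<Longrightarrow> u \<in> F x \<Longrightarrow> v \<in> F x \<Longrightarrow> (\<And>i. \<tau> x u i = \<tau> x v i) \<Longrightarrow> u = v"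
  using triv(2)[of U r \<tau> x] inj_onD[of "\<tau> x" "F x" u v] by (auto simp: bij_betw_def)

lemma triv_off: "(U, r, \<tau>) \<in> trivs E \<Longrightarrow> x \<in> U \<Longrightarrow> u \<in> F x \<Longrightarrow> r \<le> i \<Longrightarrow> \<tau> x u i = 0"
  using triv(2)[of U r \<tau> x] by (auto simp: bij_betw_def)

lemma triv_surj:
  assumes "(U, r, \<tau>) \<in> trivs E" "x \<in> U" "\<And>i. r \<le> i \<Longrightarrow> z i = 0"
  shows "\<exists>u\<in>F x. \<tau> x u = z"
proof -
  have "z \<in> \<tau> x ` F x" using triv(2)[OF assms(1,2)] assms(3) by (simp add: bij_betw_def)
  then show ?thesis by blast
qed

lemma frame:
  assumes "(U, r, \<tau>) \<in> trivs E" "x \<in> U" "j < r"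
  shows "local_frame E \<tau> j x \<in> F x" "\<tau> x (local_frame E \<tau> j x) i = (if i = j then 1 else 0)"
proof -
  have "(\<lambda>l. if l = j then 1 else 0) \<in> \<tau> x ` F x"
    using triv(2)[OF assms(1,2)] assms(3) by (auto simp: bij_betw_def)
  then show "local_frame E \<tau> j x \<in> F x" "\<tau> x (local_frame E \<tau> j x) i = (if i = j then 1 else 0)"
    unfolding local_frame_def by (auto simp: f_inv_into_f inv_into_into)
qed

lemma frame_expand:
  assumes t: "(U, r, \<tau>) \<in> trivs E" "x \<in> U" and u: "u \<in> F x"
  shows "u = (\<Sum>j<r. sc (\<tau> x u j) (local_frame E \<tau> j x))"
proof (rule triv_inj[OF t u])
  have fr: "local_frame E \<tau> j x \<in> F x" if "j \<in> {..<r}" for j using frame(1)[OF t] that by simp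
  show "(\<Sum>j<r. sc (\<tau> x u j) (local_frame E \<tau> j x)) \<in> F x" by (rule F_sum) (simp add: fr)
  fix i
  have "\<tau> x (\<Sum>j<r. sc (\<tau> x u j) (local_frame E \<tau> j x)) i = (\<Sum>j<r. \<tau> x u j * \<tau> x (local_frame E \<tau> j x) i)"
    by (rule triv_sum[OF t fr])
  also have "\<dots> = (\<Sum>j<r. if i = j then \<tau> x u i else 0)"
    by (rule sum.cong) (auto simp: frame(2)[OF t])
  also have "\<dots> = \<tau> x u i" using triv_off[OF t u, of i] by simp
  finally show "\<tau> x u i = \<tau> x (\<Sum>j<r. sc (\<tau> x u j) (local_frame E \<tau> j x)) i" by simp
qed

definition gr where "gr \<tau> i j x = h x (local_frame E \<tau> i x) (local_frame E \<tau> j x)"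

lemma h_expand:
  assumes t: "(U, r, \<tau>) \<in> trivs E" "x \<in> U" and u: "u \<in> F x" "v \<in> F x"
  shows "h x u v = (\<Sum>i<r. \<Sum>j<r. cnj (\<tau> x u i) * \<tau> x v j * gr \<tau> i j x)"
proof -
  have fr: "local_frame E \<tau> j x \<in> F x" if "j \<in> {..<r}" for j using frame(1)[OF t] that by simp
  have "h x u v = h x u (\<Sum>j<r. sc (\<tau> x v j) (local_frame E \<tau> j x))"
    using frame_expand[OF t u(2)] by simp
  also have "\<dots> = (\<Sum>j<r. \<tau> x v j * h x u (local_frame E \<tau> j x))" by (rule h_sum[OF u(1) fr])
  also have "\<dots> = (\<Sum>j<r. \<tau> x v j * h x (\<Sum>i<r. sc (\<tau> x u i) (local_frame E \<tau> i x)) (local_frame E \<tau> j x))"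
    using frame_expand[OF t u(1)] by simp
  also have "\<dots> = (\<Sum>j<r. \<tau> x v j * (\<Sum>i<r. cnj (\<tau> x u i) * gr \<tau> i j x))"
    unfolding gr_def by (intro sum.cong refl arg_cong2[where f = times] h_sum_left fr)
  also have "\<dots> = (\<Sum>j<r. \<Sum>i<r. cnj (\<tau> x u i) * \<tau> x v j * gr \<tau> i j x)"
    by (simp add: sum_distrib_left mult_ac)
  also have "\<dots> = (\<Sum>i<r. \<Sum>j<r. cnj (\<tau> x u i) * \<tau> x v j * gr \<tau> i j x)" by (rule sum.swap)
  finally show ?thesis .
qed

lemma gr_continuous:
  assumes "(U, r, \<tau>) \<in> trivs E" "i < r" "j < r"
  shows "continuous_on U (gr \<tau> i j)"
  unfolding gr_def[abs_def] by (rule smooth_fun_continuous[OF triv(4)[OF assms] triv(1)[OF assms(1)]])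

text \<open>Equivalence of norms on one fibre: in coordinates the hermitian form attains a positive
  minimum on the compact unit sphere of the maximum norm. It turns smallness in the hermitian norm
  into smallness of the coordinates.\<close>

lemma triv_bound:
  assumes t: "(U, r, \<tau>) \<in> trivs E" "x \<in> U"
  shows "\<exists>C>0. \<forall>u\<in>F x. \<forall>i. (cmod (\<tau> x u i))\<^sup>2 \<le> C * N x u"
proof (cases "r = 0")
  case True
  then have "\<tau> x u i = 0" if "u \<in> F x" for u i using triv_off[OF t that] by simp
  then show ?thesis using N_pos by (intro exI[of _ 1]) auto
next
  case False
  define q where "q z = Re (\<Sum>i<r. \<Sum>j<r. cnj (z i) * z j * gr \<tau> i j x)" for z :: "nat \<Rightarrow> complex"
  \<comment> \<open>The polydisc, with the coordinates from \<open>r\<close> on frozen at 0, so that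
    the minimiser is the coordinate vector of an element of the fibre.\<close>
  define Z where "Z = (Pi\<^sub>E UNIV (\<lambda>i. if i < r then cball 0 1 else {0}) :: (nat \<Rightarrow> complex) set)"
  define S where "S = Z \<inter> (\<Union>i<r. {z. cmod (z i) = 1})"
  have qN: "q (\<tau> x u) = N x u" if "u \<in> F x" for u
    unfolding q_def N_def h_expand[OF t that that] ..
  have "compactin (product_topology (\<lambda>_::nat. euclidean :: complex topology) UNIV) Z"
    unfolding Z_def by (simp add: compactin_PiE)
  then have Z: "compact Z" by (simp add: euclidean_product_topology)
  have cc: "continuous_on UNIV (\<lambda>z :: nat \<Rightarrow> complex. z i)" for i by (rule continuous_on_product_coordinates)
  have "closed {z :: nat \<Rightarrow> complex. cmod (z i) = 1}" for i
    by (intro closed_Collect_eq continuous_intros cc)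
  then have "closed (\<Union>i<r. {z :: nat \<Rightarrow> complex. cmod (z i) = 1})" by (intro closed_UN) auto
  then have S: "compact S" unfolding S_def by (rule compact_Int_closed[OF Z])
  have qc: "continuous_on S q" unfolding q_def
    by (intro continuous_intros continuous_on_subset[OF cc subset_UNIV])
  have ne: "S \<noteq> {}"
  proof -
    have "(\<lambda>i. if i = 0 then 1 else 0) \<in> S" using False by (auto simp: S_def Z_def PiE_def Pi_def)
    then show ?thesis by blast
  qed
  obtain z0 where z0: "z0 \<in> S" "\<And>z. z \<in> S \<Longrightarrow> q z0 \<le> q z" using continuous_attains_inf[OF S ne qc] by blast
  have "z0 i \<in> (if i < r then cball 0 1 else {0})" for i using z0(1) unfolding S_def Z_def by (blast dest: PiE_mem)
  then have "z0 i = 0" if "r \<le> i" for i using that by (metis linorder_not_less singletonD)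
  then obtain u0 where u0: "u0 \<in> F x" "\<tau> x u0 = z0" using triv_surj[OF t] by blast
  have "u0 \<noteq> 0" using z0(1) u0(2) triv_zero[OF t] by (auto simp: S_def)
  then have m: "q z0 > 0" using h_pos[OF u0(1)] qN[OF u0(1)] u0(2) by (simp add: N_def)
  have "(cmod (\<tau> x u i))\<^sup>2 \<le> (1 / q z0) * N x u" if u: "u \<in> F x" for u i
  proof (cases "\<tau> x u i = 0")
    case True
    then show ?thesis using m N_pos[OF u] by simp
  next
    case False
    then have ir: "i < r" using triv_off[OF t u] by (meson not_less)
    \<comment> \<open>The maximum norm of the coordinates; dividing by it moves the vector into
      \<open>S\<close>.\<close>
    define m' where "m' = Max ((\<lambda>i. cmod (\<tau> x u i)) ` {..<r})"
    have le: "cmod (\<tau> x u j) \<le> m'" if "j < r" for j unfolding m'_def using that by (intro Max_ge) auto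
    have mpos: "m' > 0" using le[OF ir] False by (smt (verit) zero_less_norm_iff)
    have "m' \<in> (\<lambda>i. cmod (\<tau> x u i)) ` {..<r}" unfolding m'_def using ir by (intro Max_in) auto
    then obtain k where k: "k < r" "cmod (\<tau> x u k) = m'" by auto
    obtain a :: complex where a: "cmod a = 1 / m'"
      using mpos by (intro that[of "of_real (1 / m')"]) (simp add: norm_divide)
    let ?w = "sc a u"
    have w: "?w \<in> F x" using u by simp
    have tw: "\<tau> x ?w j = a * \<tau> x u j" for j by (rule triv_scale[OF t u])
    have "\<tau> x ?w \<in> S"
      unfolding S_def Z_def
    proof (intro IntI PiE_I)
      fix j
      show "\<tau> x ?w j \<in> (if j < r then cball 0 1 else {0})"
        using le[of j] mpos triv_off[OF t u, of j] by (auto simp: tw norm_mult a field_simps)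
      show "\<tau> x ?w \<in> (\<Union>i<r. {z. cmod (z i) = 1})"
        using k mpos by (intro UN_I[of k]) (auto simp: tw norm_mult a)
    qed simp
    then have "q z0 \<le> N x ?w" using z0(2) qN[OF w] by metis
    also have "\<dots> = (1 / m')\<^sup>2 * N x u" by (simp add: N_scale[OF u] a)
    finally have "m'\<^sup>2 \<le> (1 / q z0) * N x u" using mpos m by (simp add: field_simps)
    moreover have "(cmod (\<tau> x u i))\<^sup>2 \<le> m'\<^sup>2" using le[OF ir] by (intro power_mono) auto
    ultimately show ?thesis by linarith
  qed
  then show ?thesis using m by (intro exI[of _ "1 / q z0"]) auto
qed

lemma countable_trivs: "\<exists>t::nat \<Rightarrow> _. (\<forall>n. t n \<in> trivs E) \<and> (\<Union>n. fst (t n)) = UNIV"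
proof -
  have ex: "\<exists>a. a \<in> trivs E \<and> open (fst a) \<and> x \<in> fst a" if "x \<in> UNIV" for x
    using triv_cover[of x] triv(1) by force
  show ?thesis
    using lindelof_sequence[where S=fst and P="\<lambda>a. a \<in> trivs E" and W=UNIV, OF ex] by auto
qed

end

section \<open>Hilbert spaces of square integrable sections\<close>

locale hermitian_L2 = hermitian A E
  for A :: "('m::{t2_space,second_countable_topology}, 'a::real_inner) chart set"
    and E :: "('m, 'v::ab_group_add) vbundle" +
  fixes \<mu> :: "'m measure" and X :: "'m set"
  assumes sets_mu: "sets \<mu> = sets (restrict_space borel X)"
begin

abbreviation SI where "SI \<equiv> square_integrable E \<mu>"
abbreviation cl where "cl \<equiv> L2_class E \<mu>"

lemma space_mu: "space \<mu> = X"
  using sets_eq_imp_space_eq[OF sets_mu] by (simp add: space_restrict_space)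

lemma SI_F: "\<psi> \<in> SI \<Longrightarrow> x \<in> space \<mu> \<Longrightarrow> \<psi> x \<in> F x"
  by (simp add: square_integrable_def)

lemma SI_meas: "\<psi> \<in> SI \<Longrightarrow> (U, r, \<tau>) \<in> trivs E \<Longrightarrow> (\<lambda>x. \<tau> x (\<psi> x) i) \<in> borel_measurable (restrict_space \<mu> U)"
  unfolding square_integrable_def by blast

lemma SI_int: "\<psi> \<in> SI \<Longrightarrow> (\<integral>\<^sup>+ x. ennreal (N x (\<psi> x)) \<partial>\<mu>) < \<infinity>"
  by (simp add: square_integrable_def N_def)

lemma SI_I:
  assumes "\<And>x. x \<in> space \<mu> \<Longrightarrow> \<psi> x \<in> F x"
    and "\<And>U r \<tau> i. (U, r, \<tau>) \<in> trivs E \<Longrightarrow> (\<lambda>x. \<tau> x (\<psi> x) i) \<in> borel_measurable (restrict_space \<mu> U)"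
    and "(\<integral>\<^sup>+ x. ennreal (N x (\<psi> x)) \<partial>\<mu>) < \<infinity>"
  shows "\<psi> \<in> SI"
  using assms unfolding square_integrable_def N_def by blast

lemma open_meas: "open U \<Longrightarrow> U \<inter> space \<mu> \<in> sets \<mu>"
  unfolding sets_mu space_mu sets_restrict_space by (subst Int_commute) (rule imageI, simp)

lemma continuous_meas:
  assumes U: "open U" and f: "continuous_on U (f :: 'm \<Rightarrow> 'c::topological_space)"
  shows "f \<in> borel_measurable (restrict_space \<mu> U)"
proof -
  have "f \<in> borel_measurable (restrict_space borel U)"
    by (rule borel_measurable_continuous_on_restrict[OF f])
  then have "f \<in> borel_measurable (restrict_space (restrict_space borel U) X)"
    by (rule measurable_restrict_space1)
  moreover have "sets (restrict_space (restrict_space borel U) X) = sets (restrict_space \<mu> U)"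
    using sets_restrict_space_cong[OF sets_mu, of U] by (simp add: sets_restrict_restrict_space Int_commute)
  ultimately show ?thesis using measurable_cong_sets[OF _ refl] by blast
qed

text \<open>Measurability is tested on countably many trivialising sets that cover the manifold; on
  each of them the form is a polynomial in coordinates and the continuous Gram matrix.\<close>

lemma h_meas:
  assumes u: "\<And>x. x \<in> space \<mu> \<Longrightarrow> u x \<in> F x" "\<And>U r \<tau> i. (U, r, \<tau>) \<in> trivs E \<Longrightarrow> (\<lambda>x. \<tau> x (u x) i) \<in> borel_measurable (restrict_space \<mu> U)"
    and v: "\<And>x. x \<in> space \<mu> \<Longrightarrow> v x \<in> F x" "\<And>U r \<tau> i. (U, r, \<tau>) \<in> trivs E \<Longrightarrow> (\<lambda>x. \<tau> x (v x) i) \<in> borel_measurable (restrict_space \<mu> U)"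
  shows "(\<lambda>x. h x (u x) (v x)) \<in> borel_measurable \<mu>"
proof -
  obtain t :: "nat \<Rightarrow> _" where t: "\<And>n. t n \<in> trivs E" "(\<Union>n. fst (t n)) = UNIV" using countable_trivs by blast
  show ?thesis
  proof (rule measurable_piecewise_restrict[of "range (\<lambda>n. fst (t n))"])
    show "space \<mu> \<subseteq> \<Union> (range (\<lambda>n. fst (t n)))" using t(2) by auto
    fix \<Omega> assume "\<Omega> \<in> range (\<lambda>n. fst (t n))"
    then obtain n where n: "\<Omega> = fst (t n)" by blast
    obtain U r \<tau> where tn: "t n = (U, r, \<tau>)" by (cases "t n") auto
    have T: "(U, r, \<tau>) \<in> trivs E" using t(1)[of n] tn by simp
    have [simp]: "\<Omega> = U" using n tn by simp
    show "\<Omega> \<inter> space \<mu> \<in> sets \<mu>" using open_meas[OF triv(1)[OF T]] by simp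
    have "(\<lambda>x. \<Sum>i<r. \<Sum>j<r. cnj (\<tau> x (u x) i) * \<tau> x (v x) j * gr \<tau> i j x) \<in> borel_measurable (restrict_space \<mu> U)"
      by (intro borel_measurable_sum borel_measurable_times measurable_compose[OF u(2)[OF T] borel_measurable_continuous_onI]
          v(2)[OF T] continuous_meas[OF triv(1)[OF T] gr_continuous[OF T]] continuous_on_cnj continuous_on_id) auto
    moreover have "h x (u x) (v x) = (\<Sum>i<r. \<Sum>j<r. cnj (\<tau> x (u x) i) * \<tau> x (v x) j * gr \<tau> i j x)"
      if "x \<in> space (restrict_space \<mu> U)" for x
      using that by (intro h_expand[OF T] u v) (auto simp: space_restrict_space)
    ultimately have "(\<lambda>x. h x (u x) (v x)) \<in> borel_measurable (restrict_space \<mu> U)"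
      by (subst measurable_cong)
    then show "(\<lambda>x. h x (u x) (v x)) \<in> borel_measurable (restrict_space \<mu> \<Omega>)" by simp
  qed auto
qed

lemma SI_h_meas: "u \<in> SI \<Longrightarrow> v \<in> SI \<Longrightarrow> (\<lambda>x. h x (u x) (v x)) \<in> borel_measurable \<mu>"
  using h_meas SI_F SI_meas by blast

lemma N_meas:
  assumes "\<And>x. x \<in> space \<mu> \<Longrightarrow> u x \<in> F x" "\<And>U r \<tau> i. (U, r, \<tau>) \<in> trivs E \<Longrightarrow> (\<lambda>x. \<tau> x (u x) i) \<in> borel_measurable (restrict_space \<mu> U)"
  shows "(\<lambda>x. N x (u x)) \<in> borel_measurable \<mu>"
proof -
  have "(\<lambda>x. h x (u x) (u x)) \<in> borel_measurable \<mu>" by (rule h_meas) (fact assms)+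
  then show ?thesis unfolding N_def by simp
qed

lemma SI_N_meas: "u \<in> SI \<Longrightarrow> (\<lambda>x. N x (u x)) \<in> borel_measurable \<mu>"
  using N_meas SI_F SI_meas by blast

lemma SI_N_int: "u \<in> SI \<Longrightarrow> integrable \<mu> (\<lambda>x. N x (u x))"
  using SI_int[of u] SI_N_meas[of u] SI_F N_pos
  by (intro integrableI_nonneg) auto

lemma SI_h_int:
  assumes "u \<in> SI" "v \<in> SI" shows "integrable \<mu> (\<lambda>x. h x (u x) (v x))"
proof (rule Bochner_Integration.integrable_bound[OF Bochner_Integration.integrable_add[OF SI_N_int[OF assms(1)] SI_N_int[OF assms(2)]] SI_h_meas[OF assms]])
  show "AE x in \<mu>. norm (h x (u x) (v x)) \<le> norm (N x (u x) + N x (v x))"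
  proof (rule AE_I2)
    fix x assume "x \<in> space \<mu>"
    then have "u x \<in> F x" "v x \<in> F x" using SI_F assms by auto
    then show "norm (h x (u x) (v x)) \<le> norm (N x (u x) + N x (v x))"
      using h_bound N_pos by (metis add_nonneg_nonneg real_norm_def abs_of_nonneg)
  qed
qed

lemma meas_add:
  assumes u: "\<And>x. x \<in> space \<mu> \<Longrightarrow> u x \<in> F x" "(\<lambda>x. \<tau> x (u x) i) \<in> borel_measurable (restrict_space \<mu> U)"
    and v: "\<And>x. x \<in> space \<mu> \<Longrightarrow> v x \<in> F x" "(\<lambda>x. \<tau> x (v x) i) \<in> borel_measurable (restrict_space \<mu> U)"
    and T: "(U, r, \<tau>) \<in> trivs E"
  shows "(\<lambda>x. \<tau> x (u x + sc a (v x)) i) \<in> borel_measurable (restrict_space \<mu> U)"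
proof -
  have "(\<lambda>x. \<tau> x (u x) i + a * \<tau> x (v x) i) \<in> borel_measurable (restrict_space \<mu> U)" using u v by simp
  moreover have "\<tau> x (u x + sc a (v x)) i = \<tau> x (u x) i + a * \<tau> x (v x) i" if "x \<in> space (restrict_space \<mu> U)" for x
    using that u(1)[of x] v(1)[of x] T by (simp add: triv_add triv_scale space_restrict_space)
  ultimately show ?thesis by (subst measurable_cong)
qed

lemma SI_lin:
  assumes "u \<in> SI" "v \<in> SI" shows "(\<lambda>x. u x + sc a (v x)) \<in> SI"
proof (rule SI_I)
  show "u x + sc a (v x) \<in> F x" if "x \<in> space \<mu>" for x using SI_F assms that by simp
  show "(\<lambda>x. \<tau> x (u x + sc a (v x)) i) \<in> borel_measurable (restrict_space \<mu> U)"
    if "(U, r, \<tau>) \<in> trivs E" for U r \<tau> i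
    by (intro meas_add[OF _ _ _ _ that] SI_F SI_meas[OF _ that] assms)
  have "(\<integral>\<^sup>+ x. ennreal (N x (u x + sc a (v x))) \<partial>\<mu>)
      \<le> (\<integral>\<^sup>+ x. ennreal 2 * ennreal (N x (u x)) + ennreal (2 * (cmod a)\<^sup>2) * ennreal (N x (v x)) \<partial>\<mu>)"
  proof (rule nn_integral_mono)
    fix x assume "x \<in> space \<mu>"
    then have f: "u x \<in> F x" "v x \<in> F x" using SI_F assms by auto
    have "N x (u x + sc a (v x)) \<le> 2 * N x (u x) + 2 * (cmod a)\<^sup>2 * N x (v x)"
      using N_add_le[of "u x" x "sc a (v x)"] f by (simp add: N_scale)
    then have "ennreal (N x (u x + sc a (v x))) \<le> ennreal (2 * N x (u x) + 2 * (cmod a)\<^sup>2 * N x (v x))"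
      by (rule ennreal_leI)
    also have "\<dots> = ennreal 2 * ennreal (N x (u x)) + ennreal (2 * (cmod a)\<^sup>2) * ennreal (N x (v x))"
      using N_pos[OF f(1)] N_pos[OF f(2)] by (subst ennreal_plus) (simp_all add: ennreal_mult')
    finally show "ennreal (N x (u x + sc a (v x))) \<le> ennreal 2 * ennreal (N x (u x)) + ennreal (2 * (cmod a)\<^sup>2) * ennreal (N x (v x))" .
  qed
  also have "\<dots> = ennreal 2 * (\<integral>\<^sup>+ x. ennreal (N x (u x)) \<partial>\<mu>) + ennreal (2 * (cmod a)\<^sup>2) * (\<integral>\<^sup>+ x. ennreal (N x (v x)) \<partial>\<mu>)"
    using SI_N_meas[OF assms(1)] SI_N_meas[OF assms(2)] by (subst nn_integral_add) (simp_all add: nn_integral_cmult)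
  also have "\<dots> < \<infinity>" using SI_int[OF assms(1)] SI_int[OF assms(2)] by (simp add: ennreal_mult_less_top)
  finally show "(\<integral>\<^sup>+ x. ennreal (N x (u x + sc a (v x))) \<partial>\<mu>) < \<infinity>" .
qed

lemma SI_zero: "(\<lambda>_. 0) \<in> SI"
proof (rule SI_I)
  show "(\<lambda>x. \<tau> x 0 i) \<in> borel_measurable (restrict_space \<mu> U)" if T: "(U, r, \<tau>) \<in> trivs E" for U r \<tau> i
  proof -
    have "(\<lambda>x. 0 :: complex) \<in> borel_measurable (restrict_space \<mu> U)" by simp
    then show ?thesis
      by (subst measurable_cong[of _ _ "\<lambda>_. 0"]) (auto simp: triv_zero[OF T] space_restrict_space)
  qed
qed auto

lemma SI_add: "u \<in> SI \<Longrightarrow> v \<in> SI \<Longrightarrow> (\<lambda>x. u x + v x) \<in> SI"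
  using SI_lin[of u v 1] by simp

lemma SI_scale: "v \<in> SI \<Longrightarrow> (\<lambda>x. sc a (v x)) \<in> SI"
  using SI_lin[OF SI_zero, of v a] by simp

lemma mem_cl: "\<psi>' \<in> cl \<psi> \<longleftrightarrow> \<psi>' \<in> SI \<and> (AE x in \<mu>. \<psi>' x = \<psi> x)"
  by (simp add: L2_class_def)

lemma cl_eq: "(AE x in \<mu>. \<psi> x = \<phi> x) \<Longrightarrow> cl \<psi> = cl \<phi>"
proof -
  assume e: "AE x in \<mu>. \<psi> x = \<phi> x"
  have "(AE x in \<mu>. u x = \<psi> x) \<longleftrightarrow> (AE x in \<mu>. u x = \<phi> x)" for u
  proof
    assume "AE x in \<mu>. u x = \<psi> x"
    with e show "AE x in \<mu>. u x = \<phi> x" by eventually_elim simp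
  next
    assume "AE x in \<mu>. u x = \<phi> x"
    with e show "AE x in \<mu>. u x = \<psi> x" by eventually_elim simp
  qed
  then show ?thesis unfolding L2_class_def by simp
qed

lemma rep_cl: "\<psi> \<in> SI \<Longrightarrow> rep (cl \<psi>) \<in> SI \<and> (AE x in \<mu>. rep (cl \<psi>) x = \<psi> x)"
proof -
  assume "\<psi> \<in> SI"
  then have "\<psi> \<in> cl \<psi>" by (simp add: mem_cl)
  then have "rep (cl \<psi>) \<in> cl \<psi>" unfolding rep_def by (rule someI[of "\<lambda>\<phi>. \<phi> \<in> cl \<psi>"])
  then show ?thesis by (simp add: mem_cl)
qed

abbreviation L where "L \<equiv> L2_space E \<mu>"

lemma carrier_L: "hcarrier L = cl ` SI"
  by (simp add: L2_space_def)

lemma zero_L: "hzero L = cl (\<lambda>_. 0)"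
  by (simp add: L2_space_def)

lemma add_L: "\<psi> \<in> SI \<Longrightarrow> \<phi> \<in> SI \<Longrightarrow> hadd L (cl \<psi>) (cl \<phi>) = cl (\<lambda>x. \<psi> x + \<phi> x)"
  using rep_cl[of \<psi>] rep_cl[of \<phi>] by (auto simp: L2_space_def intro!: cl_eq)

lemma scale_L: "\<psi> \<in> SI \<Longrightarrow> hscale L a (cl \<psi>) = cl (\<lambda>x. sc a (\<psi> x))"
  using rep_cl[of \<psi>] by (auto simp: L2_space_def intro!: cl_eq)

lemma inner_L:
  assumes "\<psi> \<in> SI" "\<phi> \<in> SI"
  shows "hinner L (cl \<psi>) (cl \<phi>) () = (\<integral>x. h x (\<psi> x) (\<phi> x) \<partial>\<mu>)"
proof -
  note r = rep_cl[OF assms(1)] rep_cl[OF assms(2)]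
  have "hinner L (cl \<psi>) (cl \<phi>) () = (\<integral>x. h x (rep (cl \<psi>) x) (rep (cl \<phi>) x) \<partial>\<mu>)" by (simp add: L2_space_def)
  also have "\<dots> = (\<integral>x. h x (\<psi> x) (\<phi> x) \<partial>\<mu>)"
    by (rule integral_cong_AE) (use r SI_h_meas assms in auto)
  finally show ?thesis .
qed

lemma inner_self_L: "\<psi> \<in> SI \<Longrightarrow> hinner L (cl \<psi>) (cl \<psi>) () = of_real (\<integral>x. N x (\<psi> x) \<partial>\<mu>)"
proof -
  assume \<psi>: "\<psi> \<in> SI"
  have "(\<integral>x. h x (\<psi> x) (\<psi> x) \<partial>\<mu>) = (\<integral>x. complex_of_real (N x (\<psi> x)) \<partial>\<mu>)"
    by (rule Bochner_Integration.integral_cong) (use SI_F \<psi> h_self in auto)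
  then show ?thesis using inner_L[OF \<psi> \<psi>] by simp
qed

lemma integral_N_nonneg: "\<psi> \<in> SI \<Longrightarrow> 0 \<le> (\<integral>x. N x (\<psi> x) \<partial>\<mu>)"
  by (rule Bochner_Integration.integral_nonneg_AE) (auto intro!: AE_I2 N_pos SI_F)

lemma norm_L: "\<psi> \<in> SI \<Longrightarrow> hnorm L (cl \<psi>) = sqrt (\<integral>x. N x (\<psi> x) \<partial>\<mu>)"
  unfolding hnorm_def UNIV_unit by (simp add: inner_self_L integral_N_nonneg)

lemma dist_L: "\<psi> \<in> SI \<Longrightarrow> \<phi> \<in> SI \<Longrightarrow> hdist L (cl \<psi>) (cl \<phi>) = sqrt (\<integral>x. N x (\<psi> x + sc (-1) (\<phi> x)) \<partial>\<mu>)"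
  unfolding hdist_def by (simp add: scale_L add_L SI_scale norm_L SI_lin)

lemma nn_integral_N: "\<psi> \<in> SI \<Longrightarrow> (\<integral>\<^sup>+x. ennreal (N x (\<psi> x)) \<partial>\<mu>) = ennreal (\<integral>x. N x (\<psi> x) \<partial>\<mu>)"
  by (rule nn_integral_eq_integral[OF SI_N_int]) (auto intro!: AE_I2 N_pos SI_F)

text \<open>The values lie in different vector spaces at different points, so the pointwise limit is
  formed in coordinates. Almost everywhere convergence of a fast subsequence produces the limit
  section, Fatou's lemma the estimate.\<close>

lemma riesz_fischer:
  assumes \<psi>: "\<And>n::nat. \<psi> n \<in> SI"
    and Cauchy: "\<And>\<epsilon>. \<epsilon> > 0 \<Longrightarrow> \<exists>N0. \<forall>m\<ge>N0. \<forall>n\<ge>N0. (\<integral>x. N x (\<psi> m x + sc (-1) (\<psi> n x)) \<partial>\<mu>) < \<epsilon>"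
  shows "\<exists>\<phi>\<in>SI. \<forall>\<epsilon>>0. \<exists>N0. \<forall>n\<ge>N0. (\<integral>x. N x (\<psi> n x + sc (-1) (\<phi> x)) \<partial>\<mu>) \<le> \<epsilon>"
proof -
  define J where "J m n = (\<integral>x. N x (\<psi> m x + sc (-1) (\<psi> n x)) \<partial>\<mu>)" for m n
  have JI: "(\<lambda>x. \<psi> m x + sc (-1) (\<psi> n x)) \<in> SI" for m n by (rule SI_lin[OF \<psi> \<psi>])
  \<comment> \<open>The rate 1/8 leaves room for the weight \<open>4 ^ n\<close> below: the weighted
    sum still has finite integral, and its finiteness at a point bounds the coordinates of the
    increments by multiples of \<open>(1/2) ^ n\<close>.\<close>
  have "\<forall>n. \<exists>N0. \<forall>m\<ge>N0. \<forall>l\<ge>N0. J m l < (1/8)^n" unfolding J_def by (intro allI Cauchy) simp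
  then obtain N0 where N0: "\<And>n m l. N0 n \<le> m \<Longrightarrow> N0 n \<le> l \<Longrightarrow> J m l < (1/8)^n" by metis
  \<comment> \<open>Partial sums make \<open>k\<close> monotone and at least \<open>N0 n\<close>;
    the summand \<open>n\<close> makes it unbounded.\<close>
  define k where "k n = (\<Sum>i\<le>n. N0 i) + n" for n
  have k: "N0 n \<le> k n" "k n \<le> k (Suc n)" "n \<le> k n" for n
    using member_le_sum[of n "{..n}" N0] by (auto simp: k_def)
  define d where "d n x = \<psi> (k (Suc n)) x + sc (-1) (\<psi> (k n) x)" for n x
  have d: "d n \<in> SI" for n unfolding d_def by (rule JI)
  have dJ: "(\<integral>x. N x (d n x) \<partial>\<mu>) \<le> (1/8)^n" for n
    using N0[of n "k (Suc n)" "k n"] k(1)[of n] k(2)[of n] unfolding J_def d_def by simp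
  define s where "s x = (\<Sum>n. ennreal (4^n * N x (d n x)))" for x
  have smeas: "s \<in> borel_measurable \<mu>" unfolding s_def using SI_N_meas[OF d] by measurable
  have "(\<integral>\<^sup>+x. s x \<partial>\<mu>) = (\<Sum>n. \<integral>\<^sup>+x. ennreal (4^n * N x (d n x)) \<partial>\<mu>)"
    unfolding s_def using SI_N_meas[OF d] by (intro nn_integral_suminf) measurable
  also have "\<dots> \<le> (\<Sum>n. ennreal ((1/2)^n))"
  proof (rule suminf_le)
    fix n
    have "(\<integral>\<^sup>+x. ennreal (4^n * N x (d n x)) \<partial>\<mu>) = ennreal (4^n) * (\<integral>\<^sup>+x. ennreal (N x (d n x)) \<partial>\<mu>)"
      using SI_N_meas[OF d] by (subst nn_integral_cmult[symmetric]) (auto simp: ennreal_mult')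
    also have "\<dots> \<le> ennreal (4^n) * ennreal ((1/8)^n)"
      unfolding nn_integral_N[OF d] using dJ by (intro mult_left_mono ennreal_leI) auto
    also have "\<dots> = ennreal ((1/2)^n)" by (simp flip: ennreal_mult' add: power_mult_distrib[symmetric])
    finally show "(\<integral>\<^sup>+x. ennreal (4^n * N x (d n x)) \<partial>\<mu>) \<le> ennreal ((1/2)^n)" .
  qed auto
  also have "\<dots> = ennreal (\<Sum>n. (1/2)^n)" by (rule suminf_ennreal2) (auto simp: summable_geometric)
  finally have "(\<integral>\<^sup>+x. s x \<partial>\<mu>) \<noteq> \<infinity>" by (auto simp: top_unique)
  then have AEs: "AE x in \<mu>. s x \<noteq> \<infinity>" by (rule nn_integral_PInf_AE[OF smeas])
  define G where "G = {x \<in> space \<mu>. s x \<noteq> \<infinity>}"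
  have G: "G \<in> sets \<mu>" unfolding G_def using smeas by measurable
  have AEG: "AE x in \<mu>. x \<in> G" using AEs by (auto simp: G_def intro: AE_mp)
  have conv: "convergent (\<lambda>n. \<tau> x (\<psi> (k n) x) i)" if x: "x \<in> G" and T: "(U, r, \<tau>) \<in> trivs E" "x \<in> U" for x U r \<tau> i
  proof -
    have xs: "x \<in> space \<mu>" using x by (simp add: G_def)
    have dF: "d n x \<in> F x" "\<psi> n x \<in> F x" for n using SI_F[OF d xs] SI_F[OF \<psi> xs] .
    obtain c where c: "c > 0" "\<And>u i. u \<in> F x \<Longrightarrow> (cmod (\<tau> x u i))\<^sup>2 \<le> c * N x u" using triv_bound[OF T] by blast
    have "s x < \<infinity>" using x by (auto simp: G_def less_top)
    then obtain K where K: "K \<ge> 0" "s x = ennreal K" by (cases "s x") auto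
    have "N x (d n x) \<le> K * (1/4)^n" for n
    proof -
      have "ennreal (4^n * N x (d n x)) \<le> s x"
        unfolding s_def using sum_le_suminf[of "\<lambda>n. ennreal (4^n * N x (d n x))" "{n}"] by simp
      then have "4^n * N x (d n x) \<le> K" using K by simp
      then show ?thesis by (simp add: power_one_over field_simps)
    qed
    then have sq0: "(cmod (\<tau> x (d n x) i))\<^sup>2 \<le> c * (K * (1/4)^n)" for n
      using c(2)[OF dF(1), of n i] c(1) by (meson mult_left_mono order_trans less_imp_le)
    have sq: "(cmod (\<tau> x (d n x) i))\<^sup>2 \<le> (sqrt (c * K) * (1/2)^n)\<^sup>2" for n
    proof -
      have "((1/2 :: real) ^ n)\<^sup>2 = (1/4) ^ n" unfolding power2_eq_square power_mult_distrib[symmetric] by simp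
      then have "(sqrt (c * K) * (1/2)^n)\<^sup>2 = c * (K * (1/4)^n)"
        unfolding power_mult_distrib using c(1) K(1) by simp
      then show ?thesis using sq0[of n] by simp
    qed
    have b: "cmod (\<tau> x (d n x) i) \<le> sqrt (c * K) * (1/2)^n" for n
      by (rule power2_le_imp_le[OF sq]) (use c(1) K(1) in simp)
    have "summable (\<lambda>n. \<tau> x (d n x) i)"
      by (rule summable_comparison_test'[OF summable_mult[OF summable_geometric]]) (use b in auto)
    moreover have "\<tau> x (d n x) i = \<tau> x (\<psi> (k (Suc n)) x) i - \<tau> x (\<psi> (k n) x) i" for n
      unfolding d_def using dF(2) T by (simp add: triv_add triv_scale)
    ultimately have "summable (\<lambda>n. \<tau> x (\<psi> (k (Suc n)) x) i - \<tau> x (\<psi> (k n) x) i)" by simp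
    then have "convergent (\<lambda>n. \<Sum>m<n. \<tau> x (\<psi> (k (Suc m)) x) i - \<tau> x (\<psi> (k m) x) i)"
      by (simp add: summable_iff_convergent)
    then have "convergent (\<lambda>n. (\<tau> x (\<psi> (k n) x) i - \<tau> x (\<psi> (k 0) x) i))"
      by (simp only: sum_lessThan_telescope[of "\<lambda>n. \<tau> x (\<psi> (k n) x) i"])
    then show ?thesis
      using convergent_add[OF _ convergent_const[of "\<tau> x (\<psi> (k 0) x) i"]] by fastforce
  qed
  \<comment> \<open>The limit is taken in one trivialisation; in any other one the coordinates are
    fixed linear combinations of these, so they converge to those of the same vector.\<close>
  have ex: "\<exists>u. u \<in> F x \<and> (\<forall>U r \<tau> i. (U, r, \<tau>) \<in> trivs E \<longrightarrow> x \<in> U \<longrightarrow> (\<lambda>n. \<tau> x (\<psi> (k n) x) i) \<longlonglongrightarrow> \<tau> x u i)" if x: "x \<in> G" for x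
  proof -
    have xs: "x \<in> space \<mu>" using x by (simp add: G_def)
    have \<psi>F: "\<psi> n x \<in> F x" for n using SI_F[OF \<psi> xs] .
    obtain U r \<tau> where T: "(U, r, \<tau>) \<in> trivs E" "x \<in> U" using triv_cover by blast
    define z where "z i = lim (\<lambda>n. \<tau> x (\<psi> (k n) x) i)" for i
    have z: "(\<lambda>n. \<tau> x (\<psi> (k n) x) i) \<longlonglongrightarrow> z i" for i
      using conv[OF x T] unfolding z_def by (simp add: convergent_LIMSEQ_iff)
    have "z i = 0" if "r \<le> i" for i
      using z[of i] triv_off[OF T \<psi>F that] by (simp add: LIMSEQ_const_iff)
    then obtain u where u: "u \<in> F x" "\<tau> x u = z" using triv_surj[OF T] by blast
    have "(\<lambda>n. \<tau>' x (\<psi> (k n) x) i) \<longlonglongrightarrow> \<tau>' x u i" if T': "(U', r', \<tau>') \<in> trivs E" "x \<in> U'" for U' r' \<tau>' i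
    proof -
      have e: "\<tau>' x v i = (\<Sum>j<r. \<tau> x v j * \<tau>' x (local_frame E \<tau> j x) i)" if v: "v \<in> F x" for v
        by (subst frame_expand[OF T v]) (rule triv_sum[OF T'], use frame(1)[OF T] in auto)
      have "(\<lambda>n. \<Sum>j<r. \<tau> x (\<psi> (k n) x) j * \<tau>' x (local_frame E \<tau> j x) i)
          \<longlonglongrightarrow> (\<Sum>j<r. \<tau> x u j * \<tau>' x (local_frame E \<tau> j x) i)"
        unfolding u(2) by (intro tendsto_intros z)
      then show ?thesis by (simp add: e[OF \<psi>F] e[OF u(1)])
    qed
    then show ?thesis using u(1) by blast
  qed
  have "\<exists>f. \<forall>x\<in>G. f x \<in> F x \<and> (\<forall>U r \<tau> i. (U, r, \<tau>) \<in> trivs E \<longrightarrow> x \<in> U \<longrightarrow> (\<lambda>n. \<tau> x (\<psi> (k n) x) i) \<longlonglongrightarrow> \<tau> x (f x) i)"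
    by (rule bchoice, rule ballI, rule ex)
  then obtain \<phi>0 where f: "\<forall>x\<in>G. \<phi>0 x \<in> F x \<and> (\<forall>U r \<tau> i. (U, r, \<tau>) \<in> trivs E \<longrightarrow> x \<in> U \<longrightarrow> (\<lambda>n. \<tau> x (\<psi> (k n) x) i) \<longlonglongrightarrow> \<tau> x (\<phi>0 x) i)"
    by (rule exE)
  have \<phi>0: "\<phi>0 x \<in> F x" "(U, r, \<tau>) \<in> trivs E \<Longrightarrow> x \<in> U \<Longrightarrow> (\<lambda>n. \<tau> x (\<psi> (k n) x) i) \<longlonglongrightarrow> \<tau> x (\<phi>0 x) i"
    if "x \<in> G" for x U r \<tau> i
    using conjunct1[OF bspec[OF f that]] conjunct2[OF bspec[OF f that], rule_format, of U r \<tau> i] by simp_all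
  define \<phi> where "\<phi> x = (if x \<in> G then \<phi>0 x else 0)" for x
  have \<phi>F: "\<phi> x \<in> F x" for x using \<phi>0(1) by (simp add: \<phi>_def)
  have \<phi>meas: "(\<lambda>x. \<tau> x (\<phi> x) i) \<in> borel_measurable (restrict_space \<mu> U)" if T: "(U, r, \<tau>) \<in> trivs E" for U r \<tau> i
  proof (rule borel_measurable_LIMSEQ_metric)
    have "{x \<in> space (restrict_space \<mu> U). x \<in> G} = U \<inter> G" by (auto simp: space_restrict_space G_def)
    then have Gr: "{x \<in> space (restrict_space \<mu> U). x \<in> G} \<in> sets (restrict_space \<mu> U)"
      using G by (auto simp: sets_restrict_space)
    \<comment> \<open>Set to 0 off \<open>G\<close>, where the coordinates need not converge, in
      agreement with the value of \<open>\<phi>\<close> there.\<close>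
    show "(\<lambda>x. if x \<in> G then \<tau> x (\<psi> (k n) x) i else 0) \<in> borel_measurable (restrict_space \<mu> U)" for n
      by (intro measurable_If SI_meas[OF \<psi> T] measurable_const Gr) simp
    show "(\<lambda>n. if x \<in> G then \<tau> x (\<psi> (k n) x) i else 0) \<longlonglongrightarrow> \<tau> x (\<phi> x) i" if "x \<in> space (restrict_space \<mu> U)" for x
      using that \<phi>0(2)[OF _ T] triv_zero[OF T] by (auto simp: \<phi>_def space_restrict_space)
  qed
  have limN: "(\<lambda>m. N x (\<psi> n x + sc (-1) (\<psi> (k m) x))) \<longlonglongrightarrow> N x (\<psi> n x + sc (-1) (\<phi> x))" if x: "x \<in> G" for x n
  proof -
    have xs: "x \<in> space \<mu>" using x by (simp add: G_def)
    have \<psi>F: "\<psi> n x \<in> F x" for n using SI_F[OF \<psi> xs] .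
    obtain U r \<tau> where T: "(U, r, \<tau>) \<in> trivs E" "x \<in> U" using triv_cover by blast
    have e: "N x (\<psi> n x + sc (-1) v) = Re (\<Sum>i<r. \<Sum>j<r. cnj (\<tau> x (\<psi> n x) i - \<tau> x v i) * (\<tau> x (\<psi> n x) j - \<tau> x v j) * gr \<tau> i j x)"
      if v: "v \<in> F x" for v
      unfolding N_def using h_expand[OF T, of "\<psi> n x + sc (-1) v" "\<psi> n x + sc (-1) v"] \<psi>F v T
      by (simp add: triv_add triv_scale)
    have \<phi>x: "\<phi> x = \<phi>0 x" using x by (simp add: \<phi>_def)
    show ?thesis
      unfolding e[OF \<psi>F] e[OF \<phi>F] by (intro tendsto_intros) (use \<phi>0(2)[OF x T] \<phi>x in simp)+
  qed
  have dmeas: "(\<lambda>x. \<tau> x (\<psi> n x + sc (-1) (\<phi> x)) i) \<in> borel_measurable (restrict_space \<mu> U)"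
    if T: "(U, r, \<tau>) \<in> trivs E" for U r \<tau> i n
    by (rule meas_add[OF SI_F[OF \<psi>] SI_meas[OF \<psi> T] \<phi>F \<phi>meas[OF T] T])
  \<comment> \<open>Fatou's lemma along the subsequence \<open>k\<close>.\<close>
  have key: "(\<integral>\<^sup>+x. ennreal (N x (\<psi> n x + sc (-1) (\<phi> x))) \<partial>\<mu>) \<le> ennreal e"
    if e: "e > 0" and n: "\<And>m. m \<ge> M0 \<Longrightarrow> J n m \<le> e" for n e M0
  proof -
    have "(\<integral>\<^sup>+x. ennreal (N x (\<psi> n x + sc (-1) (\<phi> x))) \<partial>\<mu>)
        = (\<integral>\<^sup>+x. liminf (\<lambda>m. ennreal (N x (\<psi> n x + sc (-1) (\<psi> (k m) x)))) \<partial>\<mu>)"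
    proof (rule nn_integral_cong_AE, rule AE_mp[OF AEG], rule AE_I2, rule impI)
      fix x assume "x \<in> G"
      then have "(\<lambda>m. ennreal (N x (\<psi> n x + sc (-1) (\<psi> (k m) x)))) \<longlonglongrightarrow> ennreal (N x (\<psi> n x + sc (-1) (\<phi> x)))"
        by (intro tendsto_ennrealI limN)
      then show "ennreal (N x (\<psi> n x + sc (-1) (\<phi> x))) = liminf (\<lambda>m. ennreal (N x (\<psi> n x + sc (-1) (\<psi> (k m) x))))"
        using lim_imp_Liminf[OF sequentially_bot] by metis
    qed
    also have "\<dots> \<le> liminf (\<lambda>m. \<integral>\<^sup>+x. ennreal (N x (\<psi> n x + sc (-1) (\<psi> (k m) x))) \<partial>\<mu>)"
      using SI_N_meas[OF JI] by (intro nn_integral_liminf) measurable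
    also have "\<dots> = liminf (\<lambda>m. ennreal (J n (k m)))" unfolding J_def nn_integral_N[OF JI] ..
    also have "\<dots> \<le> liminf (\<lambda>m. ennreal e)"
    proof (rule Liminf_mono, rule eventually_sequentiallyI[of M0])
      fix m assume "m \<ge> M0"
      then have "M0 \<le> k m" using k(3)[of m] by simp
      then show "ennreal (J n (k m)) \<le> ennreal e" using n by (intro ennreal_leI)
    qed
    also have "\<dots> = ennreal e" by (rule Liminf_const) simp
    finally show ?thesis .
  qed
  have \<phi>SI: "\<phi> \<in> SI"
  proof -
    obtain M where M: "\<And>m n. m \<ge> M \<Longrightarrow> n \<ge> M \<Longrightarrow> J m n < 1" using Cauchy[of 1] unfolding J_def by auto
    have fin: "(\<integral>\<^sup>+x. ennreal (N x (\<psi> M x + sc (-1) (\<phi> x))) \<partial>\<mu>) \<le> ennreal 1"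
      by (rule key[of 1 M M]) (use M[of M] in \<open>auto intro: less_imp_le\<close>)
    have dSI: "(\<lambda>x. \<psi> M x + sc (-1) (\<phi> x)) \<in> SI"
    proof (rule SI_I)
      show "\<psi> M x + sc (-1) (\<phi> x) \<in> F x" if "x \<in> space \<mu>" for x using SI_F[OF \<psi> that] \<phi>F by simp
      show "(\<lambda>x. \<tau> x (\<psi> M x + sc (-1) (\<phi> x)) i) \<in> borel_measurable (restrict_space \<mu> U)"
        if T: "(U, r, \<tau>) \<in> trivs E" for U r \<tau> i
        by (rule dmeas[OF T])
      show "(\<integral>\<^sup>+x. ennreal (N x (\<psi> M x + sc (-1) (\<phi> x))) \<partial>\<mu>) < \<infinity>"
        by (rule le_less_trans[OF fin]) simp
    qed
    \<comment> \<open>\<open>\<phi>\<close> is recovered by subtracting its difference to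
      \<open>\<psi> M\<close> from \<open>\<psi> M\<close>; both are square integrable.\<close>
    have "(\<lambda>x. \<psi> M x + sc (-1) (\<psi> M x + sc (-1) (\<phi> x))) \<in> SI" by (rule SI_lin[OF \<psi> dSI])
    then show ?thesis by (simp add: vs.scale_right_distrib vs.scale_minus_left)
  qed
  have "\<exists>N0. \<forall>n\<ge>N0. (\<integral>x. N x (\<psi> n x + sc (-1) (\<phi> x)) \<partial>\<mu>) \<le> e" if e: "e > 0" for e
  proof -
    obtain M where M: "\<And>m n. m \<ge> M \<Longrightarrow> n \<ge> M \<Longrightarrow> J m n < e" using Cauchy[OF e] unfolding J_def by auto
    have "(\<integral>x. N x (\<psi> n x + sc (-1) (\<phi> x)) \<partial>\<mu>) \<le> e" if "n \<ge> M" for n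
    proof -
      have "ennreal (\<integral>x. N x (\<psi> n x + sc (-1) (\<phi> x)) \<partial>\<mu>) \<le> ennreal e"
        using key[OF e, of M n] M[OF that] nn_integral_N[OF SI_lin[OF \<psi> \<phi>SI, of n "-1"]] by (simp add: less_imp_le)
      then show ?thesis using e by simp
    qed
    then show ?thesis by blast
  qed
  with \<phi>SI show ?thesis by blast
qed

lemma hilbert_L: "hilbert L"
proof (unfold_locales, goal_cases)
  case 1 show ?case unfolding carrier_L zero_L using SI_zero by blast
next
  case (2 x y) then show ?case unfolding carrier_L using SI_add by (auto simp: add_L)
next
  case (3 a x) then show ?case unfolding carrier_L using SI_scale by (auto simp: scale_L)
next
  case (4 x)
  then obtain \<psi> where \<psi>: "\<psi> \<in> SI" "x = cl \<psi>" unfolding carrier_L by blast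
  have "(\<integral>x. h x (\<psi> x) 0 \<partial>\<mu>) = (\<integral>x. 0 \<partial>\<mu>)"
    by (rule Bochner_Integration.integral_cong) (use SI_F \<psi>(1) h_zero in auto)
  then show ?case unfolding \<psi>(2) zero_L by (simp add: inner_L \<psi>(1) SI_zero)
next
  case (5 x y z)
  then obtain a b c where m: "a \<in> SI" "x = cl a" "b \<in> SI" "y = cl b" "c \<in> SI" "z = cl c" unfolding carrier_L by blast
  have "(\<integral>x. h x (c x) (a x + b x) \<partial>\<mu>) = (\<integral>x. h x (c x) (a x) + h x (c x) (b x) \<partial>\<mu>)"
    by (rule Bochner_Integration.integral_cong) (use SI_F m h_add in auto)
  then show ?case using m by (simp add: add_L inner_L SI_add SI_h_int)
next
  case (6 a x z)
  then obtain b c where m: "b \<in> SI" "x = cl b" "c \<in> SI" "z = cl c" unfolding carrier_L by blast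
  have "(\<integral>x. h x (c x) (sc a (b x)) \<partial>\<mu>) = (\<integral>x. a * h x (c x) (b x) \<partial>\<mu>)"
    by (rule Bochner_Integration.integral_cong) (use SI_F m h_scale in auto)
  then show ?case using m by (simp add: scale_L inner_L SI_scale)
next
  case (7 x y)
  then obtain b c where m: "b \<in> SI" "x = cl b" "c \<in> SI" "y = cl c" unfolding carrier_L by blast
  have "(\<integral>x. h x (b x) (c x) \<partial>\<mu>) = (\<integral>x. cnj (h x (c x) (b x)) \<partial>\<mu>)"
    by (rule Bochner_Integration.integral_cong) (use SI_F m h_sym in blast)+
  then show ?case using m by (simp add: inner_L)
next
  case (8 x)
  then obtain b where m: "b \<in> SI" "x = cl b" unfolding carrier_L by blast
  then show ?case by (simp add: inner_self_L integral_N_nonneg)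
next
  case (9 x y)
  then obtain b c where m: "b \<in> SI" "x = cl b" "c \<in> SI" "y = cl c" unfolding carrier_L by blast
  \<comment> \<open>Equality of two classes is tested against the difference of their
    representatives.\<close>
  define e where "e x = b x + sc (-1) (c x)" for x
  have e: "e \<in> SI" unfolding e_def by (rule SI_lin[OF m(1,3)])
  have "hinner L (cl e) (cl b) () = hinner L (cl e) (cl c) ()"
    using 9(3)[of "cl e"] e m unfolding carrier_L by blast
  then have "(\<integral>x. h x (e x) (b x) \<partial>\<mu>) - (\<integral>x. h x (e x) (c x) \<partial>\<mu>) = 0" using e m by (simp add: inner_L)
  then have "(\<integral>x. h x (e x) (b x) - h x (e x) (c x) \<partial>\<mu>) = 0" using e m by (simp add: SI_h_int)
  moreover have "(\<integral>x. h x (e x) (b x) - h x (e x) (c x) \<partial>\<mu>) = (\<integral>x. h x (e x) (e x) \<partial>\<mu>)"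
  proof (rule Bochner_Integration.integral_cong[OF refl])
    fix x assume "x \<in> space \<mu>"
    then have f: "e x \<in> F x" "b x \<in> F x" "c x \<in> F x" using SI_F e m by auto
    have "h x (e x) (e x) = h x (e x) (b x + sc (-1) (c x))" by (simp add: e_def)
    also have "\<dots> = h x (e x) (b x) - h x (e x) (c x)" using f by (simp add: h_add h_scale)
    finally show "h x (e x) (b x) - h x (e x) (c x) = h x (e x) (e x)" by simp
  qed
  ultimately have "(\<integral>x. N x (e x) \<partial>\<mu>) = 0" using inner_self_L[OF e] inner_L[OF e e] by simp
  then have "AE x in \<mu>. N x (e x) = 0"
    by (subst (asm) integral_nonneg_eq_0_iff_AE[OF SI_N_int[OF e]]) (auto intro!: AE_I2 N_pos SI_F[OF e])
  then have "AE x in \<mu>. b x = c x"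
  proof (rule AE_mp, intro AE_I2 impI)
    fix x assume x: "x \<in> space \<mu>" "N x (e x) = 0"
    then have "e x = 0" using N_eq_0 SI_F[OF e] by blast
    then show "b x = c x" by (simp add: e_def vs.scale_minus_left)
  qed
  then show ?case unfolding m by (rule cl_eq)
next
  case (10 Y)
  have "\<forall>n. \<exists>\<psi>\<in>SI. Y n = cl \<psi>" using 10(1) unfolding carrier_L by blast
  then obtain \<psi> where \<psi>: "\<And>n. \<psi> n \<in> SI" "\<And>n. Y n = cl (\<psi> n)" by metis
  have "\<exists>\<phi>\<in>SI. \<forall>\<epsilon>>0. \<exists>N0. \<forall>n\<ge>N0. (\<integral>x. N x (\<psi> n x + sc (-1) (\<phi> x)) \<partial>\<mu>) \<le> \<epsilon>"
  proof (rule riesz_fischer[OF \<psi>(1)])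
    fix e :: real assume e: "e > 0"
    then obtain N0 where "\<forall>m\<ge>N0. \<forall>n\<ge>N0. hdist L (Y m) (Y n) < sqrt e" using 10(2)[of "sqrt e"] by auto
    then show "\<exists>N0. \<forall>m\<ge>N0. \<forall>n\<ge>N0. (\<integral>x. N x (\<psi> m x + sc (-1) (\<psi> n x)) \<partial>\<mu>) < e"
      by (auto simp: \<psi> dist_L)
  qed
  then obtain \<phi> where \<phi>: "\<phi> \<in> SI" "\<And>e. e > 0 \<Longrightarrow> \<exists>N0. \<forall>n\<ge>N0. (\<integral>x. N x (\<psi> n x + sc (-1) (\<phi> x)) \<partial>\<mu>) \<le> e" by blast
  have "(\<lambda>n. hdist L (Y n) (cl \<phi>)) \<longlonglongrightarrow> 0"
  proof (rule LIMSEQ_I)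
    fix e :: real assume e: "e > 0"
    then obtain N0 where N0: "\<forall>n\<ge>N0. (\<integral>x. N x (\<psi> n x + sc (-1) (\<phi> x)) \<partial>\<mu>) \<le> (e/2)\<^sup>2" using \<phi>(2)[of "(e/2)\<^sup>2"] by auto
    have "norm (hdist L (Y n) (cl \<phi>) - 0) < e" if "n \<ge> N0" for n
    proof -
      have "hdist L (Y n) (cl \<phi>) \<le> sqrt ((e/2)\<^sup>2)"
        unfolding \<psi>(2) dist_L[OF \<psi>(1) \<phi>(1)] using N0 that by (intro real_sqrt_le_mono) blast
      moreover have "0 \<le> hdist L (Y n) (cl \<phi>)"
        unfolding \<psi>(2) dist_L[OF \<psi>(1) \<phi>(1)] by (intro real_sqrt_ge_zero integral_N_nonneg SI_lin \<psi> \<phi>)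
      ultimately show ?thesis using e by simp
    qed
    then show "\<exists>no. \<forall>n\<ge>no. norm (hdist L (Y n) (cl \<phi>) - 0) < e" by blast
  qed
  moreover have "cl \<phi> \<in> hcarrier L" unfolding carrier_L using \<phi>(1) by blast
  ultimately show ?case by blast
qed

end

section \<open>Vertical differential operators\<close>

text \<open>The positive and the negative part define finite measures that agree on the traces of
  open sets, an intersection-stable generator, hence everywhere. The second measure vanishes on the
  set where \<open>f\<close> is positive, and so does the first.\<close>

lemma AE_nonpos_of_open_integrals:
  fixes f :: "'m::topological_space \<Rightarrow> real"
  assumes sets: "sets \<mu> = sets (restrict_space borel X)" and X: "X \<in> sets borel"
    and f: "integrable \<mu> f"
    and zero: "\<And>W. open W \<Longrightarrow> (\<integral>x. f x * indicator W x \<partial>\<mu>) = 0"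
  shows "AE x in \<mu>. f x \<le> 0"
proof -
  define M1 where "M1 = density \<mu> (\<lambda>x. ennreal (f x))"
  define M2 where "M2 = density \<mu> (\<lambda>x. ennreal (- f x))"
  have fm: "f \<in> borel_measurable \<mu>" using f by auto
  have space: "space \<mu> = X" using sets_eq_imp_space_eq[OF sets] by (simp add: space_restrict_space)
  define E where "E = {W \<inter> X | W. open W}"
  have gen: "sets \<mu> = sigma_sets X E"
  proof -
    have "sets \<mu> = (\<inter>) X ` sigma_sets UNIV {S. open S}"
      using sets by (simp add: sets_restrict_space borel_def)
    also have "\<dots> = sigma_sets X ((\<inter>) X ` {S. open S})"
      by (rule sigma_sets_Int) (use X in \<open>auto simp: borel_def\<close>)
    also have "(\<inter>) X ` {S. open S} = E" unfolding E_def by (auto simp: Int_commute)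
    finally show ?thesis .
  qed
  have WX: "W \<inter> X \<in> sets \<mu>" if "open W" for W
    unfolding sets sets_restrict_space by (subst Int_commute) (rule imageI, use that in simp)
  have em: "emeasure (density \<mu> (\<lambda>x. ennreal (s * f x))) (W \<inter> X) = ennreal (\<integral>x. max 0 (s * f x) * indicator W x \<partial>\<mu>)"
    if W: "open W" for s W
  proof -
    have "emeasure (density \<mu> (\<lambda>x. ennreal (s * f x))) (W \<inter> X) = (\<integral>\<^sup>+x. ennreal (s * f x) * indicator (W \<inter> X) x \<partial>\<mu>)"
      by (rule emeasure_density) (use fm WX[OF W] in auto)
    also have "\<dots> = (\<integral>\<^sup>+x. ennreal (max 0 (s * f x) * indicator W x) \<partial>\<mu>)"
      by (rule nn_integral_cong) (auto simp: space indicator_def max_def ennreal_neg)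
    also have "\<dots> = ennreal (\<integral>x. max 0 (s * f x) * indicator W x \<partial>\<mu>)"
    proof (rule nn_integral_eq_integral)
      have m: "(\<lambda>x. indicator W x :: real) \<in> borel_measurable \<mu>"
        using borel_measurable_indicator[OF WX[OF W]]
        by (rule measurable_cong[THEN iffD1, rotated]) (auto simp: space indicator_def)
      show "integrable \<mu> (\<lambda>x. max 0 (s * f x) * indicator W x)"
        by (rule Bochner_Integration.integrable_bound[OF integrable_mult_right[OF f, of s]])
          (use fm m in \<open>auto intro!: AE_I2 simp: indicator_def max_def\<close>)
    qed (auto intro!: AE_I2)
    finally show ?thesis .
  qed
  have int: "integrable \<mu> (\<lambda>x. max 0 (s * f x) * indicator W x)" if W: "open W" for s W
  proof -
    have m: "(\<lambda>x. indicator W x :: real) \<in> borel_measurable \<mu>"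
      using borel_measurable_indicator[OF WX[OF W]]
      by (rule measurable_cong[THEN iffD1, rotated]) (auto simp: space indicator_def)
    show ?thesis
      by (rule Bochner_Integration.integrable_bound[OF integrable_mult_right[OF f, of s]])
        (use fm m in \<open>auto intro!: AE_I2 simp: indicator_def max_def\<close>)
  qed
  have M12: "M1 = M2"
  proof (rule measure_eqI_generator_eq[of E X _ _ "\<lambda>_. X"])
    show "Int_stable E" unfolding Int_stable_def E_def
    proof clarify
      fix W W' :: "'m set" assume "open W" "open W'"
      then show "\<exists>V. W \<inter> X \<inter> (W' \<inter> X) = V \<inter> X \<and> open V" by (intro exI[of _ "W \<inter> W'"]) auto
    qed
    show "E \<subseteq> Pow X" by (auto simp: E_def)
    show "sets M1 = sigma_sets X E" "sets M2 = sigma_sets X E" by (simp_all add: M1_def M2_def gen)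
    show "range (\<lambda>_. X) \<subseteq> E" by (auto simp: E_def intro!: exI[of _ UNIV])
    show "emeasure M1 X \<noteq> \<infinity>" using em[OF open_UNIV, of 1] by (simp add: M1_def)
    fix Y assume "Y \<in> E"
    then obtain W where W: "open W" "Y = W \<inter> X" by (auto simp: E_def)
    have "(\<integral>x. max 0 (1 * f x) * indicator W x \<partial>\<mu>) - (\<integral>x. max 0 (-1 * f x) * indicator W x \<partial>\<mu>)
        = (\<integral>x. max 0 (1 * f x) * indicator W x - max 0 (-1 * f x) * indicator W x \<partial>\<mu>)"
      by (rule Bochner_Integration.integral_diff[symmetric]; rule int[OF W(1)])
    also have "\<dots> = (\<integral>x. f x * indicator W x \<partial>\<mu>)"
      by (rule Bochner_Integration.integral_cong) (auto simp: max_def)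
    finally have "(\<integral>x. max 0 (1 * f x) * indicator W x \<partial>\<mu>) = (\<integral>x. max 0 (-1 * f x) * indicator W x \<partial>\<mu>)"
      using zero[OF W(1)] by simp
    then show "emeasure M1 Y = emeasure M2 Y"
      using em[OF W(1), of 1] em[OF W(1), of "-1"] by (simp add: M1_def M2_def W(2))
  qed auto
  define P where "P = {x \<in> space \<mu>. 0 < f x}"
  have P: "P \<in> sets \<mu>" unfolding P_def using fm by measurable
  have "emeasure M2 P = (\<integral>\<^sup>+x. ennreal (- f x) * indicator P x \<partial>\<mu>)"
    unfolding M2_def by (rule emeasure_density) (use fm P in auto)
  also have "\<dots> = (\<integral>\<^sup>+x. 0 \<partial>\<mu>)"
    by (rule nn_integral_cong) (auto simp: P_def indicator_def ennreal_neg)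
  finally have "emeasure M1 P = 0" using M12 by simp
  then have "(\<integral>\<^sup>+x. ennreal (f x) * indicator P x \<partial>\<mu>) = 0"
    unfolding M1_def by (subst (asm) emeasure_density) (use fm P in auto)
  then have "AE x in \<mu>. ennreal (f x) * indicator P x = 0"
    by (subst (asm) nn_integral_0_iff_AE) (use fm P in auto)
  then show ?thesis
    by (rule AE_mp) (auto intro!: AE_I2 simp: P_def indicator_def ennreal_eq_0_iff split: if_splits)
qed

text \<open>Four instances of the real case: plus and minus the real and the imaginary part.\<close>

lemma AE_zero_of_open_integrals:
  fixes f :: "'m::topological_space \<Rightarrow> complex"
  assumes sets: "sets \<mu> = sets (restrict_space borel X)" and X: "X \<in> sets borel"
    and f: "integrable \<mu> f"
    and zero: "\<And>W. open W \<Longrightarrow> (\<integral>x. f x * indicator W x \<partial>\<mu>) = 0"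
  shows "AE x in \<mu>. f x = 0"
proof -
  have space: "space \<mu> = X" using sets_eq_imp_space_eq[OF sets] by (simp add: space_restrict_space)
  have WX: "W \<inter> X \<in> sets \<mu>" if "open W" for W
    unfolding sets sets_restrict_space by (subst Int_commute) (rule imageI, use that in simp)
  have i: "integrable \<mu> (\<lambda>x. f x * indicator W x)" if W: "open W" for W
  proof -
    have m: "(\<lambda>x. indicator W x :: complex) \<in> borel_measurable \<mu>"
      using borel_measurable_indicator[OF WX[OF W]]
      by (rule measurable_cong[THEN iffD1, rotated]) (auto simp: space indicator_def)
    show ?thesis
      by (rule Bochner_Integration.integrable_bound[OF f])
        (use f m in \<open>auto intro!: AE_I2 simp: indicator_def\<close>)
  qed
  have R: "AE x in \<mu>. L (f x) \<le> 0" if L: "bounded_linear (L :: complex \<Rightarrow> real)" for L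
  proof (rule AE_nonpos_of_open_integrals[OF sets X])
    show "integrable \<mu> (\<lambda>x. L (f x))" by (rule integrable_bounded_linear[OF L f])
    fix W :: "'m set" assume W: "open W"
    have "(\<integral>x. L (f x) * indicator W x \<partial>\<mu>) = (\<integral>x. L (f x * indicator W x) \<partial>\<mu>)"
      by (rule Bochner_Integration.integral_cong) (auto simp: indicator_def linear_0[OF bounded_linear.linear[OF L]])
    also have "\<dots> = L (\<integral>x. f x * indicator W x \<partial>\<mu>)" by (rule integral_bounded_linear[OF L i[OF W]])
    finally show "(\<integral>x. L (f x) * indicator W x \<partial>\<mu>) = 0"
      using zero[OF W] by (simp add: linear_0[OF bounded_linear.linear[OF L]])
  qed
  note n = bounded_linear_minus
  show ?thesis
    using R[OF bounded_linear_Re] R[OF bounded_linear_Im] R[OF n[OF bounded_linear_Re]] R[OF n[OF bounded_linear_Im]]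
    by eventually_elim (simp add: complex_eq_iff)
qed

lemma (in hilbert) dst_scale_diff: "x \<in> C \<Longrightarrow> dst (hscale H a x) (hscale H c x) = cmod (a - c) * nrm x"
proof -
  assume x: "x \<in> C"
  then have "sub (hscale H a x) (hscale H c x) = hscale H (a - c) x"
    by (intro inner_ext) (simp_all add: hilb_simps algebra_simps)
  with x show ?thesis by (simp add: dst_eq nrm_scale)
qed

section \<open>Smooth sections and their cutoffs\<close>

context hermitian
begin

abbreviation \<Gamma> where "\<Gamma> \<equiv> smooth_sections A UNIV E"
abbreviation \<Gamma>c where "\<Gamma>c \<equiv> compact_sections A UNIV E"

lemma sec_F: "s \<in> \<Gamma> \<Longrightarrow> s x \<in> F x"
  by (simp add: smooth_sections_def)

lemma sec_smooth: "s \<in> \<Gamma> \<Longrightarrow> (U, r, \<tau>) \<in> trivs E \<Longrightarrow> smooth_fun A U (\<lambda>x. \<tau> x (s x) i)"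
  unfolding smooth_sections_def by auto

lemma sec_I:
  assumes "\<And>x. s x \<in> F x" "\<And>U r \<tau> i. (U, r, \<tau>) \<in> trivs E \<Longrightarrow> smooth_fun A U (\<lambda>x. \<tau> x (s x) i)"
  shows "s \<in> \<Gamma>"
  using assms unfolding smooth_sections_def by auto

lemma sec_mult:
  assumes s: "s \<in> \<Gamma>" and f: "smooth_fun A UNIV (f :: 'm \<Rightarrow> complex)"
  shows "(\<lambda>x. sc (f x) (s x)) \<in> \<Gamma>"
proof (rule sec_I)
  show "sc (f x) (s x) \<in> F x" for x using sec_F[OF s] by simp
  fix U r \<tau> i assume T: "(U, r, \<tau>) \<in> trivs E"
  have "smooth_fun A U (\<lambda>x. f x * \<tau> x (s x) i)"
    by (intro smooth_fun_mult[OF triv(1)[OF T]] smooth_fun_subset[OF f subset_UNIV] sec_smooth[OF s T])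
  then show "smooth_fun A U (\<lambda>x. \<tau> x (sc (f x) (s x)) i)"
    by (rule smooth_fun_cong[OF triv(1)[OF T], rotated]) (simp add: triv_scale[OF T] sec_F[OF s])
qed

lemma sec_lin:
  assumes s: "s \<in> \<Gamma>" "t \<in> \<Gamma>"
  shows "(\<lambda>x. s x + sc a (t x)) \<in> \<Gamma>"
proof (rule sec_I)
  show "s x + sc a (t x) \<in> F x" for x using sec_F s by simp
  fix U r \<tau> i assume T: "(U, r, \<tau>) \<in> trivs E"
  have "smooth_fun A U (\<lambda>x. \<tau> x (s x) i + a * \<tau> x (t x) i)"
    by (intro smooth_fun_add[OF triv(1)[OF T]] smooth_fun_mult[OF triv(1)[OF T]] smooth_fun_const sec_smooth[OF _ T] s)
  then show "smooth_fun A U (\<lambda>x. \<tau> x (s x + sc a (t x)) i)"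
    by (rule smooth_fun_cong[OF triv(1)[OF T], rotated]) (simp add: triv_add[OF T] triv_scale[OF T] sec_F s)
qed

lemma sec_zero: "(\<lambda>_. 0) \<in> \<Gamma>"
proof (rule sec_I)
  fix U r \<tau> i assume T: "(U, r, \<tau>) \<in> trivs E"
  show "smooth_fun A U (\<lambda>x. \<tau> x 0 i)"
    by (rule smooth_fun_cong[OF triv(1)[OF T] _ smooth_fun_const[of _ 0]]) (simp add: triv_zero[OF T])
qed simp

lemma csec_iff: "s \<in> \<Gamma>c \<longleftrightarrow> s \<in> \<Gamma> \<and> (\<exists>K. compact K \<and> (\<forall>x. x \<notin> K \<longrightarrow> s x = 0))"
  by (simp add: compact_sections_def Ball_def)

lemma csec_lin:
  assumes "s \<in> \<Gamma>c" "t \<in> \<Gamma>c" shows "(\<lambda>x. s x + sc a (t x)) \<in> \<Gamma>c"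
proof -
  obtain K where K: "compact K" "\<forall>x. x \<notin> K \<longrightarrow> s x = 0" using assms csec_iff by blast
  obtain K' where K': "compact K'" "\<forall>x. x \<notin> K' \<longrightarrow> t x = 0" using assms csec_iff by blast
  have "compact (K \<union> K')" "\<forall>x. x \<notin> K \<union> K' \<longrightarrow> s x + sc a (t x) = 0" using K K' by auto
  then show ?thesis using sec_lin assms unfolding csec_iff by blast
qed

lemma csec_zero: "(\<lambda>_. 0) \<in> \<Gamma>c"
  unfolding csec_iff using sec_zero compact_empty by auto

lemma csec_add: "s \<in> \<Gamma>c \<Longrightarrow> t \<in> \<Gamma>c \<Longrightarrow> (\<lambda>x. s x + t x) \<in> \<Gamma>c"
  using csec_lin[of s t 1] by simp

lemma csec_scale: "t \<in> \<Gamma>c \<Longrightarrow> (\<lambda>x. sc a (t x)) \<in> \<Gamma>c"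
  using csec_lin[OF csec_zero, of t a] by simp

lemma csec_mult:
  assumes "s \<in> \<Gamma>c" "smooth_fun A UNIV (f :: 'm \<Rightarrow> complex)" shows "(\<lambda>x. sc (f x) (s x)) \<in> \<Gamma>c"
proof -
  obtain K where K: "compact K" "\<forall>x. x \<notin> K \<longrightarrow> s x = 0" using assms csec_iff by blast
  then have "\<forall>x. x \<notin> K \<longrightarrow> sc (f x) (s x) = 0" by simp
  then show ?thesis using K(1) sec_mult assms unfolding csec_iff by blast
qed

lemma sec_cutoff:
  assumes s: "s \<in> \<Gamma>" and \<eta>: "bump W V \<eta>"
  shows "(\<lambda>x. sc (of_real (\<eta> x)) (s x)) \<in> \<Gamma>c"
proof -
  obtain K where K: "compact K" "K \<subseteq> W" "\<forall>z. z \<notin> K \<longrightarrow> \<eta> z = 0" using bumpD(7)[OF \<eta>] by blast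
  have "smooth_fun A UNIV (\<lambda>x. complex_of_real (\<eta> x))"
    by (rule smooth_fun_linear[OF open_UNIV bounded_linear_of_real bumpD(1)[OF \<eta>]])
  then have "(\<lambda>x. sc (of_real (\<eta> x)) (s x)) \<in> \<Gamma>" by (rule sec_mult[OF s])
  moreover have "\<forall>x. x \<notin> K \<longrightarrow> sc (of_real (\<eta> x)) (s x) = 0" using K(3) by simp
  ultimately show ?thesis using K(1) unfolding csec_iff by blast
qed

text \<open>Cut off and extended by zero, a local frame vector becomes a global test section; such
  sections serve both for density in the fibres and for the form of \<open>D\<close> at a
  point.\<close>

definition frame_sec where
  "frame_sec U \<tau> j \<eta> x = (if x \<in> U then sc (complex_of_real (\<eta> x)) (local_frame E \<tau> j x) else 0)"

lemma frame_sec: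
  assumes T: "(U, r, \<tau>) \<in> trivs E" "j < r" and \<eta>: "bump U V \<eta>"
  shows "frame_sec U \<tau> j \<eta> \<in> \<Gamma>c"
proof -
  obtain K where K: "compact K" "K \<subseteq> U" "\<forall>z. z \<notin> K \<longrightarrow> \<eta> z = 0" using bumpD(7)[OF \<eta>] by blast
  have oK: "open (- K)" using compact_imp_closed[OF K(1)] by (simp add: open_Compl)
  have z: "frame_sec U \<tau> j \<eta> x = 0" if "x \<notin> K" for x using K(3) that by (simp add: frame_sec_def)
  have "frame_sec U \<tau> j \<eta> \<in> \<Gamma>"
  proof (rule sec_I)
    show "frame_sec U \<tau> j \<eta> x \<in> F x" for x unfolding frame_sec_def using frame(1)[OF T(1) _ T(2)] by simp
    fix U' r' \<tau>' i assume T': "(U', r', \<tau>') \<in> trivs E"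
    have o: "open (U \<inter> U')" using triv(1)[OF T(1)] triv(1)[OF T'] by blast
    have "smooth_fun A (U \<inter> U') (\<lambda>x. complex_of_real (\<eta> x) * \<tau>' x (local_frame E \<tau> j x) i)"
      by (intro smooth_fun_mult[OF o] smooth_fun_linear[OF o bounded_linear_of_real] triv(5)[OF T(1) T' T(2)]
          smooth_fun_subset[OF bumpD(1)[OF \<eta>] subset_UNIV])
    then have 1: "smooth_fun A (U \<inter> U') (\<lambda>x. \<tau>' x (frame_sec U \<tau> j \<eta> x) i)"
      by (rule smooth_fun_cong[OF o, rotated]) (simp add: frame_sec_def triv_scale[OF T'] frame(1)[OF T(1) _ T(2)])
    have o2: "open (- K \<inter> U')" using oK triv(1)[OF T'] by blast
    have 2: "smooth_fun A (- K \<inter> U') (\<lambda>x. \<tau>' x (frame_sec U \<tau> j \<eta> x) i)"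
      by (rule smooth_fun_cong[OF o2 _ smooth_fun_const[of _ 0]]) (simp add: z triv_zero[OF T'])
    have "(U \<inter> U') \<union> (- K \<inter> U') = U'" using K(2) by blast
    then show "smooth_fun A U' (\<lambda>x. \<tau>' x (frame_sec U \<tau> j \<eta> x) i)" using smooth_fun_Un[OF o o2 1 2] by simp
  qed
  then show ?thesis using K(1) z unfolding csec_iff by blast
qed

lemma h_continuous:
  assumes s: "s \<in> \<Gamma>" "t \<in> \<Gamma>"
  shows "continuous_on UNIV (\<lambda>x. h x (s x) (t x))"
proof (intro continuous_at_imp_continuous_on ballI)
  fix x
  obtain U r \<tau> where T: "(U, r, \<tau>) \<in> trivs E" "x \<in> U" using triv_cover by blast
  have U: "open U" by (rule triv(1)[OF T(1)])
  have c: "continuous_on U (\<lambda>x. \<tau> x (s x) i)" if "s \<in> \<Gamma>" for s i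
    by (rule smooth_fun_continuous[OF sec_smooth[OF that T(1)] U])
  have "continuous_on U (\<lambda>x. \<Sum>i<r. \<Sum>j<r. cnj (\<tau> x (s x) i) * \<tau> x (t x) j * gr \<tau> i j x)"
    by (intro continuous_on_sum continuous_on_mult continuous_on_cnj c s gr_continuous[OF T(1)]) auto
  then have "continuous_on U (\<lambda>x. h x (s x) (t x))"
    by (subst continuous_on_cong[OF refl h_expand[OF T(1)]]) (use sec_F s in auto)
  then show "isCont (\<lambda>x. h x (s x) (t x)) x" using U T(2) by (simp add: continuous_on_eq_continuous_at)
qed

lemma N_continuous: "s \<in> \<Gamma> \<Longrightarrow> continuous_on UNIV (\<lambda>x. N x (s x))"
  unfolding N_def by (intro continuous_on_Re h_continuous)

end

locale vertical_operator = hermitian A E + vertical_submersion A A' \<pi> g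
  for A :: "('m::{t2_space,second_countable_topology}, 'f::real_inner \<times> 'e::real_inner) chart set"
    and A' :: "('b::{t2_space,second_countable_topology}, 'e) chart set" and \<pi> :: "'m \<Rightarrow> 'b"
    and g :: "'m \<Rightarrow> 'm tangent \<Rightarrow> 'm tangent \<Rightarrow> real" and E :: "('m, 'v::ab_group_add) vbundle" +
  fixes D :: "('m \<Rightarrow> 'v) \<Rightarrow> 'm \<Rightarrow> 'v"
  assumes vdo: "vertical_diffop A A' \<pi> E D"
    and symD: "symmetric_op A E (fibre_volume A A' \<pi> g) D"
begin

sublocale L2: hermitian_L2 A E "vol b" "\<pi> -` {b}" for b
  by unfold_locales (simp add: sets_vol fibm_def)

lemma fibre_borel: "\<pi> -` {b} \<in> sets borel"
proof -
  have "closed (\<pi> -` {b})" using continuous_closed_vimage[OF _ continuous_pi[unfolded continuous_on_eq_continuous_at[OF open_UNIV], rule_format]] by simp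
  then show ?thesis by simp
qed

lemma sec_meas:
  assumes "s \<in> \<Gamma>" "(U, r, \<tau>) \<in> trivs E"
  shows "(\<lambda>x. \<tau> x (s x) i) \<in> borel_measurable (restrict_space (vol b) U)"
  by (rule L2.continuous_meas[OF triv(1)[OF assms(2)] smooth_fun_continuous[OF sec_smooth[OF assms] triv(1)[OF assms(2)]]])

lemma csec_L2:
  assumes s: "s \<in> \<Gamma>c"
  shows "s \<in> L2.SI b"
    and "\<exists>I. continuous_on UNIV I \<and> (\<forall>b. 0 \<le> I b \<and> (\<integral>\<^sup>+x. ennreal (N x (s x)) \<partial>vol b) = ennreal (I b))"
proof -
  have s': "s \<in> \<Gamma>" using s csec_iff by blast
  obtain K where K: "compact K" "\<forall>x. x \<notin> K \<longrightarrow> s x = 0" using s csec_iff by blast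
  show ex: "\<exists>I. continuous_on UNIV I \<and> (\<forall>b. 0 \<le> I b \<and> (\<integral>\<^sup>+x. ennreal (N x (s x)) \<partial>vol b) = ennreal (I b))"
    by (rule vol_continuous[OF N_continuous[OF s'] N_pos[OF sec_F[OF s']] K(1)]) (use K(2) in simp)
  show "s \<in> L2.SI b"
    by (rule L2.SI_I) (use ex sec_F[OF s'] sec_meas[OF s'] in auto)
qed

lemma csec_norm_continuous:
  assumes s: "s \<in> \<Gamma>c"
  shows "continuous_on UNIV (\<lambda>b. hnorm (L2.L b) (L2.cl b s))"
proof -
  obtain I where I: "continuous_on UNIV I" "\<And>b. 0 \<le> I b" "\<And>b. (\<integral>\<^sup>+x. ennreal (N x (s x)) \<partial>vol b) = ennreal (I b)"
    using csec_L2(2)[OF s] by blast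
  have "hnorm (L2.L b) (L2.cl b s) = sqrt (I b)" for b
  proof -
    have "ennreal (\<integral>x. N x (s x) \<partial>vol b) = ennreal (I b)"
      using L2.nn_integral_N[OF csec_L2(1)[OF s, of b]] I(3)[of b] by simp
    then have "(\<integral>x. N x (s x) \<partial>vol b) = I b"
      using I(2) L2.integral_N_nonneg[OF csec_L2(1)[OF s, of b]] by simp
    then show ?thesis using L2.norm_L[OF csec_L2(1)[OF s, of b]] by simp
  qed
  then show ?thesis using continuous_on_real_sqrt[OF I(1)] by simp
qed

section \<open>Locality of the operator along the fibres\<close>

lemma D_sec:
  assumes "s \<in> \<Gamma>" shows "D s \<in> \<Gamma>"
proof -
  have "\<forall>s\<in>\<Gamma>. D s \<in> \<Gamma>"
    using vdo unfolding vertical_diffop_def first_order_diffop_def by (elim conjE)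
  then show ?thesis using assms by (rule bspec)
qed

lemma D_mult:
  "s \<in> \<Gamma> \<Longrightarrow> smooth_fun A' UNIV (f :: 'b \<Rightarrow> complex) \<Longrightarrow> D (\<lambda>y. sc (f (\<pi> y)) (s y)) x = sc (f (\<pi> x)) (D s x)"
  using vdo unfolding vertical_diffop_def by blast

abbreviation lc where "lc c \<tau> s l \<equiv> (\<lambda>y. \<tau> (chart_inv c y) (s (chart_inv c y)) l)"

lemma D_formula:
  assumes c: "c \<in> A" and T: "(U, r, \<tau>) \<in> trivs E"
  shows "\<exists>Bs a b. \<forall>s\<in>\<Gamma>. \<forall>x\<in>fst c \<inter> U. \<forall>k<r. \<tau> x (D s x) k =
    (\<Sum>l<r. (\<Sum>e\<in>Bs. (a k l e x :: complex) * frechet_derivative (lc c \<tau> s l) (at (snd c x)) e) + b k l x * \<tau> x (s x) l)"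
proof -
  have "\<forall>c\<in>A. \<forall>(V, r, \<tau>)\<in>trivs E. \<exists>Bs a b. finite Bs \<and>
        (\<forall>k<r. \<forall>l<r. (\<forall>e\<in>Bs. smooth_fun A (fst c \<inter> V) (a k l e)) \<and>
                     smooth_fun A (fst c \<inter> V) (b k l)) \<and>
        (\<forall>s\<in>\<Gamma>. \<forall>x\<in>fst c \<inter> V. \<forall>k<r.
           \<tau> x (D s x) k =
             (\<Sum>l<r. (\<Sum>e\<in>Bs. (a k l e x :: complex) * frechet_derivative (lc c \<tau> s l) (at (snd c x)) e)
               + b k l x * \<tau> x (s x) l))"
    using vdo unfolding vertical_diffop_def first_order_diffop_def by (elim conjE)
  from bspec[OF bspec[OF this c] T, unfolded prod.case]
  show ?thesis by (elim exE conjE, intro exI)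
qed

lemma lc_derivative:
  assumes "c \<in> smooth_charts A" "x \<in> fst c" "(U, r, \<tau>) \<in> trivs E" "x \<in> U" "s \<in> \<Gamma>"
  shows "(lc c \<tau> s l has_derivative frechet_derivative (lc c \<tau> s l) (at (snd c x))) (at (snd c x))"
proof -
  have "smooth_on (snd c ` (fst c \<inter> U)) ((\<lambda>x. \<tau> x (s x) l) \<circ> chart_inv c)"
    by (rule smooth_fun_chart[OF sec_smooth[OF assms(5,3)] triv(1)[OF assms(3)] assms(1)])
  then have "smooth_on (snd c ` (fst c \<inter> U)) (lc c \<tau> s l)" by (simp add: o_def)
  then show ?thesis by (rule smooth_on_has_derivative) (use assms in blast)
qed

lemma lc_lin_derivative:
  assumes c: "c \<in> A" "x \<in> fst c" and T: "(U, r, \<tau>) \<in> trivs E" "x \<in> U" and s: "s \<in> \<Gamma>" "t \<in> \<Gamma>"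
  shows "frechet_derivative (lc c \<tau> (\<lambda>x. s x + sc a (t x)) l) (at (snd c x)) e
    = frechet_derivative (lc c \<tau> s l) (at (snd c x)) e + a * frechet_derivative (lc c \<tau> t l) (at (snd c x)) e"
proof -
  have ic: "is_chart c" by (rule atlas_chart[OF c(1)])
  note cf = chart_facts[OF ic]
  note d = lc_derivative[OF atlas_smooth_charts[OF c(1)] c(2) T]
  have "((\<lambda>y. lc c \<tau> s l y + a * lc c \<tau> t l y) has_derivative (\<lambda>e. frechet_derivative (lc c \<tau> s l) (at (snd c x)) e
      + a * frechet_derivative (lc c \<tau> t l) (at (snd c x)) e)) (at (snd c x))"
    by (intro has_derivative_add has_derivative_mult_right d s)
  then have "(lc c \<tau> (\<lambda>x. s x + sc a (t x)) l has_derivative (\<lambda>e. frechet_derivative (lc c \<tau> s l) (at (snd c x)) e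
      + a * frechet_derivative (lc c \<tau> t l) (at (snd c x)) e)) (at (snd c x))"
  proof (rule has_derivative_transform_within_open[OF _ chart_image_open[OF ic triv(1)[OF T(1)]]])
    show "snd c x \<in> snd c ` (fst c \<inter> U)" using c T by blast
    fix y assume "y \<in> snd c ` (fst c \<inter> U)"
    then have "chart_inv c y \<in> U" using cf(6) by auto
    then show "lc c \<tau> s l y + a * lc c \<tau> t l y = lc c \<tau> (\<lambda>x. s x + sc a (t x)) l y"
      by (simp add: triv_add[OF T(1)] triv_scale[OF T(1)] sec_F s)
  qed
  from frechet_derivative_at[OF this, symmetric] show ?thesis by simp
qed

text \<open>Linearity is read off from the local coordinate formula, as both sides are determined by
  their components in a trivialisation.\<close>

lemma D_lin:
  assumes s: "s \<in> \<Gamma>" "t \<in> \<Gamma>"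
  shows "D (\<lambda>x. s x + sc a (t x)) x = D s x + sc a (D t x)"
proof -
  obtain c where c: "c \<in> A" "x \<in> fst c" using atlas_cover by blast
  obtain U r \<tau> where T: "(U, r, \<tau>) \<in> trivs E" "x \<in> U" using triv_cover by blast
  obtain Bs co cb where f0: "\<forall>s\<in>\<Gamma>. \<forall>x\<in>fst c \<inter> U. \<forall>k<r. \<tau> x (D s x) k =
    (\<Sum>l<r. (\<Sum>e\<in>Bs. (co k l e x :: complex) * frechet_derivative (lc c \<tau> s l) (at (snd c x)) e) + cb k l x * \<tau> x (s x) l)"
    using D_formula[OF c(1) T(1)] by (elim exE) (rule that)
  note f = f0[rule_format, OF _ IntI]
  have F: "D s x \<in> F x" "D t x \<in> F x" "D (\<lambda>x. s x + sc a (t x)) x \<in> F x"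
    using sec_F D_sec sec_lin s by blast+
  show ?thesis
  proof (rule triv_inj[OF T])
    fix k
    show "\<tau> x (D (\<lambda>x. s x + sc a (t x)) x) k = \<tau> x (D s x + sc a (D t x)) k"
    proof (cases "k < r")
      case True
      have "\<tau> x (D (\<lambda>x. s x + sc a (t x)) x) k
          = (\<Sum>l<r. ((\<Sum>e\<in>Bs. co k l e x * frechet_derivative (lc c \<tau> s l) (at (snd c x)) e) + cb k l x * \<tau> x (s x) l)
             + a * ((\<Sum>e\<in>Bs. co k l e x * frechet_derivative (lc c \<tau> t l) (at (snd c x)) e) + cb k l x * \<tau> x (t x) l))"
        unfolding f[OF sec_lin[OF s] c(2) T(2) True] lc_lin_derivative[OF c T s]
        by (simp add: triv_add[OF T] triv_scale[OF T] sec_F s sum.distrib sum_distrib_left algebra_simps)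
      also have "\<dots> = \<tau> x (D s x) k + a * \<tau> x (D t x) k"
        unfolding f[OF s(1) c(2) T(2) True] f[OF s(2) c(2) T(2) True] by (simp add: sum.distrib sum_distrib_left distrib_left)
      finally show ?thesis using F by (simp add: triv_add[OF T] triv_scale[OF T])
    next
      case False
      then show ?thesis using F triv_off[OF T] by simp
    qed
  qed (use F in simp_all)
qed

text \<open>
  \<open>D t\<close> at \<open>x\<close> is compared with \<open>D ((H \<circ> \<pi>) e\<^sub>l)\<close> for a frame section \<open>e\<^sub>l\<close> and a function
  \<open>H\<close> vanishing at \<open>\<pi> x\<close> with the same derivative as the component \<open>l\<close> of \<open>t\<close>.
\<close>

lemma D_vertical:
  assumes t: "t \<in> \<Gamma>" and W: "open W" "x \<in> W" and zero: "\<And>y. y \<in> W \<Longrightarrow> \<pi> y = \<pi> x \<Longrightarrow> t y = 0"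
  shows "D t x = 0"
proof -
  obtain c where c: "c \<in> A" "x \<in> fst c" using atlas_cover by blast
  have ic: "is_chart c" by (rule atlas_chart[OF c(1)])
  note cf = chart_facts[OF ic]
  obtain U r \<tau> where T: "(U, r, \<tau>) \<in> trivs E" "x \<in> U" using triv_cover by blast
  obtain Bs co cb where f0: "\<forall>s\<in>\<Gamma>. \<forall>x\<in>fst c \<inter> U. \<forall>k<r. \<tau> x (D s x) k =
    (\<Sum>l<r. (\<Sum>e\<in>Bs. (co k l e x :: complex) * frechet_derivative (lc c \<tau> s l) (at (snd c x)) e) + cb k l x * \<tau> x (s x) l)"
    using D_formula[OF c(1) T(1)] by (elim exE) (rule that)
  note f = f0[rule_format, OF _ IntI]
  obtain c' where c': "c' \<in> submersion_charts A A' \<pi>" "x \<in> fst c'" using submersion_chart_exists by blast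
  note cs' = submersion_chartD[OF c'(1)]
  note cf' = chart_facts[OF cs'(2)]
  obtain d where d: "d \<in> smooth_charts A'" "\<pi> ` fst c' \<subseteq> fst d" "\<forall>x\<in>fst c'. snd (snd c' x) = snd d (\<pi> x)"
    using cs'(3) by blast
  note sl = fibre_chart_facts[OF cs'(1) d]
  define b where "b = \<pi> x"
  define p where "p = snd c x"
  define q where "q = snd c' x"
  have bd: "b \<in> fst d" using d(2) c'(2) by (auto simp: b_def)
  have q2: "snd q = snd d b" using bspec[OF d(3) c'(2)] by (simp add: q_def b_def)
  define tr where "tr = (\<lambda>y. snd c' (chart_inv c y))"
  have trp: "tr p = q" using cf(6)[OF c(2)] by (simp add: tr_def p_def q_def)
  have "smooth_on (snd c ` (fst c \<inter> fst c')) (snd c' \<circ> chart_inv c)"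
    by (rule smooth_fun_chart[OF smooth_fun_chart_map[OF cs'(1)] cf'(1) atlas_smooth_charts[OF c(1)]])
  then have "smooth_on (snd c ` (fst c \<inter> fst c')) tr" by (simp add: tr_def o_def)
  then have R: "(tr has_derivative frechet_derivative tr (at p)) (at p)"
    by (rule smooth_on_has_derivative) (use c c' in \<open>auto simp: p_def\<close>)
  let ?R = "frechet_derivative tr (at p)"
  have opc: "open (snd c ` (fst c \<inter> fst c'))" "p \<in> snd c ` (fst c \<inter> fst c')"
    using chart_image_open[OF ic cf'(1)] c c' by (auto simp: p_def)
  have zero_sum: "(\<Sum>e\<in>Bs. co k l e x * frechet_derivative (lc c \<tau> t l) (at p) e) = 0" if kl: "k < r" "l < r" for k l
  proof -
    define \<Lambda>0 where "\<Lambda>0 = frechet_derivative (lc c' \<tau> t l) (at q)"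
    have \<Lambda>0: "(lc c' \<tau> t l has_derivative \<Lambda>0) (at q)"
      unfolding \<Lambda>0_def q_def by (rule lc_derivative[OF cs'(1) c'(2) T t])
    \<comment> \<open>\<open>t\<close> vanishes on the fibre near \<open>x\<close>, so the
      derivative of its components vanishes in the fibre directions.\<close>
    have vert: "\<Lambda>0 (v, 0) = 0" for v
    proof -
      have i: "((\<lambda>y. (y, snd q)) has_derivative (\<lambda>v. (v, 0))) (at (fst q))"
        by (intro has_derivative_Pair has_derivative_ident has_derivative_const)
      have 1: "((\<lambda>y. lc c' \<tau> t l (y, snd q)) has_derivative (\<lambda>v. \<Lambda>0 (v, 0))) (at (fst q))"
        by (rule has_derivative_compose[OF i]) (use \<Lambda>0 in simp)
      let ?O = "(\<lambda>y. (y, snd q)) -` (snd c' ` (fst c' \<inter> (U \<inter> W)))"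
      have oU: "open (U \<inter> W)" using triv(1)[OF T(1)] W(1) by blast
      have O: "open ?O"
        by (rule open_vimage[OF chart_image_open[OF cs'(2) oU]]) (intro continuous_intros)
      have "q \<in> snd c' ` (fst c' \<inter> (U \<inter> W))" using c'(2) T(2) W(2) by (auto simp: q_def)
      then have fq: "fst q \<in> ?O" by simp
      have "((\<lambda>y. 0 :: complex) has_derivative (\<lambda>v. 0)) (at (fst q))" by (rule has_derivative_const)
      then have 2: "((\<lambda>y. lc c' \<tau> t l (y, snd q)) has_derivative (\<lambda>v. 0)) (at (fst q))"
      proof (rule has_derivative_transform_within_open[OF _ O fq])
        fix y assume y: "y \<in> ?O"
        then have m: "(y, snd q) \<in> snd c' ` fst c'" "chart_inv c' (y, snd q) \<in> U" "chart_inv c' (y, snd q) \<in> W"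
          using chart_mem_image[OF cs'(2), of "(y, snd q)" "U \<inter> W"] by auto
        have "\<pi> (chart_inv c' (y, snd q)) = \<pi> x" using sl(2)[OF bd, of y] m(1) unfolding q2 by (simp add: b_def)
        then have "t (chart_inv c' (y, snd q)) = 0" using zero m(3) by blast
        then show "0 = lc c' \<tau> t l (y, snd q)" using triv_zero[OF T(1) m(2)] by simp
      qed
      show ?thesis using has_derivative_unique[OF 1 2] by metis
    qed
    define \<Lambda> where "\<Lambda> w = \<Lambda>0 (0, w)" for w
    have lin0: "bounded_linear \<Lambda>0" using \<Lambda>0 has_derivative_bounded_linear by blast
    have \<Lambda>: "bounded_linear \<Lambda>" unfolding \<Lambda>_def
      by (rule bounded_linear_compose[OF lin0]) (intro bounded_linear_Pair bounded_linear_zero bounded_linear_ident)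
    \<comment> \<open>Only the base component of a direction matters, so at \<open>x\<close> the
      derivative is that of a function pulled back from the base.\<close>
    have \<Lambda>0_eq: "\<Lambda>0 v = \<Lambda> (snd v)" for v
    proof -
      have "\<Lambda>0 v = \<Lambda>0 ((fst v, 0) + (0, snd v))" by simp
      also have "\<dots> = \<Lambda>0 (fst v, 0) + \<Lambda>0 (0, snd v)" by (rule linear_add[OF bounded_linear.linear[OF lin0]])
      finally show ?thesis by (simp add: vert \<Lambda>_def)
    qed
    have "((\<lambda>y. lc c' \<tau> t l (tr y)) has_derivative (\<lambda>e. \<Lambda>0 (?R e))) (at p)"
      by (rule has_derivative_compose[OF R]) (use \<Lambda>0 trp in simp)
    then have "(lc c \<tau> t l has_derivative (\<lambda>e. \<Lambda>0 (?R e))) (at p)"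
    proof (rule has_derivative_transform_within_open[OF _ opc])
      fix y assume "y \<in> snd c ` (fst c \<inter> fst c')"
      then have "chart_inv c y \<in> fst c'" using cf(6) by auto
      then show "lc c' \<tau> t l (tr y) = lc c \<tau> t l y" using cf'(6) by (simp add: tr_def)
    qed
    then have e1: "frechet_derivative (lc c \<tau> t l) (at p) e = \<Lambda> (snd (?R e))" for e
      using frechet_derivative_at \<Lambda>0_eq by metis
    obtain Hf where Hf: "smooth_fun A' UNIV Hf" "Hf b = 0"
      "\<exists>V. open V \<and> b \<in> V \<and> V \<subseteq> fst d \<and> (\<forall>z\<in>V. Hf z = \<Lambda> (snd d z - snd d b))"
      using base_function[OF d(1) bd \<Lambda>] by metis
    obtain V where V: "open V" "b \<in> V" "\<And>z. z \<in> V \<Longrightarrow> Hf z = \<Lambda> (snd d z - snd d b)" using Hf(3) by blast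
    obtain V' \<eta> where \<eta>: "bump U V' \<eta>" "x \<in> V'" using point_bump[OF triv(1)[OF T(1)] T(2)] by blast
    define s where "s = frame_sec U \<tau> l \<eta>"
    have s: "s \<in> \<Gamma>" using frame_sec[OF T(1) kl(2) \<eta>(1)] csec_iff by (simp add: s_def)
    define s' where "s' = (\<lambda>y. sc (Hf (\<pi> y)) (s y))"
    have s': "s' \<in> \<Gamma>" unfolding s'_def
      by (rule sec_mult[OF s]) (use smooth_compose_pi[OF open_UNIV Hf(1)] in simp)
    \<comment> \<open>By linearity over functions on the base, and since \<open>Hf\<close> vanishes
      at \<open>b\<close>.\<close>
    have "D s' x = 0" unfolding s'_def D_mult[OF s Hf(1)] using Hf(2) by (simp add: b_def)
    then have D0: "\<tau> x (D s' x) k = 0" using triv_zero[OF T] by simp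
    have s'x: "s' x = 0" using Hf(2) by (simp add: s'_def b_def)
    let ?O = "snd c ` (fst c \<inter> (fst c' \<inter> (V' \<inter> U \<inter> \<pi> -` V)))"
    have O: "open ?O" "p \<in> ?O"
    proof -
      have "open (fst c' \<inter> (V' \<inter> U \<inter> \<pi> -` V))"
        using cf'(1) bumpD(4)[OF \<eta>(1)] triv(1)[OF T(1)] open_preimage[OF V(1)] by blast
      then show "open ?O" by (rule chart_image_open[OF ic])
      show "p \<in> ?O" using c c' \<eta>(2) T(2) V(2) by (auto simp: p_def b_def)
    qed
    have fd': "frechet_derivative (lc c \<tau> s' l') (at p) e = (if l' = l then \<Lambda> (snd (?R e)) else 0)" for l' e
    proof -
      have "((\<lambda>y. tr y - q) has_derivative (\<lambda>e. ?R e - 0)) (at p)"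
        by (intro has_derivative_diff R has_derivative_const)
      then have "((\<lambda>y. \<Lambda> (snd (tr y - q))) has_derivative (\<lambda>e. \<Lambda> (snd (?R e - 0)))) (at p)"
        by (intro bounded_linear.has_derivative[OF \<Lambda>] has_derivative_snd)
      then have d0: "((\<lambda>y. \<Lambda> (snd (tr y - q))) has_derivative (\<lambda>e. \<Lambda> (snd (?R e)))) (at p)" by simp
      have "((\<lambda>y. if l' = l then \<Lambda> (snd (tr y - q)) else 0) has_derivative (\<lambda>e. if l' = l then \<Lambda> (snd (?R e)) else 0)) (at p)"
        using d0 by (cases "l' = l") simp_all
      then have "(lc c \<tau> s' l' has_derivative (\<lambda>e. if l' = l then \<Lambda> (snd (?R e)) else 0)) (at p)"
      proof (rule has_derivative_transform_within_open[OF _ O])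
        fix y assume "y \<in> ?O"
        then obtain z where z: "z \<in> fst c" "z \<in> fst c'" "z \<in> V'" "z \<in> U" "\<pi> z \<in> V" "y = snd c z" by blast
        have zy: "chart_inv c y = z" using cf(6)[OF z(1)] z(6) by simp
        have sz: "s z = local_frame E \<tau> l z" using bumpD(5)[OF \<eta>(1) z(3)] z(4) by (simp add: s_def frame_sec_def)
        have "lc c \<tau> s' l' y = Hf (\<pi> z) * (if l' = l then 1 else 0)"
          unfolding zy s'_def sz by (simp add: triv_scale[OF T(1) z(4)] frame[OF T(1) z(4) kl(2)])
        also have "Hf (\<pi> z) = \<Lambda> (snd d (\<pi> z) - snd d b)" by (rule V(3)[OF z(5)])
        also have "snd d (\<pi> z) - snd d b = snd (tr y - q)" using bspec[OF d(3) z(2)] q2 by (simp add: tr_def zy)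
        finally show "(if l' = l then \<Lambda> (snd (tr y - q)) else 0) = lc c \<tau> s' l' y" by simp
      qed
      then show ?thesis by (rule frechet_derivative_at[THEN sym, THEN fun_cong])
    qed
    \<comment> \<open>\<open>s'\<close> vanishes at \<open>x\<close> and only its component
      \<open>l\<close> has a derivative there, so the local formula for \<open>s'\<close> reduces to
      the sum that occurs for \<open>t\<close>.\<close>
    have "0 = (\<Sum>l'<r. (\<Sum>e\<in>Bs. co k l' e x * frechet_derivative (lc c \<tau> s' l') (at p) e) + cb k l' x * \<tau> x (s' x) l')"
      using f[OF s' c(2) T(2) kl(1)] D0 by (simp add: p_def)
    also have "\<dots> = (\<Sum>l'<r. if l' = l then (\<Sum>e\<in>Bs. co k l e x * \<Lambda> (snd (?R e))) else 0)"
      unfolding fd' s'x using triv_zero[OF T] by (intro sum.cong) auto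
    also have "\<dots> = (\<Sum>e\<in>Bs. co k l e x * \<Lambda> (snd (?R e)))" using kl(2) by simp
    finally show ?thesis by (simp add: e1)
  qed
  have tx: "t x = 0" by (rule zero[OF W(2) refl])
  show ?thesis
  proof (rule triv_inj[OF T])
    fix k
    show "\<tau> x (D t x) k = \<tau> x 0 k"
    proof (cases "k < r")
      case True
      then show ?thesis
        using f[OF t c(2) T(2) True] zero_sum[OF True] tx triv_zero[OF T] by (simp add: p_def)
    next
      case False
      then show ?thesis using triv_off[OF T] sec_F D_sec t triv_zero[OF T] by simp
    qed
  qed (use sec_F D_sec t in auto)
qed

lemma D_csec:
  assumes s: "s \<in> \<Gamma>c" shows "D s \<in> \<Gamma>c"
proof -
  have s': "s \<in> \<Gamma>" using s csec_iff by blast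
  obtain K where K: "compact K" "\<forall>x. x \<notin> K \<longrightarrow> s x = 0" using s csec_iff by blast
  have oK: "open (- K)" using compact_imp_closed[OF K(1)] by (simp add: open_Compl)
  have "D s x = 0" if "x \<notin> K" for x
    by (rule D_vertical[OF s' oK]) (use that K(2) in auto)
  then show ?thesis using K(1) D_sec[OF s'] csec_iff by blast
qed

text \<open>Makes the choice of the extension in \<open>fibre_op\<close> immaterial: the difference
  of two extensions vanishes on the fibre, and \<open>D_vertical\<close> applies to it.\<close>

lemma D_fibre:
  assumes s: "s \<in> \<Gamma>" "t \<in> \<Gamma>" and eq: "\<And>y. \<pi> y = \<pi> x \<Longrightarrow> s y = t y"
  shows "D s x = D t x"
proof -
  have l: "(\<lambda>x. s x + sc (-1) (t x)) \<in> \<Gamma>" by (rule sec_lin[OF s])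
  have "D (\<lambda>x. s x + sc (-1) (t x)) x = 0"
    by (rule D_vertical[OF l open_UNIV]) (use eq in \<open>auto simp: vs.scale_minus_left\<close>)
  then have "D s x + sc (-1) (D t x) = 0" using D_lin[OF s] by simp
  then show ?thesis by (simp add: vs.scale_minus_left)
qed

section \<open>Restriction to a fibre\<close>

lemma fibre_section:
  assumes s: "s \<in> \<Gamma>c"
  shows "s \<in> compact_sections (fibre_atlas A A' \<pi> b) (\<pi> -` {b}) E"
proof -
  have s': "s \<in> \<Gamma>" using s csec_iff by blast
  obtain K where K: "compact K" "\<forall>x. x \<notin> K \<longrightarrow> s x = 0" using s csec_iff by blast
  have cl: "closed (\<pi> -` {b})" using continuous_closed_vimage[OF _ continuous_pi[unfolded continuous_on_eq_continuous_at[OF open_UNIV], rule_format]] by simp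
  have "smooth_fun (fibre_atlas A A' \<pi> b) (U \<inter> \<pi> -` {b}) (\<lambda>x. \<tau> x (s x) i)" if T: "(U, r, \<tau>) \<in> trivs E" for U r \<tau> i
    unfolding smooth_fun_def
  proof
    fix cb assume "cb \<in> fibre_atlas A A' \<pi> b"
    then obtain c where c: "c \<in> submersion_charts A A' \<pi>" "cb = fibre_chart \<pi> b c" by (auto simp: fibre_atlas_def)
    note cs = submersion_chartD[OF c(1)]
    note cf = chart_facts[OF cs(2)]
    obtain d where d: "d \<in> smooth_charts A'" "\<pi> ` fst c \<subseteq> fst d" "\<forall>x\<in>fst c. snd (snd c x) = snd d (\<pi> x)"
      using cs(3) by blast
    note sl = fibre_chart_facts[OF cs(1) d]
    have im: "snd cb ` (fst cb \<inter> (U \<inter> \<pi> -` {b})) = (fst \<circ> snd c) ` (fst c \<inter> \<pi> -` {b} \<inter> U)"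
      unfolding c(2) fibre_chart_def fst_conv snd_conv by (rule arg_cong[where f = "image _"]) blast
    show "smooth_on (snd cb ` (fst cb \<inter> (U \<inter> \<pi> -` {b}))) ((\<lambda>x. \<tau> x (s x) i) \<circ> chart_inv cb)"
    proof (cases "b \<in> fst d")
      case True
      let ?e = "snd d b" and ?S = "(fst \<circ> snd c) ` (fst c \<inter> \<pi> -` {b} \<inter> U)"
      have S: "?S = (\<lambda>y. (y, ?e)) -` (snd c ` (fst c \<inter> U))"
      proof (rule set_eqI)
        show "y \<in> ?S \<longleftrightarrow> y \<in> (\<lambda>y. (y, ?e)) -` (snd c ` (fst c \<inter> U))" for y
          unfolding vimage_eq[of y "\<lambda>y. (y, ?e)"] sl(1)[OF True] chart_mem_image[OF cs(2)] by (rule refl)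
      qed
      have oS: "open ?S" unfolding S
        by (rule open_vimage[OF chart_image_open[OF cs(2) triv(1)[OF T]]]) (intro continuous_intros)
      have "smooth_on ?S (\<lambda>y. ((\<lambda>x. \<tau> x (s x) i) \<circ> chart_inv c) (y, ?e))"
      proof (rule smooth_on_compose[OF fd oS, where g="\<lambda>y. (y, ?e)" and V="snd c ` (fst c \<inter> U)" and f="(\<lambda>x. \<tau> x (s x) i) \<circ> chart_inv c"])
        show "(\<lambda>y. (y, ?e)) ` ?S \<subseteq> snd c ` (fst c \<inter> U)" unfolding S by blast
        show "smooth_on (snd c ` (fst c \<inter> U)) ((\<lambda>x. \<tau> x (s x) i) \<circ> chart_inv c)"
          by (rule smooth_fun_chart[OF sec_smooth[OF s' T] triv(1)[OF T] cs(1)])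
        show "smooth_on ?S (\<lambda>y. (y, ?e))"
          by (intro smooth_on_Pair oS smooth_on_const smooth_on_linear[OF bounded_linear_ident])
      qed
      then have "smooth_on ?S ((\<lambda>x. \<tau> x (s x) i) \<circ> chart_inv cb)"
      proof (rule smooth_on_cong[OF oS, rotated])
        fix y assume "y \<in> ?S"
        then have "(y, ?e) \<in> snd c ` fst c" unfolding S by blast
        then show "((\<lambda>x. \<tau> x (s x) i) \<circ> chart_inv c) (y, ?e) = ((\<lambda>x. \<tau> x (s x) i) \<circ> chart_inv cb) y"
          using sl(3)[OF True] by (simp add: c(2))
      qed
      then show ?thesis unfolding im .
    next
      case False
      \<comment> \<open>The chart misses the fibre, so the smoothness claim is about the empty
        set.\<close>
      then show ?thesis unfolding im sl(4)[OF False] by (simp add: smooth_on_def) (rule allI, rule Ck_on_local, simp)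
    qed
  qed
  then have "s \<in> smooth_sections (fibre_atlas A A' \<pi> b) (\<pi> -` {b}) E"
    unfolding smooth_sections_def using sec_F[OF s'] by auto
  moreover have "compact (K \<inter> \<pi> -` {b})" by (rule compact_Int_closed[OF K(1) cl])
  ultimately show ?thesis unfolding compact_sections_def using K(2)
    by (intro CollectI conjI exI[of _ "K \<inter> \<pi> -` {b}"]) auto
qed

lemma cl_cong_fibre: "(\<And>x. \<pi> x = b \<Longrightarrow> s x = t x) \<Longrightarrow> L2.cl b s = L2.cl b t"
  by (rule L2.cl_eq) (auto intro!: AE_I2 simp: space_vol)

text \<open>An extension of a compactly supported section of the fibre can be cut off by a function
  equal to 1 on the support. This changes neither the restriction nor, by \<open>D_fibre\<close>,
  the value of \<open>D\<close> over \<open>b\<close>, so the fibre operator is generated by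
  restrictions of global compactly supported sections.\<close>

lemma fibre_op_eq:
  "fibre_op A A' \<pi> E vol D b = op_closure (L2.L b)
     {(L2.cl b \<phi>, L2.cl b (D \<phi>)) | \<phi>. \<phi> \<in> \<Gamma>c}"
proof -
  have "{(L2.cl b s, L2.cl b (D t)) | s t.
        s \<in> compact_sections (fibre_atlas A A' \<pi> b) (\<pi> -` {b}) E \<and>
        t \<in> \<Gamma> \<and> (\<forall>x\<in>\<pi> -` {b}. t x = s x)}
      = {(L2.cl b \<phi>, L2.cl b (D \<phi>)) | \<phi>. \<phi> \<in> \<Gamma>c}" (is "?L = ?R")
  proof (intro equalityI subsetI)
    fix z assume "z \<in> ?L"
    then obtain s t where z: "z = (L2.cl b s, L2.cl b (D t))"
      and s: "s \<in> compact_sections (fibre_atlas A A' \<pi> b) (\<pi> -` {b}) E"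
      and t: "t \<in> \<Gamma>" "\<And>x. \<pi> x = b \<Longrightarrow> t x = s x" by auto
    obtain K where K: "compact K" "K \<subseteq> \<pi> -` {b}" "\<And>x. \<pi> x = b \<Longrightarrow> x \<notin> K \<Longrightarrow> s x = 0"
      using s unfolding compact_sections_def by auto
    obtain V \<eta> where \<eta>: "bump UNIV V \<eta>" "K \<subseteq> V" using compact_bump[OF K(1) subset_UNIV open_UNIV] by blast
    define \<phi> where "\<phi> = (\<lambda>x. sc (complex_of_real (\<eta> x)) (t x))"
    have \<phi>: "\<phi> \<in> \<Gamma>c" unfolding \<phi>_def by (rule sec_cutoff[OF t(1) \<eta>(1)])
    have eq: "\<phi> x = t x" if "\<pi> x = b" for x
    proof (cases "x \<in> K")
      case True
      then have "\<eta> x = 1" using \<eta>(2) bumpD(5)[OF \<eta>(1)] by blast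
      then show ?thesis by (simp add: \<phi>_def)
    next
      case False
      then have "t x = 0" using K(3)[OF that False] t(2)[OF that] by simp
      then show ?thesis by (simp add: \<phi>_def)
    qed
    have \<phi>': "\<phi> \<in> \<Gamma>" using \<phi> csec_iff by blast
    have "L2.cl b s = L2.cl b \<phi>"
      by (rule cl_cong_fibre) (simp add: eq t(2))
    moreover have "L2.cl b (D t) = L2.cl b (D \<phi>)"
      by (rule cl_cong_fibre, rule D_fibre[OF t(1) \<phi>']) (simp add: eq)
    ultimately show "z \<in> ?R" using z \<phi> by blast
  next
    fix z assume "z \<in> ?R"
    then obtain \<phi> where z: "z = (L2.cl b \<phi>, L2.cl b (D \<phi>))" "\<phi> \<in> \<Gamma>c" by blast
    have "\<phi> \<in> \<Gamma>" using z(2) csec_iff by blast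
    then show "z \<in> ?L" using z fibre_section[OF z(2), of b] by blast
  qed
  then show ?thesis unfolding fibre_op_def by simp
qed

lemma smooth_approx:
  fixes f :: "'b \<Rightarrow> complex"
  assumes f: "continuous_on UNIV f" and K: "compact K" and e: "e > 0"
  obtains f' where "smooth_fun A' UNIV f'" "\<And>b. b \<in> K \<Longrightarrow> cmod (f b - f' b) < e"
proof -
  \<comment> \<open>Cutoffs on the base separate points, so Stone-Weierstrass applies to the ring of
    smooth functions on \<open>K\<close>; real and imaginary parts are treated separately.\<close>
  interpret R: function_ring_on "{h :: 'b \<Rightarrow> real. smooth_fun A' UNIV h}" K
  proof
    fix x y :: 'b assume "x \<noteq> y"
    then have "open (- {y})" "x \<in> - {y}" by auto
    then obtain V \<eta> where \<eta>: "B.bump (- {y}) V \<eta>" "x \<in> V" using B.point_bump by blast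
    then have "\<eta> x = 1" "\<eta> y = 0" using B.bumpD(5)[OF \<eta>(1)] B.bumpD(6)[OF \<eta>(1), of y] by auto
    then have "\<eta> x \<noteq> \<eta> y" by simp
    show "\<exists>f\<in>{h :: 'b \<Rightarrow> real. smooth_fun A' UNIV h}. f x \<noteq> f y" by (rule bexI[of _ \<eta>]) (use B.bumpD(1)[OF \<eta>(1)] \<open>\<eta> x \<noteq> \<eta> y\<close> in simp_all)
  qed (auto intro: K continuous_on_subset[OF B.smooth_fun_continuous[OF _ open_UNIV]] B.smooth_fun_const
        B.smooth_fun_add[OF open_UNIV] B.smooth_fun_mult[OF open_UNIV])
  have "continuous_on K (\<lambda>b. Re (f b))" "continuous_on K (\<lambda>b. Im (f b))"
    by (intro continuous_intros continuous_on_subset[OF f subset_UNIV])+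
  then obtain u v where u: "smooth_fun A' UNIV u" "\<forall>b\<in>K. \<bar>Re (f b) - u b\<bar> < e / 2"
    and v: "smooth_fun A' UNIV v" "\<forall>b\<in>K. \<bar>Im (f b) - v b\<bar> < e / 2"
    using R.Stone_Weierstrass_basic[of "\<lambda>b. Re (f b)" "e/2"] R.Stone_Weierstrass_basic[of "\<lambda>b. Im (f b)" "e/2"] e by auto
  define f' where "f' b = complex_of_real (u b) + \<i> * complex_of_real (v b)" for b
  have "smooth_fun A' UNIV f'" unfolding f'_def
    by (intro B.smooth_fun_add[OF open_UNIV] B.smooth_fun_mult[OF open_UNIV] B.smooth_fun_const
        B.smooth_fun_linear[OF open_UNIV bounded_linear_of_real] u v)
  moreover have "cmod (f b - f' b) < e" if "b \<in> K" for b
  proof -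
    have "cmod (f b - f' b) \<le> \<bar>Re (f b - f' b)\<bar> + \<bar>Im (f b - f' b)\<bar>" by (rule cmod_le)
    then show ?thesis using u(2) v(2) that by (fastforce simp: f'_def)
  qed
  ultimately show thesis using that by blast
qed

text \<open>Cut off frames may be multiplied by smooth functions approaching the indicator of any
  open set, so the pairing of \<open>\<psi>\<close> with each frame vanishes almost everywhere.
  Countably many frames cover the manifold, and a vector orthogonal to a frame is zero.\<close>

lemma csec_dense:
  assumes \<psi>: "\<psi> \<in> L2.SI b"
    and orth: "\<And>\<phi>. \<phi> \<in> \<Gamma>c \<Longrightarrow> (\<integral>x. h x (\<phi> x) (\<psi> x) \<partial>vol b) = 0"
  shows "AE x in vol b. \<psi> x = 0"
proof -
  define R where "R p \<longleftrightarrow> fst (fst p) \<in> trivs E \<and> bump (fst (fst (fst p))) (snd p) (snd (fst p))"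
    for p :: "(('m set \<times> nat \<times> ('m \<Rightarrow> 'v \<Rightarrow> nat \<Rightarrow> complex)) \<times> ('m \<Rightarrow> real)) \<times> 'm set"
  have ex: "\<exists>p. R p \<and> open (snd p) \<and> x \<in> snd p" if "x \<in> UNIV" for x
  proof -
    obtain U r \<tau> where T: "(U, r, \<tau>) \<in> trivs E" "x \<in> U" using triv_cover by blast
    obtain V \<eta> where \<eta>: "bump U V \<eta>" "x \<in> V" using point_bump[OF triv(1)[OF T(1)] T(2)] by blast
    then have "R (((U, r, \<tau>), \<eta>), V)" using T by (simp add: R_def)
    then show ?thesis using \<eta>(2) bumpD(4)[OF \<eta>(1)] by (intro exI[of _ "(((U, r, \<tau>), \<eta>), V)"]) simp
  qed
  obtain P where P0: "(\<forall>n::nat. R (P n) \<and> open (snd (P n))) \<and> UNIV \<subseteq> (\<Union>n. snd (P n))"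
    using lindelof_sequence[where S=snd and P=R, OF ex UNIV_not_empty] by (rule exE)
  define U where "U n = fst (fst (fst (P n)))" for n
  define r where "r n = fst (snd (fst (fst (P n))))" for n
  define \<tau> where "\<tau> n = snd (snd (fst (fst (P n))))" for n
  define \<eta> where "\<eta> n = snd (fst (P n))" for n
  define V where "V n = snd (P n)" for n
  have T: "(U n, r n, \<tau> n) \<in> trivs E" and \<eta>: "bump (U n) (V n) (\<eta> n)" for n
    using P0 by (simp_all add: R_def U_def r_def \<tau>_def \<eta>_def V_def)
  have cov: "\<exists>n. x \<in> V n" for x using P0 by (auto simp: V_def)
  have VU: "V n \<subseteq> U n" for n
  proof
    fix x assume "x \<in> V n"
    then have "\<eta> n x = 1" using bumpD(5)[OF \<eta>] by blast
    then show "x \<in> U n" using bumpD(6)[OF \<eta>, of x n] by (cases "x \<in> U n") auto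
  qed
  have "AE x in vol b. x \<in> V n \<longrightarrow> h x (local_frame E (\<tau> n) j x) (\<psi> x) = 0" if j: "j < r n" for n j
  proof -
    define s where "s = frame_sec (U n) (\<tau> n) j (\<eta> n)"
    have s: "s \<in> \<Gamma>c" unfolding s_def by (rule frame_sec[OF T j \<eta>])
    have sF: "s x \<in> F x" for x using s csec_iff sec_F by blast
    have int: "integrable (vol b) (\<lambda>x. h x (s x) (\<psi> x))" by (rule L2.SI_h_int[OF csec_L2(1)[OF s] \<psi>])
    have "AE x in vol b. h x (s x) (\<psi> x) = 0"
    proof (rule AE_zero_of_open_integrals[OF L2.sets_mu fibre_borel int])
      fix W :: "'m set" assume W: "open W"
      obtain \<theta> :: "nat \<Rightarrow> 'm \<Rightarrow> real" where \<theta>: "\<And>m. smooth_fun A UNIV (\<theta> m)" "\<And>m z. 0 \<le> \<theta> m z" "\<And>m z. \<theta> m z \<le> 1"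
        "\<And>z. (\<lambda>m. \<theta> m z) \<longlonglongrightarrow> indicator W z" using open_set_indicator_limit[OF W] by metis
      have z: "(\<integral>x. h x (s x) (\<psi> x) * complex_of_real (\<theta> m x) \<partial>vol b) = 0" for m
      proof -
        have "smooth_fun A UNIV (\<lambda>x. complex_of_real (\<theta> m x))"
          by (rule smooth_fun_linear[OF open_UNIV bounded_linear_of_real \<theta>(1)])
        then have c: "(\<lambda>x. sc (complex_of_real (\<theta> m x)) (s x)) \<in> \<Gamma>c" by (rule csec_mult[OF s])
        have "(\<integral>x. h x (s x) (\<psi> x) * complex_of_real (\<theta> m x) \<partial>vol b) = (\<integral>x. h x (sc (complex_of_real (\<theta> m x)) (s x)) (\<psi> x) \<partial>vol b)"
          by (rule Bochner_Integration.integral_cong) (use L2.SI_F[OF \<psi>] sF in \<open>auto simp: h_scale_left\<close>)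
        then show ?thesis using orth[OF c] by simp
      qed
      have cm: "(\<lambda>x. complex_of_real (\<theta> m x)) \<in> borel_measurable (vol b)" for m
      proof -
        have "continuous_on UNIV (\<lambda>x. complex_of_real (\<theta> m x))"
          by (intro continuous_intros smooth_fun_continuous[OF \<theta>(1) open_UNIV])
        from L2.continuous_meas[OF open_UNIV this, of b] show ?thesis by simp
      qed
      \<comment> \<open>Since \<open>\<theta> m\<close> lies between 0 and 1, the integrand without
        the cutoff dominates, and \<open>\<theta> m\<close> may be replaced by the indicator of
        \<open>W\<close>.\<close>
      have "(\<lambda>m. \<integral>x. h x (s x) (\<psi> x) * complex_of_real (\<theta> m x) \<partial>vol b) \<longlonglongrightarrow> (\<integral>x. h x (s x) (\<psi> x) * complex_of_real (indicator W x) \<partial>vol b)"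
      proof (rule integral_dominated_convergence[where s="\<lambda>m x. h x (s x) (\<psi> x) * complex_of_real (\<theta> m x)" and w="\<lambda>x. norm (h x (s x) (\<psi> x))"])
        show "(\<lambda>x. h x (s x) (\<psi> x) * complex_of_real (\<theta> m x)) \<in> borel_measurable (vol b)" for m
          using int cm by (intro borel_measurable_times) auto
        show lim: "AE x in vol b. (\<lambda>m. h x (s x) (\<psi> x) * complex_of_real (\<theta> m x)) \<longlonglongrightarrow> h x (s x) (\<psi> x) * complex_of_real (indicator W x)"
          by (rule AE_I2) (intro tendsto_intros \<theta>(4))
        show "(\<lambda>x. h x (s x) (\<psi> x) * complex_of_real (indicator W x)) \<in> borel_measurable (vol b)"
        proof (rule borel_measurable_LIMSEQ_metric[where f="\<lambda>m x. h x (s x) (\<psi> x) * complex_of_real (\<theta> m x)"])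
          show "(\<lambda>x. h x (s x) (\<psi> x) * complex_of_real (\<theta> m x)) \<in> borel_measurable (vol b)" for m
            using int cm by (intro borel_measurable_times) auto
        qed (intro tendsto_intros \<theta>(4))
        show "integrable (vol b) (\<lambda>x. norm (h x (s x) (\<psi> x)))" using int by (rule integrable_norm)
        show "AE x in vol b. norm (h x (s x) (\<psi> x) * complex_of_real (\<theta> m x)) \<le> norm (h x (s x) (\<psi> x))" for m
          using \<theta>(2,3) by (intro AE_I2) (simp add: norm_mult mult_left_le)
      qed
      then have "(\<integral>x. h x (s x) (\<psi> x) * complex_of_real (indicator W x) \<partial>vol b) = 0"
        unfolding z by (simp add: LIMSEQ_const_iff)
      moreover have "complex_of_real (indicator W x) = indicator W x" for x by (simp add: indicator_def)
      ultimately show "(\<integral>x. h x (s x) (\<psi> x) * indicator W x \<partial>vol b) = 0" by simp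
    qed
    then show ?thesis
    proof (rule AE_mp, intro AE_I2 impI)
      fix x assume "h x (s x) (\<psi> x) = 0" "x \<in> V n"
      moreover have "s x = local_frame E (\<tau> n) j x"
        using bumpD(5)[OF \<eta> \<open>x \<in> V n\<close>] VU \<open>x \<in> V n\<close> by (auto simp: s_def frame_sec_def)
      ultimately show "h x (local_frame E (\<tau> n) j x) (\<psi> x) = 0" by simp
    qed
  qed
  then have "AE x in vol b. \<forall>n. \<forall>j\<in>{..<r n}. x \<in> V n \<longrightarrow> h x (local_frame E (\<tau> n) j x) (\<psi> x) = 0"
    unfolding AE_all_countable by (intro allI AE_ball_countable') auto
  then show ?thesis
  proof (rule AE_mp, intro AE_I2 impI)
    fix x assume x: "x \<in> space (vol b)" and o: "\<forall>n. \<forall>j\<in>{..<r n}. x \<in> V n \<longrightarrow> h x (local_frame E (\<tau> n) j x) (\<psi> x) = 0"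
    obtain n where n: "x \<in> V n" using cov by blast
    then have xU: "x \<in> U n" using VU by blast
    have F: "\<psi> x \<in> F x" by (rule L2.SI_F[OF \<psi> x])
    have fr: "local_frame E (\<tau> n) j x \<in> F x" if "j \<in> {..<r n}" for j using frame(1)[OF T xU] that by simp
    have "h x (\<psi> x) (\<psi> x) = h x (\<Sum>j<r n. sc (\<tau> n x (\<psi> x) j) (local_frame E (\<tau> n) j x)) (\<psi> x)"
      using frame_expand[OF T xU F] by simp
    also have "\<dots> = (\<Sum>j<r n. cnj (\<tau> n x (\<psi> x) j) * h x (local_frame E (\<tau> n) j x) (\<psi> x))" by (rule h_sum_left[OF F fr])
    also have "\<dots> = 0" using o n by (intro sum.neutral) simp
    finally show "\<psi> x = 0" using N_eq_0[OF F] by (simp add: N_def)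
  qed
qed

section \<open>The family as a field of Hilbert spaces\<close>

definition D_graph where "D_graph = {(field_class E vol \<phi>, field_class E vol (D \<phi>)) | \<phi>. \<phi> \<in> \<Gamma>c}"

lemma hilbert_field_graph: "hilbert_field (\<lambda>b. L2.L b) D_graph"
proof (rule hilbert_field.intro, goal_cases)
  case (1 b) show ?case by (rule L2.hilbert_L)
next
  case (2 \<phi> \<psi> b)
  then obtain s where "s \<in> \<Gamma>c" "\<phi> = field_class E vol s" by (auto simp: D_graph_def)
  then show ?case using csec_L2(1)[of s b] unfolding L2.carrier_L field_class_def by blast
next
  case 3
  have "D (\<lambda>_. 0) x = 0" for x by (rule D_vertical[OF sec_zero open_UNIV]) auto
  then have "D (\<lambda>_. 0) = (\<lambda>_. 0)" by blast
  then have "(field_class E vol (\<lambda>_. 0), field_class E vol (\<lambda>_. 0)) \<in> D_graph" unfolding D_graph_def using csec_zero by force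
  then show ?case unfolding field_class_def L2.zero_L .
next
  case (4 \<phi> \<psi> \<phi>' \<psi>')
  then obtain s t where s: "s \<in> \<Gamma>c" "\<phi> = field_class E vol s" "\<psi> = field_class E vol (D s)"
    and t: "t \<in> \<Gamma>c" "\<phi>' = field_class E vol t" "\<psi>' = field_class E vol (D t)" by (auto simp: D_graph_def)
  have "s \<in> \<Gamma>" "t \<in> \<Gamma>" using s t csec_iff by auto
  then have "D (\<lambda>x. s x + t x) = (\<lambda>x. D s x + D t x)" using D_lin[of s t 1] by auto
  then have "(field_class E vol (\<lambda>x. s x + t x), field_class E vol (\<lambda>x. D s x + D t x)) \<in> D_graph"
    unfolding D_graph_def using csec_add[OF s(1) t(1)] by force
  then show ?case unfolding s t field_class_def
    by (simp add: L2.add_L csec_L2(1) s(1) t(1) D_csec)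
next
  case (5 \<phi> \<psi>)
  then show ?case unfolding D_graph_def using D_csec by blast
next
  case (6 \<phi> \<psi>)
  then obtain s where "s \<in> \<Gamma>c" "\<phi> = field_class E vol s" by (auto simp: D_graph_def)
  then show ?case using csec_norm_continuous[of s] by (simp add: field_class_def)
next
  case (7 \<phi> \<psi>)
  then obtain s where s: "s \<in> \<Gamma>c" "\<phi> = field_class E vol s" by (auto simp: D_graph_def)
  obtain K where K: "compact K" "\<forall>x. x \<notin> K \<longrightarrow> s x = 0" using s csec_iff by blast
  have "\<phi> b = hzero (L2.L b)" if "b \<in> - \<pi> ` K" for b
    unfolding s(2) field_class_def L2.zero_L by (rule cl_cong_fibre) (use that K(2) in auto)
  then show ?case
    using compact_continuous_image[OF continuous_on_subset[OF continuous_pi subset_UNIV] K(1)] by blast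
next
  case (8 b \<xi> e)
  interpret H: hilbert "L2.L b" by (rule L2.hilbert_L)
  let ?c = "L2.cl b"
  \<comment> \<open>All pairs of classes are taken so that the criterion for relations applies; the
    first component is the density wanted.\<close>
  define S where "S = {(?c s, ?c t) | s t. s \<in> \<Gamma>c \<and> t \<in> \<Gamma>c}"
  have SI: "s \<in> L2.SI b" if "s \<in> \<Gamma>c" for s using csec_L2(1)[OF that] .
  have triv0: "p = hzero (L2.L b)"
    if p: "p \<in> hcarrier (L2.L b)" and o: "\<And>s. s \<in> \<Gamma>c \<Longrightarrow> H.ip (?c s) p = 0" for p
  proof -
    obtain \<psi> where \<psi>: "\<psi> \<in> L2.SI b" "p = ?c \<psi>" using p unfolding L2.carrier_L by blast
    have "AE x in vol b. \<psi> x = 0"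
      by (rule csec_dense[OF \<psi>(1)]) (use o \<psi> L2.inner_L[OF SI \<psi>(1)] in simp)
    then show ?thesis unfolding \<psi>(2) L2.zero_L by (rule L2.cl_eq)
  qed
  have "op_closure (L2.L b) S = hcarrier (L2.L b) \<times> hcarrier (L2.L b)"
  proof (rule H.relation_dense)
    show "S \<subseteq> hcarrier (L2.L b) \<times> hcarrier (L2.L b)"
      unfolding S_def L2.carrier_L using SI by blast
    have SI': "(?c s, ?c t) \<in> S" if "s \<in> \<Gamma>c" "t \<in> \<Gamma>c" for s t using that by (auto simp: S_def)
    show "(hzero (L2.L b), hzero (L2.L b)) \<in> S"
      unfolding L2.zero_L by (rule SI'[OF csec_zero csec_zero])
    show "(hadd (L2.L b) x x', hadd (L2.L b) y y') \<in> S"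
      if xy: "(x, y) \<in> S" "(x', y') \<in> S" for x y x' y'
    proof -
      obtain s t where 1: "s \<in> \<Gamma>c" "t \<in> \<Gamma>c" "x = ?c s" "y = ?c t" using xy(1) by (auto simp: S_def)
      obtain s' t' where 2: "s' \<in> \<Gamma>c" "t' \<in> \<Gamma>c" "x' = ?c s'" "y' = ?c t'" using xy(2) by (auto simp: S_def)
      show ?thesis using SI'[OF csec_add[OF 1(1) 2(1)] csec_add[OF 1(2) 2(2)]] 1 2 by (simp add: L2.add_L SI)
    qed
    show "(hscale (L2.L b) a x, hscale (L2.L b) a y) \<in> S" if xy: "(x, y) \<in> S" for a x y
    proof -
      obtain s t where 1: "s \<in> \<Gamma>c" "t \<in> \<Gamma>c" "x = ?c s" "y = ?c t" using xy(1) by (auto simp: S_def)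
      show ?thesis using SI'[OF csec_scale[OF 1(1)] csec_scale[OF 1(2)]] 1 by (simp add: L2.scale_L SI)
    qed
    fix p q assume C: "p \<in> hcarrier (L2.L b)" "q \<in> hcarrier (L2.L b)"
      and o: "\<And>x y. (x, y) \<in> S \<Longrightarrow> H.ip x p + H.ip y q = 0"
    have z: "H.ip (?c (\<lambda>_. 0)) x = 0" if "x \<in> hcarrier (L2.L b)" for x
      using H.inner_zero_left[OF that] by (simp add: L2.zero_L)
    show "p = hzero (L2.L b) \<and> q = hzero (L2.L b)"
    proof
      show "p = hzero (L2.L b)"
        by (rule triv0[OF C(1)]) (use o[OF SI'[OF _ csec_zero]] z[OF C(2)] in simp)
      show "q = hzero (L2.L b)"
        by (rule triv0[OF C(2)]) (use o[OF SI'[OF csec_zero]] z[OF C(1)] in simp)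
    qed
  qed
  then have "(\<xi>, \<xi>) \<in> op_closure (L2.L b) S" using 8(1) by simp
  then obtain x y where xy: "(x, y) \<in> S" "H.dst \<xi> x < e" using 8(2) unfolding op_closure_def by blast
  then obtain s where s: "s \<in> \<Gamma>c" "x = ?c s" by (auto simp: S_def)
  have "field_class E vol s \<in> Domain D_graph" unfolding D_graph_def using s(1) by blast
  then show ?case using xy(2) s(2) by (intro bexI[of _ "field_class E vol s"]) (simp_all add: field_class_def)
next
  case (9 \<phi> \<psi> f e)
  then obtain s where s: "s \<in> \<Gamma>c" "\<phi> = field_class E vol s" "\<psi> = field_class E vol (D s)" by (auto simp: D_graph_def)
  have s': "s \<in> \<Gamma>" using s csec_iff by auto
  have Ds: "D s \<in> \<Gamma>c" by (rule D_csec[OF s(1)])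
  obtain K1 where K1: "compact K1" "\<forall>x. x \<notin> K1 \<longrightarrow> s x = 0" using s csec_iff by blast
  obtain K2 where K2: "compact K2" "\<forall>x. x \<notin> K2 \<longrightarrow> D s x = 0" using Ds csec_iff by blast
  \<comment> \<open>Over points outside \<open>K\<close> both the section and its image vanish, so
    \<open>f\<close> has to be approximated on a compact set only.\<close>
  define K where "K = \<pi> ` (K1 \<union> K2)"
  have K: "compact K" unfolding K_def
    by (rule compact_continuous_image[OF continuous_on_subset[OF continuous_pi subset_UNIV] compact_Un[OF K1(1) K2(1)]])
  have bd: "\<exists>B. \<forall>b\<in>K. hnorm (L2.L b) (L2.cl b t) \<le> B" if t: "t \<in> \<Gamma>c" for t
  proof -
    have "bounded ((\<lambda>b. hnorm (L2.L b) (L2.cl b t)) ` K)"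
      by (rule compact_imp_bounded[OF compact_continuous_image[OF continuous_on_subset[OF csec_norm_continuous[OF t] subset_UNIV] K]])
    then obtain B where "\<forall>x\<in>(\<lambda>b. hnorm (L2.L b) (L2.cl b t)) ` K. norm x \<le> B"
      unfolding bounded_iff by blast
    then show ?thesis by (intro exI[of _ B]) auto
  qed
  obtain B1 where B1: "\<forall>b\<in>K. hnorm (L2.L b) (L2.cl b s) \<le> B1" using bd[OF s(1)] by blast
  obtain B2 where B2: "\<forall>b\<in>K. hnorm (L2.L b) (L2.cl b (D s)) \<le> B2" using bd[OF Ds] by blast
  \<comment> \<open>A bound for both norms on \<open>K\<close>; the summand 1 makes it positive, so
    that \<open>e / C\<close> is an admissible error.\<close>
  define C where "C = max (max B1 B2) 0 + 1"
  have C: "C > 0" by (simp add: C_def add_nonneg_pos)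
  obtain f' where f': "smooth_fun A' UNIV f'" "\<And>b. b \<in> K \<Longrightarrow> cmod (f b - f' b) < e / C"
    using smooth_approx[OF 9(2) K divide_pos_pos[OF 9(3) C]] by blast
  define s2 where "s2 = (\<lambda>x. sc (f' (\<pi> x)) (s x))"
  have sm: "smooth_fun A UNIV (\<lambda>x. f' (\<pi> x))" using smooth_compose_pi[OF open_UNIV f'(1)] by simp
  have s2: "s2 \<in> \<Gamma>c" unfolding s2_def by (rule csec_mult[OF s(1) sm])
  have Ds2: "D s2 = (\<lambda>x. sc (f' (\<pi> x)) (D s x))" unfolding s2_def using D_mult[OF s' f'(1)] by blast
  \<comment> \<open>On the fibre over \<open>b\<close> the pulled back function is the constant
    \<open>f' b\<close>, so the error is \<open>cmod (f b - f' b)\<close> times the norm.\<close>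
  have main: "hdist (L2.L b) (hscale (L2.L b) (f b) (L2.cl b t)) (L2.cl b (\<lambda>x. sc (f' (\<pi> x)) (t x))) < e"
    if t: "t \<in> \<Gamma>c" "\<And>x. \<pi> x \<notin> K \<Longrightarrow> t x = 0" "\<And>b. b \<in> K \<Longrightarrow> hnorm (L2.L b) (L2.cl b t) \<le> C" for t b
  proof -
    interpret H: hilbert "L2.L b" by (rule L2.hilbert_L)
    note SI = csec_L2(1)[OF t(1), of b]
    have c: "L2.cl b t \<in> hcarrier (L2.L b)" unfolding L2.carrier_L using SI by blast
    have "L2.cl b (\<lambda>x. sc (f' (\<pi> x)) (t x)) = L2.cl b (\<lambda>x. sc (f' b) (t x))"
      by (rule cl_cong_fibre) simp
    also have "\<dots> = hscale (L2.L b) (f' b) (L2.cl b t)" by (rule L2.scale_L[OF SI, symmetric])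
    finally have "hdist (L2.L b) (hscale (L2.L b) (f b) (L2.cl b t)) (L2.cl b (\<lambda>x. sc (f' (\<pi> x)) (t x)))
        = cmod (f b - f' b) * hnorm (L2.L b) (L2.cl b t)"
      using H.dst_scale_diff[OF c] by simp
    also have "\<dots> < e"
    proof (cases "b \<in> K")
      case True
      have "cmod (f b - f' b) * hnorm (L2.L b) (L2.cl b t) \<le> cmod (f b - f' b) * C"
        by (rule mult_left_mono[OF t(3)[OF True]]) simp
      also have "\<dots> < e / C * C" using f'(2)[OF True] C by (rule mult_strict_right_mono)
      finally show ?thesis using C by simp
    next
      case False
      have "L2.cl b t = hzero (L2.L b)"
        unfolding L2.zero_L by (rule cl_cong_fibre) (use False t(2) in blast)
      then show ?thesis using 9(3) by (simp add: H.nrm_zero)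
    qed
    finally show ?thesis .
  qed
  have m1: "hdist (L2.L b) (hscale (L2.L b) (f b) (L2.cl b s)) (L2.cl b s2) < e" for b
    unfolding s2_def
  proof (rule main[OF s(1)])
    show "s x = 0" if "\<pi> x \<notin> K" for x using K1(2) that by (auto simp: K_def)
    show "hnorm (L2.L b) (L2.cl b s) \<le> C" if "b \<in> K" for b
      using bspec[OF B1 that] by (simp add: C_def)
  qed
  have m2: "hdist (L2.L b) (hscale (L2.L b) (f b) (L2.cl b (D s))) (L2.cl b (D s2)) < e" for b
    unfolding Ds2
  proof (rule main[OF Ds])
    show "D s x = 0" if "\<pi> x \<notin> K" for x using K2(2) that by (auto simp: K_def)
    show "hnorm (L2.L b) (L2.cl b (D s)) \<le> C" if "b \<in> K" for b
      using bspec[OF B2 that] by (simp add: C_def)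
  qed
  have "(field_class E vol s2, field_class E vol (D s2)) \<in> D_graph" unfolding D_graph_def using s2 by blast
  then show ?case
    by (rule bexI[rotated]) (simp add: s(2,3) field_class_def m1 m2)
next
  case (10 \<phi> \<psi> \<phi>' \<psi>' b)
  then obtain s t where s: "s \<in> \<Gamma>c" "\<phi> = field_class E vol s" "\<psi> = field_class E vol (D s)"
    and t: "t \<in> \<Gamma>c" "\<phi>' = field_class E vol t" "\<psi>' = field_class E vol (D t)" by (auto simp: D_graph_def)
  have "(\<integral>y. h y (D s y) (t y) \<partial>vol b) = (\<integral>y. h y (s y) (D t y) \<partial>vol b)"
    using symD s(1) t(1) unfolding symmetric_op_def by blast
  then show ?case unfolding s t field_class_def
    by (simp add: L2.inner_L csec_L2(1) s(1) t(1) D_csec)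
next
  case (11 b W)
  obtain V \<eta> where \<eta>: "B.bump W V \<eta>" "b \<in> V" using B.point_bump[OF 11] by blast
  have "continuous_on UNIV \<eta>" by (rule B.smooth_fun_continuous[OF B.bumpD(1)[OF \<eta>(1)] open_UNIV])
  moreover have "\<forall>x. 0 \<le> \<eta> x \<and> \<eta> x \<le> 1" using B.bumpD(2,3)[OF \<eta>(1)] by blast
  moreover have "\<eta> b = 1" by (rule B.bumpD(5)[OF \<eta>])
  moreover have "\<forall>x. \<eta> x \<noteq> 0 \<longrightarrow> x \<in> W" using B.bumpD(6)[OF \<eta>(1)] by blast
  ultimately show ?case by blast
qed

lemma Gamma0_eq: "Gamma0 A E vol = field_module (\<lambda>b. L2.L b) (Domain D_graph)"
proof -
  have "Domain D_graph = field_class E vol ` \<Gamma>c" by (auto simp: D_graph_def)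
  then show ?thesis by (simp add: Gamma0_def field_module_def)
qed

lemma regular_core_equal:
  "(regular_operator (Gamma0 A E vol) (total_op A E vol D) \<longleftrightarrow>
      (\<forall>b. is_core (L2.L b) (ev b ` Domain (op_adjoint (Gamma0 A E vol) (total_op A E vol D)))
             (op_adjoint (L2.L b) (fibre_op A A' \<pi> E vol D b)))) \<and>
   ((\<forall>b. is_core (L2.L b) (ev b ` Domain (op_adjoint (Gamma0 A E vol) (total_op A E vol D)))
             (op_adjoint (L2.L b) (fibre_op A A' \<pi> E vol D b))) \<longleftrightarrow>
      (\<forall>b. ev b ` Domain (op_adjoint (Gamma0 A E vol) (total_op A E vol D))
             = Domain (op_adjoint (L2.L b) (fibre_op A A' \<pi> E vol D b))))"
proof -
  interpret X: hilbert_field "\<lambda>b. L2.L b" D_graph by (rule hilbert_field_graph)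
  have M: "X.M = Gamma0 A E vol" unfolding X.M_def Gamma0_eq ..
  have T: "X.T = total_op A E vol D" unfolding X.T_def total_op_def M unfolding D_graph_def ..
  have "X.Gb b = {(L2.cl b \<phi>, L2.cl b (D \<phi>)) | \<phi>. \<phi> \<in> \<Gamma>c}" for b
  proof (intro equalityI subsetI)
    fix z assume "z \<in> X.Gb b"
    then show "z \<in> {(L2.cl b \<phi>, L2.cl b (D \<phi>)) | \<phi>. \<phi> \<in> \<Gamma>c}"
      unfolding X.Gb_def by (auto simp: D_graph_def field_class_def)
  next
    fix z assume "z \<in> {(L2.cl b \<phi>, L2.cl b (D \<phi>)) | \<phi>. \<phi> \<in> \<Gamma>c}"
    then obtain \<phi> where "\<phi> \<in> \<Gamma>c" and z: "z = (L2.cl b \<phi>, L2.cl b (D \<phi>))" by blast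
    then have "(field_class E vol \<phi>, field_class E vol (D \<phi>)) \<in> D_graph" unfolding D_graph_def by blast
    moreover have "z = (field_class E vol \<phi> b, field_class E vol (D \<phi>) b)" by (simp add: z field_class_def)
    ultimately show "z \<in> X.Gb b" unfolding X.Gb_def by blast
  qed
  then have Tb: "X.Tb b = fibre_op A A' \<pi> E vol D b" for b unfolding X.Tb_def fibre_op_eq by simp
  show ?thesis using X.regular_core_eq unfolding M T Tb .
qed

end

theorem lemma2p3:
  fixes A :: "('m::{t2_space,second_countable_topology}, 'f::real_inner \<times> 'e::real_inner) chart set"
    and A' :: "('b::{t2_space,second_countable_topology}, 'e) chart set"
    and \<pi> :: "'m \<Rightarrow> 'b"
    and g :: "'m \<Rightarrow> 'm tangent \<Rightarrow> 'm tangent \<Rightarrow> real"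
    and E :: "('m, 'v::ab_group_add) vbundle"
    and D :: "('m \<Rightarrow> 'v) \<Rightarrow> 'm \<Rightarrow> 'v"
  defines "vol \<equiv> fibre_volume A A' \<pi> g"
  defines "T \<equiv> total_op A E vol D"
  defines "T\<^sub>b \<equiv> fibre_op A A' \<pi> E vol D"
  assumes "smooth_manifold A" and "smooth_manifold A'"
    and "submersion A A' \<pi>"
    and "vertical_metric A A' \<pi> g"
    and "hermitian_bundle A E"
    and "vertically_elliptic A A' \<pi> E D"
    and "symmetric_op A E vol D"
  shows "(regular_operator (Gamma0 A E vol) T \<longleftrightarrow>
            (\<forall>b. is_core (L2_space E (vol b)) (ev b ` Domain (op_adjoint (Gamma0 A E vol) T))
                   (op_adjoint (L2_space E (vol b)) (T\<^sub>b b)))) \<and>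
         ((\<forall>b. is_core (L2_space E (vol b)) (ev b ` Domain (op_adjoint (Gamma0 A E vol) T))
                   (op_adjoint (L2_space E (vol b)) (T\<^sub>b b))) \<longleftrightarrow>
            (\<forall>b. ev b ` Domain (op_adjoint (Gamma0 A E vol) T)
                   = Domain (op_adjoint (L2_space E (vol b)) (T\<^sub>b b))))"
proof -
  interpret vertical_operator A A' \<pi> g E D
    by unfold_locales (use assms in \<open>auto simp: vertically_elliptic_def\<close>)
  show ?thesis unfolding vol_def T_def T\<^sub>b_def by (rule regular_core_equal)
qed

end
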